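(* Let $n\ge2$ and let $\rho:F_n\to\mathrm{PSL}_2(\mathbb C)$ be a discrete, faithful and geometrically finite representation with one cusp $c$, where $c$ is a blocking curve. Then $\rho$ is primitive-stable.
   Context: $F_n$ is the free group with a fixed free generating set $X=\{x_1,\dots,x_n\}$. One cusp: $N_\rho=\mathbb H^3/\rho(F_n)$ has exactly one cusp, i.e. $\rho(F_n)$ has a single conjugacy class of maximal parabolic subgroups, which are infinite cyclic, and $c$ denotes the conjugacy class in $F_n$ of a generator of such a subgroup. Geometric finiteness then means that the convex core of $N_\rho$ is the union of a compact genus-$n$ handlebody $H$ (with $\pi_1(H)\cong F_n$) and a part of the parabolic cusp, glued along an annulus in $\partial H$ whose core curve is $c$. Blocking: an element of $F_n$ is primitive if it is a member of some free generating set of $F_n$. A reduced word $g$ in the generators $X$ and their inverses is primitive-blocking if it does not appear as a subword of any cyclically reduced word representing a primitive element. A cyclically reduced word $g$ is blocking if some power $g^k$ ($k\ge1$) is primitive-blocking. A curve on the boundary of the handlebody is blocking if a cyclically reduced representative, in the generators $X$, of its conjugacy class in the fundamental group $F_n$ is blocking. Primitive-stable: let $\widetilde\Gamma$ be the Cayley graph of $F_n$ with respect to $X$, a tree with edges of length 1. For a conjugacy class $[w]$ of a primitive element, the axes in $\widetilde\Gamma$ of the elements of $[w]$ form an $F_n$-invariant family of bi-infinite geodesics; these are called primitive leaves. Given $x\in\mathbb H^3$, let $\tau_{\rho,x}:\widetilde\Gamma\to\mathbb H^3$ be the unique $\rho$-equivariant map sending the origin (identity vertex) to $x$ and each edge to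 a geodesic segment. $\rho$ is primitive-stable if there are constants $K,\delta$ and a basepoint $x\in\mathbb H^3$ such that $\tau_{\rho,x}$ maps every primitive leaf to a $(K,\delta)$-quasi-geodesic, i.e. $\frac1K d_{\widetilde\Gamma}(s,t)-\delta\le d_{\mathbb H^3}(\tau_{\rho,x}(s),\tau_{\rho,x}(t))\le K d_{\widetilde\Gamma}(s,t)+\delta$ for all $s,t$ on the leaf. *)

theory Defs
  imports
    "HOL-Analysis.Analysis"
    "HOL-Algebra.Generated_Groups"
    "HOL-Library.Sublist"
begin

text \<open>The letter \<open>(x, True)\<close> is the generator \<open>x\<close> and \<open>(x, False)\<close> is its inverse.\<close>

type_synonym 'a word = "('a \<times> bool) list"

definition inv_letter :: "'a \<times> bool \<Rightarrow> 'a \<times> bool" where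
  "inv_letter a = (fst a, \<not> snd a)"

definition reduced :: "'a word \<Rightarrow> bool" where
  "reduced w \<longleftrightarrow> successively (\<lambda>a b. b \<noteq> inv_letter a) w"

definition cyclically_reduced :: "'a word \<Rightarrow> bool" where
  "cyclically_reduced w \<longleftrightarrow> reduced w \<and> (w \<noteq> [] \<longrightarrow> hd w \<noteq> inv_letter (last w))"

fun cancel_cons :: "'a \<times> bool \<Rightarrow> 'a word \<Rightarrow> 'a word" where
  "cancel_cons a [] = [a]"
| "cancel_cons a (b # w) = (if b = inv_letter a then w else a # b # w)"

definition reduce_word :: "'a word \<Rightarrow> 'a word" where
  "reduce_word w = foldr cancel_cons w []"

text \<open>Elements of the free group on \<open>S\<close> are the reduced words over \<open>S\<close>.\<close>

definition free_group :: "'a set \<Rightarrow> 'a word monoid" where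
  "free_group S = \<lparr>carrier = {w. reduced w \<and> fst ` set w \<subseteq> S},
                   monoid.mult = (\<lambda>u v. reduce_word (u @ v)), one = []\<rparr>"

definition word_eval :: "('g, 'b) monoid_scheme \<Rightarrow> 'g word \<Rightarrow> 'g" where
  "word_eval G w =
     foldr (\<lambda>a y. (if snd a then fst a else inv\<^bsub>G\<^esub> (fst a)) \<otimes>\<^bsub>G\<^esub> y) w \<one>\<^bsub>G\<^esub>"

definition free_generating_set :: "('g, 'b) monoid_scheme \<Rightarrow> 'g set \<Rightarrow> bool" where
  "free_generating_set G B \<longleftrightarrow> B \<subseteq> carrier G \<and> word_eval G \<in> iso (free_group B) G"

abbreviation Fn :: "nat \<Rightarrow> nat word monoid" where
  "Fn n \<equiv> free_group {0..<n}"

definition conj_class :: "('g, 'b) monoid_scheme \<Rightarrow> 'g \<Rightarrow> 'g set" where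
  "conj_class G g = (\<lambda>h. h \<otimes>\<^bsub>G\<^esub> g \<otimes>\<^bsub>G\<^esub> inv\<^bsub>G\<^esub> h) ` carrier G"

definition primitive_element :: "nat \<Rightarrow> nat word \<Rightarrow> bool" where
  "primitive_element n g \<longleftrightarrow> (\<exists>B. free_generating_set (Fn n) B \<and> g \<in> B)"

definition primitive_blocking :: "nat \<Rightarrow> nat word \<Rightarrow> bool" where
  "primitive_blocking n g \<longleftrightarrow> g \<in> carrier (Fn n) \<and>
     \<not> (\<exists>w. cyclically_reduced w \<and> primitive_element n w \<and> sublist g w)"

definition blocking_word :: "nat \<Rightarrow> nat word \<Rightarrow> bool" where
  "blocking_word n g \<longleftrightarrow> g \<in> carrier (Fn n) \<and> cyclically_reduced g \<and>
     (\<exists>k\<ge>1. primitive_blocking n (concat (replicate k g)))"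

text \<open>A curve is given by its conjugacy class \<open>c\<close>. The cyclically reduced representatives of
  \<open>c\<close> are cyclic permutations of one another, so the choice of representative is immaterial.\<close>

definition blocking_curve :: "nat \<Rightarrow> nat word set \<Rightarrow> bool" where
  "blocking_curve n c \<longleftrightarrow> (\<exists>g\<in>c. blocking_word n g)"

definition SL2C :: "(complex^2^2) monoid" where
  "SL2C = \<lparr>carrier = {A. det A = 1}, monoid.mult = (**), one = mat 1\<rparr>"

text \<open>The elements are the cosets \<open>{A, - A}\<close>.\<close>

definition PSL2C :: "(complex^2^2) set monoid" where
  "PSL2C = SL2C Mod {mat 1, - mat 1}"

text \<open>The quotient topology; \<open>\<Union>U\<close> is the preimage of \<open>U\<close> under the projection from \<open>SL\<^sub>2\<close>.\<close>

definition PSL2C_topology :: "(complex^2^2) set topology" where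
  "PSL2C_topology =
     topology (\<lambda>U. U \<subseteq> carrier PSL2C \<and> openin (top_of_set (carrier SL2C)) (\<Union>U))"

definition discrete_in_PSL2C :: "(complex^2^2) set set \<Rightarrow> bool" where
  "discrete_in_PSL2C \<Gamma> \<longleftrightarrow> subtopology PSL2C_topology \<Gamma> = discrete_topology \<Gamma>"

text \<open>Hyperbolic 3-space in the upper half-space model.\<close>

type_synonym hpoint = "complex \<times> real"

definition H3 :: "hpoint set" where
  "H3 = {p. snd p > 0}"

definition hdist :: "hpoint \<Rightarrow> hpoint \<Rightarrow> real" where
  "hdist p q = arcosh (1 + (dist p q)\<^sup>2 / (2 * snd p * snd q))"

text \<open>The sphere at infinity is the Riemann sphere, with \<open>None\<close> as the point at infinity.\<close>

type_synonym ideal_point = "complex option"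

definition tendsto_ideal :: "('i \<Rightarrow> hpoint) \<Rightarrow> ideal_point \<Rightarrow> 'i filter \<Rightarrow> bool" where
  "tendsto_ideal f \<xi> F \<longleftrightarrow>
     (case \<xi> of None \<Rightarrow> filterlim f at_infinity F | Some z \<Rightarrow> (f \<longlongrightarrow> (z, 0)) F)"

text \<open>Poincare extension of \<open>z \<mapsto> (a z + b) / (c z + d)\<close>, for \<open>a d - b c = 1\<close>.\<close>

definition SL2C_act :: "complex^2^2 \<Rightarrow> hpoint \<Rightarrow> hpoint" where
  "SL2C_act A p = (let a = A$1$1; b = A$1$2; c = A$2$1; d = A$2$2; z = fst p; t = snd p;
       N = (cmod (c * z + d))\<^sup>2 + (cmod c)\<^sup>2 * t\<^sup>2
     in (((a * z + b) * cnj (c * z + d) + a * cnj c * of_real (t\<^sup>2)) / of_real N, t / N))"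

definition SL2C_act_ideal :: "complex^2^2 \<Rightarrow> ideal_point \<Rightarrow> ideal_point" where
  "SL2C_act_ideal A \<xi> = (let a = A$1$1; b = A$1$2; c = A$2$1; d = A$2$2 in
     case \<xi> of
       None \<Rightarrow> if c = 0 then None else Some (a / c)
     | Some z \<Rightarrow> if c * z + d = 0 then None else Some ((a * z + b) / (c * z + d)))"

text \<open>\<open>A\<close> and \<open>- A\<close> act in the same way, so the images below are singletons.\<close>

definition act :: "(complex^2^2) set \<Rightarrow> hpoint \<Rightarrow> hpoint" where
  "act g p = the_elem ((\<lambda>A. SL2C_act A p) ` g)"

definition act_ideal :: "(complex^2^2) set \<Rightarrow> ideal_point \<Rightarrow> ideal_point" where
  "act_ideal g \<xi> = the_elem ((\<lambda>A. SL2C_act_ideal A \<xi>) ` g)"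

definition geodesic_segment :: "hpoint \<Rightarrow> hpoint \<Rightarrow> hpoint set" where
  "geodesic_segment p q = {m \<in> H3. hdist p m + hdist m q = hdist p q}"

definition geodesic_line :: "(real \<Rightarrow> hpoint) \<Rightarrow> bool" where
  "geodesic_line \<gamma> \<longleftrightarrow> range \<gamma> \<subseteq> H3 \<and> (\<forall>s t. hdist (\<gamma> s) (\<gamma> t) = \<bar>s - t\<bar>)"

definition hconvex :: "hpoint set \<Rightarrow> bool" where
  "hconvex C \<longleftrightarrow> C \<subseteq> H3 \<and> (\<forall>p\<in>C. \<forall>q\<in>C. geodesic_segment p q \<subseteq> C)"

definition hhull :: "ideal_point set \<Rightarrow> hpoint set" where
  "hhull \<Lambda> = \<Inter>{C. hconvex C \<and>
     (\<forall>\<gamma> \<xi> \<eta>. geodesic_line \<gamma> \<longrightarrow> \<xi> \<in> \<Lambda> \<longrightarrow> \<eta> \<in> \<Lambda> \<longrightarrow>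
        tendsto_ideal \<gamma> \<xi> at_bot \<longrightarrow> tendsto_ideal \<gamma> \<eta> at_top \<longrightarrow> range \<gamma> \<subseteq> C)}"

text \<open>Open horoballs; at a finite \<open>z\<close> these are the Euclidean balls tangent to the boundary plane
  at \<open>z\<close>.\<close>

definition horoball_at :: "ideal_point \<Rightarrow> hpoint set \<Rightarrow> bool" where
  "horoball_at \<xi> B \<longleftrightarrow> (case \<xi> of
       None \<Rightarrow> (\<exists>h>0. B = {p. snd p > h})
     | Some z \<Rightarrow> (\<exists>r>0. B = ball (z, r) r))"

text \<open>For discrete \<open>\<Gamma>\<close> an orbit accumulates only at infinity, and the accumulation points do not
  depend on the orbit.\<close>

definition limit_set :: "(complex^2^2) set set \<Rightarrow> ideal_point set" where
  "limit_set \<Gamma> = {\<xi>. \<exists>x\<in>H3. \<exists>g::nat \<Rightarrow> (complex^2^2) set.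
     range g \<subseteq> \<Gamma> \<and> tendsto_ideal (\<lambda>k. act (g k) x) \<xi> sequentially}"

text \<open>Parabolic: exactly one fixed point on the sphere at infinity, here \<open>\<xi>\<close>.\<close>

definition parabolic_fixing :: "ideal_point \<Rightarrow> (complex^2^2) set \<Rightarrow> bool" where
  "parabolic_fixing \<xi> g \<longleftrightarrow> g \<in> carrier PSL2C \<and> {\<eta>. act_ideal g \<eta> = \<eta>} = {\<xi>}"

definition parabolic_subgroup ::
    "(complex^2^2) set set \<Rightarrow> (complex^2^2) set set \<Rightarrow> bool" where
  "parabolic_subgroup \<Gamma> P \<longleftrightarrow> subgroup P PSL2C \<and> P \<subseteq> \<Gamma> \<and> P \<noteq> {\<one>\<^bsub>PSL2C\<^esub>} \<and>
     (\<exists>\<xi>. \<forall>g\<in>P - {\<one>\<^bsub>PSL2C\<^esub>}. parabolic_fixing \<xi> g)"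

definition maximal_parabolic_subgroup ::
    "(complex^2^2) set set \<Rightarrow> (complex^2^2) set set \<Rightarrow> bool" where
  "maximal_parabolic_subgroup \<Gamma> P \<longleftrightarrow> parabolic_subgroup \<Gamma> P \<and>
     (\<forall>Q. parabolic_subgroup \<Gamma> Q \<longrightarrow> P \<subseteq> Q \<longrightarrow> Q = P)"

definition parabolic_fixed_points :: "(complex^2^2) set set \<Rightarrow> ideal_point set" where
  "parabolic_fixed_points \<Gamma> = {\<xi>. \<exists>g\<in>\<Gamma>. parabolic_fixing \<xi> g}"

text \<open>An equivariant choice of pairwise disjoint open horoballs at the parabolic fixed points,
  that is, the preimage in hyperbolic space of a cuspidal neighbourhood in the quotient.\<close>

definition cusp_horoballs ::
    "(complex^2^2) set set \<Rightarrow> (ideal_point \<Rightarrow> hpoint set) \<Rightarrow> bool" where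
  "cusp_horoballs \<Gamma> B \<longleftrightarrow>
     (\<forall>\<xi>\<in>parabolic_fixed_points \<Gamma>. horoball_at \<xi> (B \<xi>)) \<and>
     (\<forall>\<xi>\<in>parabolic_fixed_points \<Gamma>. \<forall>g\<in>\<Gamma>. B (act_ideal g \<xi>) = act g ` B \<xi>) \<and>
     disjoint_family_on B (parabolic_fixed_points \<Gamma>)"

text \<open>The convex core of the quotient manifold is the quotient of the convex hull of the limit set.
  Geometric finiteness says that it is the union of a compact set and a part of the cusps. The
  compact piece is the image of the compact set \<open>K\<close>; for discrete \<open>\<Gamma>\<close>, the existence of \<open>K\<close>
  is equivalent to compactness of the quotient of the hull minus the horoballs.\<close>

definition geometrically_finite :: "(complex^2^2) set set \<Rightarrow> bool" where
  "geometrically_finite \<Gamma> \<longleftrightarrow> (\<exists>B K. cusp_horoballs \<Gamma> B \<and> compact K \<and>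
     (\<Union>g\<in>\<Gamma>. act g ` K) = hhull (limit_set \<Gamma>) - \<Union>(B ` parabolic_fixed_points \<Gamma>))"

definition faithful_rep :: "nat \<Rightarrow> (nat word \<Rightarrow> (complex^2^2) set) \<Rightarrow> bool" where
  "faithful_rep n \<rho> \<longleftrightarrow> \<rho> \<in> hom (Fn n) PSL2C \<and> inj_on \<rho> (carrier (Fn n))"

text \<open>\<open>c\<close> is determined only up to replacing the generator by its inverse; both choices are
  allowed.\<close>

definition one_cusp :: "nat \<Rightarrow> (nat word \<Rightarrow> (complex^2^2) set) \<Rightarrow> nat word set \<Rightarrow> bool" where
  "one_cusp n \<rho> c \<longleftrightarrow> (let \<Gamma> = \<rho> ` carrier (Fn n) in
     (\<forall>P Q. maximal_parabolic_subgroup \<Gamma> P \<longrightarrow> maximal_parabolic_subgroup \<Gamma> Q \<longrightarrow>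
        (\<exists>g\<in>\<Gamma>. Q = (\<lambda>p. g \<otimes>\<^bsub>PSL2C\<^esub> p \<otimes>\<^bsub>PSL2C\<^esub> inv\<^bsub>PSL2C\<^esub> g) ` P)) \<and>
     (\<forall>P. maximal_parabolic_subgroup \<Gamma> P \<longrightarrow>
        infinite P \<and> (\<exists>p\<in>P. P = generate PSL2C {p})) \<and>
     (\<exists>g\<in>carrier (Fn n). maximal_parabolic_subgroup \<Gamma> (generate PSL2C {\<rho> g}) \<and>
        c = conj_class (Fn n) g))"

text \<open>The geometric realization of the Cayley graph, in barycentric coordinates: a point is a function on the vertex set.
  A vertex is its indicator function, and \<open>edge_point g h s\<close> is the point at distance \<open>s\<close> from \<open>g\<close>
  on the edge between \<open>g\<close> and \<open>h\<close>.\<close>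

type_synonym cpoint = "nat word \<Rightarrow> real"

definition vertex :: "nat word \<Rightarrow> cpoint" where
  "vertex g = (\<lambda>v. if v = g then 1 else 0)"

definition edge_point :: "nat word \<Rightarrow> nat word \<Rightarrow> real \<Rightarrow> cpoint" where
  "edge_point g h s = (\<lambda>v. (1 - s) * vertex g v + s * vertex h v)"

definition adjacent :: "nat \<Rightarrow> nat word \<Rightarrow> nat word \<Rightarrow> bool" where
  "adjacent n g h \<longleftrightarrow> g \<in> carrier (Fn n) \<and> h \<in> carrier (Fn n) \<and>
     (\<exists>i<n. h = g \<otimes>\<^bsub>Fn n\<^esub> [(i, True)] \<or> g = h \<otimes>\<^bsub>Fn n\<^esub> [(i, True)])"

definition cayley :: "nat \<Rightarrow> cpoint set" where
  "cayley n = {edge_point g h s | g h s. adjacent n g h \<and> 0 \<le> s \<and> s \<le> 1}"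

text \<open>The path metric: a shortest path either stays inside one edge, or leaves the edge of \<open>p\<close>
  through an end vertex \<open>u\<close>, at distance \<open>1 - p u\<close> from \<open>p\<close>, and enters the edge of \<open>q\<close>
  through an end vertex \<open>v\<close>; the distance between the vertices \<open>u\<close> and \<open>v\<close> is the length of the
  reduced word \<open>u\<^sup>-\<^sup>1 v\<close>.\<close>

definition cayley_dist :: "nat \<Rightarrow> cpoint \<Rightarrow> cpoint \<Rightarrow> real" where
  "cayley_dist n p q = Inf (
     {\<bar>s - t\<bar> | s t. \<exists>g h. adjacent n g h \<and> s \<in> {0..1} \<and> t \<in> {0..1} \<and>
        p = edge_point g h s \<and> q = edge_point g h t} \<union>
     {(1 - p u) + length (inv\<^bsub>Fn n\<^esub> u \<otimes>\<^bsub>Fn n\<^esub> v) + (1 - q v) | u v.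
        u \<in> carrier (Fn n) \<and> v \<in> carrier (Fn n) \<and> p u > 0 \<and> q v > 0})"

definition cayley_act :: "nat \<Rightarrow> nat word \<Rightarrow> cpoint \<Rightarrow> cpoint" where
  "cayley_act n g p = (\<lambda>v. if v \<in> carrier (Fn n) then p (inv\<^bsub>Fn n\<^esub> g \<otimes>\<^bsub>Fn n\<^esub> v) else 0)"

text \<open>\<open>L\<close> is a bi-infinite geodesic along which \<open>g\<close> acts as a nontrivial translation.\<close>

definition axis_of :: "nat \<Rightarrow> nat word \<Rightarrow> cpoint set \<Rightarrow> bool" where
  "axis_of n g L \<longleftrightarrow> (\<exists>\<gamma>::real \<Rightarrow> cpoint. L = range \<gamma> \<and> range \<gamma> \<subseteq> cayley n \<and>
     (\<forall>s t. cayley_dist n (\<gamma> s) (\<gamma> t) = \<bar>s - t\<bar>) \<and>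
     (\<exists>l>0. \<forall>t. cayley_act n g (\<gamma> t) = \<gamma> (t + l)))"

definition primitive_leaf :: "nat \<Rightarrow> cpoint set \<Rightarrow> bool" where
  "primitive_leaf n L \<longleftrightarrow> (\<exists>g. primitive_element n g \<and> axis_of n g L)"

text \<open>\<open>\<tau>\<close> is the equivariant map sending the origin to \<open>x\<close> and each edge, at constant speed, to a
  geodesic segment; its restriction to the Cayley graph is unique.\<close>

definition orbit_map ::
    "nat \<Rightarrow> (nat word \<Rightarrow> (complex^2^2) set) \<Rightarrow> hpoint \<Rightarrow> (cpoint \<Rightarrow> hpoint) \<Rightarrow> bool" where
  "orbit_map n \<rho> x \<tau> \<longleftrightarrow> \<tau> ` cayley n \<subseteq> H3 \<and> \<tau> (vertex []) = x \<and>
     (\<forall>g\<in>carrier (Fn n). \<forall>p\<in>cayley n. \<tau> (cayley_act n g p) = act (\<rho> g) (\<tau> p)) \<and>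
     (\<forall>g h s. adjacent n g h \<longrightarrow> 0 \<le> s \<longrightarrow> s \<le> 1 \<longrightarrow>
        hdist (\<tau> (vertex g)) (\<tau> (edge_point g h s))
          = s * hdist (\<tau> (vertex g)) (\<tau> (vertex h)) \<and>
        hdist (\<tau> (edge_point g h s)) (\<tau> (vertex h))
          = (1 - s) * hdist (\<tau> (vertex g)) (\<tau> (vertex h)))"

definition quasi_geodesic_on ::
    "nat \<Rightarrow> real \<Rightarrow> real \<Rightarrow> (cpoint \<Rightarrow> hpoint) \<Rightarrow> cpoint set \<Rightarrow> bool" where
  "quasi_geodesic_on n K \<delta> \<tau> L \<longleftrightarrow> (\<forall>s\<in>L. \<forall>t\<in>L.
     1 / K * cayley_dist n s t - \<delta> \<le> hdist (\<tau> s) (\<tau> t) \<and>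
     hdist (\<tau> s) (\<tau> t) \<le> K * cayley_dist n s t + \<delta>)"

definition primitive_stable :: "nat \<Rightarrow> (nat word \<Rightarrow> (complex^2^2) set) \<Rightarrow> bool" where
  "primitive_stable n \<rho> \<longleftrightarrow> (\<exists>K\<ge>1. \<exists>\<delta>\<ge>0. \<exists>x\<in>H3. \<exists>\<tau>. orbit_map n \<rho> x \<tau> \<and>
     (\<forall>L. primitive_leaf n L \<longrightarrow> quasi_geodesic_on n K \<delta> \<tau> L))"

end

theory Submission
  imports Defs
begin

text \<open>By geometric finiteness, a geodesic between two orbit points stays within bounded distance of
  the orbit as long as it is outside the horoballs, so that it is followed there by a path in the
  Cayley tree. In a horoball stabilised by \<open>g \<langle>c\<rangle> g\<^sup>-\<^sup>1\<close> it is followed instead by a segment of the axis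
  of a conjugate of \<open>c\<close>, possibly exponentially longer. Every path in the tree passes through all
  vertices of the geodesic with the same ends; hence the word \<open>r\<close> of an orbit point \<open>\<rho> r x\<close> whose
  length is not bounded linearly by the distance from \<open>x\<close> shares a long segment with an axis of a
  conjugate of \<open>c\<close>, that is, contains a high power of \<open>c\<close> or its inverse.

  A primitive leaf is labelled by the powers of a cyclically reduced primitive word \<open>w\<close>. If \<open>w\<close> and
  \<open>b\<close> belong to a common basis, then \<open>w\<^sup>N b\<close> is primitive as well and, for large \<open>N\<close>, its cyclic
  reduction contains any given power of \<open>w\<close>. So a blocked power of \<open>c\<close> occurs in no power of \<open>w\<close>,
  and the linear bound holds uniformly along all primitive leaves.\<close>

section \<open>Hyperbolic space as Hermitian matrices\<close>

text \<open>The obstacle is backtracking. The walk that follows a geodesic is not a geodesic of the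
  tree, so a vertex of \<open>r\<close> may lie deep on the axis segment of a horoball without
  \<open>r\<close> running along that axis: the walk may come back over the segment later. This is
  excluded because horoballs cast small shadows. In coordinates where one horoball is the region
  above height 1, every horoball disjoint from it is a Euclidean ball of diameter at most 1, and a
  geodesic moves sideways by at most 1 on its way to the horosphere. Hence axis vertices covered by
  the geodesic before its entry, or after its exit, are close to the entry or exit point, and these
  are few.

  Heights are controlled by matrices: hyperbolic space becomes a hyperboloid of Hermitian matrices
  on which the group acts linearly, and the reciprocal height is a matrix entry, hence a combination
  of \<open>cosh\<close> and \<open>sinh\<close> along a geodesic. The linear bound is finally a
  count: boundedly many prefixes of a word belong to each unit of length of the geodesic.\<close>

definition mk2 :: "complex \<Rightarrow> complex \<Rightarrow> complex \<Rightarrow> complex \<Rightarrow> complex^2^2" where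
  "mk2 a b c d = vector [vector [a, b], vector [c, d]]"

lemma mk2_nth [simp]:
  "mk2 a b c d $ 1 $ 1 = a" "mk2 a b c d $ 1 $ 2 = b"
  "mk2 a b c d $ 2 $ 1 = c" "mk2 a b c d $ 2 $ 2 = d"
  by (simp_all add: mk2_def)

lemma mat2_eq_iff:
  "A = B \<longleftrightarrow> A$1$1 = B$1$1 \<and> A$1$2 = B$1$2 \<and> A$2$1 = B$2$1 \<and> A$2$2 = B$2$2"
  for A B :: "complex^2^2"
  by (auto simp: vec_eq_iff forall_2)

lemma mat2_mult_nth: "(A ** B) $ i $ j = A$i$1 * B$1$j + A$i$2 * B$2$j"
  for A B :: "complex^2^2"
  by (simp add: matrix_matrix_mult_def sum_2)

lemma mat1_nth [simp]:
  "(mat 1 :: complex^2^2)$1$1 = 1" "(mat 1 :: complex^2^2)$1$2 = 0"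
  "(mat 1 :: complex^2^2)$2$1 = 0" "(mat 1 :: complex^2^2)$2$2 = 1"
  by (simp_all add: mat_def)

text \<open>The conjugate transpose; its fixed points are the Hermitian matrices.\<close>

definition ctr :: "complex^2^2 \<Rightarrow> complex^2^2" where
  "ctr A = (\<chi> i j. cnj (A$j$i))"

lemma ctr_nth [simp]: "ctr A $ i $ j = cnj (A$j$i)"
  by (simp add: ctr_def)

lemma ctr_mult: "ctr (A ** B) = ctr B ** ctr A"
  by (simp add: mat2_eq_iff mat2_mult_nth mult.commute)

lemma ctr_ctr [simp]: "ctr (ctr A) = A"
  by (simp add: mat2_eq_iff)

lemma det_ctr: "det (ctr A) = cnj (det A)"
  by (simp add: det_2 mult.commute)

text \<open>The polarisation of the determinant. On Hermitian matrices it is the Lorentz form whose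
  unit hyperboloid models hyperbolic space.\<close>

definition mdet :: "complex^2^2 \<Rightarrow> complex^2^2 \<Rightarrow> complex" where
  "mdet M N = (M$1$1 * N$2$2 + M$2$2 * N$1$1 - M$1$2 * N$2$1 - M$2$1 * N$1$2) / 2"

lemma mdet_self: "mdet M M = det M"
  by (simp add: mdet_def det_2)

lemma mdet_polar: "2 * mdet M N = det (M + N) - det M - det N"
  by (simp add: mdet_def det_2 field_simps)

lemma matrix_add_rdistrib2: "(B + C) ** A = B ** A + C ** A" for A B C :: "complex^2^2"
  by (simp add: mat2_eq_iff mat2_mult_nth algebra_simps)

lemma scaleR_mat_nth: "(a *\<^sub>R M) $ i $ j = of_real a * M $ i $ j" for M :: "complex^2^2"
  by (simp add: scaleR_conv_of_real[where 'a = complex])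

lemma of_real_cmod_square:
  "complex_of_real (cmod z) * complex_of_real (cmod z) = z * cnj z"
  "complex_of_real (cmod z) * (complex_of_real (cmod z) * x) = z * (cnj z * x)"
proof -
  show *: "complex_of_real (cmod z) * complex_of_real (cmod z) = z * cnj z"
    using complex_norm_square[of z] by (simp add: power2_eq_square)
  show "complex_of_real (cmod z) * (complex_of_real (cmod z) * x) = z * (cnj z * x)"
    using * by (metis mult.assoc)
qed

text \<open>By polarisation this is multiplicativity of \<open>det\<close>. With
  \<open>B = ctr A\<close> it makes matrices of determinant 1 act by isometries.\<close>

lemma mdet_congruence: "mdet (A ** M ** B) (A ** N ** B) = det A * det B * mdet M N"
proof -
  have "2 * mdet (A ** M ** B) (A ** N ** B) = det (A ** (M + N) ** B) - det (A ** M ** B) - det (A ** N ** B)"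
    unfolding mdet_polar by (simp add: matrix_add_ldistrib matrix_add_rdistrib2)
  also have "\<dots> = det A * det B * (2 * mdet M N)"
    unfolding mdet_polar by (simp add: det_mul algebra_simps)
  finally show ?thesis by simp
qed

text \<open>The point \<open>(z, t)\<close> becomes the positive Hermitian matrix of determinant 1 on which
  \<open>SL\<^sub>2\<close> acts by \<open>M \<mapsto> A M A\<^sup>*\<close>; its lower right entry is the reciprocal of the height.\<close>

definition hv :: "hpoint \<Rightarrow> complex^2^2" where
  "hv p = mk2 (of_real (((cmod (fst p))\<^sup>2 + (snd p)\<^sup>2) / snd p)) (fst p / of_real (snd p))
     (cnj (fst p) / of_real (snd p)) (of_real (1 / snd p))"

text \<open>The inverse of \<open>hv\<close>: the second column alone determines the point.\<close>

definition pt_of :: "complex^2^2 \<Rightarrow> hpoint" where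
  "pt_of M = (M$1$2 / M$2$2, 1 / Re (M$2$2))"

lemma det_hv: "p \<in> H3 \<Longrightarrow> det (hv p) = 1"
  by (simp add: det_2 hv_def H3_def of_real_cmod_square field_simps power2_eq_square)

lemma ctr_hv [simp]: "ctr (hv p) = hv p"
  by (simp add: mat2_eq_iff hv_def)

lemma hv_22: "hv p $ 2 $ 2 = of_real (1 / snd p)"
  by (simp add: hv_def)

lemma pt_of_hv [simp]: "p \<in> H3 \<Longrightarrow> pt_of (hv p) = p"
  by (cases p) (simp add: pt_of_def hv_def H3_def)

lemma hv_inj: "p \<in> H3 \<Longrightarrow> q \<in> H3 \<Longrightarrow> hv p = hv q \<Longrightarrow> p = q"
  by (metis pt_of_hv)

text \<open>A Hermitian matrix has real diagonal entries \<open>a\<close>, \<open>b\<close> and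
  off-diagonal entries \<open>w\<close>, \<open>cnj w\<close>. Determinant 1 means
  \<open>a * b = 1 + |w|^2\<close>, so \<open>a\<close> is recovered from the second column.\<close>

lemma hv_pt_of:
  assumes "ctr M = M" "det M = 1" "Re (M$2$2) > 0"
  shows "hv (pt_of M) = M" "pt_of M \<in> H3"
proof -
  have "cnj (M$1$1) = M$1$1" "cnj (M$2$2) = M$2$2" and c: "M$2$1 = cnj (M$1$2)"
    using assms(1) unfolding mat2_eq_iff ctr_nth by metis+
  hence r1: "M$1$1 = of_real (Re (M$1$1))" and r2: "M$2$2 = of_real (Re (M$2$2))"
    by (metis Reals_cnj_iff of_real_Re)+
  define a b w where "a = Re (M$1$1)" "b = Re (M$2$2)" "w = M$1$2"
  have M: "M = mk2 (of_real a) w (cnj w) (of_real b)"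
    unfolding mat2_eq_iff mk2_nth a_b_w_def using r1 r2 c by blast
  have b: "b > 0" using assms(3) by (simp add: a_b_w_def)
  have "of_real a * of_real b - of_real ((cmod w)\<^sup>2) = (1::complex)"
    using assms(2) unfolding M det_2 complex_norm_square by simp
  hence "of_real (a * b - (cmod w)\<^sup>2) = (1::complex)" by simp
  hence ab: "a * b - (cmod w)\<^sup>2 = 1" using of_real_eq_1_iff by blast
  have "a * b = (cmod w)\<^sup>2 + 1" using ab by simp
  hence "a = ((cmod w)\<^sup>2 + 1) / b" using b by (metis less_irrefl nonzero_mult_div_cancel_right)
  hence "((cmod w / b)\<^sup>2 + (1/b)\<^sup>2) * b = a"
    using b by (simp add: power2_eq_square add_divide_distrib distrib_right)
  thus "hv (pt_of M) = M"
    unfolding M using b by (simp add: mat2_eq_iff hv_def pt_of_def norm_divide)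
  show "pt_of M \<in> H3" using assms(3) by (simp add: H3_def pt_of_def)
qed

lemma cosh_hdist_eq:
  assumes "p \<in> H3" "q \<in> H3"
  shows "cosh (hdist p q) = 1 + (dist p q)\<^sup>2 / (2 * snd p * snd q)"
  using assms by (simp add: hdist_def H3_def)

lemma dist_hpoint: "(dist p q)\<^sup>2 = (cmod (fst p - fst q))\<^sup>2 + (snd p - snd q)\<^sup>2"
  for p q :: hpoint
  by (simp add: dist_prod_def dist_norm)

lemma cosh_hdist_coord:
  assumes "p \<in> H3" "q \<in> H3"
  shows "cosh (hdist p q) =
    ((cmod (fst p - fst q))\<^sup>2 + (snd p)\<^sup>2 + (snd q)\<^sup>2) / (2 * snd p * snd q)"
  using assms unfolding cosh_hdist_eq[OF assms] dist_hpoint H3_def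
  by (simp add: field_simps power2_eq_square)

lemma hv_entries:
  "hv p $ 1 $ 1 = (fst p * cnj (fst p) + of_real (snd p) * of_real (snd p)) / of_real (snd p)"
  "hv p $ 1 $ 2 = fst p / of_real (snd p)" "hv p $ 2 $ 1 = cnj (fst p) / of_real (snd p)"
  "hv p $ 2 $ 2 = 1 / of_real (snd p)"
  by (simp_all add: hv_def power2_eq_square of_real_cmod_square)

text \<open>The distance formula of the hyperboloid model; isometry and arc length become statements
  about a bilinear form.\<close>

lemma mdet_hv:
  assumes "p \<in> H3" "q \<in> H3"
  shows "mdet (hv p) (hv q) = of_real (cosh (hdist p q))"
proof -
  define z w T S where defs: "z = fst p" "w = fst q" "T = complex_of_real (snd p)" "S = complex_of_real (snd q)"
  have nz: "T \<noteq> 0" "S \<noteq> 0" using assms by (auto simp: H3_def defs)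
  have c: "of_real (cosh (hdist p q)) = ((z - w) * (cnj z - cnj w) + T * T + S * S) / (2 * T * S)"
    unfolding cosh_hdist_coord[OF assms] defs by (simp add: power2_eq_square of_real_cmod_square)
  show ?thesis
    unfolding c mdet_def hv_entries defs[symmetric] using nz by (simp add: divide_simps) algebra
qed

lemma hdist_nonneg: "p \<in> H3 \<Longrightarrow> q \<in> H3 \<Longrightarrow> 0 \<le> hdist p q"
  unfolding hdist_def by (rule arcosh_nonneg_real) (simp add: H3_def)

lemma hdist_sym: "hdist p q = hdist q p"
  by (simp add: hdist_def dist_commute mult.commute mult.left_commute)

lemma hdist_self [simp]: "hdist p p = 0"
  by (simp add: hdist_def)

lemma hdist_eqI:
  assumes "p \<in> H3" "q \<in> H3" "cosh (hdist p q) = cosh r" "r \<ge> 0"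
  shows "hdist p q = r"
  by (metis arcosh_cosh_real assms hdist_nonneg)

lemma hdist_eq_0_iff:
  assumes "p \<in> H3" "q \<in> H3" shows "hdist p q = 0 \<longleftrightarrow> p = q"
proof
  assume "hdist p q = 0"
  hence "(dist p q)\<^sup>2 / (2 * snd p * snd q) = 0" using cosh_hdist_eq[OF assms] by simp
  moreover have "2 * snd p * snd q \<noteq> 0" using assms by (simp add: H3_def)
  ultimately show "p = q" by (metis dist_eq_0_iff divide_eq_0_iff power_eq_0_iff)
qed simp

lemma cosh_le_mono: "0 \<le> x \<Longrightarrow> x \<le> y \<Longrightarrow> cosh x \<le> cosh (y::real)"
  by (metis cosh_real_nonneg_le_iff order_trans)

lemma hdist_le_iff: "p \<in> H3 \<Longrightarrow> q \<in> H3 \<Longrightarrow> r \<ge> 0 \<Longrightarrow> hdist p q \<le> r \<longleftrightarrow> cosh (hdist p q) \<le> cosh r"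
  by (metis cosh_real_nonneg_le_iff hdist_nonneg)

section \<open>The action by isometries\<close>

text \<open>The denominator \<open>N\<close> of \<open>SL2C_act\<close> is \<open>t\<close> times
  the lower right entry of \<open>A ** hv p ** ctr A\<close>, and the first component is the
  normalised entry above it. So the Poincare extension is congruence of matrices, and the action
  laws below reduce to matrix algebra through \<open>hv_inj\<close>.\<close>

lemma hv_act:
  assumes "det A = 1" "p \<in> H3"
  shows "hv (SL2C_act A p) = A ** hv p ** ctr A" "SL2C_act A p \<in> H3"
proof -
  define M where "M = A ** hv p ** ctr A"
  obtain z t where p: "p = (z, t)" by (cases p)
  have t: "t > 0" using assms p by (auto simp: H3_def)
  define N where "N = (cmod (A$2$1 * z + A$2$2))\<^sup>2 + (cmod (A$2$1))\<^sup>2 * t\<^sup>2"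
  have Npos: "N > 0"
  proof (cases "A$2$1 = 0")
    case True
    hence "A$2$2 \<noteq> 0" using assms(1) by (auto simp: det_2)
    thus ?thesis using True by (simp add: N_def)
  next
    case False
    hence "(cmod (A$2$1))\<^sup>2 * t\<^sup>2 > 0" using t by simp
    thus ?thesis unfolding N_def by (simp add: add_nonneg_pos)
  qed
  have herm: "ctr M = M" unfolding M_def by (simp add: ctr_mult matrix_mul_assoc)
  have det: "det M = 1" unfolding M_def using assms det_hv[OF assms(2)]
    by (simp add: det_mul det_ctr)
  have entry: "(a * ((z * cnj z + T * T) / T) + b * (cnj z / T)) * c + (a * (z / T) + b * (1 / T)) * d
      = ((a * z + b) * (c * cnj z + d) + a * c * (T * T)) / T" if "T \<noteq> 0" for a b c d T :: complex
    using that by (simp add: divide_simps) algebra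
  have t0: "complex_of_real t \<noteq> 0" using t by simp
  have cN: "complex_of_real N = (A$2$1 * z + A$2$2) * (cnj (A$2$1) * cnj z + cnj (A$2$2)) + A$2$1 * cnj (A$2$1) * (of_real t * of_real t)"
    unfolding N_def by (simp add: power2_eq_square of_real_cmod_square)
  have M22: "M$2$2 = of_real (N / t)"
    unfolding M_def of_real_divide cN mat2_mult_nth hv_entries p fst_conv snd_conv ctr_nth entry[OF t0] ..
  have M12: "M$1$2 = ((A$1$1 * z + A$1$2) * cnj (A$2$1 * z + A$2$2) + A$1$1 * cnj (A$2$1) * of_real (t\<^sup>2)) / of_real t"
    unfolding M_def mat2_mult_nth hv_entries p fst_conv snd_conv ctr_nth entry[OF t0]
    by (simp add: power2_eq_square)
  have eq: "SL2C_act A p = pt_of M"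
    unfolding SL2C_act_def pt_of_def M22 M12 Let_def p fst_conv snd_conv N_def[symmetric]
    using t Npos by simp
  have pos: "Re (M$2$2) > 0" using M22 Npos t by simp
  show "hv (SL2C_act A p) = A ** hv p ** ctr A" "SL2C_act A p \<in> H3"
    using hv_pt_of[OF herm det pos] eq M_def by auto
qed

lemma SL2C_act_isometry:
  assumes "det A = 1" "p \<in> H3" "q \<in> H3"
  shows "hdist (SL2C_act A p) (SL2C_act A q) = hdist p q"
proof (rule hdist_eqI)
  show H: "SL2C_act A p \<in> H3" "SL2C_act A q \<in> H3" using assms hv_act(2) by blast+
  have "complex_of_real (cosh (hdist (SL2C_act A p) (SL2C_act A q))) = of_real (cosh (hdist p q))"
    unfolding mdet_hv[OF H, symmetric] mdet_hv[OF assms(2,3), symmetric]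
      hv_act(1)[OF assms(1,2)] hv_act(1)[OF assms(1,3)] mdet_congruence det_ctr assms(1) by simp
  thus "cosh (hdist (SL2C_act A p) (SL2C_act A q)) = cosh (hdist p q)"
    using of_real_eq_iff by blast
  show "hdist p q \<ge> 0" using assms hdist_nonneg by blast
qed

lemma SL2C_act_mult:
  assumes "det A = 1" "det B = 1" "p \<in> H3"
  shows "SL2C_act (A ** B) p = SL2C_act A (SL2C_act B p)"
proof (rule hv_inj)
  have d: "det (A ** B) = 1" using assms by (simp add: det_mul)
  note B = hv_act[OF assms(2,3)]
  show "SL2C_act (A ** B) p \<in> H3" "SL2C_act A (SL2C_act B p) \<in> H3"
    using hv_act(2)[OF d assms(3)] hv_act(2)[OF assms(1) B(2)] .
  show "hv (SL2C_act (A ** B) p) = hv (SL2C_act A (SL2C_act B p))"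
    unfolding hv_act(1)[OF d assms(3)] hv_act(1)[OF assms(1) B(2)] B(1) ctr_mult matrix_mul_assoc ..
qed

lemma SL2C_act_one: 
  assumes "p \<in> H3" shows "SL2C_act (mat 1) p = p"
proof (rule hv_inj)
  have d: "det (mat 1 :: complex^2^2) = 1" by simp
  have c: "ctr (mat 1) = mat 1" by (simp add: mat2_eq_iff)
  show "SL2C_act (mat 1) p \<in> H3" using hv_act(2)[OF d assms] .
  show "hv (SL2C_act (mat 1) p) = hv p" unfolding hv_act(1)[OF d assms] c by simp
qed (rule assms)

lemma SL2C_act_uminus:
  assumes "det A = 1" "p \<in> H3"
  shows "SL2C_act (- A) p = SL2C_act A p"
proof (rule hv_inj)
  have d: "det (- A) = 1" using assms by (simp add: det_2)
  show "hv (SL2C_act (- A) p) = hv (SL2C_act A p)"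
    using assms d by (simp add: hv_act) (simp add: mat2_eq_iff mat2_mult_nth algebra_simps)
  show "SL2C_act (- A) p \<in> H3" "SL2C_act A p \<in> H3" using assms d hv_act(2) by auto
qed

definition inv2 :: "complex^2^2 \<Rightarrow> complex^2^2" where
  "inv2 A = mk2 (A$2$2) (- A$1$2) (- A$2$1) (A$1$1)"

lemma inv2: assumes "det A = 1"
  shows "A ** inv2 A = mat 1" "inv2 A ** A = mat 1" "det (inv2 A) = 1"
proof -
  have d: "A$1$1 * A$2$2 - A$1$2 * A$2$1 = 1" using assms by (simp add: det_2)
  show "A ** inv2 A = mat 1" "inv2 A ** A = mat 1" "det (inv2 A) = 1"
    unfolding mat2_eq_iff mat2_mult_nth inv2_def det_2 mk2_nth mat1_nth using d
    by (auto simp: mult.commute)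
qed

lemma SL2C_act_inv2:
  assumes "det A = 1" "p \<in> H3"
  shows "SL2C_act (inv2 A) (SL2C_act A p) = p" "SL2C_act A (SL2C_act (inv2 A) p) = p"
  using SL2C_act_mult[of "inv2 A" A p] SL2C_act_mult[of A "inv2 A" p] assms inv2[OF assms(1)]
  by (simp_all add: SL2C_act_one)

definition base_pt :: hpoint where "base_pt = (0, 1)"

lemma base_pt_H3 [simp]: "base_pt \<in> H3" by (simp add: base_pt_def H3_def)

lemma SL2C_transitive:
  assumes "p \<in> H3" shows "\<exists>A. det A = 1 \<and> SL2C_act A p = base_pt"
proof -
  obtain z t where p: "p = (z, t)" by (cases p)
  have t: "t > 0" using assms p by (auto simp: H3_def)
  define A where "A = mk2 (of_real (1 / sqrt t)) (- z / of_real (sqrt t)) 0 (of_real (sqrt t))"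
  have s: "of_real (sqrt t) * of_real (sqrt t) = complex_of_real t" "sqrt t > 0"
    using t by (auto simp flip: of_real_mult)
  have "det A = 1" using t by (simp add: A_def det_2)
  moreover have "SL2C_act A p = base_pt"
    using t s by (simp add: SL2C_act_def A_def p base_pt_def Let_def)
  ultimately show ?thesis by blast
qed

text \<open>By transitivity the middle point may be taken to be \<open>base_pt\<close>. Then
  \<open>cosh (hdist p r)\<close> is a product of two values of \<open>cosh\<close> minus a
  Euclidean inner product of vectors whose norms are the corresponding values of
  \<open>sinh\<close>, and Cauchy-Schwarz bounds it by \<open>cosh\<close> of the sum.\<close>

lemma hdist_triangle:
  assumes "p \<in> H3" "q \<in> H3" "r \<in> H3"
  shows "hdist p r \<le> hdist p q + hdist q r"
proof -
  have base: "hdist p r \<le> hdist p base_pt + hdist base_pt r" if "p \<in> H3" "r \<in> H3" for p r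
  proof -
    \<comment> \<open>\<open>(x p, y p)\<close> are the space coordinates of \<open>p\<close> on the
      hyperboloid; the time coordinate is \<open>cosh (hdist p base_pt)\<close>.\<close>
    define x where "x p = ((cmod (fst p))\<^sup>2 + (snd p)\<^sup>2 - 1) / (2 * snd p)" for p :: hpoint
    define y where "y p = (1 / snd p) *\<^sub>R fst p" for p :: hpoint
    have c0: "cosh (hdist p base_pt) = ((cmod (fst p))\<^sup>2 + (snd p)\<^sup>2 + 1) / (2 * snd p)"
      if "p \<in> H3" for p
      using cosh_hdist_coord[OF that base_pt_H3] by (simp add: base_pt_def)
    have s0: "sinh (hdist p base_pt) = norm (x p, y p)" if "p \<in> H3" for p
    proof -
      have "(sinh (hdist p base_pt))\<^sup>2 = (cosh (hdist p base_pt))\<^sup>2 - 1"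
        by (simp add: cosh_square_eq)
      also have "\<dots> = (x p)\<^sup>2 + (cmod (y p))\<^sup>2"
        using that unfolding c0[OF that] x_def y_def
        by (simp add: H3_def field_simps power2_eq_square)
      finally have "(sinh (hdist p base_pt))\<^sup>2 = (norm (x p, y p))\<^sup>2"
        by (simp add: norm_prod_def)
      moreover have "sinh (hdist p base_pt) \<ge> 0" using hdist_nonneg[OF that] by simp
      ultimately show ?thesis by (simp add: power2_eq_iff_nonneg)
    qed
    have "cosh (hdist p r) = cosh (hdist p base_pt) * cosh (hdist base_pt r) - (x p, y p) \<bullet> (x r, y r)"
    proof -
      have n: "(cmod u)\<^sup>2 = Re u * Re u + Im u * Im u" for u
        using cmod_power2[of u] by (simp add: power2_eq_square)
      show ?thesis
        unfolding hdist_sym[of base_pt] c0[OF that(1)] c0[OF that(2)] cosh_hdist_coord[OF that] x_def y_def inner_Pair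
        using that unfolding n by (simp add: inner_complex_def H3_def field_simps power2_eq_square)
    qed
    also have "\<dots> \<le> cosh (hdist p base_pt) * cosh (hdist base_pt r) + norm (x p, y p) * norm (x r, y r)"
      using norm_cauchy_schwarz[of "- (x p, y p)" "(x r, y r)"]
      unfolding norm_minus_cancel by (simp del: uminus_Pair)
    also have "\<dots> = cosh (hdist p base_pt + hdist base_pt r)"
      using s0[OF that(1)] s0[OF that(2)] by (simp add: cosh_add hdist_sym)
    finally show ?thesis
      using that hdist_nonneg by (subst hdist_le_iff) auto
  qed
  obtain A where A: "det A = 1" "SL2C_act A q = base_pt" using SL2C_transitive assms(2) by blast
  show ?thesis
    using base[of "SL2C_act A p" "SL2C_act A r"] A assms hv_act(2)[OF A(1)]
      SL2C_act_isometry[OF A(1)] by metis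
qed

section \<open>Geodesics\<close>

text \<open>Parametrised by arc length on \<open>[0, hdist p q]\<close>.\<close>

definition geod :: "hpoint \<Rightarrow> hpoint \<Rightarrow> real \<Rightarrow> hpoint" where
  "geod p q s = (if p = q then p else
     pt_of ((sinh (hdist p q - s) / sinh (hdist p q)) *\<^sub>R hv p + (sinh s / sinh (hdist p q)) *\<^sub>R hv q))"

lemma mdet_combination:
  "mdet (a *\<^sub>R M + b *\<^sub>R N) (c *\<^sub>R M + d *\<^sub>R N) =
     of_real (a * c) * det M + of_real (b * d) * det N + of_real (a * d + b * c) * mdet M N"
  unfolding mdet_def det_2 vector_add_component scaleR_mat_nth of_real_mult of_real_add
  by (simp add: field_simps)

text \<open>A geodesic is the slice of the hyperboloid by the plane through its ends, with these
  ratios of \<open>sinh\<close> as coefficients. The value of the form at two parameters gives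
  determinant 1 for \<open>s = t\<close> and the arc length parametrisation in general.\<close>

lemma geod_combination:
  fixes d s t :: real
  assumes "d > 0"
  shows "(sinh (d - s) / sinh d) * (sinh (d - t) / sinh d) + (sinh s / sinh d) * (sinh t / sinh d)
    + ((sinh (d - s) / sinh d) * (sinh t / sinh d) + (sinh s / sinh d) * (sinh (d - t) / sinh d)) * cosh d
    = cosh (s - t)"
proof -
  have S: "sinh d \<noteq> 0" using assms by simp
  have c: "cosh d * cosh d = 1 + sinh d * sinh d" using cosh_square_eq[of d] by (simp add: power2_eq_square)
  have "sinh (d - s) * sinh (d - t) + sinh s * sinh t + (sinh (d - s) * sinh t + sinh s * sinh (d - t)) * cosh d
     = sinh d * sinh d * cosh (s - t)"
    unfolding sinh_diff cosh_diff using c by algebra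
  hence "(sinh (d - s) * sinh (d - t) + sinh s * sinh t + (sinh (d - s) * sinh t + sinh s * sinh (d - t)) * cosh d)
      / (sinh d * sinh d) = cosh (s - t)"
    using S by simp
  thus ?thesis by (simp add: add_divide_distrib algebra_simps)
qed

lemma hv_geod:
  assumes "p \<in> H3" "q \<in> H3" "p \<noteq> q" "0 \<le> s" "s \<le> hdist p q"
  shows "hv (geod p q s) = (sinh (hdist p q - s) / sinh (hdist p q)) *\<^sub>R hv p + (sinh s / sinh (hdist p q)) *\<^sub>R hv q"
    (is "_ = ?M")
    "geod p q s \<in> H3"
proof -
  have d: "hdist p q > 0" using assms hdist_nonneg hdist_eq_0_iff by (metis less_eq_real_def)
  have h: "ctr ?M = ?M" using assms(1,2)
    by (simp add: mat2_eq_iff hv_def scaleR_mat_nth)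
  have "det ?M = mdet ?M ?M" by (simp add: mdet_self)
  also have "\<dots> = of_real (cosh (s - s))"
    unfolding mdet_combination mdet_hv[OF assms(1,2)] det_hv[OF assms(1)] det_hv[OF assms(2)]
    geod_combination[OF d, of s s, symmetric] by simp
  finally have det: "det ?M = 1" by simp
  have "sinh (hdist p q - s) / sinh (hdist p q) \<ge> 0" "sinh s / sinh (hdist p q) \<ge> 0"
    "sinh (hdist p q - s) / sinh (hdist p q) > 0 \<or> sinh s / sinh (hdist p q) > 0"
    using assms d by (auto simp: zero_less_divide_iff)
  hence pos: "Re (?M$2$2) > 0" using assms(1,2)
    by (auto simp: hv_22 H3_def add_pos_nonneg add_nonneg_pos simp del: divide_divide_eq_left)
  show "hv (geod p q s) = ?M" "geod p q s \<in> H3"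
    using hv_pt_of[OF h det pos] assms(3) by (auto simp: geod_def)
qed

lemma geod_H3: "p \<in> H3 \<Longrightarrow> q \<in> H3 \<Longrightarrow> 0 \<le> s \<Longrightarrow> s \<le> hdist p q \<Longrightarrow> geod p q s \<in> H3"
  using hv_geod(2) by (cases "p = q") (auto simp: geod_def)

lemma geod_0 [simp]: "p \<in> H3 \<Longrightarrow> q \<in> H3 \<Longrightarrow> geod p q 0 = p"
  using hdist_eq_0_iff[of p q] by (simp add: geod_def)

lemma geod_end [simp]: "p \<in> H3 \<Longrightarrow> q \<in> H3 \<Longrightarrow> geod p q (hdist p q) = q"
  using hdist_eq_0_iff[of p q] by (simp add: geod_def)

lemma geod_dist:
  assumes "p \<in> H3" "q \<in> H3" "0 \<le> s" "s \<le> hdist p q" "0 \<le> t" "t \<le> hdist p q"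
  shows "hdist (geod p q s) (geod p q t) = \<bar>s - t\<bar>"
proof (cases "p = q")
  case True thus ?thesis using assms by (simp add: geod_def)
next
  case False
  have d: "hdist p q > 0" using assms hdist_nonneg hdist_eq_0_iff False by (metis less_eq_real_def)
  have "complex_of_real (cosh (hdist (geod p q s) (geod p q t))) = of_real (cosh (s - t))"
    unfolding mdet_hv[OF geod_H3[OF assms(1-4)] geod_H3[OF assms(1,2,5,6)], symmetric]
      hv_geod(1)[OF assms(1,2) False assms(3,4)] hv_geod(1)[OF assms(1,2) False assms(5,6)]
      mdet_combination mdet_hv[OF assms(1,2)] det_hv[OF assms(1)] det_hv[OF assms(2)]
      geod_combination[OF d, symmetric] by simp
  hence "cosh (hdist (geod p q s) (geod p q t)) = cosh \<bar>s - t\<bar>"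
    by (metis cosh_real_abs of_real_eq_iff)
  thus ?thesis using assms by (intro hdist_eqI geod_H3) auto
qed

lemma geod_dist_ends:
  assumes "p \<in> H3" "q \<in> H3" "0 \<le> s" "s \<le> hdist p q"
  shows "hdist p (geod p q s) = s" "hdist (geod p q s) q = hdist p q - s"
  using geod_dist[OF assms(1,2) order_refl hdist_nonneg[OF assms(1,2)] assms(3,4)]
    geod_dist[OF assms hdist_nonneg[OF assms(1,2)] order_refl] assms by simp_all

lemma geod_in_segment:
  assumes "p \<in> H3" "q \<in> H3" "0 \<le> s" "s \<le> hdist p q"
  shows "geod p q s \<in> geodesic_segment p q"
  using geod_dist_ends[OF assms] geod_H3[OF assms] by (simp add: geodesic_segment_def)

text \<open>The action is linear in \<open>hv\<close>, so it preserves the coefficients of the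
  combination that defines \<open>geod\<close>.\<close>

lemma geod_act:
  assumes "det A = 1" "p \<in> H3" "q \<in> H3" "0 \<le> s" "s \<le> hdist p q"
  shows "SL2C_act A (geod p q s) = geod (SL2C_act A p) (SL2C_act A q) s"
proof (cases "p = q")
  case True thus ?thesis by (simp add: geod_def)
next
  case False
  note H = hv_act(2)[OF assms(1)]
  have ne: "SL2C_act A p \<noteq> SL2C_act A q" using False assms SL2C_act_inv2 by metis
  have dd: "hdist (SL2C_act A p) (SL2C_act A q) = hdist p q" using SL2C_act_isometry assms by blast
  show ?thesis
  proof (rule hv_inj)
    show "hv (SL2C_act A (geod p q s)) = hv (geod (SL2C_act A p) (SL2C_act A q) s)"
      using assms False ne H geod_H3
      by (simp add: hv_act hv_geod dd matrix_add_ldistrib matrix_add_rdistrib2)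
        (simp add: mat2_eq_iff mat2_mult_nth scaleR_mat_nth algebra_simps)
  qed (use assms H dd geod_H3 in auto)
qed

lemma geod_rev: "p \<in> H3 \<Longrightarrow> q \<in> H3 \<Longrightarrow> geod q p s = geod p q (hdist p q - s)"
  by (auto simp: geod_def hdist_sym add.commute)

text \<open>The reciprocal height is the lower right entry of \<open>hv\<close>, which is linear
  along the combination.\<close>

lemma geod_height:
  assumes "p \<in> H3" "q \<in> H3" "p \<noteq> q" "0 \<le> s" "s \<le> hdist p q"
  shows "1 / snd (geod p q s) = (sinh (hdist p q - s) * (1 / snd p) + sinh s * (1 / snd q)) / sinh (hdist p q)"
proof -
  have "complex_of_real (1 / snd (geod p q s)) = hv (geod p q s) $2$2" by (simp add: hv_22)
  also have "\<dots> = of_real ((sinh (hdist p q - s) * (1 / snd p) + sinh s * (1 / snd q)) / sinh (hdist p q))"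
    unfolding hv_geod[OF assms] by (simp add: hv_22 scaleR_mat_nth add_divide_distrib mult.commute del: vector_scaleR_component)
  finally show ?thesis using of_real_eq_iff by blast
qed

lemma continuous_on_geod:
  assumes "p \<in> H3" "q \<in> H3"
  shows "continuous_on {0..hdist p q} (geod p q)"
proof (cases "p = q")
  case True thus ?thesis by (simp add: geod_def [abs_def])
next
  case False
  define M where "M s = (sinh (hdist p q - s) / sinh (hdist p q)) *\<^sub>R hv p + (sinh s / sinh (hdist p q)) *\<^sub>R hv q" for s
  have d: "sinh (hdist p q) \<noteq> 0" using assms False hdist_eq_0_iff by simp
  have nz: "Re (M s $ 2 $ 2) \<noteq> 0" if "s \<in> {0..hdist p q}" for s
    using hv_geod[OF assms False, of s] that hv_22[of "geod p q s"] by (auto simp: M_def H3_def)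
  hence nz': "M s $ 2 $ 2 \<noteq> 0" if "s \<in> {0..hdist p q}" for s using that by force
  have c: "continuous_on {0..hdist p q} M" unfolding M_def
    by (intro continuous_intros) (use d in auto)
  have "continuous_on {0..hdist p q} (\<lambda>s. pt_of (M s))" unfolding pt_of_def
    by (intro continuous_intros c) (use nz nz' in auto)
  thus ?thesis using False by (simp add: geod_def[abs_def] M_def)
qed

section \<open>Horoballs\<close>

lemma height_le:
  assumes "p \<in> H3" "q \<in> H3"
  shows "snd q \<le> 2 * snd p * cosh (hdist p q)"
proof -
  have t: "snd p > 0" "snd q > 0" using assms by (auto simp: H3_def)
  have "(snd q)\<^sup>2 \<le> (cmod (fst p - fst q))\<^sup>2 + (snd p)\<^sup>2 + (snd q)\<^sup>2" by simp
  also have "\<dots> = cosh (hdist p q) * (2 * snd p * snd q)"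
    unfolding cosh_hdist_coord[OF assms] using t by simp
  finally have "snd q * snd q \<le> (2 * snd p * cosh (hdist p q)) * snd q"
    by (simp add: power2_eq_square mult_ac)
  thus ?thesis using t(2) by (rule mult_right_le_imp_le)
qed

lemma horizontal_le:
  assumes "p \<in> H3" "q \<in> H3"
  shows "(cmod (fst p - fst q))\<^sup>2 \<le> 2 * snd p * snd q * cosh (hdist p q)"
proof -
  have t: "snd p > 0" "snd q > 0" using assms by (auto simp: H3_def)
  have "(cmod (fst p - fst q))\<^sup>2 \<le> (cmod (fst p - fst q))\<^sup>2 + (snd p)\<^sup>2 + (snd q)\<^sup>2" by simp
  also have "\<dots> = cosh (hdist p q) * (2 * snd p * snd q)"
    unfolding cosh_hdist_coord[OF assms] using t by simp
  finally show ?thesis by (simp add: mult_ac)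
qed

text \<open>A geodesic that reaches the horosphere of height 1 at \<open>e\<close> from below moves horizontally
  by at most 1.\<close>

lemma horizontal_le_1:
  assumes "e \<in> H3" "y \<in> H3" "snd e = 1" "cosh (hdist e y) \<le> 1 / snd y"
  shows "cmod (fst e - fst y) \<le> 1" "snd y \<le> 1"
proof -
  have t: "snd y > 0" using assms(2) by (simp add: H3_def)
  have "((cmod (fst e - fst y))\<^sup>2 + 1 + (snd y)\<^sup>2) / (2 * snd y) \<le> 2 / (2 * snd y)"
    using assms(4) unfolding cosh_hdist_coord[OF assms(1,2)] assms(3) by simp
  hence *: "(cmod (fst e - fst y))\<^sup>2 + (snd y)\<^sup>2 \<le> 1"
    using t unfolding divide_le_cancel by auto
  have "(cmod (fst e - fst y))\<^sup>2 \<le> 1\<^sup>2" "(snd y)\<^sup>2 \<le> 1\<^sup>2"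
    unfolding one_power2 using * zero_le_power2[of "snd y"] zero_le_power2[of "cmod (fst e - fst y)"]
    by linarith+
  thus "cmod (fst e - fst y) \<le> 1" "snd y \<le> 1"
    by (metis abs_le_square_iff abs_norm_cancel abs_one, metis abs_le_square_iff abs_one abs_of_pos t)
qed

text \<open>Horoballs are encoded as pullbacks of the standard one by matrices of determinant 1.
  This treats finite and infinite centres alike and lets all estimates be made at height 1.\<close>

definition horoset :: "complex^2^2 \<Rightarrow> hpoint set" where
  "horoset C = {p \<in> H3. 1 < snd (SL2C_act C p)}"

lemma snd_SL2C_act:
  "snd (SL2C_act A p) =
     snd p / ((cmod (A$2$1 * fst p + A$2$2))\<^sup>2 + (cmod (A$2$1))\<^sup>2 * (snd p)\<^sup>2)"
  by (simp add: SL2C_act_def Let_def)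

text \<open>A horoball disjoint from the standard one is a Euclidean ball of diameter at most 1.\<close>

lemma disjoint_horoball_shadow:
  assumes D: "det D = 1" and disj: "\<And>p. p \<in> H3 \<Longrightarrow> 1 < snd p \<Longrightarrow> \<not> 1 < snd (SL2C_act D p)"
  shows "\<exists>\<zeta>. \<forall>y\<in>H3. 1 \<le> snd (SL2C_act D y) \<longrightarrow> cmod (fst y - \<zeta>) \<le> 1 \<and> snd y \<le> 1"
proof -
  define g d where "g = D$2$1" "d = D$2$2"
  \<comment> \<open>For \<open>g = 0\<close> the second horoball is centred at infinity as well, and
    a high point lies in both.\<close>
  have g0: "g \<noteq> 0"
  proof
    assume g: "g = 0"
    hence d: "d \<noteq> 0" using D by (auto simp: det_2 g_d_def)
    define t where "t = (cmod d)\<^sup>2 + 2"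
    have t: "t > 1" "t > (cmod d)\<^sup>2" "t > 0" unfolding t_def using zero_le_power2[of "cmod d"] by linarith+
    have "1 < t / (cmod d)\<^sup>2" using t(2) d by (simp add: less_divide_eq_1_pos)
    hence "1 < snd (SL2C_act D (0, t))"
      using g unfolding snd_SL2C_act g_d_def by simp
    thus False using disj[of "(0, t)"] t by (simp add: H3_def)
  qed
  \<comment> \<open>The second horoball is the Euclidean ball of diameter \<open>1 / |g|^2\<close>
    that touches the boundary at \<open>- d / g\<close>. If the diameter exceeded 1, a point just
    below the top would lie in both horoballs.\<close>
  have g1: "(cmod g)\<^sup>2 \<ge> 1"
  proof (rule ccontr)
    assume "\<not> (cmod g)\<^sup>2 \<ge> 1"
    hence "1 < 1 / (cmod g)\<^sup>2" using g0 by (simp add: less_divide_eq_1_pos)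
    then obtain t where t: "1 < t" "t < 1 / (cmod g)\<^sup>2" using dense by blast
    have G: "(cmod g)\<^sup>2 > 0" using g0 by simp
    have "t * (cmod g)\<^sup>2 < 1" using t(2) pos_less_divide_eq[OF G] by blast
    moreover have "t * (cmod g)\<^sup>2 > 0" using G t by simp
    ultimately have "1 < 1 / (t * (cmod g)\<^sup>2)" by (simp only: less_divide_eq_1_pos)
    also have "\<dots> = t / ((cmod g)\<^sup>2 * t\<^sup>2)" using t(1) by (simp add: power2_eq_square)
    also have "\<dots> = snd (SL2C_act D (- d / g, t))" using g0 unfolding snd_SL2C_act g_d_def by simp
    finally show False using disj[of "(- d / g, t)"] t by (simp add: H3_def)
  qed
  have "cmod (fst y - (- d / g)) \<le> 1 \<and> snd y \<le> 1" if y: "y \<in> H3" "1 \<le> snd (SL2C_act D y)" for y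
  proof -
    have t: "snd y > 0" using y by (simp add: H3_def)
    define N where "N = (cmod (g * fst y + d))\<^sup>2 + (cmod g)\<^sup>2 * (snd y)\<^sup>2"
    have N0: "N > 0" unfolding N_def using g0 t by (intro add_nonneg_pos mult_pos_pos) auto
    have "1 \<le> snd y / N" using y(2) unfolding snd_SL2C_act N_def g_d_def .
    hence 1: "N \<le> snd y" using N0 by (simp only: le_divide_eq_1_pos)
    have "g * fst y + d = g * (fst y - (- d / g))" using g0 by (simp add: distrib_left)
    hence "cmod (g * fst y + d) = cmod g * cmod (fst y - (- d / g))" by (simp only: norm_mult)
    hence "N = (cmod g)\<^sup>2 * ((cmod (fst y - (- d / g)))\<^sup>2 + (snd y)\<^sup>2)"
      unfolding N_def by (simp only: power_mult_distrib distrib_left)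
    hence *: "(cmod g)\<^sup>2 * ((cmod (fst y - (- d / g)))\<^sup>2 + (snd y)\<^sup>2) \<le> snd y" using 1 by simp
    have "1 * ((cmod (fst y - (- d / g)))\<^sup>2 + (snd y)\<^sup>2) \<le> (cmod g)\<^sup>2 * ((cmod (fst y - (- d / g)))\<^sup>2 + (snd y)\<^sup>2)"
      by (intro mult_right_mono g1) simp
    hence **: "(cmod (fst y - (- d / g)))\<^sup>2 + (snd y)\<^sup>2 \<le> snd y" using * by simp
    hence "(snd y) * (snd y) \<le> 1 * snd y"
      using zero_le_power2[of "cmod (fst y - (- d / g))"] power2_eq_square[of "snd y"] by linarith
    hence h: "snd y \<le> 1" using t by (rule mult_right_le_imp_le)
    hence "(cmod (fst y - (- d / g)))\<^sup>2 \<le> 1\<^sup>2"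
      unfolding one_power2 using ** zero_le_power2[of "snd y"] by linarith
    hence "cmod (fst y - (- d / g)) \<le> 1" by (metis abs_le_square_iff abs_norm_cancel abs_one)
    thus ?thesis using h by blast
  qed
  thus ?thesis by blast
qed

text \<open>In \<open>3 + sqrt (2 * cosh R)\<close> the 3 counts sideways moves of size 1: from the
  entry point to \<open>y\<close>, from \<open>y\<close> to the foot of the other horoball, and from
  there to a point of that horoball near \<open>o'\<close>. The square root is the sideways distance
  of points at height at most 1 and distance at most \<open>R\<close>. The summand 2 bounds the two
  squared heights, and the factor \<open>cosh R\<close> bounds
  \<open>1 / (2 * snd o')\<close>.\<close>

definition entry_bound :: "real \<Rightarrow> real" where
  "entry_bound R = cosh R * ((3 + sqrt (2 * cosh R))\<^sup>2 + 2)"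

text \<open>A geodesic enters the standard horoball at \<open>e\<close>, coming from \<open>y\<close>. A point \<open>o\<close> close to the
  horoball is close to \<open>e\<close> if it is close to \<open>y\<close>, or to another horoball that the geodesic
  leaves at \<open>y\<close>.\<close>

lemma entry_close_standard:
  assumes e: "e \<in> H3" "snd e = 1" and y: "y \<in> H3" "cosh (hdist e y) \<le> 1 / snd y"
    and o: "o' \<in> H3" "snd o' \<le> 1" and b: "b \<in> H3" "1 < snd b" "hdist o' b \<le> R"
    and alt: "hdist y o' \<le> R \<or> (\<exists>D b'. det D = 1 \<and> (\<forall>p\<in>H3. 1 < snd p \<longrightarrow> \<not> 1 < snd (SL2C_act D p))
      \<and> 1 \<le> snd (SL2C_act D y) \<and> b' \<in> horoset D \<and> hdist o' b' \<le> R)"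
  shows "cosh (hdist e o') \<le> entry_bound R"
proof -
  define k where "k = cosh R"
  have k1: "k \<ge> 1" unfolding k_def by (rule cosh_real_ge_1)
  have kR: "cosh (hdist p q) \<le> k" if "p \<in> H3" "q \<in> H3" "hdist p q \<le> R" for p q
    unfolding k_def using cosh_le_mono[OF hdist_nonneg[OF that(1,2)] that(3)] .
  have zy: "cmod (fst e - fst y) \<le> 1" "snd y \<le> 1" using horizontal_le_1 e y by auto
  have near: "cmod (fst p - fst q) \<le> sqrt (2 * k)"
    if "p \<in> H3" "q \<in> H3" "snd p \<le> 1" "snd q \<le> 1" "hdist p q \<le> R" for p q
  proof (rule real_le_rsqrt)
    have pos: "0 < snd p" "0 < snd q" using that by (auto simp: H3_def)
    have "snd p * snd q * cosh (hdist p q) \<le> 1 * 1 * k"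
      using that pos kR k1 by (intro mult_mono) auto
    thus "(cmod (fst p - fst q))\<^sup>2 \<le> 2 * k" using horizontal_le[OF that(1,2)] by linarith
  qed
  have zo: "cmod (fst e - fst o') \<le> 3 + sqrt (2 * k)"
    using alt
  proof
    assume "hdist y o' \<le> R"
    hence "cmod (fst y - fst o') \<le> sqrt (2 * k)" using near y(1) o zy by blast
    moreover have "fst e - fst o' = (fst e - fst y) + (fst y - fst o')" by simp
    hence "cmod (fst e - fst o') \<le> cmod (fst e - fst y) + cmod (fst y - fst o')"
      by (metis norm_triangle_ineq)
    ultimately show ?thesis using zy by linarith
  next
    assume "\<exists>D b'. det D = 1 \<and> (\<forall>p\<in>H3. 1 < snd p \<longrightarrow> \<not> 1 < snd (SL2C_act D p))
      \<and> 1 \<le> snd (SL2C_act D y) \<and> b' \<in> horoset D \<and> hdist o' b' \<le> R"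
    then obtain D b' where D: "det D = 1" "\<And>p. p\<in>H3 \<Longrightarrow> 1 < snd p \<Longrightarrow> \<not> 1 < snd (SL2C_act D p)"
      "1 \<le> snd (SL2C_act D y)" "b' \<in> H3" "1 \<le> snd (SL2C_act D b')" "hdist o' b' \<le> R"
      unfolding horoset_def by force
    obtain \<zeta> where z: "\<And>y. y \<in> H3 \<Longrightarrow> 1 \<le> snd (SL2C_act D y) \<Longrightarrow> cmod (fst y - \<zeta>) \<le> 1 \<and> snd y \<le> 1"
      using disjoint_horoball_shadow[OF D(1,2)] by blast
    have 1: "cmod (fst y - \<zeta>) \<le> 1" "cmod (fst b' - \<zeta>) \<le> 1" "snd b' \<le> 1" using z y(1) D by auto
    have 2: "cmod (fst o' - fst b') \<le> sqrt (2 * k)" using near o D 1 by blast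
    have "cmod (fst e - fst o') = cmod ((fst e - fst y) + (fst y - \<zeta>) - (fst b' - \<zeta>) - (fst o' - fst b'))" by simp
    hence "cmod (fst e - fst o') \<le> cmod (fst e - fst y) + cmod (fst y - \<zeta>) + cmod (fst b' - \<zeta>) + cmod (fst o' - fst b')"
      using norm_triangle_ineq4[of "(fst e - fst y) + (fst y - \<zeta>) - (fst b' - \<zeta>)" "fst o' - fst b'"]
        norm_triangle_ineq4[of "(fst e - fst y) + (fst y - \<zeta>)" "fst b' - \<zeta>"]
        norm_triangle_ineq[of "fst e - fst y" "fst y - \<zeta>"] by linarith
    thus ?thesis using 1 2 zy by linarith
  qed
  have opos: "snd o' > 0" using o by (simp add: H3_def)
  \<comment> \<open>Being within \<open>R\<close> of the standard horoball keeps \<open>o'\<close>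
    from being low, which bounds the denominator of the distance formula.\<close>
  have "1 < 2 * snd o' * k"
  proof -
    have "snd b \<le> 2 * snd o' * cosh (hdist o' b)" using height_le o b by blast
    also have "\<dots> \<le> 2 * snd o' * k" using kR[OF o(1) b(1,3)] opos by simp
    finally show ?thesis using b by simp
  qed
  hence "1 \<le> k * (2 * snd o')" by (simp add: mult_ac)
  hence inv: "1 / (2 * snd o') \<le> k" using opos by (simp only: pos_divide_le_eq mult_pos_pos zero_less_numeral)
  have num: "(cmod (fst e - fst o'))\<^sup>2 + 1 + (snd o')\<^sup>2 \<le> (3 + sqrt (2 * k))\<^sup>2 + 2"
    using power_mono[OF zo, of 2] power_mono[OF o(2), of 2] opos unfolding one_power2
    by (smt (verit, best) norm_ge_zero)
  have "cosh (hdist e o') = (1 / (2 * snd o')) * ((cmod (fst e - fst o'))\<^sup>2 + 1 + (snd o')\<^sup>2)"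
    unfolding cosh_hdist_coord[OF e(1) o(1)] e(2) by simp
  also have "\<dots> \<le> k * ((3 + sqrt (2 * k))\<^sup>2 + 2)"
    using inv num opos k1 by (intro mult_mono) auto
  finally show ?thesis unfolding entry_bound_def k_def .
qed

text \<open>The coordinate change \<open>C\<close> reduces this to the standard horoball; the image
  of \<open>horoset D\<close> under \<open>C\<close> is described by
  \<open>D ** inv2 C\<close>.\<close>

lemma entry_close:
  assumes C: "det C = 1" and e: "e \<in> H3" "snd (SL2C_act C e) = 1"
    and y: "y \<in> H3" "cosh (hdist e y) \<le> 1 / snd (SL2C_act C y)"
    and o: "o' \<in> H3" "o' \<notin> horoset C" and b: "b \<in> horoset C" "hdist o' b \<le> R"
    and alt: "hdist y o' \<le> R \<or> (\<exists>D b'. det D = 1 \<and> horoset C \<inter> horoset D = {}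
      \<and> 1 \<le> snd (SL2C_act D y) \<and> b' \<in> horoset D \<and> hdist o' b' \<le> R)"
  shows "cosh (hdist e o') \<le> entry_bound R"
proof -
  note H = hv_act(2)[OF C] and I = SL2C_act_isometry[OF C]
  have "cosh (hdist (SL2C_act C e) (SL2C_act C o')) \<le> entry_bound R"
  proof (rule entry_close_standard)
    show "SL2C_act C e \<in> H3" "SL2C_act C y \<in> H3" "SL2C_act C o' \<in> H3" "SL2C_act C b \<in> H3"
      using H e y o b by (auto simp: horoset_def)
    show "snd (SL2C_act C e) = 1" "snd (SL2C_act C o') \<le> 1" "1 < snd (SL2C_act C b)"
      using e o b by (auto simp: horoset_def)
    show "cosh (hdist (SL2C_act C e) (SL2C_act C y)) \<le> 1 / snd (SL2C_act C y)"
      using y I[OF e(1) y(1)] by simp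
    show "hdist (SL2C_act C o') (SL2C_act C b) \<le> R" using b o I by (auto simp: horoset_def)
    show "hdist (SL2C_act C y) (SL2C_act C o') \<le> R \<or>
      (\<exists>D b'. det D = 1 \<and> (\<forall>p\<in>H3. 1 < snd p \<longrightarrow> \<not> 1 < snd (SL2C_act D p)) \<and>
       1 \<le> snd (SL2C_act D (SL2C_act C y)) \<and> b' \<in> horoset D \<and> hdist (SL2C_act C o') b' \<le> R)"
      using alt
    proof
      assume "hdist y o' \<le> R" thus ?thesis using I[OF y(1) o(1)] by simp
    next
      assume "\<exists>D b'. det D = 1 \<and> horoset C \<inter> horoset D = {}
      \<and> 1 \<le> snd (SL2C_act D y) \<and> b' \<in> horoset D \<and> hdist o' b' \<le> R"
      then obtain D b' where D: "det D = 1" "horoset C \<inter> horoset D = {}"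
        "1 \<le> snd (SL2C_act D y)" "b' \<in> H3" "1 < snd (SL2C_act D b')" "hdist o' b' \<le> R"
        by (auto simp: horoset_def)
      note CI = inv2[OF C]
      let ?E = "D ** inv2 C"
      have dE: "det ?E = 1" using D CI by (simp add: det_mul)
      have E: "SL2C_act ?E (SL2C_act C p) = SL2C_act D p" if "p \<in> H3" for p
        using SL2C_act_mult[OF D(1) CI(3) H[OF that]] SL2C_act_inv2(1)[OF C that] by simp
      have "\<not> 1 < snd (SL2C_act ?E p)" if p: "p \<in> H3" "1 < snd p" for p
      proof -
        define q where "q = SL2C_act (inv2 C) p"
        have q: "q \<in> H3" "SL2C_act C q = p"
          unfolding q_def using hv_act(2)[OF CI(3) p(1)] SL2C_act_inv2(2)[OF C p(1)] by auto
        hence "q \<in> horoset C" using p by (simp add: horoset_def)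
        hence "q \<notin> horoset D" using D(2) by blast
        thus ?thesis using E[OF q(1)] q by (simp add: horoset_def)
      qed
      moreover have "1 \<le> snd (SL2C_act ?E (SL2C_act C y))" using E y D by simp
      moreover have "SL2C_act C b' \<in> horoset ?E" using E D H by (simp add: horoset_def)
      moreover have "hdist (SL2C_act C o') (SL2C_act C b') \<le> R" using I o D by simp
      ultimately show ?thesis using dE by blast
    qed
  qed
  thus ?thesis using I[OF e(1) o(1)] by simp
qed

text \<open>In the coordinates of the horoball, \<open>y'\<close> is \<open>y\<close> raised by the
  factor 4, which costs the distance \<open>ln 4\<close>, with \<open>cosh (ln 4) = 17/8\<close>.
  Where \<open>cosh\<close> of the distance is at most \<open>3/2\<close> the height drops at most
  by the factor 3, so the whole ball around \<open>y'\<close> stays inside. Such balls of fixed size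
  drive the packing argument for horoballs.\<close>

lemma horoball_deep_point:
  assumes C: "det C = 1" and y: "y \<in> H3" "1 \<le> snd (SL2C_act C y)"
  shows "\<exists>y'\<in>H3. cosh (hdist y y') = 17/8 \<and> (\<forall>q\<in>H3. cosh (hdist y' q) \<le> 3/2 \<longrightarrow> q \<in> horoset C)"
proof -
  note H = hv_act(2)[OF C] and I = SL2C_act_isometry[OF C] and CI = inv2[OF C]
  define p where "p = SL2C_act C y"
  have p: "p \<in> H3" "1 \<le> snd p" using H y p_def by auto
  define p' where "p' = (fst p, 4 * snd p)"
  have p': "p' \<in> H3" using p by (simp add: H3_def p'_def)
  define y' where "y' = SL2C_act (inv2 C) p'"
  have y': "y' \<in> H3" "SL2C_act C y' = p'"
    unfolding y'_def using hv_act(2)[OF CI(3) p'] SL2C_act_inv2(2)[OF C p'] by auto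
  have "cosh (hdist p p') = (17 * (snd p)\<^sup>2) / (8 * (snd p)\<^sup>2)"
    unfolding cosh_hdist_coord[OF p(1) p'] by (simp add: p'_def power2_eq_square)
  hence "cosh (hdist p p') = 17/8" using p(2) by simp
  hence 1: "cosh (hdist y y') = 17/8" using I[OF y(1) y'(1)] y' p_def by simp
  have "q \<in> horoset C" if q: "q \<in> H3" "cosh (hdist y' q) \<le> 3/2" for q
  proof -
    have "snd p' \<le> 2 * snd (SL2C_act C q) * cosh (hdist (SL2C_act C q) p')"
      using height_le H[OF q(1)] p' by blast
    also have "cosh (hdist (SL2C_act C q) p') = cosh (hdist y' q)"
      using I[OF q(1) y'(1)] y' hdist_sym by metis
    also have "2 * snd (SL2C_act C q) * cosh (hdist y' q) \<le> 2 * snd (SL2C_act C q) * (3/2)"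
      using q H[OF q(1)] by (intro mult_left_mono) (auto simp: H3_def)
    finally have "4 * snd p \<le> 3 * snd (SL2C_act C q)" by (simp add: p'_def)
    thus ?thesis using p(2) q(1) by (simp add: horoset_def)
  qed
  thus ?thesis using 1 y' by blast
qed

section \<open>Compactness of balls\<close>

lemma compact_hball:
  assumes "x \<in> H3" shows "compact {q \<in> H3. hdist x q \<le> R}"
proof (cases "R \<ge> 0")
  case False
  hence "{q \<in> H3. hdist x q \<le> R} = {}" using hdist_nonneg[OF assms] by fastforce
  thus ?thesis by (metis compact_empty)
next
  case True
  define k t where "k = cosh R" "t = snd x"
  have k: "k \<ge> 1" and t: "t > 0" using assms by (auto simp: k_t_def H3_def cosh_real_ge_1)
  \<comment> \<open>The lower bound on the height comes from \<open>height_le\<close>. It keeps the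
    set away from the boundary plane, so that the strict inequality of \<open>H3\<close> is replaced
    by closed conditions.\<close>
  define S where "S = {q :: hpoint. t / (2 * k) \<le> snd q \<and>
    (cmod (fst x - fst q))\<^sup>2 + t\<^sup>2 + (snd q)\<^sup>2 \<le> 2 * t * snd q * k}"
  have eq: "{q \<in> H3. hdist x q \<le> R} = S"
  proof (intro equalityI subsetI)
    fix q assume "q \<in> {q \<in> H3. hdist x q \<le> R}"
    hence q: "q \<in> H3" "hdist x q \<le> R" by blast+
    hence q: "q \<in> H3" "cosh (hdist x q) \<le> k"
      using hdist_le_iff[OF assms q(1) True] by (simp_all only: k_t_def)
    have s: "snd q > 0" using q by (simp add: H3_def)
    have "2 * snd q * cosh (hdist q x) \<le> 2 * snd q * k"
      using q(2) s hdist_sym[of x q] by (intro mult_left_mono) auto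
    hence "t \<le> 2 * snd q * k" using height_le[OF q(1) assms] k_t_def(2) by linarith
    hence "t \<le> snd q * (2 * k)" by (simp only: mult_ac)
    hence 1: "t / (2 * k) \<le> snd q" using k by (subst pos_divide_le_eq) auto
    have "cosh (hdist x q) * (2 * t * snd q) \<le> k * (2 * t * snd q)"
      using q s t by (intro mult_right_mono) auto
    thus "q \<in> S" using 1 s t unfolding cosh_hdist_coord[OF assms q(1)] S_def
      by (simp add: k_t_def mult_ac)
  next
    fix q assume q: "q \<in> S"
    have "0 < t / (2 * k)" using k t by simp
    hence s: "snd q > 0" using q unfolding S_def by force
    hence h: "q \<in> H3" by (simp add: H3_def)
    have "cosh (hdist x q) * (2 * t * snd q) \<le> k * (2 * t * snd q)"
      using q s t unfolding cosh_hdist_coord[OF assms h] S_def by (simp add: k_t_def mult_ac)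
    hence "cosh (hdist x q) \<le> k" by (rule mult_right_le_imp_le) (use s t in simp)
    thus "q \<in> {q \<in> H3. hdist x q \<le> R}" using hdist_le_iff[OF assms h True] h by (simp add: k_t_def)
  qed
  have "closed S" unfolding S_def
    by (intro closed_Collect_conj closed_Collect_le continuous_intros)
  moreover have "bounded S"
  proof -
    have "S \<subseteq> cball (fst x) (2 * t * k) \<times> {0..2 * t * k}"
    proof
      fix q assume q: "q \<in> S"
      have "0 < t / (2 * k)" using k t by simp
      hence s: "snd q > 0" using q unfolding S_def by force
      have q2: "(cmod (fst x - fst q))\<^sup>2 + t\<^sup>2 + (snd q)\<^sup>2 \<le> 2 * t * snd q * k" using q S_def by blast
      hence "(snd q)\<^sup>2 \<le> 2 * t * snd q * k"
        using zero_le_power2[of "cmod (fst x - fst q)"] zero_le_power2[of t] by linarith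
      hence "snd q * snd q \<le> (2 * t * k) * snd q" by (simp add: power2_eq_square mult_ac)
      hence s2: "snd q \<le> 2 * t * k" using s by (rule mult_right_le_imp_le)
      have "(cmod (fst x - fst q))\<^sup>2 \<le> 2 * t * snd q * k"
        using q2 zero_le_power2[of "snd q"] zero_le_power2[of t] by linarith
      hence "(cmod (fst x - fst q))\<^sup>2 \<le> (2 * t * k) * snd q" by (simp add: mult_ac)
      also have "(2 * t * k) * snd q \<le> (2 * t * k) * (2 * t * k)" using s2 t k by (intro mult_left_mono) auto
      finally have "(cmod (fst x - fst q))\<^sup>2 \<le> (2 * t * k)\<^sup>2" by (simp add: power2_eq_square)
      hence "cmod (fst x - fst q) \<le> 2 * t * k" by (rule power2_le_imp_le) (use t k in simp)
      thus "q \<in> cball (fst x) (2 * t * k) \<times> {0..2 * t * k}"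
        using s s2 by (cases q) (auto simp: dist_norm)
    qed
    thus ?thesis by (rule bounded_subset[rotated]) (intro bounded_Times bounded_cball bounded_closed_interval)
  qed
  ultimately show ?thesis unfolding eq compact_eq_bounded_closed by blast
qed

lemma infinite_in_compact_close:
  fixes S :: "'a::euclidean_space set"
  assumes "compact K" "S \<subseteq> K" "infinite S" "m > 0"
  shows "\<exists>p\<in>S. \<exists>q\<in>S. p \<noteq> q \<and> dist p q < m"
proof -
  obtain l where l: "l islimpt S"
    using Heine_Borel_imp_Bolzano_Weierstrass[OF assms(1,3,2)] by blast
  have inf: "infinite (S \<inter> ball l (m/2))"
    using l half_gt_zero[OF assms(4)] unfolding islimpt_eq_infinite_ball by blast
  obtain p where p: "p \<in> S \<inter> ball l (m/2)" using infinite_imp_nonempty[OF inf] by blast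
  have "infinite (S \<inter> ball l (m/2) - {p})" using inf by (rule infinite_remove)
  then obtain q where q: "q \<in> S \<inter> ball l (m/2) - {p}" using infinite_imp_nonempty by blast
  have p': "p \<in> S" "dist l p < m / 2" using p by simp_all
  have q': "q \<in> S" "dist l q < m / 2" "p \<noteq> q" using q by auto
  have "dist p q < m" using p'(2) q'(2) by (rule dist_triangle_half_r)
  thus ?thesis using p'(1) q'(1,3) by (intro bexI[of _ p] bexI[of _ q] conjI)
qed

text \<open>Heights in the ball are at least \<open>m\<close>. An infinite set would contain two
  points at Euclidean distance below \<open>m\<close>, and for these \<open>cosh (hdist p q)\<close>
  is at most \<open>1 + m^2 / (2 * m^2) = 3/2\<close>.\<close>

lemma hball_packing:
  assumes "x \<in> H3" "S \<subseteq> {q \<in> H3. hdist x q \<le> R}"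
    and sep: "\<And>p q. p \<in> S \<Longrightarrow> q \<in> S \<Longrightarrow> p \<noteq> q \<Longrightarrow> \<not> cosh (hdist p q) \<le> 3/2"
  shows "finite S"
proof (rule ccontr)
  assume inf: "infinite S"
  define m where "m = snd x / (2 * cosh R)"
  have t: "snd x > 0" using assms(1) by (simp add: H3_def)
  hence m: "m > 0" unfolding m_def by (intro divide_pos_pos mult_pos_pos) auto
  have low: "m \<le> snd q" if "q \<in> S" for q
  proof -
    have q: "q \<in> H3" "hdist x q \<le> R" using subsetD[OF assms(2) that] by simp_all
    have s: "snd q > 0" using q by (simp add: H3_def)
    have "snd x \<le> 2 * snd q * cosh (hdist q x)" using height_le[OF q(1) assms(1)] .
    also have "\<dots> \<le> 2 * snd q * cosh R"
      using cosh_le_mono[OF hdist_nonneg[OF assms(1) q(1)] q(2)] s hdist_sym[of x q] by simp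
    finally have "snd x \<le> snd q * (2 * cosh R)" by (simp only: mult_ac)
    thus ?thesis unfolding m_def by (subst pos_divide_le_eq) auto
  qed
  obtain p q where pq: "p \<in> S" "q \<in> S" "p \<noteq> q" "dist p q < m"
    using infinite_in_compact_close[OF compact_hball[OF assms(1)] assms(2) inf m] by blast
  have h: "p \<in> H3" "q \<in> H3" using subsetD[OF assms(2) pq(1)] subsetD[OF assms(2) pq(2)] by simp_all
  have "(dist p q)\<^sup>2 \<le> m * m" unfolding power2_eq_square
    using pq(4) m by (intro mult_mono) auto
  also have "\<dots> \<le> snd p * snd q" using low[OF pq(1)] low[OF pq(2)] m by (intro mult_mono) auto
  finally have "(dist p q)\<^sup>2 / (2 * snd p * snd q) \<le> 1/2"
    using h unfolding H3_def by (subst pos_divide_le_eq) simp_all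
  hence "cosh (hdist p q) \<le> 3/2" using cosh_hdist_eq[OF h] by simp
  thus False using sep pq by blast
qed

section \<open>Heights along geodesics\<close>

text \<open>Along a geodesic the reciprocal height in the coordinates of any horoball solves
  \<open>f'' = f\<close>, and the horoball is the region \<open>f < 1\<close>. Entering and leaving
  horoballs thus becomes a question about functions of one variable.\<close>

lemma geod_height_wave:
  assumes "det C = 1" "p \<in> H3" "q \<in> H3"
  shows "\<exists>X Y. \<forall>u. 0 \<le> u \<longrightarrow> u \<le> hdist p q \<longrightarrow>
     1 / snd (SL2C_act C (geod p q u)) = X * cosh u + Y * sinh u"
proof (cases "p = q")
  case True
  hence "\<forall>u. 0 \<le> u \<longrightarrow> u \<le> hdist p q \<longrightarrow>
     1 / snd (SL2C_act C (geod p q u)) = (1 / snd (SL2C_act C p)) * cosh u + 0 * sinh u"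
    using assms by (auto simp: geod_def)
  thus ?thesis by blast
next
  case False
  define p' q' where pq: "p' = SL2C_act C p" "q' = SL2C_act C q"
  have h: "p' \<in> H3" "q' \<in> H3" "p' \<noteq> q'" "hdist p' q' = hdist p q"
    unfolding pq using hv_act(2)[OF assms(1)] assms(2,3) False SL2C_act_inv2(1)[OF assms(1)]
      SL2C_act_isometry[OF assms(1)] by metis+
  define d where "d = hdist p q"
  have "1 / snd (SL2C_act C (geod p q u)) = (1 / snd p') * cosh u +
      ((1 / snd q' - cosh d * (1 / snd p')) / sinh d) * sinh u" if "0 \<le> u" "u \<le> hdist p q" for u
  proof -
    have d: "sinh d \<noteq> 0" using h hdist_eq_0_iff[OF assms(2,3)] False by (simp add: d_def)
    have "1 / snd (SL2C_act C (geod p q u)) = 1 / snd (geod p' q' u)"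
      using geod_act[OF assms that] pq by simp
    also have "\<dots> = (sinh (d - u) * (1 / snd p') + sinh u * (1 / snd q')) / sinh d"
      using geod_height[OF h(1,2,3), of u] that h(4) by (simp add: d_def)
    also have "\<dots> = (1 / snd p') * cosh u + ((1 / snd q' - cosh d * (1 / snd p')) / sinh d) * sinh u"
      unfolding sinh_diff using d by (simp add: add_divide_distrib diff_divide_distrib algebra_simps)
    finally show ?thesis .
  qed
  thus ?thesis by blast
qed

lemma wave_shift:
  fixes X Y a u :: real
  shows "X * cosh u + Y * sinh u =
    (X * cosh a + Y * sinh a) * cosh (a - u) - (X * sinh a + Y * cosh a) * sinh (a - u)"
proof -
  have "cosh a * cosh a = 1 + sinh a * sinh a" using cosh_square_eq[of a] by (simp add: power2_eq_square)
  thus ?thesis unfolding sinh_diff cosh_diff by algebra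
qed

text \<open>The derivative at \<open>a\<close> cannot be positive, since the function would then be
  below 1 just before \<open>a\<close>. Expanding around \<open>a\<close> by
  \<open>wave_shift\<close> leaves \<open>cosh (a - s)\<close> plus a nonnegative multiple of
  \<open>sinh (a - s)\<close>. This is the hypothesis of \<open>horizontal_le_1\<close> for a
  geodesic arriving from outside.\<close>

lemma wave_left:
  fixes X Y a s :: real
  assumes "s \<le> a" "X * cosh a + Y * sinh a = 1" "\<And>u. s \<le> u \<Longrightarrow> u \<le> a \<Longrightarrow> X * cosh u + Y * sinh u \<ge> 1"
  shows "X * cosh s + Y * sinh s \<ge> cosh (a - s)"
proof (cases "s = a")
  case True thus ?thesis using assms by simp
next
  case False
  define D where "D = X * sinh a + Y * cosh a"
  have "D \<le> 0"
  proof (rule ccontr)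
    assume "\<not> D \<le> 0"
    moreover have "((\<lambda>u. X * cosh u + Y * sinh u) has_real_derivative D) (at a)"
      unfolding D_def by (auto intro!: derivative_eq_intros)
    ultimately obtain d where d: "d > 0" "\<And>h. h > 0 \<Longrightarrow> h < d \<Longrightarrow>
        X * cosh (a - h) + Y * sinh (a - h) < X * cosh a + Y * sinh a"
      using DERIV_pos_inc_left[of "\<lambda>u. X * cosh u + Y * sinh u" D a] by force
    define h where "h = min (d / 2) (a - s)"
    have "h > 0" "h < d" "s \<le> a - h" "a - h \<le> a" using d(1) False assms(1) by (auto simp: h_def)
    thus False using d(2)[of h] assms(2) assms(3)[of "a - h"] by simp
  qed
  moreover have "sinh (a - s) \<ge> 0" using assms(1) by simp
  ultimately have "D * sinh (a - s) \<le> 0" by (simp add: mult_nonpos_nonneg)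
  thus ?thesis using wave_shift[of X s Y a] assms(2) by (simp add: D_def)
qed

lemma sinh_superadd: "0 \<le> x \<Longrightarrow> 0 \<le> y \<Longrightarrow> sinh x + sinh y \<le> sinh (x + y :: real)"
proof -
  assume "0 \<le> x" "0 \<le> y"
  hence "sinh x * 1 \<le> sinh x * cosh y" "1 * sinh y \<le> cosh x * sinh y"
    by (intro mult_left_mono mult_right_mono cosh_real_ge_1; simp)+
  thus ?thesis unfolding sinh_add by simp
qed

text \<open>The value at \<open>u\<close> is a combination of the end values with weights
  \<open>sinh (s2 - u)\<close> and \<open>sinh (u - s1)\<close>, divided by
  \<open>sinh (s2 - s1)\<close>; by superadditivity of \<open>sinh\<close> the weights sum to at
  most 1. Geometrically: horoballs are convex.\<close>

lemma wave_convex: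
  fixes X Y s1 s2 u :: real
  assumes "s1 \<le> u" "u \<le> s2" "X * cosh s1 + Y * sinh s1 < 1" "X * cosh s2 + Y * sinh s2 < 1"
  shows "X * cosh u + Y * sinh u < 1"
proof (cases "s1 = u \<or> s2 = u")
  case True thus ?thesis using assms by auto
next
  case False
  hence lt: "s1 < u" "u < s2" using assms by auto
  define f where "f v = X * cosh v + Y * sinh v" for v
  have "f u * sinh (s2 - s1) = sinh (s2 - u) * f s1 + sinh (u - s1) * f s2"
    unfolding f_def sinh_diff cosh_diff by (simp add: algebra_simps)
  also have "\<dots> < sinh (s2 - u) * 1 + sinh (u - s1) * 1"
    using assms lt by (intro add_strict_mono mult_strict_left_mono) (auto simp: f_def)
  also have "\<dots> \<le> sinh (s2 - s1)" using sinh_superadd[of "s2 - u" "u - s1"] lt by simp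
  finally have "f u * sinh (s2 - s1) < 1 * sinh (s2 - s1)" by simp
  thus ?thesis using lt unfolding f_def by (subst (asm) mult_less_cancel_right) auto
qed

section \<open>Reduced words\<close>

lemma inv_letter_inv [simp]: "inv_letter (inv_letter a) = a"
  by (simp add: inv_letter_def)

lemma inv_letter_neq [simp]: "inv_letter a \<noteq> a" "a \<noteq> inv_letter a"
  by (metis fst_conv inv_letter_def snd_conv)+

lemma fst_inv_letter [simp]: "fst (inv_letter a) = fst a"
  by (simp add: inv_letter_def)

lemma inv_letter_eq_iff: "inv_letter a = b \<longleftrightarrow> a = inv_letter b"
  by (metis inv_letter_inv)

lemma reduced_Nil [simp]: "reduced []" by (simp add: reduced_def)

lemma reduced_Cons: "reduced (a # w) \<longleftrightarrow> (w = [] \<or> hd w \<noteq> inv_letter a) \<and> reduced w"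
  by (auto simp: reduced_def successively_Cons)

lemma reduced_append:
  "reduced (u @ v) \<longleftrightarrow> reduced u \<and> reduced v \<and> (u = [] \<or> v = [] \<or> hd v \<noteq> inv_letter (last u))"
  by (auto simp: reduced_def successively_append_iff)

lemma reduced_sublist: "reduced w \<Longrightarrow> sublist v w \<Longrightarrow> reduced v"
  by (auto simp: sublist_def reduced_append)

lemma reduced_cancel_cons: "reduced w \<Longrightarrow> reduced (cancel_cons a w)"
  by (cases w) (auto simp: reduced_Cons)

lemma reduced_foldr: "reduced v \<Longrightarrow> reduced (foldr cancel_cons u v)"
  by (induction u) (auto intro: reduced_cancel_cons)

lemma reduced_reduce [simp]: "reduced (reduce_word w)"
  by (simp add: reduce_word_def reduced_foldr)

text \<open>Letters act on reduced words by \<open>cancel_cons\<close>, a letter and its inverse by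
  inverse permutations. The group laws of the free group are derived from this action, with
  \<open>reduce_word w\<close> as the image of the empty word under \<open>w\<close>.\<close>

lemma cancel_cons_inv:
  assumes "reduced w" shows "cancel_cons a (cancel_cons (inv_letter a) w) = w"
proof (cases w)
  case (Cons b w')
  thus ?thesis using assms by (cases w') (auto simp: reduced_Cons)
qed simp

lemma cancel_cons_reduced: "reduced (a # w) \<Longrightarrow> cancel_cons a w = a # w"
  by (cases w) (auto simp: reduced_Cons)

lemma foldr_reduced: "reduced (u @ v) \<Longrightarrow> foldr cancel_cons u v = u @ v"
proof (induction u)
  case (Cons a u)
  hence "reduced (u @ v)" "reduced (a # u @ v)" by (auto simp: reduced_Cons)
  thus ?case using Cons.IH cancel_cons_reduced by simp
qed simp

lemma reduce_reduced [simp]: "reduced w \<Longrightarrow> reduce_word w = w"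
  using foldr_reduced[of w "[]"] by (simp add: reduce_word_def)

lemma foldr_cancel_cons:
  assumes "reduced v"
  shows "foldr cancel_cons (cancel_cons a w) v = cancel_cons a (foldr cancel_cons w v)"
proof (cases w)
  case (Cons b w')
  have "cancel_cons a (cancel_cons (inv_letter a) (foldr cancel_cons w' v)) = foldr cancel_cons w' v"
    by (intro cancel_cons_inv reduced_foldr assms)
  thus ?thesis using Cons by simp
qed simp

lemma foldr_reduce_word: "reduced v \<Longrightarrow> foldr cancel_cons (reduce_word u) v = foldr cancel_cons u v"
proof (induction u)
  case (Cons a u)
  have "foldr cancel_cons (reduce_word (a # u)) v = foldr cancel_cons (cancel_cons a (reduce_word u)) v"
    by (simp add: reduce_word_def)
  thus ?case using Cons foldr_cancel_cons[OF Cons.prems] by simp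
qed (simp add: reduce_word_def)

lemma reduce_append: "reduce_word (u @ v) = foldr cancel_cons u (reduce_word v)"
  by (simp add: reduce_word_def)

lemma reduce_append_left [simp]: "reduce_word (reduce_word u @ v) = reduce_word (u @ v)"
  by (simp add: reduce_append foldr_reduce_word)

lemma reduce_append_right [simp]: "reduce_word (u @ reduce_word v) = reduce_word (u @ v)"
  by (simp add: reduce_append)

lemma reduce_append_mid: "reduce_word (u @ reduce_word v @ w) = reduce_word (u @ v @ w)"
  by (metis reduce_append_left reduce_append_right)

definition inv_word :: "'a word \<Rightarrow> 'a word" where
  "inv_word w = rev (map inv_letter w)"

lemma inv_word_simps [simp]:
  "inv_word [] = []" "inv_word (a # w) = inv_word w @ [inv_letter a]"
  "inv_word (u @ v) = inv_word v @ inv_word u" "inv_word (inv_word w) = w"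
  "length (inv_word w) = length w" "inv_word w = [] \<longleftrightarrow> w = []"
  by (simp_all add: inv_word_def rev_map comp_def)

lemma fst_set_inv_word [simp]: "fst ` set (inv_word w) = fst ` set w"
  by (simp add: inv_word_def image_image)

lemma reduced_inv_word [simp]: "reduced (inv_word w) \<longleftrightarrow> reduced w"
proof -
  have "reduced (inv_word w)" if "reduced w" for w :: "'a word"
    using that
  proof (induction w)
    case (Cons a w)
    show ?case
    proof (cases w)
      case (Cons b w')
      thus ?thesis using Cons.IH Cons.prems by (auto simp: reduced_append reduced_Cons inv_letter_eq_iff)
    qed (simp add: reduced_Cons)
  qed simp
  thus ?thesis by (metis inv_word_simps(4))
qed

lemma foldr_inv_word: "reduced v \<Longrightarrow> foldr cancel_cons w (foldr cancel_cons (inv_word w) v) = v"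
proof (induction w arbitrary: v)
  case (Cons a w)
  thus ?case by (simp add: reduced_cancel_cons cancel_cons_inv)
qed simp

lemma reduce_cancel_right [simp]:
  "reduce_word (w @ inv_word w @ v) = reduce_word v" "reduce_word (inv_word w @ w @ v) = reduce_word v"
  "reduce_word (w @ inv_word w) = []" "reduce_word (inv_word w @ w) = []"
proof -
  have *: "reduce_word (w @ inv_word w @ v) = reduce_word v" for v w :: "'a word"
    using foldr_inv_word[of "reduce_word v" w] by (simp add: reduce_append)
  show "reduce_word (w @ inv_word w @ v) = reduce_word v" by (rule *)
  show "reduce_word (inv_word w @ w @ v) = reduce_word v" using *[of "inv_word w"] by simp
  show "reduce_word (w @ inv_word w) = []" using *[of w "[]"] by simp
  show "reduce_word (inv_word w @ w) = []" using *[of "inv_word w" "[]"] by simp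
qed

lemma reduce_cancel_mid [simp]:
  "reduce_word (u @ w @ inv_word w) = reduce_word u" "reduce_word (u @ inv_word w @ w) = reduce_word u"
  "reduce_word (u @ w @ inv_word w @ v) = reduce_word (u @ v)"
  "reduce_word (u @ inv_word w @ w @ v) = reduce_word (u @ v)"
proof -
  show "reduce_word (u @ w @ inv_word w) = reduce_word u" "reduce_word (u @ inv_word w @ w) = reduce_word u"
    by (metis append_Nil2 reduce_append_right reduce_cancel_right(3,4))+
  show "reduce_word (u @ w @ inv_word w @ v) = reduce_word (u @ v)"
   "reduce_word (u @ inv_word w @ w @ v) = reduce_word (u @ v)"
    by (metis reduce_append_right reduce_cancel_right(1,2))+
qed

lemma fst_set_foldr_subset: "fst ` set (foldr cancel_cons u v) \<subseteq> fst ` set u \<union> fst ` set v"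
proof (induction u)
  case (Cons a u)
  have "fst ` set (cancel_cons a w) \<subseteq> {fst a} \<union> fst ` set w" for w
    by (cases w) auto
  from this[of "foldr cancel_cons u v"] Cons show ?case by auto
qed simp

lemma fst_set_reduce_subset: "fst ` set (reduce_word w) \<subseteq> fst ` set w"
  using fst_set_foldr_subset[of w "[]"] by (simp add: reduce_word_def)

lemma length_reduce_le: "length (reduce_word w) \<le> length w"
proof -
  have "length (cancel_cons a w) \<le> Suc (length w)" for a :: "'a \<times> bool" and w by (cases w) auto
  hence "length (foldr cancel_cons w []) \<le> length w" for w :: "'a word"
    by (induction w) (auto intro: order_trans)
  thus ?thesis by (simp add: reduce_word_def)
qed

text \<open>A path in the tree passes through every vertex of the geodesic between its ends.\<close>

lemma reduce_word_split:
  "reduce_word w = g1 @ g2 \<Longrightarrow> \<exists>w1 w2. w = w1 @ w2 \<and> reduce_word w1 = g1 \<and> reduce_word w2 = g2"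
proof -
  assume H: "reduce_word w = g1 @ g2"
  \<comment> \<open>Only the tail is found by induction: the reductions of the tails of
    \<open>w\<close> change by one letter at a time and so pass through \<open>g2\<close>. The value
    of the head is then forced by cancellation in the group.\<close>
  have "\<exists>w1 w2. w = w1 @ w2 \<and> reduce_word w2 = g2" using H
  proof (induction w arbitrary: g1)
    case Nil thus ?case by (auto simp: reduce_word_def)
  next
    case (Cons a w)
    have e: "cancel_cons a (reduce_word w) = g1 @ g2" using Cons.prems by (simp add: reduce_word_def)
    show ?case
    proof (cases "g1 = []")
      case True
      hence "a # w = [] @ (a # w) \<and> reduce_word (a # w) = g2" using Cons.prems by simp
      thus ?thesis by blast
    next
      case False
      have "\<exists>h. reduce_word w = h @ g2"
      proof (cases "reduce_word w")
        case Nil thus ?thesis using e False by (cases g1) auto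
      next
        case (Cons b r)
        show ?thesis
        proof (cases "b = inv_letter a")
          case True thus ?thesis using e Cons by (auto intro!: exI[of _ "b # g1"])
        next
          case False
          thus ?thesis using e Cons \<open>g1 \<noteq> []\<close> by (cases g1) auto
        qed
      qed
      then obtain w1 w2 where "w = w1 @ w2" "reduce_word w2 = g2" using Cons.IH by blast
      hence "a # w = (a # w1) @ w2 \<and> reduce_word w2 = g2" by simp
      thus ?thesis by blast
    qed
  qed
  then obtain w1 w2 where w: "w = w1 @ w2" "reduce_word w2 = g2" by blast
  have r: "reduced (g1 @ g2)" using H reduced_reduce by metis
  have "reduce_word w1 = reduce_word ((w1 @ w2) @ inv_word w2)" by simp
  also have "\<dots> = reduce_word ((g1 @ g2) @ inv_word w2)" using w H by (metis reduce_append_left)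
  also have "\<dots> = reduce_word (g1 @ w2 @ inv_word w2)" using w(2) by (metis append.assoc reduce_append_mid)
  also have "\<dots> = g1" using r by (simp add: reduced_append)
  finally show ?thesis using w by blast
qed

text \<open>Cancellation in a product of reduced words happens only at the junction;
  \<open>k\<close> counts the letters lost on each side.\<close>

lemma foldr_cancel_cons_form:
  assumes "reduced u" "reduced v"
  shows "\<exists>k. k \<le> length u \<and> k \<le> length v \<and>
    foldr cancel_cons u v = take (length u - k) u @ drop k v"
  using assms
proof (induction u)
  case (Cons a u)
  then obtain k where k: "k \<le> length u" "k \<le> length v"
    "foldr cancel_cons u v = take (length u - k) u @ drop k v" by (auto simp: reduced_Cons)
  show ?case
  proof (cases "k = length u")
    case True
    hence f: "foldr cancel_cons (a # u) v = cancel_cons a (drop k v)" using k by simp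
    show ?thesis
    proof (cases "k < length v \<and> v ! k = inv_letter a")
      case T: True
      hence "drop k v = inv_letter a # drop (Suc k) v" using Cons_nth_drop_Suc[of k v] by simp
      thus ?thesis using f T True by (intro exI[of _ "Suc k"]) simp
    next
      case F: False
      have "cancel_cons a (drop k v) = a # drop k v"
      proof (cases "k < length v")
        case True
        hence "drop k v = v ! k # drop (Suc k) v" by (rule Cons_nth_drop_Suc[symmetric])
        thus ?thesis using F True by simp
      qed simp
      thus ?thesis using f True k by (intro exI[of _ k]) simp
    qed
  next
    case False
    then obtain b u' where u: "u = b # u'" using k by (cases u) auto
    have nb: "b \<noteq> inv_letter a" using Cons.prems u by (simp add: reduced_Cons)
    have "take (length u - k) u = b # take (length u' - k) u'"
      using False k u by (simp add: take_Cons' Suc_diff_le)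
    hence "foldr cancel_cons (a # u) v = a # take (length u - k) u @ drop k v" using k nb by simp
    thus ?thesis using k False by (intro exI[of _ k]) (simp add: Suc_diff_le)
  qed
qed simp

section \<open>Powers and cyclic reduction\<close>

definition wpow :: "'a word \<Rightarrow> nat \<Rightarrow> 'a word" where
  "wpow w k = concat (replicate k w)"

lemma wpow_simps [simp]: "wpow w 0 = []" "wpow w (Suc k) = w @ wpow w k"
  by (simp_all add: wpow_def)

lemma wpow_add: "wpow w (j + k) = wpow w j @ wpow w k"
  by (simp add: wpow_def replicate_add)

lemma wpow_Suc_right: "wpow w (Suc k) = wpow w k @ w"
  using wpow_add[of w k 1] by simp

lemma length_wpow [simp]: "length (wpow w k) = k * length w"
  by (induction k) simp_all

lemma wpow_Nil [simp]: "wpow [] k = []" by (induction k) simp_all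

lemma inv_word_wpow: "inv_word (wpow w k) = wpow (inv_word w) k"
proof (induction k)
  case (Suc k)
  have "inv_word (wpow w (Suc k)) = inv_word (wpow w k) @ inv_word w" by simp
  thus ?case using Suc wpow_Suc_right by metis
qed simp

lemma fst_set_wpow: "fst ` set (wpow w k) \<subseteq> fst ` set w"
  by (induction k) auto

lemma wpow_nth: "i < k * length w \<Longrightarrow> wpow w k ! i = w ! (i mod length w)"
proof (induction k arbitrary: i)
  case (Suc k)
  show ?case
  proof (cases "i < length w")
    case False
    hence "i - length w < k * length w" using Suc.prems by simp
    thus ?thesis using Suc.IH[of "i - length w"] False by (simp add: nth_append le_mod_geq)
  qed (simp add: nth_append)
qed simp

lemma cyclically_reduced_wpow:
  assumes "cyclically_reduced w" shows "reduced (wpow w k)"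
proof (cases "w = []")
  case False
  have "hd (wpow w (Suc k)) = hd w" for k using False by simp
  show ?thesis
  proof (induction k)
    case (Suc k)
    show ?case
    proof (cases k)
      case (Suc j)
      hence "hd (wpow w k) = hd w" using False by simp
      thus ?thesis using \<open>reduced (wpow w k)\<close> assms False by (auto simp: reduced_append cyclically_reduced_def)
    qed (use assms in \<open>simp add: cyclically_reduced_def\<close>)
  qed simp
qed simp

lemma cyclically_reduced_inv_word:
  assumes "cyclically_reduced w" shows "cyclically_reduced (inv_word w)"
proof (cases "w = []")
  case False
  have "hd (inv_word w) = inv_letter (last w)" "last (inv_word w) = inv_letter (hd w)"
    using False by (simp_all add: inv_word_def hd_rev last_rev last_map hd_map)
  thus ?thesis using assms False unfolding cyclically_reduced_def
    by (metis inv_letter_inv inv_word_simps(6) reduced_inv_word)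
qed (simp add: cyclically_reduced_def)

lemma cyclic_reduction:
  "reduced x \<Longrightarrow> \<exists>a w. x = a @ w @ inv_word a \<and> cyclically_reduced w"
proof (induction "length x" arbitrary: x rule: less_induct)
  case less
  show ?case
  proof (cases "cyclically_reduced x")
    case True
    hence "x = [] @ x @ inv_word [] \<and> cyclically_reduced x" by simp
    thus ?thesis by blast
  next
    case False
    hence x: "x \<noteq> []" "hd x = inv_letter (last x)" using less.prems by (auto simp: cyclically_reduced_def)
    obtain y l where yl: "x = y @ [l]" using x(1) by (metis append_butlast_last_id)
    have "y \<noteq> []" using x yl by auto
    then obtain e z where y: "y = e # z" by (cases y) auto
    have e: "l = inv_letter e" using x yl y by (simp add: inv_letter_eq_iff)
    have "reduced z" using less.prems yl y by (auto simp: reduced_append reduced_Cons)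
    then obtain a w where "z = a @ w @ inv_word a" "cyclically_reduced w"
      using less.hyps[of z] yl y by auto
    hence "x = (e # a) @ w @ inv_word (e # a) \<and> cyclically_reduced w" using yl y e by simp
    thus ?thesis by blast
  qed
qed

text \<open>Reading a periodic reduced word backwards and inverting never reproduces it: the reflection
  would fix a letter or swap two adjacent ones.\<close>

lemma periodic_not_self_inverse:
  fixes u :: "'a word" and M b :: nat
  assumes u: "cyclically_reduced u" "u \<noteq> []"
    and H: "\<And>i. b \<le> i \<Longrightarrow> i < b + length u \<Longrightarrow> i \<le> M \<and>
      u ! (i mod length u) = inv_letter (u ! ((M - i) mod length u))"
  shows False
proof -
  define p where "p = int (length u)"
  have p: "p > 0" using u by (simp add: p_def)
  \<comment> \<open>\<open>F\<close> continues \<open>u\<close> periodically to all integers. The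
    hypothesis covers one full period of positions, so the reflection of \<open>j\<close> to
    \<open>M - j\<close> inverts letters everywhere.\<close>
  define F where "F j = u ! nat (j mod p)" for j :: int
  have per: "F (j mod p) = F j" for j by (simp add: F_def)
  have F_nat: "F (int i) = u ! (i mod length u)" for i by (simp add: F_def p_def flip: zmod_int)
  have refl: "F j = inv_letter (F (int M - j))" for j
  proof -
    define i where "i = nat (int b + (j - int b) mod p)"
    have i: "int i = int b + (j - int b) mod p" using p by (simp add: i_def)
    have ib: "b \<le> i" "i < b + length u" using i p pos_mod_bound[OF p, of "j - int b"] pos_mod_sign[OF p, of "j - int b"]
      unfolding p_def by linarith+
    have cong: "int i mod p = j mod p" unfolding i by (simp add: mod_simps)
    have "F j = F (int i)" using cong per by metis
    also have "\<dots> = inv_letter (F (int (M - i)))" unfolding F_nat using H[OF ib] by blast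
    also have "int (M - i) = int M - int i" using H[OF ib] by auto
    also have "F (int M - int i) = F (int M - j)"
      using cong per by (metis mod_diff_right_eq)
    finally show ?thesis .
  qed
  have adj: "F (j + 1) \<noteq> inv_letter (F j)" for j
  proof -
    define i where "i = nat (j mod p)"
    have i: "int i = j mod p" using p by (simp add: i_def)
    hence "i < length u" using pos_mod_bound[OF p, of j] unfolding p_def by linarith
    note i = i this
    have 1: "F j = u ! i" using i per[of j] F_nat[of i] by simp
    have 2: "F (j + 1) = u ! (Suc i mod length u)"
      using F_nat[of "Suc i"] i(1) per by (metis mod_add_left_eq of_nat_Suc add.commute)
    show ?thesis
    proof (cases "Suc i < length u")
      case True
      have "reduced u" using u by (simp add: cyclically_reduced_def)
      hence "u ! Suc i \<noteq> inv_letter (u ! i)" unfolding reduced_def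
        using True by (simp add: successively_conv_nth)
      thus ?thesis using 1 2 True by simp
    next
      case False
      hence "i = length u - 1" "Suc i = length u" using i by auto
      thus ?thesis using 1 2 u by (simp add: cyclically_reduced_def last_conv_nth hd_conv_nth)
    qed
  qed
  show False
  proof (cases "even M")
    case True
    hence "int M - int M div 2 = int M div 2" by (auto elim!: evenE)
    thus False using refl[of "int M div 2"] inv_letter_neq by metis
  next
    case False
    hence e: "int M - int M div 2 = int M div 2 + 1" by (auto elim!: oddE)
    have "F (int M div 2) = inv_letter (F (int M div 2 + 1))" using refl[of "int M div 2"] unfolding e .
    thus False using adj[of "int M div 2"] by (metis inv_letter_inv)
  qed
qed

lemma nth_inv_word: "i < length w \<Longrightarrow> inv_word w ! i = inv_letter (w ! (length w - 1 - i))"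
  by (simp add: inv_word_def rev_nth)

lemma append_eq_shorter_left: "a @ s = b @ r \<Longrightarrow> length a \<le> length b \<Longrightarrow> \<exists>x. b = a @ x \<and> s = x @ r"
  by (auto simp: append_eq_append_conv2)

lemma append_eq_shorter_right: "s @ a = r @ b \<Longrightarrow> length a \<le> length b \<Longrightarrow> \<exists>x. b = x @ a \<and> s = r @ x"
  by (auto simp: append_eq_append_conv2)

text \<open>The conjugator \<open>a\<close> is short, because a long one would make the periodic
  part of the word its own inverse reading. In \<open>N = m + 3 * length b + 3\<close>, one
  allowance of \<open>length b + 1\<close> copies at each end absorbs \<open>a\<close> and its
  inverse, and a third one makes up for what cancels against \<open>b\<close>.\<close>

lemma wpow_sublist_conjugate:
  assumes u: "cyclically_reduced u" "u \<noteq> []" and b: "reduced b"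
    and N: "N = m + 3 * length b + 3"
    and x: "reduce_word (wpow u N @ b) = a @ w @ inv_word a"
  shows "sublist (wpow u m) w"
proof -
  define p \<beta> where "p = length u" "\<beta> = length b"
  have p1: "p \<ge> 1" using u by (simp add: p_\<beta>_def Suc_le_eq)
  define X where "X = a @ w @ inv_word a"
  have "X = foldr cancel_cons (wpow u N) b" using x b by (simp add: X_def reduce_append)
  then obtain k where k: "k \<le> N * p" "k \<le> \<beta>" "X = take (N * p - k) (wpow u N) @ drop k b"
    using foldr_cancel_cons_form[OF cyclically_reduced_wpow[OF u(1), of N] b] by (auto simp: p_\<beta>_def)
  define P where "P = N * p - k"
  have "\<beta> * 1 \<le> \<beta> * p" using p1 by (intro mult_le_mono) auto
  moreover have "N * p = m * p + 3 * (\<beta> * p) + 3 * p" unfolding N p_\<beta>_def by (simp add: algebra_simps)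
  ultimately have NP: "N * p \<ge> m * p + 2 * (\<beta> * p) + \<beta> + 3 * p" "\<beta> * p \<ge> \<beta>" by auto
  have P: "P \<ge> m * p + 2 * (\<beta> * p) + 3 * p" using NP k by (simp add: P_def)
  have lenX: "length X = P + (\<beta> - k)" using k by (simp add: P_def p_\<beta>_def)
  have Xnth: "X ! i = u ! (i mod p)" if "i < P" for i
    using that k wpow_nth[of i N u] by (simp add: P_def p_\<beta>_def nth_append)
  \<comment> \<open>Positions start at \<open>\<beta>\<close> because the last letters of
    \<open>X\<close>, at most \<open>\<beta>\<close> of them, may come from \<open>b\<close>: the
    mirror images of later positions all lie in the periodic part.\<close>
  have la: "length a \<le> \<beta> + p"
  proof (rule ccontr)
    assume "\<not> length a \<le> \<beta> + p"
    hence la: "length a > \<beta> + p" by simp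
    show False
    proof (rule periodic_not_self_inverse[OF u])
      fix i assume i: "\<beta> \<le> i" "i < \<beta> + length u"
      have il: "i < length a" using i la by (simp add: p_\<beta>_def)
      have iP: "i < P" using i P NP p1 unfolding p_\<beta>_def by linarith
      have LX: "length X = 2 * length a + length w" by (simp add: X_def)
      have "X ! i = a ! i" using il by (simp add: X_def nth_append)
      moreover have "X ! (length X - 1 - i) = inv_word a ! (length a - 1 - i)"
      proof -
        have "length X - 1 - i = length a + (length w + (length a - 1 - i))" using LX il by simp
        thus ?thesis unfolding X_def by (simp only: nth_append_length_plus)
      qed
      moreover have "inv_word a ! (length a - 1 - i) = inv_letter (a ! i)"
        using nth_inv_word[of "length a - 1 - i" a] il by simp
      ultimately have "X ! i = inv_letter (X ! (length X - 1 - i))" by simp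
      moreover have "length X - 1 - i < P" using lenX i k P p1 by simp
      ultimately have "u ! (i mod p) = inv_letter (u ! ((length X - 1 - i) mod p))"
        using Xnth iP by simp
      moreover have "i \<le> length X - 1" using il LX by simp
      ultimately show "i \<le> length X - 1 \<and> u ! (i mod length u) = inv_letter (u ! ((length X - 1 - i) mod length u))"
        by (simp add: p_\<beta>_def)
    qed
  qed
  define Y where "Y = drop ((\<beta> + 1 + m) * p) X"
  have l1: "(\<beta> + 1 + m) * p \<le> P" using P by (simp add: algebra_simps)
  have "take ((\<beta> + 1 + m) * p) X = take ((\<beta> + 1 + m) * p) (wpow u N)"
    using k l1 unfolding P_def p_\<beta>_def by auto
  also have "N = (\<beta> + 1 + m) + (N - (\<beta> + 1 + m))" using N by (simp add: p_\<beta>_def)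
  hence "take ((\<beta> + 1 + m) * p) (wpow u N) = take ((\<beta> + 1 + m) * p) (wpow u (\<beta> + 1 + m) @ wpow u (N - (\<beta> + 1 + m)))"
    by (metis wpow_add)
  also have "\<dots> = wpow u (\<beta> + 1 + m)" by (simp add: p_\<beta>_def)
  finally have X1: "X = wpow u (\<beta> + 1) @ wpow u m @ Y"
    unfolding Y_def by (metis append.assoc append_take_drop_id wpow_add)
  have la1: "length a \<le> length (wpow u (\<beta> + 1))"
  proof -
    have "length (wpow u (\<beta> + 1)) = \<beta> * p + p" by (simp add: p_\<beta>_def)
    thus ?thesis using la NP(2) by linarith
  qed
  have la2: "length (inv_word a) \<le> length Y"
  proof -
    have "(\<beta> + 1 + m) * p = \<beta> * p + p + m * p" by (simp add: algebra_simps)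
    hence "length Y = length X - (\<beta> * p + p + m * p)" by (simp add: Y_def)
    thus ?thesis using la lenX P NP(2) unfolding inv_word_simps by linarith
  qed
  have "a @ (w @ inv_word a) = wpow u (\<beta> + 1) @ (wpow u m @ Y)" using X1 unfolding X_def .
  then obtain r where "w @ inv_word a = r @ wpow u m @ Y" using append_eq_shorter_left la1 by blast
  hence "w @ inv_word a = (r @ wpow u m) @ Y" by simp
  then obtain r' where "w = (r @ wpow u m) @ r'" using append_eq_shorter_right la2 by blast
  thus ?thesis by (auto simp: sublist_def)
qed

section \<open>Free groups and free generating sets\<close>

lemma free_group_simps [simp]:
  "carrier (free_group S) = {w. reduced w \<and> fst ` set w \<subseteq> S}"
  "u \<otimes>\<^bsub>free_group S\<^esub> v = reduce_word (u @ v)"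
  "\<one>\<^bsub>free_group S\<^esub> = []"
  by (simp_all add: free_group_def)

lemma reduce_in_free_group: "fst ` set w \<subseteq> S \<Longrightarrow> reduce_word w \<in> carrier (free_group S)"
  using fst_set_reduce_subset[of w] by auto

lemma free_group_is_group: "group (free_group S)"
proof (rule groupI)
  fix u v assume "u \<in> carrier (free_group S)" "v \<in> carrier (free_group S)"
  thus "u \<otimes>\<^bsub>free_group S\<^esub> v \<in> carrier (free_group S)"
    using reduce_in_free_group[of "u @ v" S] by auto
next
  fix u assume u: "u \<in> carrier (free_group S)"
  show "\<exists>v\<in>carrier (free_group S). v \<otimes>\<^bsub>free_group S\<^esub> u = \<one>\<^bsub>free_group S\<^esub>"
    using u by (intro bexI[of _ "inv_word u"]) auto
qed auto

lemma inv_free_group: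
  assumes "u \<in> carrier (free_group S)" shows "inv\<^bsub>free_group S\<^esub> u = inv_word u"
  by (rule group.inv_equality[OF free_group_is_group]) (use assms in auto)

definition letmap :: "('a \<Rightarrow> 'b) \<Rightarrow> 'a word \<Rightarrow> 'b word" where
  "letmap f w = map (\<lambda>a. (f (fst a), snd a)) w"

lemma letmap_simps [simp]:
  "letmap f [] = []" "letmap f (a # w) = (f (fst a), snd a) # letmap f w"
  "letmap f (u @ v) = letmap f u @ letmap f v" "fst ` set (letmap f w) = f ` fst ` set w"
  by (auto simp: letmap_def image_image)

lemma letmap_cong: "(\<And>x. x \<in> fst ` set w \<Longrightarrow> f x = g x) \<Longrightarrow> letmap f w = letmap g w"
  by (auto simp: letmap_def)

lemma letmap_comp: "letmap f (letmap g w) = letmap (\<lambda>x. f (g x)) w"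
  by (simp add: letmap_def)

lemma letmap_ident: "letmap (\<lambda>x. x) w = w"
  by (simp add: letmap_def)

lemma reduced_letmap:
  "inj_on f (fst ` set w) \<Longrightarrow> reduced (letmap f w) \<longleftrightarrow> reduced w"
proof (induction w)
  case (Cons a w)
  have "inj_on f (fst ` set w)" using Cons.prems by (rule inj_on_subset) auto
  note IH = Cons.IH[OF this]
  show ?case
  proof (cases w)
    case (Cons b w')
    have "f (fst b) = f (fst a) \<longleftrightarrow> fst b = fst a"
      by (rule inj_on_eq_iff[OF Cons.prems]) (simp_all add: Cons)
    hence "(f (fst b), snd b) = inv_letter (f (fst a), snd a) \<longleftrightarrow> b = inv_letter a"
      by (cases a; cases b) (simp add: inv_letter_def)
    thus ?thesis using IH Cons by (simp add: reduced_Cons)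
  qed (simp add: reduced_Cons)
qed simp

context group
begin

definition letter_val :: "'a \<times> bool \<Rightarrow> 'a" where
  "letter_val a = (if snd a then fst a else inv (fst a))"

lemma word_eval_simps [simp]:
  "word_eval G [] = \<one>" "word_eval G (a # w) = letter_val a \<otimes> word_eval G w"
  by (simp_all add: word_eval_def letter_val_def)

lemma letter_val_closed: "fst a \<in> carrier G \<Longrightarrow> letter_val a \<in> carrier G"
  by (simp add: letter_val_def)

lemma word_eval_closed: "fst ` set w \<subseteq> carrier G \<Longrightarrow> word_eval G w \<in> carrier G"
  by (induction w) (auto intro: letter_val_closed)

lemma word_eval_append:
  "fst ` set u \<subseteq> carrier G \<Longrightarrow> fst ` set v \<subseteq> carrier G \<Longrightarrow>
    word_eval G (u @ v) = word_eval G u \<otimes> word_eval G v"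
  by (induction u) (auto simp: m_assoc letter_val_closed word_eval_closed)

lemma letter_val_inv:
  "fst a \<in> carrier G \<Longrightarrow> letter_val a \<otimes> letter_val (inv_letter a) = \<one>"
  by (simp add: letter_val_def inv_letter_def)

lemma word_eval_cancel_cons:
  assumes "f (fst a) \<in> carrier G" "f ` fst ` set w \<subseteq> carrier G"
  shows "word_eval G (letmap f (cancel_cons a w)) = word_eval G (letmap f (a # w))"
proof (cases w)
  case (Cons b w')
  show ?thesis
  proof (cases "b = inv_letter a")
    case True
    have e: "(f (fst b), snd b) = inv_letter (f (fst a), snd a)"
      using True by (simp add: inv_letter_def)
    have w': "fst ` set (letmap f w') \<subseteq> carrier G" unfolding letmap_simps(4) using assms Cons by auto
    let ?a = "(f (fst a), snd a)"
    have "word_eval G (letmap f (a # w)) =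
       letter_val ?a \<otimes> (letter_val (inv_letter ?a) \<otimes> word_eval G (letmap f w'))"
      using Cons e by simp
    also have "\<dots> = (letter_val ?a \<otimes> letter_val (inv_letter ?a)) \<otimes> word_eval G (letmap f w')"
      by (rule m_assoc[symmetric]) (use assms word_eval_closed[OF w'] in \<open>auto intro!: letter_val_closed\<close>)
    also have "\<dots> = word_eval G (letmap f w')"
      using letter_val_inv[of ?a] assms word_eval_closed[OF w'] by simp
    finally show ?thesis using Cons True by simp
  qed (simp add: Cons)
qed simp

lemma word_eval_reduce:
  "f ` fst ` set w \<subseteq> carrier G \<Longrightarrow> word_eval G (letmap f (reduce_word w)) = word_eval G (letmap f w)"
proof (induction w)
  case (Cons a w)
  have "f ` fst ` set (reduce_word w) \<subseteq> carrier G" using Cons.prems fst_set_reduce_subset[of w] by auto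
  hence "word_eval G (letmap f (cancel_cons a (reduce_word w))) = word_eval G (letmap f (a # reduce_word w))"
    using Cons.prems by (intro word_eval_cancel_cons) auto
  thus ?case using Cons by (simp add: reduce_word_def)
qed (simp add: reduce_word_def)

text \<open>One half of the universal property: every map of the generators into a group extends to
  a homomorphism.\<close>

lemma word_eval_hom:
  assumes "f ` S \<subseteq> carrier G"
  shows "(\<lambda>w. word_eval G (letmap f w)) \<in> hom (free_group S) G"
proof (rule homI)
  fix w assume "w \<in> carrier (free_group S)"
  thus "word_eval G (letmap f w) \<in> carrier G" using assms by (intro word_eval_closed) auto
next
  fix u v assume "u \<in> carrier (free_group S)" "v \<in> carrier (free_group S)"
  hence "fst ` set u \<subseteq> S" "fst ` set v \<subseteq> S" by simp_all
  hence "f ` fst ` set u \<subseteq> carrier G" "f ` fst ` set v \<subseteq> carrier G"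
    using assms by (meson image_mono order_trans)+
  thus "word_eval G (letmap f (u \<otimes>\<^bsub>free_group S\<^esub> v)) = word_eval G (letmap f u) \<otimes> word_eval G (letmap f v)"
    using word_eval_reduce[of f "u @ v"] word_eval_append[of "letmap f u" "letmap f v"] by (simp add: image_Un)
qed

lemma hom_word_eval:
  assumes "\<phi> \<in> hom G G" "fst ` set w \<subseteq> carrier G"
  shows "\<phi> (word_eval G w) = word_eval G (letmap \<phi> w)"
proof -
  interpret h: group_hom G G \<phi> by unfold_locales (rule assms)
  show ?thesis using assms(2)
  proof (induction w)
    case (Cons a w)
    have "\<phi> (letter_val a) = letter_val (\<phi> (fst a), snd a)" using Cons.prems by (simp add: letter_val_def)
    thus ?case using Cons by (auto simp: letter_val_closed word_eval_closed)
  qed simp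
qed

lemma free_generating_set_word:
  assumes "free_generating_set G B" "g \<in> carrier G"
  obtains w where "reduced w" "fst ` set w \<subseteq> B" "g = word_eval G w"
proof -
  have "g \<in> word_eval G ` carrier (free_group B)"
    using assms unfolding free_generating_set_def iso_def bij_betw_def by blast
  thus ?thesis using that by auto
qed

text \<open>The universal property for an arbitrary basis: elements are first rewritten as words
  over \<open>B\<close> by the inverse of the evaluation, and these are evaluated after substituting
  \<open>f\<close>.\<close>

lemma free_generating_set_extend:
  assumes B: "free_generating_set G B" and f: "f ` B \<subseteq> carrier G"
  shows "\<exists>\<phi>\<in>hom G G. \<forall>b\<in>B. \<phi> b = f b"
proof -
  interpret F: group "free_group B" by (rule free_group_is_group)
  have iso: "word_eval G \<in> iso (free_group B) G" and BG: "B \<subseteq> carrier G"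
    using B by (auto simp: free_generating_set_def)
  define \<theta> where "\<theta> = inv_into (carrier (free_group B)) (word_eval G)"
  have \<theta>: "\<theta> \<in> hom G (free_group B)"
    using F.iso_set_sym[OF iso] by (simp add: \<theta>_def iso_def)
  have hom: "(\<lambda>w. word_eval G (letmap f w)) \<circ> \<theta> \<in> hom G G"
    using Group.hom_compose[OF \<theta> word_eval_hom[OF f]] .
  have "((\<lambda>w. word_eval G (letmap f w)) \<circ> \<theta>) b = f b" if b: "b \<in> B" for b
  proof -
    have 1: "word_eval G [(b, True)] = b" using b BG by (auto simp: letter_val_def)
    have "[(b, True)] \<in> carrier (free_group B)" using b by (simp add: reduced_Cons)
    moreover have "inj_on (word_eval G) (carrier (free_group B))"
      using iso by (simp add: iso_def bij_betw_def)
    ultimately have "\<theta> b = [(b, True)]" unfolding \<theta>_def using inv_into_f_f 1 by metis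
    thus ?thesis using f b by (auto simp: letter_val_def)
  qed
  thus ?thesis using hom by blast
qed

lemma hom_eq_on_generators:
  assumes "free_generating_set G B" "\<phi> \<in> hom G G" "\<psi> \<in> hom G G" "\<And>b. b \<in> B \<Longrightarrow> \<phi> b = \<psi> b" "g \<in> carrier G"
  shows "\<phi> g = \<psi> g"
proof -
  obtain w where w: "fst ` set w \<subseteq> B" "g = word_eval G w"
    using free_generating_set_word[OF assms(1,5)] by metis
  have "fst ` set w \<subseteq> carrier G" using w assms(1) by (auto simp: free_generating_set_def)
  thus ?thesis using w(2) hom_word_eval[OF assms(2)] hom_word_eval[OF assms(3)]
      letmap_cong[of w \<phi> \<psi>] assms(4) w(1) by (metis subsetD)
qed

text \<open>Evaluation of words over the image basis is evaluation over \<open>B\<close>, followed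
  by the automorphism, once the letters are renamed by \<open>\<psi>\<close>.\<close>

lemma free_generating_set_image:
  assumes B: "free_generating_set G B" and \<phi>: "\<phi> \<in> iso G G"
  shows "free_generating_set G (\<phi> ` B)"
proof -
  have iso: "word_eval G \<in> iso (free_group B) G" and BG: "B \<subseteq> carrier G"
    using B by (auto simp: free_generating_set_def)
  have h: "\<phi> \<in> hom G G" and inj: "inj_on \<phi> (carrier G)" and surj: "\<phi> ` carrier G = carrier G"
    using \<phi> by (auto simp: iso_def bij_betw_def)
  have injB: "inj_on \<phi> B" using inj BG by (rule inj_on_subset)
  have BG': "\<phi> ` B \<subseteq> carrier G" using BG surj by blast
  define \<psi> where "\<psi> = inv_into B \<phi>"
  have \<psi>: "\<phi> (\<psi> x) = x" "\<psi> x \<in> B" if "x \<in> \<phi> ` B" for x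
    using that by (auto simp: \<psi>_def f_inv_into_f inv_into_into)
  have inj\<psi>: "inj_on \<psi> (\<phi> ` B)" by (metis \<psi>(1) inj_onI)
  have undo: "letmap \<phi> (letmap \<psi> w) = w" if "fst ` set w \<subseteq> \<phi> ` B" for w
    using letmap_cong[of w "\<lambda>x. \<phi> (\<psi> x)" "\<lambda>x. x"] that \<psi>(1) by (metis letmap_comp letmap_ident subsetD)
  have ev: "word_eval G w = \<phi> (word_eval G (letmap \<psi> w))" "letmap \<psi> w \<in> carrier (free_group B)"
    if w: "w \<in> carrier (free_group (\<phi> ` B))" for w
  proof -
    have l: "fst ` set w \<subseteq> \<phi> ` B" "reduced w" using w by auto
    have "fst ` set (letmap \<psi> w) \<subseteq> B" using l \<psi>(2) by auto
    moreover have "reduced (letmap \<psi> w)"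
      using reduced_letmap[OF inj_on_subset[OF inj\<psi> l(1)]] l(2) by simp
    ultimately show "letmap \<psi> w \<in> carrier (free_group B)" by simp
    thus "word_eval G w = \<phi> (word_eval G (letmap \<psi> w))"
      using hom_word_eval[OF h, of "letmap \<psi> w"] undo[OF l(1)] BG by auto
  qed
  have inj_ev: "inj_on (word_eval G) (carrier (free_group B))"
    using iso unfolding iso_def bij_betw_def by blast
  have "word_eval G \<in> hom (free_group (\<phi> ` B)) G"
    using word_eval_hom[of "\<lambda>x. x" "\<phi> ` B"] BG' by (simp add: letmap_ident)
  moreover have "inj_on (word_eval G) (carrier (free_group (\<phi> ` B)))"
  proof (rule inj_onI)
    fix w w' assume w: "w \<in> carrier (free_group (\<phi> ` B))" "w' \<in> carrier (free_group (\<phi> ` B))"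
      and eq: "word_eval G w = word_eval G w'"
    have c: "word_eval G (letmap \<psi> v) \<in> carrier G" if "v \<in> carrier (free_group (\<phi> ` B))" for v
      using ev(2)[OF that] BG by (intro word_eval_closed) auto
    have "word_eval G (letmap \<psi> w) = word_eval G (letmap \<psi> w')"
      using eq ev(1) w inj c by (metis inj_onD)
    hence "letmap \<psi> w = letmap \<psi> w'"
      by (rule inj_onD[OF inj_ev _ ev(2)[OF w(1)] ev(2)[OF w(2)]])
    moreover have "letmap \<phi> (letmap \<psi> w) = w" "letmap \<phi> (letmap \<psi> w') = w'"
      using w undo by simp_all
    ultimately show "w = w'" by metis
  qed
  moreover have "word_eval G ` carrier (free_group (\<phi> ` B)) = carrier G"
  proof
    show "word_eval G ` carrier (free_group (\<phi> ` B)) \<subseteq> carrier G"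
    proof (rule image_subsetI)
      fix w assume "w \<in> carrier (free_group (\<phi> ` B))"
      hence "fst ` set w \<subseteq> \<phi> ` B" by simp
      thus "word_eval G w \<in> carrier G" using word_eval_closed BG' by (meson order_trans)
    qed
    show "carrier G \<subseteq> word_eval G ` carrier (free_group (\<phi> ` B))"
    proof
      fix g assume "g \<in> carrier G"
      then obtain g' where g': "g' \<in> carrier G" "g = \<phi> g'" using surj by blast
      obtain w where w: "reduced w" "fst ` set w \<subseteq> B" "g' = word_eval G w"
        using free_generating_set_word[OF B g'(1)] by metis
      have "fst ` set w \<subseteq> carrier G" using w(2) BG by (rule order_trans)
      hence "g = word_eval G (letmap \<phi> w)" using g' w(3) hom_word_eval[OF h, of w] by simp
      moreover have "letmap \<phi> w \<in> carrier (free_group (\<phi> ` B))"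
        using w(1) reduced_letmap[OF inj_on_subset[OF injB w(2)]] image_mono[OF w(2), of \<phi>] by simp
      ultimately show "g \<in> word_eval G ` carrier (free_group (\<phi> ` B))" by blast
    qed
  qed
  ultimately show ?thesis using BG' by (simp add: free_generating_set_def iso_def bij_betw_def)
qed

lemma conj_iso:
  assumes "h \<in> carrier G" shows "(\<lambda>x. h \<otimes> x \<otimes> inv h) \<in> iso G G"
proof -
  have "(\<lambda>x. h \<otimes> x \<otimes> inv h) \<in> hom G G"
  proof (rule homI)
    fix x y assume xy: "x \<in> carrier G" "y \<in> carrier G"
    have "h \<otimes> x \<otimes> inv h \<otimes> (h \<otimes> y \<otimes> inv h) = h \<otimes> x \<otimes> (inv h \<otimes> h) \<otimes> y \<otimes> inv h"
      using assms xy by (simp only: m_assoc inv_closed m_closed)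
    thus "h \<otimes> (x \<otimes> y) \<otimes> inv h = h \<otimes> x \<otimes> inv h \<otimes> (h \<otimes> y \<otimes> inv h)"
      using assms xy by (simp add: m_assoc)
  qed (use assms in simp)
  moreover have "bij_betw (\<lambda>x. h \<otimes> x \<otimes> inv h) (carrier G) (carrier G)"
  proof (rule bij_betw_byWitness[where f' = "\<lambda>x. inv h \<otimes> x \<otimes> h"])
    have 1: "inv h \<otimes> (h \<otimes> a \<otimes> inv h) \<otimes> h = (inv h \<otimes> h) \<otimes> a \<otimes> (inv h \<otimes> h)"
      and 2: "h \<otimes> (inv h \<otimes> a \<otimes> h) \<otimes> inv h = (h \<otimes> inv h) \<otimes> a \<otimes> (h \<otimes> inv h)"
      if "a \<in> carrier G" for a
      using assms that by (simp_all only: m_assoc inv_closed m_closed)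
    show "\<forall>a\<in>carrier G. inv h \<otimes> (h \<otimes> a \<otimes> inv h) \<otimes> h = a"
      "\<forall>a\<in>carrier G. h \<otimes> (inv h \<otimes> a \<otimes> h) \<otimes> inv h = a"
      using assms 1 2 by simp_all
  qed (use assms in auto)
  ultimately show ?thesis by (simp add: iso_def)
qed

lemma generator_substitution_iso:
  assumes B: "free_generating_set G B" and \<phi>: "\<phi> \<in> hom G G" and \<psi>: "\<psi> \<in> hom G G"
    and "\<And>b. b \<in> B \<Longrightarrow> \<phi> (\<psi> b) = b" "\<And>b. b \<in> B \<Longrightarrow> \<psi> (\<phi> b) = b"
  shows "\<phi> \<in> iso G G"
proof -
  have id: "(\<lambda>x. x) \<in> hom G G" by (rule homI) auto
  have c: "(\<lambda>x. \<phi> (\<psi> x)) \<in> hom G G" "(\<lambda>x. \<psi> (\<phi> x)) \<in> hom G G"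
    using Group.hom_compose[OF \<psi> \<phi>] Group.hom_compose[OF \<phi> \<psi>] by (simp_all add: comp_def)
  have "\<phi> (\<psi> g) = g" "\<psi> (\<phi> g) = g" if "g \<in> carrier G" for g
    using hom_eq_on_generators[OF B c(1) id _ that] hom_eq_on_generators[OF B c(2) id _ that] assms(4,5) by auto
  hence "bij_betw \<phi> (carrier G) (carrier G)"
    using \<phi> \<psi> by (intro bij_betw_byWitness[where f' = \<psi>]) (auto simp: hom_def)
  thus ?thesis using \<phi> by (simp add: iso_def)
qed

lemma free_generating_set_invert:
  assumes B: "free_generating_set G B" and u: "u \<in> B"
  shows "\<exists>B'. free_generating_set G B' \<and> inv u \<in> B'"
proof -
  have BG: "B \<subseteq> carrier G" using B by (simp add: free_generating_set_def)
  obtain \<phi> where \<phi>: "\<phi> \<in> hom G G" "\<And>b. b \<in> B \<Longrightarrow> \<phi> b = (if b = u then inv b else b)"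
    using free_generating_set_extend[OF B, of "\<lambda>b. if b = u then inv b else b"] BG by fastforce
  interpret h: group_hom G G \<phi> by unfold_locales (rule \<phi>)
  have "\<phi> (\<phi> b) = b" if "b \<in> B" for b using that \<phi>(2) BG u by auto
  hence "\<phi> \<in> iso G G" using generator_substitution_iso[OF B \<phi>(1) \<phi>(1)] by blast
  moreover have "inv u \<in> \<phi> ` B" using \<phi>(2)[OF u] u by (metis image_eqI)
  ultimately show ?thesis using free_generating_set_image[OF B] by blast
qed

text \<open>A Nielsen transformation: replacing \<open>b\<close> by \<open>u^N b\<close> and
  replacing it by \<open>u^-N b\<close> are mutually inverse endomorphisms, as both fix
  \<open>u\<close>.\<close>

lemma free_generating_set_multiply:
  assumes B: "free_generating_set G B" and u: "u \<in> B" "b \<in> B" "u \<noteq> b"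
  shows "\<exists>B'. free_generating_set G B' \<and> u [^] (N::nat) \<otimes> b \<in> B'"
proof -
  have BG: "B \<subseteq> carrier G" using B by (simp add: free_generating_set_def)
  have uG: "u \<in> carrier G" "b \<in> carrier G" using u BG by auto
  obtain \<phi> where \<phi>: "\<phi> \<in> hom G G" "\<And>x. x \<in> B \<Longrightarrow> \<phi> x = (if x = b then u [^] N \<otimes> x else x)"
    using free_generating_set_extend[OF B, of "\<lambda>x. if x = b then u [^] N \<otimes> x else x"] BG uG by fastforce
  obtain \<psi> where \<psi>: "\<psi> \<in> hom G G" "\<And>x. x \<in> B \<Longrightarrow> \<psi> x = (if x = b then inv (u [^] N) \<otimes> x else x)"
    using free_generating_set_extend[OF B, of "\<lambda>x. if x = b then inv (u [^] N) \<otimes> x else x"] BG uG by fastforce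
  interpret h: group_hom G G \<phi> by unfold_locales (rule \<phi>)
  interpret k: group_hom G G \<psi> by unfold_locales (rule \<psi>)
  have pu: "\<phi> u = u" "\<psi> u = u" using \<phi>(2)[OF u(1)] \<psi>(2)[OF u(1)] u(3) by auto
  have pN: "\<phi> (u [^] N) = u [^] N" "\<psi> (u [^] N) = u [^] N"
    using pu uG by (simp_all add: h.hom_nat_pow k.hom_nat_pow)
  have c: "u [^] N \<in> carrier G" using uG by simp
  have "\<phi> (\<psi> x) = x" "\<psi> (\<phi> x) = x" if x: "x \<in> B" for x
  proof -
    have xG: "x \<in> carrier G" using x BG by blast
    show "\<phi> (\<psi> x) = x"
    proof (cases "x = b")
      case True
      have "\<phi> (\<psi> x) = inv (u [^] N) \<otimes> (u [^] N \<otimes> b)"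
        using True \<psi>(2)[OF u(2)] \<phi>(2)[OF u(2)] pN c uG by (simp add: h.hom_inv)
      thus ?thesis using True c uG by (simp flip: m_assoc)
    qed (use x \<phi>(2) \<psi>(2) in auto)
    show "\<psi> (\<phi> x) = x"
    proof (cases "x = b")
      case True
      have "\<psi> (\<phi> x) = u [^] N \<otimes> (inv (u [^] N) \<otimes> b)"
        using True \<psi>(2)[OF u(2)] \<phi>(2)[OF u(2)] pN c uG by (simp)
      thus ?thesis using True c uG by (simp flip: m_assoc)
    qed (use x \<phi>(2) \<psi>(2) in auto)
  qed
  hence "\<phi> \<in> iso G G" using generator_substitution_iso[OF B \<phi>(1) \<psi>(1)] by blast
  moreover have "u [^] N \<otimes> b \<in> \<phi> ` B" using \<phi>(2)[OF u(2)] u(2) by (metis image_eqI)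
  ultimately show ?thesis using free_generating_set_image[OF B] by blast
qed

text \<open>A group with at most one generator is abelian. This guarantees a second basis element
  beside a given primitive one when \<open>n \<ge> 2\<close>.\<close>

lemma singleton_basis_commutes:
  assumes "free_generating_set G B" "B \<subseteq> {u}" "u \<in> carrier G" "g \<in> carrier G" "h \<in> carrier G"
  shows "g \<otimes> h = h \<otimes> g"
proof -
  have comm: "x \<otimes> word_eval G w = word_eval G w \<otimes> x"
    if x: "x \<in> carrier G" "x \<otimes> u = u \<otimes> x" and w: "fst ` set w \<subseteq> {u}" for x w
    using w
  proof (induction w)
    case (Cons a w)
    have wc: "word_eval G w \<in> carrier G" using Cons.prems assms(3) by (intro word_eval_closed) auto
    have "x \<otimes> inv u = inv u \<otimes> x"
    proof -
      have "x \<otimes> inv u = (inv u \<otimes> u) \<otimes> x \<otimes> inv u" using x assms(3) by simp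
      also have "\<dots> = inv u \<otimes> (u \<otimes> x) \<otimes> inv u" using x(1) assms(3) by (simp only: m_assoc inv_closed m_closed)
      also have "\<dots> = inv u \<otimes> (x \<otimes> u) \<otimes> inv u" using x(2) by simp
      also have "\<dots> = inv u \<otimes> x \<otimes> (u \<otimes> inv u)" using x(1) assms(3) by (simp only: m_assoc inv_closed m_closed)
      finally show ?thesis using x(1) assms(3) by simp
    qed
    hence l: "x \<otimes> letter_val a = letter_val a \<otimes> x" "letter_val a \<in> carrier G"
      using Cons.prems x assms(3) by (auto simp: letter_val_def)
    have "x \<otimes> (letter_val a \<otimes> word_eval G w) = letter_val a \<otimes> (x \<otimes> word_eval G w)"
      using l wc x by (metis m_assoc)
    also have "\<dots> = (letter_val a \<otimes> word_eval G w) \<otimes> x" using Cons l wc x by (simp add: m_assoc)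
    finally show ?case by simp
  qed (use x in simp)
  obtain v w where v: "fst ` set v \<subseteq> {u}" "g = word_eval G v" and w: "fst ` set w \<subseteq> {u}" "h = word_eval G w"
    using free_generating_set_word[OF assms(1,4)] free_generating_set_word[OF assms(1,5)] assms(2)
    by (metis order_trans)
  have "u \<otimes> g = g \<otimes> u" unfolding v using comm[OF assms(3) refl v(1)] .
  thus ?thesis using comm[OF assms(4) _ w(1)] w(2) by simp
qed

end

section \<open>Primitive elements and blocking\<close>

interpretation Fn: group "Fn n" for n by (rule free_group_is_group)

lemma Fn_pow: "u [^]\<^bsub>Fn n\<^esub> (k::nat) = reduce_word (wpow u k)"
proof (induction k)
  case (Suc k)
  thus ?case using Fn.nat_pow_Suc[of n u k] wpow_Suc_right[of u k] by simp
qed (simp add: reduce_word_def)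

lemma primitive_in_carrier: "primitive_element n g \<Longrightarrow> g \<in> carrier (Fn n)"
  unfolding primitive_element_def free_generating_set_def by blast

lemma primitive_conj:
  assumes "primitive_element n g" "h \<in> carrier (Fn n)"
  shows "primitive_element n (reduce_word (h @ g @ inv_word h))"
proof -
  obtain B where B: "free_generating_set (Fn n) B" "g \<in> B"
    using assms unfolding primitive_element_def by blast
  have "h \<otimes>\<^bsub>Fn n\<^esub> g \<otimes>\<^bsub>Fn n\<^esub> inv\<^bsub>Fn n\<^esub> h = reduce_word (h @ g @ inv_word h)"
    using inv_free_group[OF assms(2)] by simp
  thus ?thesis using Fn.free_generating_set_image[OF B(1) Fn.conj_iso[OF assms(2)]] B(2)
    unfolding primitive_element_def by (metis (no_types, lifting) image_eqI)
qed

lemma primitive_inv_word: "primitive_element n g \<Longrightarrow> primitive_element n (inv_word g)"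
  using Fn.free_generating_set_invert[of n] inv_free_group primitive_in_carrier
  unfolding primitive_element_def by metis

text \<open>Otherwise the one-letter word \<open>[(g, True)]\<close> and the empty word would have
  the same value, against injectivity of the evaluation on a basis.\<close>

lemma primitive_nonempty:
  assumes "primitive_element n g" shows "g \<noteq> []"
proof
  assume g: "g = []"
  obtain B where B: "word_eval (Fn n) \<in> iso (free_group B) (Fn n)" "g \<in> B"
    using assms unfolding primitive_element_def free_generating_set_def by blast
  have inj: "inj_on (word_eval (Fn n)) (carrier (free_group B))"
    using B by (simp add: iso_def bij_betw_def)
  have "word_eval (Fn n) [(g, True)] = word_eval (Fn n) []"
    using g by (simp add: Fn.letter_val_def reduce_word_def)
  moreover have "[(g, True)] \<in> carrier (free_group B)" "[] \<in> carrier (free_group B)"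
    using B(2) by (auto simp: reduced_Cons)
  ultimately show False using inj by (metis inj_onD list.distinct(1))
qed

lemma primitive_extend:
  assumes n: "n \<ge> 2" and u: "primitive_element n u"
  shows "\<exists>b\<in>carrier (Fn n). \<forall>N. primitive_element n (reduce_word (wpow u N @ b))"
proof -
  obtain B where B: "free_generating_set (Fn n) B" "u \<in> B"
    using u unfolding primitive_element_def by blast
  have "\<not> B \<subseteq> {u}"
  proof
    assume "B \<subseteq> {u}"
    moreover have "[(0, True)] \<in> carrier (Fn n)" "[(1, True)] \<in> carrier (Fn n)"
      using n by (auto simp: reduced_Cons)
    ultimately have "[(0, True)] \<otimes>\<^bsub>Fn n\<^esub> [(1, True)] = [(1, True)] \<otimes>\<^bsub>Fn n\<^esub> [(0, True)]"
      by (rule Fn.singleton_basis_commutes[OF B(1) _ primitive_in_carrier[OF u]])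
    thus False by (simp add: reduce_word_def inv_letter_def)
  qed
  then obtain b where b: "b \<in> B" "u \<noteq> b" by blast
  have "primitive_element n (reduce_word (wpow u N @ b))" for N
  proof -
    have "u [^]\<^bsub>Fn n\<^esub> N \<otimes>\<^bsub>Fn n\<^esub> b = reduce_word (wpow u N @ b)"
      unfolding Fn_pow by simp
    thus ?thesis using Fn.free_generating_set_multiply[OF B b, of N] unfolding primitive_element_def by metis
  qed
  moreover have "b \<in> carrier (Fn n)" using b B by (auto simp: free_generating_set_def)
  ultimately show ?thesis by blast
qed

text \<open>A power of a primitive word \<open>w\<close> need not be primitive, but it occurs in the cyclic reduction
  of the primitive element \<open>w\<^sup>N b\<close>, where \<open>w\<close> and \<open>b\<close> belong to a common basis.\<close>

lemma blocking_not_in_power: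
  assumes n: "n \<ge> 2" and g: "primitive_blocking n g"
    and w: "primitive_element n w" "cyclically_reduced w"
  shows "\<not> sublist g (wpow w m)"
proof
  assume sub: "sublist g (wpow w m)"
  obtain b where b: "b \<in> carrier (Fn n)" "\<And>N. primitive_element n (reduce_word (wpow w N @ b))"
    using primitive_extend[OF n w(1)] by blast
  define N where "N = m + 3 * length b + 3"
  define x where "x = reduce_word (wpow w N @ b)"
  obtain a v where v: "x = a @ v @ inv_word a" "cyclically_reduced v"
    using cyclic_reduction[of x] by (auto simp: x_def)
  have "sublist (wpow w m) v"
    by (rule wpow_sublist_conjugate[OF w(2) primitive_nonempty[OF w(1)] _ N_def])
      (use b v in \<open>auto simp: x_def\<close>)
  moreover have "primitive_element n v"
  proof -
    have xp: "primitive_element n x" using b(2) x_def by simp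
    have "inv_word a \<in> carrier (Fn n)"
      using primitive_in_carrier[OF xp] v(1) by (auto simp: reduced_append)
    from primitive_conj[OF xp this] have "primitive_element n (reduce_word (inv_word a @ (a @ v @ inv_word a) @ a))"
      using v by simp
    also have "reduce_word (inv_word a @ (a @ v @ inv_word a) @ a) = v"
      using v(2) by (simp add: cyclically_reduced_def)
    finally show ?thesis .
  qed
  ultimately have "\<exists>w. cyclically_reduced w \<and> primitive_element n w \<and> sublist g w"
    using sub v(2) sublist_order.order_trans by blast
  thus False using g unfolding primitive_blocking_def by blast
qed

section \<open>The group \<open>PSL\<^sub>2\<close> and its actions\<close>

lemma SL2C_simps [simp]:
  "carrier SL2C = {A. det A = 1}" "A \<otimes>\<^bsub>SL2C\<^esub> B = A ** B" "\<one>\<^bsub>SL2C\<^esub> = mat 1"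
  by (simp_all add: SL2C_def)

lemma SL2C_group: "group SL2C"
proof (rule groupI)
  fix A assume "A \<in> carrier SL2C"
  thus "\<exists>B\<in>carrier SL2C. B \<otimes>\<^bsub>SL2C\<^esub> A = \<one>\<^bsub>SL2C\<^esub>"
    using inv2[of A] by auto
qed (auto simp: det_mul matrix_mul_assoc)

lemma uminus_mult: "(- A) ** B = - (A ** B)" "A ** (- B) = - (A ** B)" for A B :: "complex^2^2"
  by (simp_all add: mat2_eq_iff mat2_mult_nth)

lemma det_uminus2: "det (- A) = det A" for A :: "complex^2^2"
  by (simp add: det_2)

lemma center_normal: "normal {mat 1, - mat 1} SL2C"
proof -
  interpret group SL2C by (rule SL2C_group)
  have inv1: "inv\<^bsub>SL2C\<^esub> (- mat 1) = - mat 1"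
    by (rule inv_equality) (simp_all add: uminus_mult det_uminus2)
  have "subgroup {mat 1, - mat 1} SL2C"
    by (rule subgroupI) (use inv1 inv_one in \<open>auto simp: uminus_mult det_uminus2\<close>)
  moreover have "x \<otimes>\<^bsub>SL2C\<^esub> h \<otimes>\<^bsub>SL2C\<^esub> inv\<^bsub>SL2C\<^esub> x \<in> {mat 1, - mat 1}"
    if "x \<in> carrier SL2C" "h \<in> {mat 1, - mat 1}" for x h
  proof -
    have "x ** inv\<^bsub>SL2C\<^esub> x = mat 1" using r_inv[OF that(1)] by simp
    thus ?thesis using that(2) by (auto simp: uminus_mult)
  qed
  ultimately show ?thesis using normal_inv_iff by blast
qed

definition proj :: "complex^2^2 \<Rightarrow> (complex^2^2) set" where
  "proj A = {A, - A}"

lemma proj_uminus [simp]: "proj (- A) = proj A"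
  by (auto simp: proj_def)

lemma r_coset_center: "{mat 1, - mat 1} #>\<^bsub>SL2C\<^esub> A = proj A"
  by (auto simp: r_coset_def proj_def uminus_mult)

lemma PSL2C_carrier: "carrier PSL2C = proj ` {A. det A = 1}"
  by (auto simp: PSL2C_def FactGroup_def RCOSETS_def r_coset_center)

lemma PSL2C_one: "\<one>\<^bsub>PSL2C\<^esub> = proj (mat 1)"
  by (simp add: PSL2C_def FactGroup_def proj_def)

lemma PSL2C_mult: "proj A \<otimes>\<^bsub>PSL2C\<^esub> proj B = proj (A ** B)"
  by (auto simp: PSL2C_def FactGroup_def set_mult_def proj_def uminus_mult)

lemma PSL2C_group: "group PSL2C"
  unfolding PSL2C_def by (rule normal.factorgroup_is_group[OF center_normal])

lemma proj_eqI: "g \<in> carrier PSL2C \<Longrightarrow> A \<in> g \<Longrightarrow> g = proj A \<and> det A = 1"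
  unfolding PSL2C_carrier by (auto simp: proj_def det_uminus2)

lemma PSL2C_lift:
  assumes "g \<in> carrier PSL2C" obtains A where "det A = 1" "g = proj A"
  using assms unfolding PSL2C_carrier by blast

lemma act_proj: "det A = 1 \<Longrightarrow> p \<in> H3 \<Longrightarrow> act (proj A) p = SL2C_act A p"
  by (simp add: act_def proj_def SL2C_act_uminus)

text \<open>Homogeneous coordinates on the Riemann sphere. They make the action linear, so
  composition is checked without separate cases for the point at infinity.\<close>

definition ideal_vec :: "ideal_point \<Rightarrow> complex \<times> complex" where
  "ideal_vec \<xi> = (case \<xi> of None \<Rightarrow> (1, 0) | Some z \<Rightarrow> (z, 1))"

definition vec_ideal :: "complex \<Rightarrow> complex \<Rightarrow> ideal_point" where
  "vec_ideal x y = (if y = 0 then None else Some (x / y))"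

lemma SL2C_act_ideal_vec:
  "SL2C_act_ideal A \<xi> = (let (x, y) = ideal_vec \<xi> in vec_ideal (A$1$1 * x + A$1$2 * y) (A$2$1 * x + A$2$2 * y))"
  by (cases \<xi>) (simp_all add: SL2C_act_ideal_def ideal_vec_def vec_ideal_def Let_def)

lemma vec_ideal_scale: "k \<noteq> 0 \<Longrightarrow> vec_ideal (k * x) (k * y) = vec_ideal x y"
  by (simp add: vec_ideal_def)

lemma SL2C_act_ideal_uminus: "SL2C_act_ideal (- A) \<xi> = SL2C_act_ideal A \<xi>"
proof -
  obtain x y where xy: "ideal_vec \<xi> = (x, y)" by fastforce
  have e: "(- A)$i$1 * x + (- A)$i$2 * y = (- 1) * (A$i$1 * x + A$i$2 * y)" for i
    by (simp add: algebra_simps)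
  show ?thesis unfolding SL2C_act_ideal_vec xy Let_def prod.case e
    by (rule vec_ideal_scale) simp
qed

lemma act_ideal_proj: "act_ideal (proj A) \<xi> = SL2C_act_ideal A \<xi>"
  by (simp add: act_ideal_def proj_def SL2C_act_ideal_uminus)

lemma ideal_vec_vec_ideal:
  "x \<noteq> 0 \<or> y \<noteq> 0 \<Longrightarrow> \<exists>k. k \<noteq> 0 \<and> ideal_vec (vec_ideal x y) = (k * x, k * y)"
proof (cases "y = 0")
  case True
  assume "x \<noteq> 0 \<or> y \<noteq> 0"
  thus ?thesis using True by (intro exI[of _ "1 / x"]) (simp add: ideal_vec_def vec_ideal_def)
next
  case False
  thus ?thesis by (intro exI[of _ "1 / y"]) (simp add: ideal_vec_def vec_ideal_def)
qed

lemma SL2C_act_ideal_mult: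
  assumes "det B = 1"
  shows "SL2C_act_ideal (A ** B) \<xi> = SL2C_act_ideal A (SL2C_act_ideal B \<xi>)"
proof -
  obtain x y where xy: "ideal_vec \<xi> = (x, y)" by fastforce
  have nz: "x \<noteq> 0 \<or> y \<noteq> 0" using xy by (cases \<xi>) (auto simp: ideal_vec_def)
  define x' y' where xy': "x' = B$1$1 * x + B$1$2 * y" "y' = B$2$1 * x + B$2$2 * y"
  have d: "B$1$1 * B$2$2 - B$1$2 * B$2$1 = 1" using assms by (simp add: det_2)
  have "B$2$2 * x' - B$1$2 * y' = x" "B$1$1 * y' - B$2$1 * x' = y"
    unfolding xy' using d by algebra+
  hence nz': "x' \<noteq> 0 \<or> y' \<noteq> 0" using nz by auto
  then obtain k where k: "k \<noteq> 0" "ideal_vec (vec_ideal x' y') = (k * x', k * y')"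
    using ideal_vec_vec_ideal by blast
  have "SL2C_act_ideal A (SL2C_act_ideal B \<xi>) =
     vec_ideal (A$1$1 * (k * x') + A$1$2 * (k * y')) (A$2$1 * (k * x') + A$2$2 * (k * y'))"
    using k(2) by (simp add: SL2C_act_ideal_vec xy flip: xy')
  also have "\<dots> = vec_ideal (k * (A$1$1 * x' + A$1$2 * y')) (k * (A$2$1 * x' + A$2$2 * y'))"
    by (simp add: algebra_simps)
  also have "\<dots> = vec_ideal (A$1$1 * x' + A$1$2 * y') (A$2$1 * x' + A$2$2 * y')"
    using k(1) by (rule vec_ideal_scale)
  also have "\<dots> = SL2C_act_ideal (A ** B) \<xi>"
    by (simp add: SL2C_act_ideal_vec xy xy' mat2_mult_nth algebra_simps)
  finally show ?thesis ..
qed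

lemma SL2C_act_ideal_one: "SL2C_act_ideal (mat 1) \<xi> = \<xi>"
  by (cases \<xi>) (simp_all add: SL2C_act_ideal_def)

lemma SL2C_act_ideal_inv2:
  assumes "det A = 1"
  shows "SL2C_act_ideal (inv2 A) (SL2C_act_ideal A \<xi>) = \<xi>" "SL2C_act_ideal A (SL2C_act_ideal (inv2 A) \<xi>) = \<xi>"
  using SL2C_act_ideal_mult[OF assms, of "inv2 A" \<xi>] SL2C_act_ideal_mult[OF inv2(3)[OF assms], of A \<xi>]
    inv2[OF assms] by (simp_all add: SL2C_act_ideal_one)

context
  fixes g h assumes g: "g \<in> carrier PSL2C" and h: "h \<in> carrier PSL2C"
begin

lemma act_H3: "p \<in> H3 \<Longrightarrow> act g p \<in> H3"
  using g by (elim PSL2C_lift) (simp add: act_proj hv_act(2))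

lemma act_mult: "p \<in> H3 \<Longrightarrow> act (g \<otimes>\<^bsub>PSL2C\<^esub> h) p = act g (act h p)"
  using g h by (elim PSL2C_lift) (simp add: PSL2C_mult act_proj hv_act(2) det_mul SL2C_act_mult)

lemma act_isometry: "p \<in> H3 \<Longrightarrow> q \<in> H3 \<Longrightarrow> hdist (act g p) (act g q) = hdist p q"
  using g by (elim PSL2C_lift) (simp add: act_proj SL2C_act_isometry)

lemma act_geod:
  "p \<in> H3 \<Longrightarrow> q \<in> H3 \<Longrightarrow> 0 \<le> s \<Longrightarrow> s \<le> hdist p q \<Longrightarrow> act g (geod p q s) = geod (act g p) (act g q) s"
  using g by (elim PSL2C_lift) (simp add: act_proj geod_H3 geod_act)

lemma act_ideal_mult: "act_ideal (g \<otimes>\<^bsub>PSL2C\<^esub> h) \<xi> = act_ideal g (act_ideal h \<xi>)"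
  using g h by (elim PSL2C_lift) (simp add: PSL2C_mult act_ideal_proj SL2C_act_ideal_mult)

end

lemma act_one: "p \<in> H3 \<Longrightarrow> act \<one>\<^bsub>PSL2C\<^esub> p = p"
  by (simp add: PSL2C_one act_proj SL2C_act_one)

lemma act_ideal_one: "act_ideal \<one>\<^bsub>PSL2C\<^esub> \<xi> = \<xi>"
  by (simp add: PSL2C_one act_ideal_proj SL2C_act_ideal_one)

section \<open>Proper discontinuity\<close>

text \<open>The defining predicate has to be shown to be a topology before it can be unfolded.
  Unions of cosets commute with intersections because every coset is determined by any of its
  members.\<close>

lemma openin_PSL2C_topology:
  "openin PSL2C_topology U \<longleftrightarrow> U \<subseteq> carrier PSL2C \<and> openin (top_of_set (carrier SL2C)) (\<Union>U)"
proof -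
  have int: "\<Union>(S \<inter> T) = \<Union>S \<inter> \<Union>T" if "S \<subseteq> carrier PSL2C" "T \<subseteq> carrier PSL2C" for S T
  proof
    show "\<Union>S \<inter> \<Union>T \<subseteq> \<Union>(S \<inter> T)"
    proof
      fix A assume "A \<in> \<Union>S \<inter> \<Union>T"
      then obtain V W where VW: "A \<in> V" "V \<in> S" "A \<in> W" "W \<in> T" by blast
      hence "V = proj A" "W = proj A" using proj_eqI that by blast+
      thus "A \<in> \<Union>(S \<inter> T)" using VW by blast
    qed
  qed blast
  have "istopology (\<lambda>U. U \<subseteq> carrier PSL2C \<and> openin (top_of_set (carrier SL2C)) (\<Union>U))"
    unfolding istopology_def
  proof (intro conjI allI impI)
    fix S T assume "S \<subseteq> carrier PSL2C \<and> openin (top_of_set (carrier SL2C)) (\<Union>S)"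
      "T \<subseteq> carrier PSL2C \<and> openin (top_of_set (carrier SL2C)) (\<Union>T)"
    thus "S \<inter> T \<subseteq> carrier PSL2C" "openin (top_of_set (carrier SL2C)) (\<Union>(S \<inter> T))"
      using int by (auto intro: openin_Int)
  next
    fix K :: "(complex^2^2) set set set"
    assume K: "\<forall>U\<in>K. U \<subseteq> carrier PSL2C \<and> openin (top_of_set (carrier SL2C)) (\<Union>U)"
    thus "\<Union>K \<subseteq> carrier PSL2C" by blast
    have "\<Union>(\<Union>K) = \<Union>(Union ` K)" by blast
    thus "openin (top_of_set (carrier SL2C)) (\<Union>(\<Union>K))" using K by (auto intro: openin_Union)
  qed
  thus ?thesis unfolding PSL2C_topology_def by (rule fun_cong[OF topology_inverse'])
qed

lemma discrete_gap:
  assumes "discrete_in_PSL2C \<Gamma>" "\<one>\<^bsub>PSL2C\<^esub> \<in> \<Gamma>"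
  shows "\<exists>e>0. \<forall>A. det A = 1 \<longrightarrow> dist A (mat 1) < e \<longrightarrow> proj A \<in> \<Gamma> \<longrightarrow> proj A = \<one>\<^bsub>PSL2C\<^esub>"
proof -
  have "openin (subtopology PSL2C_topology \<Gamma>) {\<one>\<^bsub>PSL2C\<^esub>}"
    using assms by (simp add: discrete_in_PSL2C_def)
  then obtain U where U: "openin PSL2C_topology U" "{\<one>\<^bsub>PSL2C\<^esub>} = U \<inter> \<Gamma>"
    unfolding openin_subtopology by blast
  hence UC: "U \<subseteq> carrier PSL2C" "openin (top_of_set (carrier SL2C)) (\<Union>U)"
    by (auto simp: openin_PSL2C_topology)
  then obtain V where V: "open V" "\<Union>U = carrier SL2C \<inter> V" by (auto simp: openin_open)
  have "mat 1 \<in> \<one>\<^bsub>PSL2C\<^esub>" by (simp add: PSL2C_one proj_def)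
  hence "mat 1 \<in> V" using U(2) V(2) by blast
  then obtain e where e: "e > 0" "ball (mat 1) e \<subseteq> V" using V(1) openE by blast
  have "proj A = \<one>\<^bsub>PSL2C\<^esub>" if A: "det A = 1" "dist A (mat 1) < e" "proj A \<in> \<Gamma>" for A
  proof -
    have "A \<in> \<Union>U" using A e V(2) by (auto simp: dist_commute subset_iff)
    then obtain W where "W \<in> U" "A \<in> W" by blast
    hence "proj A \<in> U" using proj_eqI UC(1) by blast
    thus ?thesis using U(2) A(3) by blast
  qed
  thus ?thesis using e(1) by blast
qed

lemma norm_mat2: "(norm A)\<^sup>2 = (cmod (A$1$1))\<^sup>2 + (cmod (A$1$2))\<^sup>2 + (cmod (A$2$1))\<^sup>2 + (cmod (A$2$2))\<^sup>2"
  for A :: "complex^2^2"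
  by (simp add: norm_vec_def L2_set_def sum_2)

text \<open>\<open>hv base_pt\<close> is the identity, so the form returns half the trace of
  \<open>A ** ctr A\<close>. Bounded displacement of \<open>base_pt\<close> therefore means a
  bounded set of matrices.\<close>

lemma cosh_hdist_base:
  assumes "det A = 1" shows "cosh (hdist base_pt (SL2C_act A base_pt)) = (norm A)\<^sup>2 / 2"
proof -
  have b: "hv base_pt = mat 1" by (simp add: mat2_eq_iff hv_entries base_pt_def)
  have "complex_of_real (cosh (hdist base_pt (SL2C_act A base_pt))) = mdet (mat 1) (A ** ctr A)"
    unfolding mdet_hv[OF base_pt_H3 hv_act(2)[OF assms base_pt_H3], symmetric] hv_act(1)[OF assms base_pt_H3] b
    by simp
  also have "\<dots> = (A$1$1 * cnj (A$1$1) + A$1$2 * cnj (A$1$2) + A$2$1 * cnj (A$2$1) + A$2$2 * cnj (A$2$2)) / 2"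
    by (simp add: mdet_def mat2_mult_nth)
  also have "\<dots> = of_real ((norm A)\<^sup>2 / 2)"
    unfolding norm_mat2 of_real_divide of_real_add complex_norm_square by simp
  finally show ?thesis by (simp only: of_real_eq_iff)
qed

lemma continuous_on_inv2_mult:
  fixes S :: "((complex^2^2) \<times> (complex^2^2)) set"
  shows "continuous_on S (\<lambda>P. inv2 (fst P) ** snd P)"
proof -
  \<comment> \<open>By Cayley-Hamilton the inverse is the trace times the identity minus
    \<open>A\<close>; in this shape continuity is checked entrywise.\<close>
  have i: "inv2 A = (\<chi> i j. (if i = j then A$1$1 + A$2$2 else 0) - A$i$j)" for A
    by (simp add: mat2_eq_iff inv2_def)
  have "continuous_on S (\<lambda>P. \<chi> i j. (if i = j then fst P$1$1 + fst P$2$2 else 0) - fst P$i$j)"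
  proof (intro continuous_on_vec_lambda)
    fix i j :: 2
    show "continuous_on S (\<lambda>P. (if i = j then fst P$1$1 + fst P$2$2 else 0) - fst P$i$j)"
      by (cases "i = j") (auto intro!: continuous_intros)
  qed
  hence c: "continuous_on S (\<lambda>P. inv2 (fst P))" unfolding i .
  show ?thesis unfolding matrix_matrix_mult_def
    by (intro continuous_on_vec_lambda continuous_intros c)
qed

text \<open>Lifts of these elements lie in a compact set of matrices. Among infinitely many of them
  two would be so close that the quotient falls into the gap around the identity that discreteness
  provides. Uniform continuity of the quotient makes the required closeness independent of the
  pair.\<close>

lemma finite_small_displacement_base:
  assumes \<Gamma>: "subgroup \<Gamma> PSL2C" and disc: "discrete_in_PSL2C \<Gamma>"
  shows "finite {g \<in> \<Gamma>. hdist base_pt (act g base_pt) \<le> R}" (is "finite ?F")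
proof (rule ccontr)
  assume inf: "infinite ?F"
  interpret P: group PSL2C by (rule PSL2C_group)
  have \<Gamma>C: "\<Gamma> \<subseteq> carrier PSL2C" using \<Gamma> by (rule subgroup.subset)
  have "\<forall>g\<in>\<Gamma>. \<exists>A. det A = 1 \<and> g = proj A" using \<Gamma>C by (meson PSL2C_lift subsetD)
  then obtain L where "\<forall>g\<in>\<Gamma>. det (L g) = 1 \<and> g = proj (L g)" using bchoice by meson
  hence L: "\<And>g. g \<in> \<Gamma> \<Longrightarrow> det (L g) = 1 \<and> g = proj (L g)" by blast
  have injL: "inj_on L ?F"
  proof (rule inj_onI)
    fix g h assume "g \<in> ?F" "h \<in> ?F" "L g = L h"
    thus "g = h" using L[of g] L[of h] by simp
  qed
  define K where "K = cball (0 :: complex^2^2) (sqrt (2 * cosh R))"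
  have K: "compact K" by (simp add: K_def)
  have sub: "L ` ?F \<subseteq> K"
  proof (rule image_subsetI)
    fix g assume g: "g \<in> ?F"
    hence "g \<in> \<Gamma>" by blast
    hence Lg: "det (L g) = 1" "act g base_pt = SL2C_act (L g) base_pt"
      using L[of g] act_proj[of "L g" base_pt] by simp_all
    have "(norm (L g))\<^sup>2 / 2 = cosh (hdist base_pt (act g base_pt))"
      unfolding Lg(2) cosh_hdist_base[OF Lg(1)] ..
    also have "\<dots> \<le> cosh R"
    proof (rule cosh_le_mono)
      show "0 \<le> hdist base_pt (act g base_pt)"
        unfolding Lg(2) by (rule hdist_nonneg[OF base_pt_H3 hv_act(2)[OF Lg(1) base_pt_H3]])
    qed (use g in simp)
    finally have "norm (L g) \<le> sqrt (2 * cosh R)" by (intro real_le_rsqrt) simp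
    thus "L g \<in> K" by (simp add: K_def)
  qed
  obtain e where e: "e > 0" "\<And>A. det A = 1 \<Longrightarrow> dist A (mat 1) < e \<Longrightarrow> proj A \<in> \<Gamma> \<Longrightarrow> proj A = \<one>\<^bsub>PSL2C\<^esub>"
    using discrete_gap[OF disc subgroup.one_closed[OF \<Gamma>]] by blast
  have "uniformly_continuous_on (K \<times> K) (\<lambda>P. inv2 (fst P) ** snd P)"
    by (intro compact_uniformly_continuous continuous_on_inv2_mult compact_Times K)
  then obtain d where d: "d > 0" "\<And>P Q. P \<in> K \<times> K \<Longrightarrow> Q \<in> K \<times> K \<Longrightarrow> dist Q P < d \<Longrightarrow>
      dist (inv2 (fst Q) ** snd Q) (inv2 (fst P) ** snd P) < e"
    using e(1) unfolding uniformly_continuous_on_def by meson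
  have "infinite (L ` ?F)" using inf injL by (simp add: finite_image_iff)
  then obtain A B where AB: "A \<in> L ` ?F" "B \<in> L ` ?F" "A \<noteq> B" "dist A B < d"
    using infinite_in_compact_close[OF K sub _ d(1)] by blast
  obtain g h where gh: "g \<in> \<Gamma>" "h \<in> \<Gamma>" "A = L g" "B = L h" using AB by blast
  have dA: "det A = 1" "det B = 1" "g = proj A" "h = proj B"
    using L[OF gh(1)] L[OF gh(2)] gh(3,4) by simp_all
  have "A \<in> K" "B \<in> K" using AB(1,2) sub by blast+
  moreover have "dist (A, B) (A, A) < d" using AB(4) by (simp add: dist_Pair_Pair dist_commute)
  ultimately have "dist (inv2 A ** B) (inv2 A ** A) < e"
    using d(2)[of "(A, A)" "(A, B)"] by simp
  hence small: "dist (inv2 A ** B) (mat 1) < e" using inv2[OF dA(1)] by simp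
  have inv: "inv\<^bsub>PSL2C\<^esub> g = proj (inv2 A)"
  proof (rule P.inv_equality)
    show "proj (inv2 A) \<otimes>\<^bsub>PSL2C\<^esub> g = \<one>\<^bsub>PSL2C\<^esub>" using inv2[OF dA(1)] dA by (simp add: PSL2C_mult PSL2C_one)
  qed (use dA inv2(3)[OF dA(1)] PSL2C_carrier in simp_all)
  have "proj (inv2 A ** B) = inv\<^bsub>PSL2C\<^esub> g \<otimes>\<^bsub>PSL2C\<^esub> h" using inv dA by (simp add: PSL2C_mult)
  hence "proj (inv2 A ** B) \<in> \<Gamma>" using gh \<Gamma> by (simp add: subgroup.m_closed subgroup.m_inv_closed)
  moreover have "det (inv2 A ** B) = 1" using inv2[OF dA(1)] dA by (simp add: det_mul)
  ultimately have "inv\<^bsub>PSL2C\<^esub> g \<otimes>\<^bsub>PSL2C\<^esub> h = \<one>\<^bsub>PSL2C\<^esub>"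
    using e(2) small inv dA by (simp add: PSL2C_mult)
  moreover have "g \<in> carrier PSL2C" "h \<in> carrier PSL2C" using gh \<Gamma>C by blast+
  moreover have "g \<otimes>\<^bsub>PSL2C\<^esub> (inv\<^bsub>PSL2C\<^esub> g \<otimes>\<^bsub>PSL2C\<^esub> h) = h"
    using calculation(2,3) by (simp flip: P.m_assoc)
  ultimately have "g = h" by simp
  thus False using AB gh by simp
qed

lemma finite_small_displacement:
  assumes \<Gamma>: "subgroup \<Gamma> PSL2C" and disc: "discrete_in_PSL2C \<Gamma>" and x: "x \<in> H3"
  shows "finite {g \<in> \<Gamma>. hdist x (act g x) \<le> R}"
proof (rule finite_subset[OF _ finite_small_displacement_base[OF \<Gamma> disc]])
  show "{g \<in> \<Gamma>. hdist x (act g x) \<le> R} \<subseteq> {g \<in> \<Gamma>. hdist base_pt (act g base_pt) \<le> R + 2 * hdist base_pt x}"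
  proof
    fix g assume "g \<in> {g \<in> \<Gamma>. hdist x (act g x) \<le> R}"
    hence g: "g \<in> \<Gamma>" "hdist x (act g x) \<le> R" by auto
    have gC: "g \<in> carrier PSL2C" using g \<Gamma> subgroup.subset by blast
    note H = act_H3[OF gC gC]
    have "hdist base_pt (act g base_pt) \<le> hdist base_pt x + hdist x (act g base_pt)"
      using hdist_triangle x H by simp
    also have "hdist x (act g base_pt) \<le> hdist x (act g x) + hdist (act g x) (act g base_pt)"
      using hdist_triangle x H by simp
    also have "hdist (act g x) (act g base_pt) = hdist base_pt x"
      using act_isometry[OF gC gC x base_pt_H3] hdist_sym by metis
    finally show "g \<in> {g \<in> \<Gamma>. hdist base_pt (act g base_pt) \<le> R + 2 * hdist base_pt x}" using g by simp
  qed
qed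

section \<open>Horoball-avoiding words along a geodesic\<close>

text \<open>The letters of \<open>s\<close> can be touched only after all of \<open>y\<close> has
  cancelled, and then \<open>u\<close> must end in the inverse of \<open>y\<close>. In the tree: a
  path either follows the whole of \<open>y\<close> backwards, or its continuation along
  \<open>s\<close> survives in the reduced word.\<close>

lemma reduce_append_cases:
  assumes "reduced u" "reduced (y @ s)" "y \<noteq> []"
  shows "(\<exists>u'. u = u' @ inv_word y) \<or> reduce_word (u @ y @ s) = reduce_word (u @ y) @ s"
proof -
  have y: "reduced y" using assms(2) by (simp add: reduced_append)
  have "(\<exists>u'. u = u' @ inv_word y) \<or> foldr cancel_cons u (y @ s) = foldr cancel_cons u y @ s"
    using assms(1)
  proof (induction u)
    case (Cons a u)
    have ru: "reduced u" using Cons.prems by (simp add: reduced_Cons)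
    from Cons.IH[OF ru] show ?case
    proof
      assume "\<exists>u'. u = u' @ inv_word y"
      then obtain u' where "a # u = (a # u') @ inv_word y" by auto
      thus ?thesis by blast
    next
      assume H: "foldr cancel_cons u (y @ s) = foldr cancel_cons u y @ s"
      show ?thesis
      proof (cases "foldr cancel_cons u y")
        case Nil
        have "reduce_word (u @ y) = []" using Nil y by (simp add: reduce_append)
        hence "reduce_word ((u @ y) @ inv_word y) = reduce_word (inv_word y)"
          by (metis append_Nil reduce_append_left)
        hence "u = inv_word y" using ru y by simp
        hence "a # u = [a] @ inv_word y" by simp
        thus ?thesis by blast
      qed (use H in simp)
    qed
  qed simp
  moreover have "reduce_word (u @ y @ s) = foldr cancel_cons u (y @ s)"
    "reduce_word (u @ y) = foldr cancel_cons u y"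
    using assms(2) y by (simp_all only: reduce_append[of u] reduce_reduced)
  ultimately show ?thesis by simp
qed

lemma inv_word_reduce: "inv_word (reduce_word w) = reduce_word (inv_word w)"
proof -
  have "reduce_word (inv_word w) = reduce_word (inv_word w @ reduce_word w @ inv_word (reduce_word w))"
    by simp
  also have "\<dots> = reduce_word (inv_word w @ w @ inv_word (reduce_word w))"
    by (rule reduce_append_mid)
  also have "\<dots> = inv_word (reduce_word w)" by simp
  finally show ?thesis ..
qed

lemma reduce_append_cases_left:
  assumes "reduced v" "reduced (s @ y)" "y \<noteq> []"
  shows "(\<exists>v'. v = inv_word y @ v') \<or> reduce_word (s @ y @ v) = s @ reduce_word (y @ v)"
proof -
  have "reduced (inv_word y @ inv_word s)" "inv_word y \<noteq> []" "reduced (inv_word v)"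
    using assms by (simp_all flip: inv_word_simps(3))
  from reduce_append_cases[OF this(3,1,2)] show ?thesis
  proof
    assume "\<exists>u'. inv_word v = u' @ inv_word (inv_word y)"
    then obtain u' where "inv_word v = u' @ y" by auto
    hence "v = inv_word y @ inv_word u'" by (metis inv_word_simps(3,4))
    thus ?thesis by blast
  next
    assume "reduce_word (inv_word v @ inv_word y @ inv_word s) = reduce_word (inv_word v @ inv_word y) @ inv_word s"
    hence "inv_word (reduce_word (s @ y @ v)) = inv_word (s @ reduce_word (y @ v))"
      by (simp add: inv_word_reduce)
    thus ?thesis by (metis inv_word_simps(4))
  qed
qed

lemma wpow_prefix:
  assumes "wpow c m = V @ V'" "V' \<noteq> []"
  shows "\<exists>j w1 w2. j < m \<and> c = w1 @ w2 \<and> V = wpow c j @ w1"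
  using assms
proof (induction m arbitrary: V)
  case (Suc m)
  have e: "c @ wpow c m = V @ V'" using Suc.prems by simp
  show ?case
  proof (cases "length c \<le> length V")
    case True
    then obtain r where r: "V = c @ r" "wpow c m = r @ V'" using append_eq_shorter_left[OF e] by blast
    then obtain j w1 w2 where "j < m" "c = w1 @ w2" "r = wpow c j @ w1" using Suc by blast
    hence "Suc j < Suc m \<and> c = w1 @ w2 \<and> V = wpow c (Suc j) @ w1" using r by simp
    thus ?thesis by blast
  next
    case False
    then obtain r where "c = V @ r" using append_eq_shorter_left[OF e[symmetric]] by auto
    hence "0 < Suc m \<and> c = V @ r \<and> V = wpow c 0 @ V" by simp
    thus ?thesis by blast
  qed
qed simp

lemma wave_right:
  fixes X Y b s :: real
  assumes "b \<le> s" "X * cosh b + Y * sinh b = 1" "\<And>u. b \<le> u \<Longrightarrow> u \<le> s \<Longrightarrow> X * cosh u + Y * sinh u \<ge> 1"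
  shows "X * cosh s + Y * sinh s \<ge> cosh (s - b)"
  using wave_left[of "-s" "-b" X "-Y"] assms(1,2) assms(3)[of "- u" for u] by fastforce

lemma open_horoset: assumes "det C = 1" shows "open (horoset C)"
proof -
  have "horoset C = {p. 0 < snd p \<and> (cmod (C$2$1 * fst p + C$2$2))\<^sup>2 + (cmod (C$2$1))\<^sup>2 * (snd p)\<^sup>2 < snd p}"
  proof -
    have "1 < snd (SL2C_act C p) \<longleftrightarrow> (cmod (C$2$1 * fst p + C$2$2))\<^sup>2 + (cmod (C$2$1))\<^sup>2 * (snd p)\<^sup>2 < snd p"
      if p: "p \<in> H3" for p
    proof -
      define N where "N = (cmod (C$2$1 * fst p + C$2$2))\<^sup>2 + (cmod (C$2$1))\<^sup>2 * (snd p)\<^sup>2"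
      have "snd p / N > 0" using hv_act(2)[OF assms p] by (simp add: H3_def snd_SL2C_act N_def)
      moreover have "snd p > 0" using p by (simp add: H3_def)
      ultimately have "N > 0" by (simp add: zero_less_divide_iff)
      thus ?thesis unfolding snd_SL2C_act N_def[symmetric] by (simp only: less_divide_eq_1_pos)
    qed
    thus ?thesis unfolding horoset_def by (auto simp: H3_def)
  qed
  also have "open \<dots>" by (intro open_Collect_conj open_Collect_less continuous_intros)
  finally show ?thesis .
qed

lemma horoset_nonempty: assumes "det C = 1" shows "horoset C \<noteq> {}"
proof -
  have "(0, 2) \<in> H3" by (simp add: H3_def)
  hence "SL2C_act (inv2 C) (0, 2) \<in> horoset C"
    using hv_act(2)[OF inv2(3)[OF assms]] SL2C_act_inv2(2)[OF assms] by (simp add: horoset_def)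
  thus ?thesis by blast
qed

text \<open>\<open>B0\<close> is the horoball stabilised by the powers of \<open>c\<close>, and \<open>x\<close> is a base point outside the
  horoballs. Arbitrary words act through their reductions.\<close>

locale cusped_action =
  fixes n :: nat and \<beta> :: "nat word \<Rightarrow> hpoint \<Rightarrow> hpoint" and c :: "nat word"
    and B0 :: "hpoint set" and x :: hpoint and R0 :: real
  assumes moebius: "fst ` set w \<subseteq> {0..<n} \<Longrightarrow> \<exists>A. det A = 1 \<and> (\<forall>p\<in>H3. \<beta> w p = SL2C_act A p)"
    and beta_append: "fst ` set u \<subseteq> {0..<n} \<Longrightarrow> fst ` set v \<subseteq> {0..<n} \<Longrightarrow> p \<in> H3 \<Longrightarrow> \<beta> (u @ v) p = \<beta> u (\<beta> v p)"
    and beta_reduce [simp]: "\<beta> (reduce_word w) = \<beta> w"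
    and beta_Nil [simp]: "p \<in> H3 \<Longrightarrow> \<beta> [] p = p"
    and displacement_finite: "finite {w \<in> carrier (Fn n). hdist x (\<beta> w x) \<le> R}"
    and c: "c \<in> carrier (Fn n)" "cyclically_reduced c" "c \<noteq> []"
    and B0: "\<exists>C. det C = 1 \<and> B0 = horoset C"
    and c_B0: "\<beta> c ` B0 = B0"
    and B0_meets: "fst ` set w \<subseteq> {0..<n} \<Longrightarrow> \<beta> w ` B0 \<inter> B0 \<noteq> {} \<Longrightarrow>
      \<exists>m. reduce_word w = wpow c m \<or> reduce_word w = wpow (inv_word c) m"
    and x_H3: "x \<in> H3" and x_outside: "fst ` set w \<subseteq> {0..<n} \<Longrightarrow> x \<notin> \<beta> w ` B0"
    and geodesic_near: "g \<in> carrier (Fn n) \<Longrightarrow> h \<in> carrier (Fn n) \<Longrightarrow> 0 \<le> s \<Longrightarrow> s \<le> hdist (\<beta> g x) (\<beta> h x) \<Longrightarrow>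
      (\<forall>w. fst ` set w \<subseteq> {0..<n} \<longrightarrow> geod (\<beta> g x) (\<beta> h x) s \<notin> \<beta> w ` B0) \<Longrightarrow>
      \<exists>k\<in>carrier (Fn n). hdist (geod (\<beta> g x) (\<beta> h x) s) (\<beta> k x) \<le> R0"
begin

section \<open>Orbit points and translated horoballs\<close>

definition ok :: "nat word \<Rightarrow> bool" where "ok w \<longleftrightarrow> fst ` set w \<subseteq> {0..<n}"

lemma ok_simps [simp]: "ok []" "ok (u @ v) \<longleftrightarrow> ok u \<and> ok v" "ok (inv_word w) \<longleftrightarrow> ok w" "ok c"
  using c(1) by (auto simp: ok_def)

lemma ok_Cons [simp]: "ok (a # w) \<longleftrightarrow> fst a < n \<and> ok w"
  by (auto simp: ok_def)

lemma ok_reduce: "ok w \<Longrightarrow> ok (reduce_word w)"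
  using fst_set_reduce_subset[of w] by (auto simp: ok_def)

lemma ok_wpow: "ok w \<Longrightarrow> ok (wpow w k)"
  by (induction k) auto

lemma carrier_ok: "w \<in> carrier (Fn n) \<longleftrightarrow> reduced w \<and> ok w"
  by (simp add: ok_def)

lemma beta_H3: "ok w \<Longrightarrow> p \<in> H3 \<Longrightarrow> \<beta> w p \<in> H3"
  using moebius[of w] hv_act(2) unfolding ok_def by metis

lemma beta_isometry: "ok w \<Longrightarrow> p \<in> H3 \<Longrightarrow> q \<in> H3 \<Longrightarrow> hdist (\<beta> w p) (\<beta> w q) = hdist p q"
  using moebius[of w] SL2C_act_isometry unfolding ok_def by metis

lemma beta_app: "ok u \<Longrightarrow> ok v \<Longrightarrow> p \<in> H3 \<Longrightarrow> \<beta> (u @ v) p = \<beta> u (\<beta> v p)"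
  using beta_append by (simp add: ok_def)

lemma beta_cong: "reduce_word u = reduce_word v \<Longrightarrow> \<beta> u = \<beta> v"
  by (metis beta_reduce)

lemma beta_inv: "ok w \<Longrightarrow> p \<in> H3 \<Longrightarrow> \<beta> (inv_word w) (\<beta> w p) = p" "ok w \<Longrightarrow> p \<in> H3 \<Longrightarrow> \<beta> w (\<beta> (inv_word w) p) = p"
  using beta_app[of "inv_word w" w p] beta_app[of w "inv_word w" p]
    beta_cong[of "inv_word w @ w" "[]"] beta_cong[of "w @ inv_word w" "[]"] by simp_all

lemma orbit_dist: "ok u \<Longrightarrow> ok v \<Longrightarrow> hdist (\<beta> u x) (\<beta> (u @ v) x) = hdist x (\<beta> v x)"
  using beta_app[of u v x] beta_isometry[of u x "\<beta> v x"] beta_H3[of v x] x_H3 by simp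

lemma orbit_dist': "ok u \<Longrightarrow> ok v \<Longrightarrow> hdist (\<beta> u x) (\<beta> v x) = hdist x (\<beta> (inv_word u @ v) x)"
  using orbit_dist[of u "inv_word u @ v"] beta_cong[of "u @ inv_word u @ v" v] by simp

text \<open>A Lipschitz constant of the orbit map with respect to word length; a sum over the
  letters is a convenient bound for their maximal displacement.\<close>

definition lip :: real where
  "lip = (\<Sum>a\<in>{0..<n} \<times> UNIV. hdist x (\<beta> [a] x))"

lemma lip_nonneg: "lip \<ge> 0"
  unfolding lip_def by (intro sum_nonneg hdist_nonneg x_H3 beta_H3) (auto simp: ok_def)

lemma displacement_le: "ok w \<Longrightarrow> hdist x (\<beta> w x) \<le> lip * length w"
proof (induction w)
  case (Cons a w)
  have a: "ok [a]" "ok w" using Cons.prems by (auto simp: ok_def)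
  have H: "\<beta> [a] x \<in> H3" "\<beta> ([a] @ w) x \<in> H3" using a by (auto intro!: beta_H3[OF _ x_H3])
  have "hdist x (\<beta> ([a] @ w) x) \<le> hdist x (\<beta> [a] x) + hdist (\<beta> [a] x) (\<beta> ([a] @ w) x)"
    using hdist_triangle[OF x_H3 H] .
  also have "hdist x (\<beta> [a] x) \<le> lip"
    unfolding lip_def using Cons.prems
    by (intro member_le_sum[of a _ "\<lambda>a. hdist x (\<beta> [a] x)"] hdist_nonneg x_H3 beta_H3)
      (auto simp: ok_def mem_Times_iff)
  also have "hdist (\<beta> [a] x) (\<beta> ([a] @ w) x) = hdist x (\<beta> w x)" using orbit_dist a by blast
  also have "\<dots> \<le> lip * length w" using Cons a by blast
  finally show ?case by (simp add: algebra_simps)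
qed (use x_H3 in simp)

lemma displacement_le_bound: "ok w \<Longrightarrow> length w \<le> L \<Longrightarrow> hdist x (\<beta> w x) \<le> lip * real L"
  using displacement_le[of w] lip_nonneg by (meson mult_left_mono of_nat_mono order_trans)

text \<open>Proper discontinuity bounds word length in terms of displacement, but without any rate.
  The linear rate is obtained later, and only for words without high powers of
  \<open>c\<close>.\<close>

lemma short_words: "\<exists>L. \<forall>w. ok w \<longrightarrow> hdist x (\<beta> w x) \<le> R \<longrightarrow> length (reduce_word w) \<le> L"
proof -
  have "finite (length ` {w \<in> carrier (Fn n). hdist x (\<beta> w x) \<le> R})" using displacement_finite by simp
  then obtain L where L: "\<forall>l\<in>length ` {w \<in> carrier (Fn n). hdist x (\<beta> w x) \<le> R}. l \<le> L"
    using finite_nat_set_iff_bounded_le by blast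
  have "length (reduce_word w) \<le> L" if "ok w" "hdist x (\<beta> w x) \<le> R" for w
  proof -
    have "reduce_word w \<in> carrier (Fn n)" using that ok_reduce carrier_ok by simp
    moreover have "hdist x (\<beta> (reduce_word w) x) \<le> R" using that by simp
    ultimately show ?thesis using L by blast
  qed
  thus ?thesis by blast
qed

text \<open>The horoball of the coset \<open>g \<langle>c\<rangle>\<close>; the vertices of this
  coset lie on the axis of the conjugate of \<open>c\<close> by \<open>g\<close>.\<close>

definition HB :: "nat word \<Rightarrow> hpoint set" where "HB g = \<beta> g ` B0"

lemma B0_H3: "B0 \<subseteq> H3" using B0 by (auto simp: horoset_def)

lemma HB_append: "ok u \<Longrightarrow> ok v \<Longrightarrow> HB (u @ v) = \<beta> u ` HB v"
  unfolding HB_def image_image using beta_app[of u v] B0_H3 by (intro image_cong) auto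

lemma HB_cong: "reduce_word u = reduce_word v \<Longrightarrow> HB u = HB v"
  unfolding HB_def using beta_cong by metis

lemma HB_Nil: "HB [] = B0"
proof -
  have "\<beta> [] ` B0 = (\<lambda>p. p) ` B0" using B0_H3 by (intro image_cong refl beta_Nil) blast
  thus ?thesis by (simp add: HB_def)
qed

lemma HB_c: "HB c = B0" "HB (inv_word c) = B0"
proof -
  show 1: "HB c = B0" using c_B0 by (simp add: HB_def)
  have "HB (inv_word c) = \<beta> (inv_word c) ` HB c" by (simp add: HB_def[of "inv_word c"] 1)
  also have "\<dots> = HB (inv_word c @ c)" by (simp add: HB_append)
  also have "\<dots> = B0" using HB_cong[of "inv_word c @ c" "[]"] HB_Nil by simp
  finally show "HB (inv_word c) = B0" .
qed

lemma HB_wpow: "c' \<in> {c, inv_word c} \<Longrightarrow> HB (wpow c' m) = B0"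
proof (induction m)
  case (Suc m)
  have ok': "ok c'" using Suc.prems by auto
  have "HB (wpow c' (Suc m)) = \<beta> c' ` HB (wpow c' m)" using ok' by (simp add: HB_append ok_wpow)
  also have "\<dots> = HB c'" using Suc by (simp add: HB_def)
  finally show ?case using HB_c Suc.prems by auto
qed (simp add: HB_Nil)

lemma HB_append_wpow: "ok g \<Longrightarrow> c' \<in> {c, inv_word c} \<Longrightarrow> HB (g @ wpow c' m) = HB g"
  using HB_append[of g "wpow c' m"] HB_wpow[of c' m] ok_wpow[of c' m] HB_def[of g] by auto

lemma HB_meets:
  assumes "ok g" "ok h" "HB g \<inter> HB h \<noteq> {}"
  shows "\<exists>m. \<exists>c'\<in>{c, inv_word c}. reduce_word (inv_word g @ h) = wpow c' m" "HB g = HB h"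
proof -
  obtain p where p: "p \<in> HB g" "p \<in> HB h" using assms(3) by blast
  then obtain b b' where b: "b \<in> B0" "p = \<beta> g b" "b' \<in> B0" "p = \<beta> h b'" by (auto simp: HB_def)
  have bH: "b \<in> H3" "b' \<in> H3" using b B0_H3 by auto
  have "\<beta> (inv_word g @ h) b' = b" using beta_app[of "inv_word g" h b'] beta_inv(1)[of g b] assms b bH by simp
  hence "\<beta> (inv_word g @ h) ` B0 \<inter> B0 \<noteq> {}" using b by blast
  moreover have "ok (inv_word g @ h)" using assms by simp
  ultimately obtain m where m: "reduce_word (inv_word g @ h) = wpow c m \<or> reduce_word (inv_word g @ h) = wpow (inv_word c) m"
    using B0_meets[of "inv_word g @ h"] unfolding ok_def by blast
  thus ex: "\<exists>m. \<exists>c'\<in>{c, inv_word c}. reduce_word (inv_word g @ h) = wpow c' m" by blast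
  then obtain c' m where c': "c' \<in> {c, inv_word c}" "reduce_word (inv_word g @ h) = wpow c' m" by blast
  have "reduce_word h = reduce_word (g @ inv_word g @ h)" by simp
  also have "\<dots> = reduce_word (g @ wpow c' m)" by (metis c'(2) reduce_append_right)
  finally show "HB g = HB h" using HB_cong HB_append_wpow[OF assms(1) c'(1)] by metis
qed

lemma HB_horoset: assumes "ok g" shows "\<exists>C. det C = 1 \<and> HB g = horoset C"
proof -
  obtain C where C: "det C = 1" "B0 = horoset C" using B0 by blast
  obtain A where A: "det A = 1" "\<And>p. p \<in> H3 \<Longrightarrow> \<beta> g p = SL2C_act A p" using moebius[of g] assms by (auto simp: ok_def)
  have d: "det (C ** inv2 A) = 1" using C A inv2 by (simp add: det_mul)
  have "HB g = horoset (C ** inv2 A)"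
  proof (intro equalityI subsetI)
    fix p assume "p \<in> HB g"
    then obtain b where b0: "b \<in> B0" "p = \<beta> g b" unfolding HB_def by blast
    hence b: "b \<in> H3" "1 < snd (SL2C_act C b)" using C(2) by (simp_all add: horoset_def)
    note b = b b0(2)[unfolded A(2)[OF b(1)]]
    have p: "p \<in> H3" using hv_act(2) A b by simp
    have "SL2C_act (C ** inv2 A) p = SL2C_act C b"
      using SL2C_act_mult[OF C(1) inv2(3)[OF A(1)] p] SL2C_act_inv2(1)[OF A(1) b(1)] b by simp
    thus "p \<in> horoset (C ** inv2 A)" using b p by (simp add: horoset_def)
  next
    fix p assume p: "p \<in> horoset (C ** inv2 A)"
    hence pH: "p \<in> H3" by (simp add: horoset_def)
    define b where "b = SL2C_act (inv2 A) p"
    have b: "b \<in> H3" "SL2C_act A b = p"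
      unfolding b_def using hv_act(2)[OF inv2(3)[OF A(1)] pH] SL2C_act_inv2(2)[OF A(1) pH] by auto
    have "SL2C_act (C ** inv2 A) p = SL2C_act C b"
      using SL2C_act_mult[OF C(1) inv2(3)[OF A(1)] pH] b_def by simp
    hence "b \<in> B0" using p b C by (simp add: horoset_def)
    thus "p \<in> HB g" using A(2)[OF b(1)] b by (metis HB_def image_eqI)
  qed
  thus ?thesis using d by blast
qed

lemma HB_open: "ok g \<Longrightarrow> open (HB g)"
  using HB_horoset open_horoset by metis

text \<open>The closed horoball; the matrix serves as a coordinate change to the standard horoball.\<close>

definition touches :: "nat word \<Rightarrow> hpoint \<Rightarrow> bool" where
  "touches g y \<longleftrightarrow> y \<in> H3 \<and> (\<exists>C. det C = 1 \<and> HB g = horoset C \<and> 1 \<le> snd (SL2C_act C y))"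

lemma touches_translate:
  assumes "ok g" "ok h" "touches g y" shows "touches (h @ g) (\<beta> h y)"
proof -
  obtain C where C: "y \<in> H3" "det C = 1" "HB g = horoset C" "1 \<le> snd (SL2C_act C y)"
    using assms(3) by (auto simp: touches_def)
  obtain A where A: "det A = 1" "\<And>p. p \<in> H3 \<Longrightarrow> \<beta> h p = SL2C_act A p" using moebius[of h] assms by (auto simp: ok_def)
  have d: "det (C ** inv2 A) = 1" using C A inv2 by (simp add: det_mul)
  have k: "SL2C_act (C ** inv2 A) (\<beta> h p) = SL2C_act C p" "\<beta> h p \<in> H3" if p: "p \<in> H3" for p
    using SL2C_act_mult[OF C(2) inv2(3)[OF A(1)] hv_act(2)[OF A(1) p]] SL2C_act_inv2(1)[OF A(1) p]
      A(2)[OF p] hv_act(2)[OF A(1) p] by simp_all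
  have "HB (h @ g) = \<beta> h ` horoset C" using HB_append assms C(3) by simp
  also have "\<dots> = horoset (C ** inv2 A)"
  proof (intro equalityI subsetI)
    fix p assume "p \<in> \<beta> h ` horoset C"
    thus "p \<in> horoset (C ** inv2 A)" using k by (auto simp: horoset_def)
  next
    fix p assume p: "p \<in> horoset (C ** inv2 A)"
    hence pH: "p \<in> H3" by (simp add: horoset_def)
    define b where "b = \<beta> (inv_word h) p"
    have b: "b \<in> H3" "\<beta> h b = p" using beta_H3 beta_inv assms pH by (auto simp: b_def)
    thus "p \<in> \<beta> h ` horoset C" using k(1)[OF b(1)] p by (auto simp: horoset_def intro!: image_eqI[of _ _ b])
  qed
  finally have "HB (h @ g) = horoset (C ** inv2 A)" .
  thus ?thesis unfolding touches_def using d k[OF C(1)] C(4)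
    by (intro conjI exI[of _ "C ** inv2 A"]) simp_all
qed

lemma touches_cong: "HB g = HB h \<Longrightarrow> touches g y \<Longrightarrow> touches h y"
  by (simp add: touches_def)

text \<open>A horoball that touches the ball of radius \<open>R\<close> around \<open>x\<close>
  contains a hyperbolic ball of fixed size around a deep point, whose distance from \<open>x\<close>
  is at most \<open>R + dl\<close>. Distinct horoballs are disjoint, so their deep points are
  separated, and \<open>hball_packing\<close> applies.\<close>

lemma horoballs_locally_finite:
  "\<exists>E. finite E \<and> E \<subseteq> Collect ok \<and> (\<forall>g y. ok g \<longrightarrow> touches g y \<longrightarrow> hdist x y \<le> R \<longrightarrow>
    (\<exists>e\<in>E. HB e = HB g))"
proof -
  define T where "T = {g. ok g \<and> (\<exists>y. touches g y \<and> hdist x y \<le> R)}"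
  define dl where "dl = arcosh (17/8 :: real)"
  define deep where "deep H y' \<longleftrightarrow> y' \<in> H3 \<and> hdist x y' \<le> R + dl \<and> (\<forall>q\<in>H3. cosh (hdist y' q) \<le> 3/2 \<longrightarrow> q \<in> H)"
    for H y'
  have ex: "\<exists>y'. deep (HB g) y'" if gT: "g \<in> T" for g
  proof -
    obtain y C where y: "y \<in> H3" "det C = 1" "HB g = horoset C" "1 \<le> snd (SL2C_act C y)" "hdist x y \<le> R"
      using gT unfolding T_def touches_def by blast
    obtain y' where y': "y' \<in> H3" "cosh (hdist y y') = 17/8" "\<forall>q\<in>H3. cosh (hdist y' q) \<le> 3/2 \<longrightarrow> q \<in> horoset C"
      using horoball_deep_point[OF y(2,1,4)] by blast
    have "hdist y y' = dl" using arcosh_cosh_real[OF hdist_nonneg[OF y(1) y'(1)]] unfolding y'(2) dl_def by (rule sym)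
    hence "hdist x y' \<le> R + dl" using hdist_triangle[OF x_H3 y(1) y'(1)] y(5) by simp
    thus ?thesis using y'(1,3) unfolding deep_def y(3) by blast
  qed
  \<comment> \<open>The deep point is chosen per horoball, not per word: many words name the same
    horoball, and \<open>f\<close> has to be injective on horoballs.\<close>
  define f where "f H = (SOME y'. deep H y')" for H
  have f: "deep (HB g) (f (HB g))" if "g \<in> T" for g
    using ex[OF that] unfolding f_def by (rule someI_ex)
  have self: "f (HB g) \<in> HB g" if "g \<in> T" for g using f[OF that] by (auto simp: deep_def)
  have sep: "HB g = HB h" if "g \<in> T" "h \<in> T" "cosh (hdist (f (HB g)) (f (HB h))) \<le> 3/2" for g h
  proof -
    have "f (HB h) \<in> HB g" using f[OF that(1)] f[OF that(2)] that(3) by (auto simp: deep_def)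
    hence "HB g \<inter> HB h \<noteq> {}" using self[OF that(2)] by blast
    thus ?thesis using HB_meets(2) that by (auto simp: T_def)
  qed
  have "finite (f ` HB ` T)"
  proof (rule hball_packing[OF x_H3])
    show "f ` HB ` T \<subseteq> {q \<in> H3. hdist x q \<le> R + dl}" using f by (auto simp: deep_def)
    fix p q assume pq: "p \<in> f ` HB ` T" "q \<in> f ` HB ` T" "p \<noteq> q"
    then obtain g h where gh: "g \<in> T" "h \<in> T" "p = f (HB g)" "q = f (HB h)" by auto
    show "\<not> cosh (hdist p q) \<le> 3/2"
    proof
      assume "cosh (hdist p q) \<le> 3/2"
      hence "HB g = HB h" using sep gh by simp
      thus False using gh pq(3) by simp
    qed
  qed
  moreover have "inj_on f (HB ` T)"
  proof (rule inj_onI)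
    fix H H' assume "H \<in> HB ` T" "H' \<in> HB ` T" and eq: "f H = f H'"
    then obtain g h where gh: "g \<in> T" "h \<in> T" "H = HB g" "H' = HB h" by auto
    have "cosh (hdist (f H) (f H')) \<le> 3/2" using eq by simp
    thus "H = H'" using sep gh by simp
  qed
  ultimately have "finite (HB ` T)" using finite_image_iff by blast
  then obtain E where E: "E \<subseteq> T" "finite E" "HB ` T = HB ` E" by (meson finite_subset_image order_refl)
  have "\<exists>e\<in>E. HB e = HB g" if "ok g" "touches g y" "hdist x y \<le> R" for g y
  proof -
    have "g \<in> T" unfolding T_def using that by blast
    hence "HB g \<in> HB ` E" using E(3) by blast
    thus ?thesis by auto
  qed
  moreover have "E \<subseteq> Collect ok" using E(1) by (auto simp: T_def)
  ultimately show ?thesis using E(2) by blast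
qed

end

text \<open>Strict superadditivity of \<open>sinh\<close>: a geodesic between two points of a
  horosphere runs strictly inside the horoball.\<close>

lemma wave_chord:
  fixes X Y a b m u :: real
  assumes u: "a < u" "u < b" and "X * cosh a + Y * sinh a = 1" "X * cosh b + Y * sinh b = 1"
  shows "X * cosh u + Y * sinh u < 1"
proof -
  have id: "(X * cosh v + Y * sinh v) * sinh (b - a) = sinh (b - v) * (X * cosh a + Y * sinh a)
      + sinh (v - a) * (X * cosh b + Y * sinh b)" for v
    unfolding sinh_diff cosh_diff by (simp add: algebra_simps)
  have "sinh (b - u) + sinh (u - a) < sinh (b - a)"
  proof -
    have "cosh (u - a) \<noteq> 1" "cosh (b - u) \<noteq> 1" using u by simp_all
    hence "cosh (u - a) > 1" "cosh (b - u) > 1"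
      using cosh_real_ge_1[of "u - a"] cosh_real_ge_1[of "b - u"] by linarith+
    hence "sinh (b - u) * 1 < sinh (b - u) * cosh (u - a)" "1 * sinh (u - a) < cosh (b - u) * sinh (u - a)"
      using u by simp_all
    thus ?thesis using sinh_add[of "b - u" "u - a"] by simp
  qed
  hence "(X * cosh u + Y * sinh u) * sinh (b - a) < 1 * sinh (b - a)"
    unfolding id[of u] using assms by simp
  moreover have "sinh (b - a) > 0" using u by simp
  ultimately show ?thesis by (simp only: mult_less_cancel_right_pos)
qed

section \<open>Thick parameters, excursions into horoballs and covered vertices\<close>

context cusped_action
begin

definition geo :: "nat word \<Rightarrow> nat word \<Rightarrow> real \<Rightarrow> hpoint" where
  "geo g h = geod (\<beta> g x) (\<beta> h x)"

definition len :: "nat word \<Rightarrow> nat word \<Rightarrow> real" where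
  "len g h = hdist (\<beta> g x) (\<beta> h x)"

definition thick :: "nat word \<Rightarrow> nat word \<Rightarrow> real set" where
  "thick g h = {s. 0 \<le> s \<and> s \<le> len g h \<and> (\<forall>k. ok k \<longrightarrow> geo g h s \<notin> HB k)}"

text \<open>A maximal excursion of the geodesic into one horoball: both ends lie on its horosphere
  and outside all the open horoballs.\<close>

definition jump :: "nat word \<Rightarrow> nat word \<Rightarrow> real \<Rightarrow> real \<Rightarrow> nat word \<Rightarrow> bool" where
  "jump g h a b k \<longleftrightarrow> ok k \<and> a < b \<and> a \<in> thick g h \<and> b \<in> thick g h \<and>
     touches k (geo g h a) \<and> touches k (geo g h b) \<and> (\<forall>u. a < u \<longrightarrow> u < b \<longrightarrow> geo g h u \<in> HB k)"

text \<open>In the second alternative \<open>v\<close> lies on the axis segment that replaces an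
  excursion into \<open>HB k\<close>: it starts at \<open>k\<close> and runs along \<open>m\<close>
  copies of \<open>c'\<close>, its ends being close to the ends of the excursion. No bound on
  \<open>m\<close> is asked for, and \<open>w1\<close> is the incomplete copy of \<open>c'\<close>
  on which \<open>v\<close> lies.\<close>

definition covered :: "nat word \<Rightarrow> nat word \<Rightarrow> real \<Rightarrow> real \<Rightarrow> real \<Rightarrow> nat word \<Rightarrow> bool" where
  "covered g h R s0 s1 v \<longleftrightarrow>
     (\<exists>s. s0 \<le> s \<and> s \<le> s1 \<and> s \<in> thick g h \<and> hdist (geo g h s) (\<beta> v x) \<le> R) \<or>
     (\<exists>a b k c' j m w1 w2. s0 \<le> a \<and> b \<le> s1 \<and> jump g h a b k \<and>
        hdist (geo g h a) (\<beta> k x) \<le> R \<and> hdist (geo g h b) (\<beta> (k @ wpow c' m) x) \<le> R \<and>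
        c' \<in> {c, inv_word c} \<and> j < m \<and> c' = w1 @ w2 \<and> reduce_word v = reduce_word (k @ wpow c' j @ w1))"

text \<open>A walk in the Cayley tree from \<open>h0\<close> to \<open>h1\<close>; its vertices are
  \<open>h0 @ W1\<close> for the initial segments \<open>W1\<close> of \<open>W\<close>.\<close>

definition linked :: "nat word \<Rightarrow> nat word \<Rightarrow> real \<Rightarrow> real \<Rightarrow> real \<Rightarrow> nat word \<Rightarrow> nat word \<Rightarrow> bool" where
  "linked g h R s0 s1 h0 h1 \<longleftrightarrow> (\<exists>W. ok W \<and> reduce_word (h0 @ W) = reduce_word h1 \<and>
     (\<forall>W1 W2. W = W1 @ W2 \<longrightarrow> covered g h R s0 s1 (h0 @ W1)))"

lemma covered_mono:
  assumes "covered g h R s0 s1 v" "t0 \<le> s0" "s1 \<le> t1" "R \<le> R'"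
  shows "covered g h R' t0 t1 v"
proof -
  consider (near) s where "s0 \<le> s" "s \<le> s1" "s \<in> thick g h" "hdist (geo g h s) (\<beta> v x) \<le> R"
    | (cross) a b k c' j m w1 w2 where "s0 \<le> a" "b \<le> s1" "jump g h a b k" "hdist (geo g h a) (\<beta> k x) \<le> R"
      "hdist (geo g h b) (\<beta> (k @ wpow c' m) x) \<le> R" "c' \<in> {c, inv_word c}" "j < m" "c' = w1 @ w2"
      "reduce_word v = reduce_word (k @ wpow c' j @ w1)"
    using assms(1) unfolding covered_def by blast
  thus ?thesis
  proof cases
    case near
    hence "t0 \<le> s" "s \<le> t1" "hdist (geo g h s) (\<beta> v x) \<le> R'" using assms(2-4) by linarith+
    thus ?thesis using near(3) unfolding covered_def by blast
  next
    case cross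
    hence "t0 \<le> a" "b \<le> t1" "hdist (geo g h a) (\<beta> k x) \<le> R'" "hdist (geo g h b) (\<beta> (k @ wpow c' m) x) \<le> R'"
      using assms(2-4) by linarith+
    thus ?thesis using cross(3,6-9) unfolding covered_def by blast
  qed
qed

lemma covered_cong: "reduce_word v = reduce_word v' \<Longrightarrow> covered g h R s0 s1 v \<Longrightarrow> covered g h R s0 s1 v'"
  unfolding covered_def using beta_cong[of v v'] by simp

lemma linked_trans:
  assumes "linked g h R s0 s1 h0 h1" "linked g h R s1 s2 h1 h2" "s0 \<le> s1" "s1 \<le> s2"
  shows "linked g h R s0 s2 h0 h2"
proof -
  obtain W where W: "ok W" "reduce_word (h0 @ W) = reduce_word h1"
    "\<And>W1 W2. W = W1 @ W2 \<Longrightarrow> covered g h R s0 s1 (h0 @ W1)" using assms(1) unfolding linked_def by blast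
  obtain V where V: "ok V" "reduce_word (h1 @ V) = reduce_word h2"
    "\<And>W1 W2. V = W1 @ W2 \<Longrightarrow> covered g h R s1 s2 (h1 @ W1)" using assms(2) unfolding linked_def by blast
  have eq: "reduce_word (h0 @ W @ U) = reduce_word (h1 @ U)" for U
    using W(2) by (metis append.assoc reduce_append_left)
  have "covered g h R s0 s2 (h0 @ W1)" if WV: "W @ V = W1 @ W2" for W1 W2
  proof (cases "length W1 \<le> length W")
    case True
    then obtain r where "W = W1 @ r" using append_eq_shorter_left[OF WV[symmetric]] by blast
    thus ?thesis using covered_mono[OF W(3) order_refl assms(4) order_refl] by blast
  next
    case False
    then obtain r where r: "W1 = W @ r" "V = r @ W2" using append_eq_shorter_left[OF WV] by force
    have "covered g h R s0 s2 (h1 @ r)" using covered_mono[OF V(3)[OF r(2)] assms(3) order_refl order_refl] .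
    thus ?thesis using covered_cong[of "h1 @ r" "h0 @ W1"] eq[of r] r(1) by simp
  qed
  moreover have "ok (W @ V)" using W(1) V(1) by simp
  moreover have "reduce_word (h0 @ W @ V) = reduce_word h2" using eq[of V] V(2) by simp
  ultimately show ?thesis unfolding linked_def by blast
qed

context
  fixes g h assumes g: "g \<in> carrier (Fn n)" and h: "h \<in> carrier (Fn n)"
begin

lemma ok_gh: "ok g" "ok h" using g h carrier_ok by auto

lemma ends_H3: "\<beta> g x \<in> H3" "\<beta> h x \<in> H3"
  using beta_H3[OF ok_gh(1) x_H3] beta_H3[OF ok_gh(2) x_H3] .

lemma geo_H3: "0 \<le> s \<Longrightarrow> s \<le> len g h \<Longrightarrow> geo g h s \<in> H3"
  unfolding geo_def len_def by (rule geod_H3[OF ends_H3])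

lemma geo_dist: "0 \<le> s \<Longrightarrow> s \<le> len g h \<Longrightarrow> 0 \<le> t \<Longrightarrow> t \<le> len g h \<Longrightarrow> hdist (geo g h s) (geo g h t) = \<bar>s - t\<bar>"
  unfolding geo_def len_def by (rule geod_dist[OF ends_H3])

lemma geo_ends: "geo g h 0 = \<beta> g x" "geo g h (len g h) = \<beta> h x"
  unfolding geo_def len_def by (rule geod_0[OF ends_H3], rule geod_end[OF ends_H3])

lemma len_nonneg: "0 \<le> len g h"
  unfolding len_def by (rule hdist_nonneg[OF ends_H3])

lemma geo_continuous: "continuous_on {0..len g h} (geo g h)"
  unfolding geo_def len_def by (rule continuous_on_geod[OF ends_H3])

lemma orbit_outside:
  assumes "ok u" "ok k" shows "\<beta> u x \<notin> HB k"
proof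
  assume "\<beta> u x \<in> HB k"
  hence "\<beta> (inv_word u) (\<beta> u x) \<in> \<beta> (inv_word u) ` HB k" by (rule imageI)
  hence "x \<in> HB (inv_word u @ k)"
    unfolding beta_inv(1)[OF assms(1) x_H3] using HB_append[of "inv_word u" k] assms by simp
  moreover have "ok (inv_word u @ k)" using assms by simp
  ultimately show False using x_outside[of "inv_word u @ k"] unfolding HB_def ok_def by blast
qed

lemma ends_thick: "0 \<in> thick g h" "len g h \<in> thick g h"
  unfolding thick_def mem_Collect_eq geo_ends
  using len_nonneg orbit_outside[OF ok_gh(1)] orbit_outside[OF ok_gh(2)] by blast+

lemma thick_near: "s \<in> thick g h \<Longrightarrow> \<exists>k. ok k \<and> hdist (geo g h s) (\<beta> k x) \<le> R0"
proof -
  assume s: "s \<in> thick g h"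
  hence "0 \<le> s" "s \<le> hdist (\<beta> g x) (\<beta> h x)"
    "\<forall>w. fst ` set w \<subseteq> {0..<n} \<longrightarrow> geod (\<beta> g x) (\<beta> h x) s \<notin> \<beta> w ` B0"
    by (simp_all add: thick_def geo_def len_def HB_def ok_def)
  from geodesic_near[OF g h this] obtain k where "k \<in> carrier (Fn n)" "hdist (geo g h s) (\<beta> k x) \<le> R0"
    unfolding geo_def by blast
  thus ?thesis using carrier_ok by blast
qed

lemma height_wave:
  assumes "det C = 1"
  shows "\<exists>X Y. \<forall>u. 0 \<le> u \<longrightarrow> u \<le> len g h \<longrightarrow>
    1 / snd (SL2C_act C (geo g h u)) = X * cosh u + Y * sinh u \<and>
    (geo g h u \<in> horoset C \<longleftrightarrow> X * cosh u + Y * sinh u < 1) \<and>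
    (1 \<le> snd (SL2C_act C (geo g h u)) \<longleftrightarrow> X * cosh u + Y * sinh u \<le> 1)"
proof -
  from geod_height_wave[OF assms ends_H3] obtain X Y where
    XY: "\<And>u. 0 \<le> u \<Longrightarrow> u \<le> len g h \<Longrightarrow> 1 / snd (SL2C_act C (geo g h u)) = X * cosh u + Y * sinh u"
    unfolding geo_def len_def by blast
  have "(geo g h u \<in> horoset C \<longleftrightarrow> X * cosh u + Y * sinh u < 1) \<and>
    (1 \<le> snd (SL2C_act C (geo g h u)) \<longleftrightarrow> X * cosh u + Y * sinh u \<le> 1)" if u: "0 \<le> u" "u \<le> len g h" for u
  proof -
    have G: "geo g h u \<in> H3" using geo_H3[OF u] .
    have pos: "snd (SL2C_act C (geo g h u)) > 0" using hv_act(2)[OF assms G] unfolding H3_def by blast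
    show ?thesis unfolding XY[OF u, symmetric] horoset_def divide_less_eq_1_pos[OF pos] divide_le_eq_1_pos[OF pos]
      using G by blast
  qed
  thus ?thesis using XY by blast
qed

text \<open>In the coordinates of the horoball that contains the point, the reciprocal height is
  below 1 at \<open>m\<close> and at least 1 at both ends of the geodesic. The intermediate value
  theorem gives the crossings on either side, and \<open>wave_chord\<close> keeps the geodesic
  inside between them.\<close>

lemma jump_exists:
  assumes m: "0 \<le> m" "m \<le> len g h" "m \<notin> thick g h"
  shows "\<exists>a b k. jump g h a b k \<and> a < m \<and> m < b"
proof -
  obtain k where k: "ok k" "geo g h m \<in> HB k" using m unfolding thick_def by blast
  obtain C where C: "det C = 1" "HB k = horoset C" using HB_horoset k(1) by blast
  obtain X Y where "\<forall>u. 0 \<le> u \<longrightarrow> u \<le> len g h \<longrightarrow>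
    1 / snd (SL2C_act C (geo g h u)) = X * cosh u + Y * sinh u \<and>
    (geo g h u \<in> horoset C \<longleftrightarrow> X * cosh u + Y * sinh u < 1) \<and>
    (1 \<le> snd (SL2C_act C (geo g h u)) \<longleftrightarrow> X * cosh u + Y * sinh u \<le> 1)"
    using height_wave[OF C(1)] by blast
  hence XY: "geo g h u \<in> horoset C \<longleftrightarrow> X * cosh u + Y * sinh u < 1"
    "1 \<le> snd (SL2C_act C (geo g h u)) \<longleftrightarrow> X * cosh u + Y * sinh u \<le> 1" if "0 \<le> u" "u \<le> len g h" for u
    using that by blast+
  define f where "f u = X * cosh u + Y * sinh u" for u
  have cf: "continuous_on S f" for S unfolding f_def by (intro continuous_intros)
  have fm: "f m < 1" using XY(1)[OF m(1,2)] k(2) unfolding C(2) f_def by blast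
  have ends: "f 0 \<ge> 1" "f (len g h) \<ge> 1"
  proof -
    have "geo g h 0 \<notin> horoset C" "geo g h (len g h) \<notin> horoset C"
      using ends_thick k(1) unfolding thick_def C(2)[symmetric] by blast+
    thus "f 0 \<ge> 1" "f (len g h) \<ge> 1"
      using XY(1)[OF order_refl len_nonneg] XY(1)[OF len_nonneg order_refl] unfolding f_def by linarith+
  qed
  have "\<exists>a. 0 \<le> a \<and> a \<le> m \<and> f a = 1" by (rule IVT2'[OF less_imp_le[OF fm] ends(1) m(1) cf])
  then obtain a where a: "0 \<le> a" "a \<le> m" "f a = 1" by blast
  have "\<exists>b. m \<le> b \<and> b \<le> len g h \<and> f b = 1" by (rule IVT'[OF less_imp_le[OF fm] ends(2) m(2) cf])
  then obtain b where b: "m \<le> b" "b \<le> len g h" "f b = 1" by blast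
  have am: "a < m" "m < b" 
  proof -
    have "a \<noteq> m" "b \<noteq> m" using a(3) b(3) fm by auto
    thus "a < m" "m < b" using a(2) b(1) by linarith+
  qed
  have inside: "f u < 1" if u: "a < u" "u < b" for u
  proof (rule ccontr)
    assume n: "\<not> f u < 1"
    have fa: "X * cosh a + Y * sinh a = 1" and fb: "X * cosh b + Y * sinh b = 1" using a b by (simp_all add: f_def)
    show False using wave_chord[OF u fa fb] n by (simp add: f_def)
  qed
  have ins: "geo g h u \<in> HB k" if "a < u" "u < b" for u
  proof -
    have "0 \<le> u" "u \<le> len g h" using that a(1) b(2) by linarith+
    thus ?thesis using XY(1) inside[OF that] unfolding C(2) f_def by blast
  qed
  have bd: "touches k (geo g h s)" "s \<in> thick g h" if s: "s = a \<or> s = b" for s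
  proof -
    have "0 \<le> b" "a \<le> len g h" using a b m by linarith+
    hence s0: "0 \<le> s" "s \<le> len g h" "f s = 1" using s a b by blast+
    show "touches k (geo g h s)" unfolding touches_def
      using geo_H3[OF s0(1,2)] C XY(2)[OF s0(1,2)] s0(3)[unfolded f_def] by (metis order_refl)
    \<comment> \<open>An open horoball containing the crossing point would also contain parameters
      just inside the excursion, so it would meet \<open>HB k\<close> and equal it, although
      \<open>f s = 1\<close> puts the crossing outside.\<close>
    have "geo g h s \<notin> HB k'" if k': "ok k'" for k'
    proof
      assume in': "geo g h s \<in> HB k'"
      have "openin (top_of_set {0..len g h}) ({0..len g h} \<inter> geo g h -` HB k')"
        using continuous_openin_preimage_gen[OF geo_continuous HB_open[OF k']] .
      moreover have "s \<in> {0..len g h} \<inter> geo g h -` HB k'" using in' s0 by simp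
      ultimately obtain e where e: "e > 0" "\<And>t. t \<in> {0..len g h} \<Longrightarrow> dist t s < e \<Longrightarrow> geo g h t \<in> HB k'"
        unfolding openin_euclidean_subtopology_iff by blast
      define \<delta> where "\<delta> = min (e/2) ((b - a)/2)"
      have ab: "a < b" using am by linarith
      have h: "e/2 < e" "(b - a)/2 < b - a" using e(1) ab by simp_all
      have "\<delta> \<le> e/2" unfolding \<delta>_def by (rule min.cobounded1)
      moreover have "\<delta> \<le> (b - a)/2" unfolding \<delta>_def by (rule min.cobounded2)
      ultimately have \<delta>: "\<delta> < e" "\<delta> < b - a" using h by (blast intro: order_le_less_trans)+
      have \<delta>0: "\<delta> > 0" unfolding \<delta>_def min_less_iff_conj using e(1) ab by simp
      define t where "t = (if s = a then a + \<delta> else b - \<delta>)"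
      have t: "a < t" "t < b" "dist t s < e"
      proof -
        have "a < t \<and> t < b \<and> \<bar>t - s\<bar> < e"
        proof (cases "s = a")
          case True
          have "t = a + \<delta>" using True by (simp add: t_def)
          thus ?thesis using True \<delta> \<delta>0 ab by linarith
        next
          case False
          hence "t = b - \<delta>" "s = b" using s by (simp_all add: t_def)
          thus ?thesis using \<delta> \<delta>0 ab by linarith
        qed
        thus "a < t" "t < b" "dist t s < e" by (simp_all add: dist_real_def)
      qed
      have "t \<in> {0..len g h}" using t(1,2) a(1) b(2) by simp
      hence "geo g h t \<in> HB k' \<inter> HB k" using e(2)[of t] t ins[OF t(1,2)] by blast
      hence "HB k' = HB k" using HB_meets(2)[OF k' k(1)] by blast
      hence "f s < 1" using in' XY(1)[OF s0(1,2)] unfolding C(2) f_def by blast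
      thus False using s0 by simp
    qed
    thus "s \<in> thick g h" using s0 by (simp add: thick_def)
  qed
  have "a < b" using am by linarith
  hence "jump g h a b k" unfolding jump_def using k(1) bd ins by blast
  thus ?thesis using am by blast
qed

end

end

section \<open>Walks that follow a geodesic\<close>

context cusped_action
begin

context
  fixes g h assumes g: "g \<in> carrier (Fn n)" and h: "h \<in> carrier (Fn n)"
begin

text \<open>The two orbit points are at most \<open>r + 1 + r\<close> apart, so the word between
  them has length at most \<open>L\<close> and its vertices all stay close to the geodesic at
  \<open>s0\<close>.\<close>

lemma short_step:
  assumes L: "\<forall>w. ok w \<longrightarrow> hdist x (\<beta> w x) \<le> 2 * r + 1 \<longrightarrow> length (reduce_word w) \<le> L"
    and s: "s0 \<in> thick g h" "s1 \<in> thick g h" "s0 \<le> s1" "s1 \<le> s0 + 1"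
    and h0: "ok h0" "hdist (geo g h s0) (\<beta> h0 x) \<le> r"
    and h1: "ok h1" "hdist (geo g h s1) (\<beta> h1 x) \<le> r"
    and R: "r + lip * L \<le> R"
  shows "linked g h R s0 s1 h0 h1"
proof -
  have sb: "0 \<le> s0" "s0 \<le> len g h" "0 \<le> s1" "s1 \<le> len g h" using s by (auto simp: thick_def)
  note G = geo_H3[OF g h sb(1,2)] geo_H3[OF g h sb(3,4)]
  note H = beta_H3[OF h0(1) x_H3] beta_H3[OF h1(1) x_H3]
  define W where "W = reduce_word (inv_word h0 @ h1)"
  have okW: "ok W" unfolding W_def using ok_reduce h0 h1 by simp
  have "hdist (\<beta> h0 x) (\<beta> h1 x) \<le> hdist (\<beta> h0 x) (geo g h s0) + hdist (geo g h s0) (\<beta> h1 x)"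
    using hdist_triangle[OF H(1) G(1) H(2)] .
  also have "hdist (geo g h s0) (\<beta> h1 x) \<le> hdist (geo g h s0) (geo g h s1) + hdist (geo g h s1) (\<beta> h1 x)"
    using hdist_triangle[OF G H(2)] .
  also have "hdist (geo g h s0) (geo g h s1) = \<bar>s0 - s1\<bar>" using geo_dist[OF g h sb] .
  finally have "hdist (\<beta> h0 x) (\<beta> h1 x) \<le> 2 * r + 1"
    using h0(2) h1(2) s(3,4) hdist_sym[of "\<beta> h0 x"] by simp
  hence "hdist x (\<beta> (inv_word h0 @ h1) x) \<le> 2 * r + 1" using orbit_dist'[OF h0(1) h1(1)] by simp
  hence lW: "length W \<le> L" unfolding W_def using L[rule_format, of "inv_word h0 @ h1"] h0(1) h1(1) by simp
  have "covered g h R s0 s1 (h0 @ W1)" if W12: "W = W1 @ W2" for W1 W2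
  proof -
    have ok1: "ok W1" using okW W12 by simp
    have l1: "length W1 \<le> L" using lW W12 by simp
    have "ok (h0 @ W1)" using h0(1) ok1 by simp
    note H1 = beta_H3[OF this x_H3]
    have "hdist (geo g h s0) (\<beta> (h0 @ W1) x) \<le> hdist (geo g h s0) (\<beta> h0 x) + hdist (\<beta> h0 x) (\<beta> (h0 @ W1) x)"
      using hdist_triangle[OF G(1) H(1) H1] .
    also have "hdist (\<beta> h0 x) (\<beta> (h0 @ W1) x) \<le> lip * L"
      unfolding orbit_dist[OF h0(1) ok1] using displacement_le_bound[OF ok1 l1] .
    finally have "hdist (geo g h s0) (\<beta> (h0 @ W1) x) \<le> R" using h0(2) R by simp
    thus ?thesis unfolding covered_def using s(1,3) by blast
  qed
  moreover have "reduce_word (h0 @ W) = reduce_word h1" unfolding W_def by simp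
  ultimately show ?thesis unfolding linked_def using okW by blast
qed

text \<open>From each end of the excursion a word of length at most \<open>L\<close> leads to a
  vertex of the coset that belongs to the horoball. Two vertices of one coset differ by a power of
  \<open>c\<close> or its inverse, and the walk uses this power, however long it is.\<close>

lemma jump_step:
  assumes E: "\<forall>k y. ok k \<longrightarrow> touches k y \<longrightarrow> hdist x y \<le> r \<longrightarrow> (\<exists>e\<in>E. HB e = HB k)"
    and Eok: "\<forall>e\<in>E. ok e \<and> length e \<le> L"
    and J: "jump g h a b k"
    and h0: "ok h0" "hdist (geo g h a) (\<beta> h0 x) \<le> r"
    and h1: "ok h1" "hdist (geo g h b) (\<beta> h1 x) \<le> r"
    and R: "r + 2 * (lip * L) \<le> R"
  shows "linked g h R a b h0 h1"
proof -
  have k: "ok k" "a < b" "a \<in> thick g h" "b \<in> thick g h" "touches k (geo g h a)" "touches k (geo g h b)"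
    using J by (auto simp: jump_def)
  have lL: "lip * L \<ge> 0" using lip_nonneg by simp
  have sb: "0 \<le> a" "a \<le> len g h" "0 \<le> b" "b \<le> len g h" using k by (auto simp: thick_def)
  note G = geo_H3[OF g h sb(1,2)] geo_H3[OF g h sb(3,4)]
  \<comment> \<open>Translated back by \<open>h'\<close>, the horoball touches the ball of radius
    \<open>r\<close> around \<open>x\<close> and is one of the finitely many horoballs listed by
    \<open>E\<close>.\<close>
  have rep: "\<exists>e\<in>E. HB (h' @ e) = HB k" if h': "ok h'" "touches k y" "hdist y (\<beta> h' x) \<le> r" for h' y
  proof -
    have y: "y \<in> H3" using h' by (simp add: touches_def)
    have t: "touches (inv_word h' @ k) (\<beta> (inv_word h') y)"
      using touches_translate[OF k(1) _ h'(2), of "inv_word h'"] h'(1) by simp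
    have oki: "ok (inv_word h')" "ok (inv_word h' @ k)" using h'(1) k(1) by simp_all
    have "hdist x (\<beta> (inv_word h') y) = hdist (\<beta> h' x) y"
      using beta_isometry[OF h'(1) x_H3 beta_H3[OF oki(1) y]] beta_inv(2)[OF h'(1) y] by simp
    hence "hdist x (\<beta> (inv_word h') y) \<le> r" using h'(3) hdist_sym[of y] by simp
    then obtain e where e: "e \<in> E" "HB e = HB (inv_word h' @ k)"
      using E[rule_format, OF oki(2) t] by blast
    have "HB (h' @ e) = HB (h' @ inv_word h' @ k)" using e HB_append[OF h'(1)] Eok h' k(1) by simp
    also have "\<dots> = HB k" by (rule HB_cong) simp
    finally show ?thesis using e by blast
  qed
  obtain e where e: "e \<in> E" "HB (h0 @ e) = HB k" using rep[OF h0(1) k(5) h0(2)] by blast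
  obtain e' where e': "e' \<in> E" "HB (h1 @ e') = HB k" using rep[OF h1(1) k(6) h1(2)] by blast
  have oke: "ok e" "ok e'" "length e \<le> L" "length e' \<le> L" using Eok e e' by auto
  have ne: "HB (h0 @ e) \<inter> HB (h1 @ e') \<noteq> {}"
  proof -
    obtain C where "det C = 1" "HB k = horoset C" using HB_horoset[OF k(1)] by blast
    thus ?thesis using e(2) e'(2) horoset_nonempty[of C] by simp
  qed
  obtain c' m where c': "c' \<in> {c, inv_word c}" "reduce_word (inv_word (h0 @ e) @ h1 @ e') = wpow c' m"
  proof -
    have "ok (h0 @ e)" "ok (h1 @ e')" using h0(1) h1(1) oke by simp_all
    from HB_meets(1)[OF this ne] show ?thesis using that by blast
  qed
  have okc: "ok c'" using c' by auto
  have vert: "reduce_word (h0 @ e @ wpow c' m @ U) = reduce_word (h1 @ e' @ U)" for U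
  proof -
    have "reduce_word (h0 @ e @ wpow c' m @ U) = reduce_word ((h0 @ e) @ reduce_word (inv_word (h0 @ e) @ h1 @ e') @ U)"
      unfolding c'(2) by simp
    also have "\<dots> = reduce_word ((h0 @ e) @ (inv_word (h0 @ e) @ h1 @ e') @ U)" by (rule reduce_append_mid)
    also have "\<dots> = reduce_word ((h0 @ e) @ inv_word (h0 @ e) @ (h1 @ e' @ U))" by (simp del: inv_word_simps)
    also have "\<dots> = reduce_word (h1 @ e' @ U)" by (rule reduce_cancel_right(1))
    finally show ?thesis .
  qed
  define W where "W = e @ wpow c' m @ inv_word e'"
  have okW: "ok W" unfolding W_def using oke ok_wpow[OF okc] by simp
  have ends: "reduce_word (h0 @ W) = reduce_word h1" unfolding W_def using vert[of "inv_word e'"] by simp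
  have near: "hdist y (\<beta> (h' @ V) x) \<le> R"
    if y: "y \<in> H3" "ok h'" "hdist y (\<beta> h' x) \<le> r" "ok V" "length V \<le> 2 * L" for y h' V
  proof -
    have "ok (h' @ V)" using y by simp
    note Hy = beta_H3[OF y(2) x_H3] beta_H3[OF this x_H3]
    have "hdist y (\<beta> (h' @ V) x) \<le> hdist y (\<beta> h' x) + hdist (\<beta> h' x) (\<beta> (h' @ V) x)"
      using hdist_triangle[OF y(1) Hy] .
    also have "hdist (\<beta> h' x) (\<beta> (h' @ V) x) \<le> lip * real (2 * L)"
      unfolding orbit_dist[OF y(2,4)] using displacement_le_bound[OF y(4,5)] .
    finally show ?thesis using y(3) R by simp
  qed
  have "covered g h R a b (h0 @ W1)" if W12: "W = W1 @ W2" for W1 W2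
  proof -
    have ok1: "ok W1" using okW W12 by simp
    \<comment> \<open>Vertices on \<open>e\<close> and on the way back along \<open>e'\<close> are
      close to the points at \<open>a\<close> and \<open>b\<close>; only those in between need the
      second alternative of \<open>covered\<close>. In the final piece the way is measured from
      \<open>h1\<close>, over \<open>e'\<close> and then back, whence the
      \<open>2 * L\<close>.\<close>
    consider (start) "length W1 \<le> length e"
      | (middle) V where "W1 = e @ V" "length V < length (wpow c' m)"
      | (final) V where "W1 = e @ wpow c' m @ V" "inv_word e' = V @ W2"
    proof (cases "length W1 \<le> length e")
      case False
      have 0: "e @ (wpow c' m @ inv_word e') = W1 @ W2" using W12 unfolding W_def .
      obtain V where V: "W1 = e @ V" "wpow c' m @ inv_word e' = V @ W2"
        using append_eq_shorter_left[OF 0] False by auto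
      show ?thesis
      proof (cases "length V < length (wpow c' m)")
        case True thus ?thesis using that(2) V(1) by blast
      next
        case F: False
        then obtain V' where "V = wpow c' m @ V'" "inv_word e' = V' @ W2"
          using append_eq_shorter_left[OF V(2)] by auto
        thus ?thesis using that(3) V(1) by simp
      qed
    qed (use that in blast)
    thus ?thesis
    proof cases
      case start
      hence "length W1 \<le> 2 * L" using oke by simp
      hence "hdist (geo g h a) (\<beta> (h0 @ W1) x) \<le> R" using near[OF G(1) h0 ok1] by blast
      thus ?thesis unfolding covered_def using k(2,3) by (intro disjI1 exI[of _ a]) auto
    next
      case middle
      have eq: "wpow c' m @ inv_word e' = V @ W2" using W12 middle(1) unfolding W_def by simp
      obtain V' where V': "wpow c' m = V @ V'" using append_eq_shorter_left[OF eq[symmetric]] middle(2) by auto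
      hence "V' \<noteq> []" using middle(2) by auto
      then obtain j w1 w2 where j: "j < m" "c' = w1 @ w2" "V = wpow c' j @ w1" using wpow_prefix V' by blast
      have "jump g h a b (h0 @ e)" using J e(2) oke h0(1) touches_cong[of k "h0 @ e"] unfolding jump_def by simp
      moreover have "hdist (geo g h a) (\<beta> (h0 @ e) x) \<le> R" using near[OF G(1) h0 oke(1)] oke(3) by simp
      moreover have "hdist (geo g h b) (\<beta> ((h0 @ e) @ wpow c' m) x) \<le> R"
      proof -
        have "\<beta> ((h0 @ e) @ wpow c' m) = \<beta> (h1 @ e')" by (rule beta_cong) (use vert[of "[]"] in simp)
        thus ?thesis using near[OF G(2) h1 oke(2)] oke(4) by simp
      qed
      moreover have "reduce_word (h0 @ W1) = reduce_word ((h0 @ e) @ wpow c' j @ w1)" using middle(1) j(3) by simp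
      ultimately show ?thesis unfolding covered_def using c'(1) j(1,2) by blast
    next
      case final
      have lV: "length V \<le> L" 
      proof -
        have "length V + length W2 = length (inv_word e')" unfolding final(2) by simp
        thus ?thesis using oke(4) by simp
      qed
      have okV: "ok V" using ok1 final(1) by simp
      have "length (e' @ V) \<le> 2 * L" using lV oke(4) by simp
      hence "hdist (geo g h b) (\<beta> (h1 @ e' @ V) x) \<le> R" using near[OF G(2) h1, of "e' @ V"] oke(2) okV by simp
      moreover have "\<beta> (h1 @ e' @ V) = \<beta> (h0 @ W1)" by (rule beta_cong) (use vert[of V] final(1) in simp)
      ultimately show ?thesis unfolding covered_def using k(2,4) by (intro disjI1 exI[of _ b]) auto
    qed
  qed
  thus ?thesis unfolding linked_def using okW ends by blast
qed

text \<open>Unless \<open>s1\<close> is within reach of a single short step, the induction advances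
  the parameter by at least \<open>1/2\<close>, which is why the remaining length is measured in
  halves.\<close>

lemma chain_exists:
  assumes L: "\<forall>w. ok w \<longrightarrow> hdist x (\<beta> w x) \<le> 2 * r + 1 \<longrightarrow> length (reduce_word w) \<le> L"
    and E: "\<forall>k y. ok k \<longrightarrow> touches k y \<longrightarrow> hdist x y \<le> r \<longrightarrow> (\<exists>e\<in>E. HB e = HB k)"
    and Eok: "\<forall>e\<in>E. ok e \<and> length e \<le> L"
    and r: "R0 \<le> r" and R: "r + 2 * (lip * L) \<le> R"
    and h1: "ok h1" "hdist (geo g h s1) (\<beta> h1 x) \<le> r" and s1: "s1 \<in> thick g h"
  shows "s0 \<in> thick g h \<Longrightarrow> s0 \<le> s1 \<Longrightarrow> s1 - s0 \<le> real N / 2 \<Longrightarrow> ok h0 \<Longrightarrow>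
     hdist (geo g h s0) (\<beta> h0 x) \<le> r \<Longrightarrow> linked g h R s0 s1 h0 h1"
proof (induction N arbitrary: s0 h0)
  case (0 s0 h0)
  have "s1 \<le> s0 + 1" using 0(3) by simp
  have "0 \<le> lip * real L" using lip_nonneg by simp
  hence R': "r + lip * L \<le> R" using R by linarith
  show ?case by (rule short_step[OF L 0(1) s1 0(2) \<open>s1 \<le> s0 + 1\<close> 0(4,5) h1 R'])
next
  case (Suc N s0 h0)
  have "0 \<le> lip * real L" using lip_nonneg by simp
  hence R': "r + lip * L \<le> R" using R by linarith
  have rep: "\<exists>k. ok k \<and> hdist (geo g h s) (\<beta> k x) \<le> r" if st: "s \<in> thick g h" for s
  proof -
    obtain k where "ok k" "hdist (geo g h s) (\<beta> k x) \<le> R0" using thick_near[OF g h st] by blast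
    thus ?thesis using r by (intro exI[of _ k]) simp
  qed
  have N2: "s1 - s0 \<le> real N / 2 + 1/2" using Suc.prems(3) by (simp add: add_divide_distrib)
  show ?case
  proof (cases "s1 \<le> s0 + 1")
    case True
    show ?thesis by (rule short_step[OF L Suc.prems(1) s1 Suc.prems(2) True Suc.prems(4,5) h1 R'])
  next
    case False
    show ?thesis
    proof (cases "\<exists>t\<in>thick g h. s0 + 1/2 \<le> t \<and> t \<le> s0 + 1")
      case True
      then obtain t where t: "t \<in> thick g h" "s0 + 1/2 \<le> t" "t \<le> s0 + 1" by blast
      obtain k where k: "ok k" "hdist (geo g h t) (\<beta> k x) \<le> r" using rep[OF t(1)] by blast
      have ts: "s0 \<le> t" "t \<le> s1" "s1 - t \<le> real N / 2" using t False N2 by linarith+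
      have "linked g h R s0 t h0 k"
        by (rule short_step[OF L Suc.prems(1) t(1) ts(1) t(3) Suc.prems(4,5) k R'])
      moreover have "linked g h R t s1 k h1" using Suc.IH[OF t(1) ts(2,3) k] .
      ultimately show ?thesis using ts(1,2) by (rule linked_trans)
    next
      \<comment> \<open>No thick parameter lies between \<open>s0 + 1/2\<close> and
        \<open>s0 + 1\<close>, so \<open>s0 + 1\<close> is inside an excursion. As its ends are
        thick, it begins before \<open>s0 + 1/2\<close> and ends after \<open>s0 + 1\<close>; as
        \<open>s0\<close> and \<open>s1\<close> are thick, it lies between them.\<close>
      case none: False
      have s0b: "0 \<le> s0" "s1 \<le> len g h" using Suc.prems(1) s1 unfolding thick_def by blast+
      have "s0 + 1/2 \<le> s0 + 1" by simp
      hence nt: "s0 + 1 \<notin> thick g h" using none by blast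
      have "0 \<le> s0 + 1" "s0 + 1 \<le> len g h" using s0b False by linarith+
      then obtain a b k where J: "jump g h a b k" "a < s0 + 1" "s0 + 1 < b"
        using jump_exists[OF g h _ _ nt] by blast
      have th: "a \<in> thick g h" "b \<in> thick g h" "ok k" using J(1) unfolding jump_def by blast+
      have gap: "u \<notin> thick g h" if "a < u" "u < b" for u
        using J(1) that unfolding jump_def thick_def by blast
      have "s0 \<le> a" 
      proof (rule ccontr)
        assume "\<not> s0 \<le> a"
        hence "a < s0" "s0 < b" using J(3) by linarith+
        thus False using gap[of s0] Suc.prems(1) by blast
      qed
      moreover have "b \<le> s1" 
      proof (rule ccontr)
        assume "\<not> b \<le> s1"
        hence "a < s1" "s1 < b" using J(2) False by linarith+
        thus False using gap[of s1] s1 by blast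
      qed
      moreover have "a \<le> s0 + 1/2" 
      proof (rule ccontr)
        assume "\<not> a \<le> s0 + 1/2"
        hence "s0 + 1/2 \<le> a \<and> a \<le> s0 + 1" using J(2) by linarith
        thus False using none th(1) by blast
      qed
      ultimately have ab: "s0 \<le> a" "b \<le> s1" "a \<le> s0 + 1" "s1 - b \<le> real N / 2" "a \<le> b"
        using J(2,3) N2 by linarith+
      obtain ka where ka: "ok ka" "hdist (geo g h a) (\<beta> ka x) \<le> r" using rep[OF th(1)] by blast
      obtain kb where kb: "ok kb" "hdist (geo g h b) (\<beta> kb x) \<le> r" using rep[OF th(2)] by blast
      have 1: "linked g h R s0 a h0 ka"
        by (rule short_step[OF L Suc.prems(1) th(1) ab(1,3) Suc.prems(4,5) ka R'])
      have 2: "linked g h R a b ka kb" by (rule jump_step[OF E Eok J(1) ka kb R])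
      have 3: "linked g h R b s1 kb h1" using Suc.IH[OF th(2) ab(2,4) kb] .
      have "a \<le> s1" using ab by linarith
      thus ?thesis using linked_trans[OF 1 linked_trans[OF 2 3 ab(5,2)] ab(1)] by blast
    qed
  qed
qed

end

text \<open>Uniformity is the point: \<open>R\<close> depends on \<open>r\<close> alone, because the
  same short words and the same finitely many horoballs near \<open>x\<close> serve all geodesics
  after translation.\<close>

lemma chain_bound:
  "\<exists>R\<ge>r. \<forall>g h s0 s1 h0 h1. g \<in> carrier (Fn n) \<longrightarrow> h \<in> carrier (Fn n) \<longrightarrow>
     s0 \<in> thick g h \<longrightarrow> s1 \<in> thick g h \<longrightarrow> s0 \<le> s1 \<longrightarrow> ok h0 \<longrightarrow> ok h1 \<longrightarrow>
     hdist (geo g h s0) (\<beta> h0 x) \<le> r \<longrightarrow> hdist (geo g h s1) (\<beta> h1 x) \<le> r \<longrightarrow> linked g h R s0 s1 h0 h1"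
proof -
  define r' where "r' = max r R0"
  obtain L1 where L1: "\<forall>w. ok w \<longrightarrow> hdist x (\<beta> w x) \<le> 2 * r' + 1 \<longrightarrow> length (reduce_word w) \<le> L1"
    using short_words[of "2 * r' + 1"] by blast
  obtain E where E: "finite E" "E \<subseteq> Collect ok" "\<forall>k y. ok k \<longrightarrow> touches k y \<longrightarrow> hdist x y \<le> r' \<longrightarrow> (\<exists>e\<in>E. HB e = HB k)"
    using horoballs_locally_finite[of r'] by blast
  obtain L2 where L2: "\<forall>l\<in>length ` E. l \<le> L2" using E(1) finite_nat_set_iff_bounded_le by blast
  define L where "L = max L1 L2"
  define R where "R = r' + 2 * (lip * L)"
  have main: "linked g h R s0 s1 h0 h1" if H: "g \<in> carrier (Fn n)" "h \<in> carrier (Fn n)"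
    "s0 \<in> thick g h" "s1 \<in> thick g h" "s0 \<le> s1" "ok h0" "ok h1"
    "hdist (geo g h s0) (\<beta> h0 x) \<le> r" "hdist (geo g h s1) (\<beta> h1 x) \<le> r" for g h s0 s1 h0 h1
  proof -
    obtain N where "(s1 - s0) * 2 \<le> real N" using real_arch_simple by blast
    hence N: "s1 - s0 \<le> real N / 2" by simp
    show ?thesis
    proof (rule chain_exists[OF H(1,2) _ _ _ _ _ H(7) _ H(4) H(3,5) N H(6)])
      show "\<forall>w. ok w \<longrightarrow> hdist x (\<beta> w x) \<le> 2 * r' + 1 \<longrightarrow> length (reduce_word w) \<le> L"
      proof (intro allI impI)
        fix w assume "ok w" "hdist x (\<beta> w x) \<le> 2 * r' + 1"
        hence "length (reduce_word w) \<le> L1" using L1 by blast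
        thus "length (reduce_word w) \<le> L" unfolding L_def by (rule max.coboundedI1)
      qed
      show "\<forall>k y. ok k \<longrightarrow> touches k y \<longrightarrow> hdist x y \<le> r' \<longrightarrow> (\<exists>e\<in>E. HB e = HB k)" by (rule E(3))
      show "\<forall>e\<in>E. ok e \<and> length e \<le> L"
      proof
        fix e assume "e \<in> E"
        hence "ok e" "length e \<le> L2" using E(2) L2 by blast+
        thus "ok e \<and> length e \<le> L" unfolding L_def by (intro conjI max.coboundedI2)
      qed
      show "R0 \<le> r'" unfolding r'_def by (rule max.cobounded2)
      show "r' + 2 * (lip * L) \<le> R" by (simp add: R_def)
      show "hdist (geo g h s1) (\<beta> h1 x) \<le> r'" "hdist (geo g h s0) (\<beta> h0 x) \<le> r'" 
        using H(8,9) max.cobounded1[of r R0] unfolding r'_def by linarith+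
    qed
  qed
  have rR: "r \<le> R"
  proof -
    have "0 \<le> lip * real L" using lip_nonneg by simp
    moreover have "r \<le> r'" unfolding r'_def by (rule max.cobounded1)
    ultimately show ?thesis unfolding R_def by linarith
  qed
  show ?thesis by (intro exI[of _ R] conjI allI impI rR main)
qed

end

section \<open>Linear growth of words without high powers of the cusp word\<close>

context cusped_action
begin

text \<open>A chosen point of \<open>B0\<close> is carried along with \<open>x\<close>, so the
  distance is the same for all translates.\<close>

lemma near_horoball:
  "\<exists>\<rho>\<ge>0. \<forall>z. ok z \<longrightarrow> (\<exists>b\<in>HB z. hdist (\<beta> z x) b = \<rho>)"
proof -
  obtain C where C: "det C = 1" "B0 = horoset C" using B0 by blast
  obtain b where b: "b \<in> B0" using horoset_nonempty[OF C(1)] unfolding C(2) by blast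
  have bH: "b \<in> H3" using b B0_H3 by blast
  have "\<exists>b'\<in>HB z. hdist (\<beta> z x) b' = hdist x b" if z: "ok z" for z
    using beta_isometry[OF z x_H3 bH] b unfolding HB_def by blast
  thus ?thesis using hdist_nonneg[OF x_H3 bH] by blast
qed

context
  fixes g h assumes g: "g \<in> carrier (Fn n)" and h: "h \<in> carrier (Fn n)"
begin

text \<open>By \<open>wave_convex\<close> the parameters inside \<open>HB k\<close> form an
  interval, so the geodesic visits \<open>HB k\<close> only during this excursion.\<close>

lemma jump_outside:
  assumes J: "jump g h a b k" and u: "0 \<le> u" "u \<le> len g h" "u \<le> a \<or> b \<le> u"
  shows "geo g h u \<notin> HB k"
proof
  assume in': "geo g h u \<in> HB k"
  have k: "ok k" "a < b" "a \<in> thick g h" "b \<in> thick g h" "\<And>u. a < u \<Longrightarrow> u < b \<Longrightarrow> geo g h u \<in> HB k"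
    using J unfolding jump_def by blast+
  have ab: "0 \<le> a" "b \<le> len g h" "geo g h a \<notin> HB k" "geo g h b \<notin> HB k"
    using k unfolding thick_def by blast+
  obtain C where C: "det C = 1" "HB k = horoset C" using HB_horoset[OF k(1)] by blast
  obtain X Y where "\<forall>u. 0 \<le> u \<longrightarrow> u \<le> len g h \<longrightarrow>
    1 / snd (SL2C_act C (geo g h u)) = X * cosh u + Y * sinh u \<and>
    (geo g h u \<in> horoset C \<longleftrightarrow> X * cosh u + Y * sinh u < 1) \<and>
    (1 \<le> snd (SL2C_act C (geo g h u)) \<longleftrightarrow> X * cosh u + Y * sinh u \<le> 1)"
    using height_wave[OF g h C(1)] by blast
  hence XY: "geo g h u \<in> HB k \<longleftrightarrow> X * cosh u + Y * sinh u < 1" if "0 \<le> u" "u \<le> len g h" for u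
    using that unfolding C(2) by blast
  define t where "t = (a + b) / 2"
  have t: "a < t" "t < b" using k(2) by (simp_all add: t_def)
  have t0: "0 \<le> t" "t \<le> len g h" "0 \<le> b" "a \<le> len g h" using t ab by linarith+
  have ft: "X * cosh t + Y * sinh t < 1" using XY[OF t0(1,2)] k(5)[OF t] by blast
  have fu: "X * cosh u + Y * sinh u < 1" using XY[OF u(1,2)] in' by blast
  from u(3) show False
  proof
    assume "u \<le> a"
    hence "X * cosh a + Y * sinh a < 1" using wave_convex[OF _ less_imp_le[OF t(1)] fu ft] by blast
    thus False using XY[OF ab(1) t0(4)] ab(3) by blast
  next
    assume "b \<le> u"
    hence "X * cosh b + Y * sinh b < 1" using wave_convex[OF less_imp_le[OF t(2)] _ ft fu] by blast
    thus False using XY[OF t0(3) ab(2)] ab(4) by blast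
  qed
qed

text \<open>A vertex on the axis attached to \<open>HB k\<close> that is covered outside \<open>HB k\<close> is close to the point where the
  geodesic enters or leaves \<open>HB k\<close>.\<close>

lemma covered_close:
  assumes \<rho>: "0 \<le> \<rho>" "\<And>z. ok z \<Longrightarrow> \<exists>b\<in>HB z. hdist (\<beta> z x) b = \<rho>"
    and k: "ok k" "touches k (geo g h e)"
    and I: "0 \<le> lo" "lo \<le> hi" "hi \<le> len g h" "e = lo \<or> e = hi"
    and out: "\<And>u. lo \<le> u \<Longrightarrow> u \<le> hi \<Longrightarrow> geo g h u \<notin> HB k"
    and z: "ok z" "HB z = HB k" and cov: "covered g h R lo hi z" and R: "0 \<le> R"
  shows "cosh (hdist (geo g h e) (\<beta> z x)) \<le> entry_bound (R + lip * length c + \<rho>)"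
proof -
  let ?R = "R + lip * length c + \<rho>"
  have lc: "0 \<le> lip * real (length c)" using lip_nonneg by simp
  have e0: "0 \<le> e" "e \<le> len g h" "lo \<le> e" "e \<le> hi" using I by auto
  note eH = geo_H3[OF g h e0(1,2)]
  obtain C where C: "det C = 1" "HB k = horoset C" "1 \<le> snd (SL2C_act C (geo g h e))"
    using k(2) unfolding touches_def by blast
  have e1: "snd (SL2C_act C (geo g h e)) = 1"
    using out[OF e0(3,4)] C(3) eH unfolding C(2) horoset_def by force
  obtain X Y where "\<forall>u. 0 \<le> u \<longrightarrow> u \<le> len g h \<longrightarrow>
    1 / snd (SL2C_act C (geo g h u)) = X * cosh u + Y * sinh u \<and>
    (geo g h u \<in> horoset C \<longleftrightarrow> X * cosh u + Y * sinh u < 1) \<and>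
    (1 \<le> snd (SL2C_act C (geo g h u)) \<longleftrightarrow> X * cosh u + Y * sinh u \<le> 1)"
    using height_wave[OF g h C(1)] by blast
  hence XY: "1 / snd (SL2C_act C (geo g h u)) = X * cosh u + Y * sinh u"
    "geo g h u \<in> HB k \<longleftrightarrow> X * cosh u + Y * sinh u < 1" if "0 \<le> u" "u \<le> len g h" for u
    using that unfolding C(2) by blast+
  have fe: "X * cosh e + Y * sinh e = 1" using XY(1)[OF e0(1,2)] e1 by simp
  have ge1: "X * cosh u + Y * sinh u \<ge> 1" if "lo \<le> u" "u \<le> hi" for u
  proof -
    have "0 \<le> u" "u \<le> len g h" using that I by linarith+
    thus ?thesis using XY(2) out[OF that] by force
  qed
  \<comment> \<open>On the outer side of \<open>e\<close> the reciprocal height grows at least like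
    \<open>cosh\<close> of the distance from \<open>e\<close>, as \<open>entry_close\<close>
    requires; \<open>wave_left\<close> serves an entry and \<open>wave_right\<close> an
    exit.\<close>
  have steep: "cosh (hdist (geo g h e) (geo g h s)) \<le> 1 / snd (SL2C_act C (geo g h s))" "geo g h s \<in> H3"
    if s: "lo \<le> s" "s \<le> hi" for s
  proof -
    have s0: "0 \<le> s" "s \<le> len g h" using s I by linarith+
    show "geo g h s \<in> H3" using geo_H3[OF g h s0] .
    have "X * cosh s + Y * sinh s \<ge> cosh (e - s)"
    proof (cases "e = hi")
      case True
      thus ?thesis using s by (intro wave_left[OF _ fe] ge1) auto
    next
      case False
      hence elo: "e = lo" using I(4) by blast
      have "X * cosh s + Y * sinh s \<ge> cosh (s - e)"
        using s elo by (intro wave_right[OF _ fe] ge1) auto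
      moreover have "cosh (e - s) = cosh (s - e)" by (metis cosh_minus minus_diff_eq)
      ultimately show ?thesis by metis
    qed
    thus "cosh (hdist (geo g h e) (geo g h s)) \<le> 1 / snd (SL2C_act C (geo g h s))"
      unfolding geo_dist[OF g h e0(1,2) s0] XY(1)[OF s0] cosh_real_abs .
  qed
  have oH: "\<beta> z x \<in> H3" using beta_H3[OF z(1) x_H3] .
  have oC: "\<beta> z x \<notin> horoset C" using orbit_outside[OF g h z(1) k(1)] unfolding C(2) .
  obtain b where b: "b \<in> horoset C" "hdist (\<beta> z x) b \<le> ?R"
    using \<rho>(2)[OF z(1)] z(2) R lc unfolding C(2) by force
  consider (near) s where "lo \<le> s" "s \<le> hi" "hdist (geo g h s) (\<beta> z x) \<le> R"
    | (cross) a b k' c' j w1 w2 where "lo \<le> a" "b \<le> hi" "jump g h a b k'"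
      "c' \<in> {c, inv_word c}" "c' = w1 @ w2" "reduce_word z = reduce_word (k' @ wpow c' j @ w1)"
    using cov unfolding covered_def by blast
  thus ?thesis
  proof cases
    case near
    hence "hdist (geo g h s) (\<beta> z x) \<le> ?R" using lc \<rho>(1) by linarith
    thus ?thesis using entry_close[OF C(1) eH e1 steep(2,1)[OF near(1,2)] oH oC b] by blast
  next
    case cross
    have k': "ok k'" "a < b" "touches k' (geo g h a)" "touches k' (geo g h b)"
      "\<And>u. a < u \<Longrightarrow> u < b \<Longrightarrow> geo g h u \<in> HB k'" using cross(3) unfolding jump_def by blast+
    \<comment> \<open>The end of the other excursion that faces \<open>e\<close>.\<close>
    define s where "s = (if e = hi then b else a)"
    have s: "lo \<le> s" "s \<le> hi" "touches k' (geo g h s)" using cross(1,2) k' by (auto simp: s_def)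
    obtain D where D: "det D = 1" "HB k' = horoset D" "1 \<le> snd (SL2C_act D (geo g h s))"
      using s(3) unfolding touches_def by blast
    \<comment> \<open>If the horoballs met they would be equal, and the midpoint of the excursion
      would lie in \<open>HB k\<close>, against \<open>out\<close>.\<close>
    have disj: "horoset C \<inter> horoset D = {}"
    proof (rule ccontr)
      assume "horoset C \<inter> horoset D \<noteq> {}"
      hence eq: "HB k = HB k'" using HB_meets(2)[OF k(1) k'(1)] C(2) D(2) by simp
      have t: "a < (a + b) / 2" "(a + b) / 2 < b" using k'(2) by simp_all
      hence "geo g h ((a + b) / 2) \<in> HB k" using k'(5) eq by simp
      moreover have "lo \<le> (a + b) / 2" "(a + b) / 2 \<le> hi" using t cross(1,2) by linarith+
      ultimately show False using out by blast
    qed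
    \<comment> \<open>\<open>v\<close> is \<open>z\<close> without its incomplete copy
      \<open>w1\<close> of \<open>c'\<close>. It is attached to \<open>HB k'\<close>, and dropping
      \<open>w1\<close> costs at most the summand \<open>lip * length c\<close> of the
      radius.\<close>
    define v where "v = k' @ wpow c' j"
    have okc: "ok c'" using cross(4) by auto
    have okv: "ok v" "ok w1" using k'(1) ok_wpow[OF okc] okc cross(5) by (simp_all add: v_def)
    have HBv: "HB v = horoset D" using HB_append_wpow[OF k'(1) cross(4)] D(2) by (simp add: v_def)
    obtain b' where b': "b' \<in> horoset D" "hdist (\<beta> v x) b' = \<rho>" using \<rho>(2)[OF okv(1)] HBv by blast
    have "\<beta> z = \<beta> (v @ w1)" by (rule beta_cong) (simp add: cross(6) v_def)
    hence "hdist (\<beta> z x) (\<beta> v x) = hdist x (\<beta> w1 x)" using orbit_dist[OF okv] hdist_sym by metis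
    also have "\<dots> \<le> lip * length c"
    proof (rule displacement_le_bound[OF okv(2)])
      have "length c' = length c" using cross(4) by auto
      thus "length w1 \<le> length c" using cross(5) by simp
    qed
    finally have "hdist (\<beta> z x) (\<beta> v x) \<le> lip * length c" .
    moreover have "b' \<in> H3" using b'(1) by (simp add: horoset_def)
    ultimately have "hdist (\<beta> z x) b' \<le> ?R"
      using hdist_triangle[OF oH beta_H3[OF okv(1) x_H3], of b'] b'(2) R by simp
    hence "\<exists>D b'. det D = 1 \<and> horoset C \<inter> horoset D = {} \<and> 1 \<le> snd (SL2C_act D (geo g h s)) \<and> b' \<in> horoset D \<and> hdist (\<beta> z x) b' \<le> ?R"
      using D(1,3) disj b'(1) by blast
    thus ?thesis using entry_close[OF C(1) eH e1 steep(2,1)[OF s(1,2)] oH oC b] by blast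
  qed
qed

end

definition thin :: "nat \<Rightarrow> nat word \<Rightarrow> bool" where
  "thin K r \<longleftrightarrow> r \<in> carrier (Fn n) \<and> (\<forall>c'\<in>{c, inv_word c}. \<not> sublist (wpow c' K) r)"

lemma arg_le_cosh: "d \<le> 2 * cosh d" for d :: real
proof -
  have "2 * cosh d = exp d + exp (- d)" by (simp add: cosh_def)
  moreover have "1 + d \<le> exp d" by (rule exp_ge_add_one_self)
  moreover have "exp (- d) > 0" by simp
  ultimately show ?thesis by linarith
qed

lemma cyclically_reduced_c': "c' \<in> {c, inv_word c} \<Longrightarrow> cyclically_reduced c'"
  using c(2) cyclically_reduced_inv_word by auto

text \<open>If the geodesic missed a vertex \<open>u\<close> of the tree geodesic by far, it would cross a horoball
  so that \<open>u\<close> lies in the middle of a long segment of the corresponding axis. As the word is thin,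
  the tree geodesic leaves this axis near \<open>u\<close>, and so a point of the axis far from one of its ends
  would be covered by the part of the geodesic outside the horoball.\<close>

lemma thin_words_track_geodesics:
  assumes K: "K \<ge> 1"
  shows "\<exists>D. \<forall>u v. thin K (u @ v) \<longrightarrow> (\<exists>s. 0 \<le> s \<and> s \<le> len [] (u @ v) \<and> hdist (geo [] (u @ v) s) (\<beta> u x) \<le> D)"
proof -
  \<comment> \<open>The walk for the whole geodesic begins and ends at the orbit points themselves,
    hence radius 0. Walks restarted at an end of an excursion begin only within \<open>R1\<close> of
    the geodesic, hence the second constant \<open>R2\<close>.\<close>
  obtain R1 where R1: "0 \<le> R1" and ch1: "\<forall>g h s0 s1 h0 h1. g \<in> carrier (Fn n) \<longrightarrow> h \<in> carrier (Fn n) \<longrightarrow>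
     s0 \<in> thick g h \<longrightarrow> s1 \<in> thick g h \<longrightarrow> s0 \<le> s1 \<longrightarrow> ok h0 \<longrightarrow> ok h1 \<longrightarrow>
     hdist (geo g h s0) (\<beta> h0 x) \<le> 0 \<longrightarrow> hdist (geo g h s1) (\<beta> h1 x) \<le> 0 \<longrightarrow> linked g h R1 s0 s1 h0 h1"
    using chain_bound[of 0] by blast
  obtain R2 where R2: "R1 \<le> R2" and ch2: "\<forall>g h s0 s1 h0 h1. g \<in> carrier (Fn n) \<longrightarrow> h \<in> carrier (Fn n) \<longrightarrow>
     s0 \<in> thick g h \<longrightarrow> s1 \<in> thick g h \<longrightarrow> s0 \<le> s1 \<longrightarrow> ok h0 \<longrightarrow> ok h1 \<longrightarrow>
     hdist (geo g h s0) (\<beta> h0 x) \<le> R1 \<longrightarrow> hdist (geo g h s1) (\<beta> h1 x) \<le> R1 \<longrightarrow> linked g h R2 s0 s1 h0 h1"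
    using chain_bound[of R1] by blast
  obtain \<rho> where \<rho>: "0 \<le> \<rho>" "\<And>z. ok z \<Longrightarrow> \<exists>b\<in>HB z. hdist (\<beta> z x) b = \<rho>" using near_horoball by blast
  define EB where "EB = entry_bound (R2 + lip * length c + \<rho>)"
  \<comment> \<open>An axis vertex close to an end of its excursion in the sense of
    \<open>covered_close\<close> is within \<open>R1 + 2 * EB\<close> of the corresponding end of
    the segment, by \<open>arg_le_cosh\<close>; so at most \<open>L\<close> copies of
    \<open>c\<close> separate them.\<close>
  obtain L where L: "\<And>w. ok w \<Longrightarrow> hdist x (\<beta> w x) \<le> R1 + 2 * EB \<Longrightarrow> length (reduce_word w) \<le> L"
    using short_words[of "R1 + 2 * EB"] by blast
  \<comment> \<open>Reached when \<open>u\<close> is at most \<open>L + K\<close> full copies of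
    \<open>c'\<close>, and an incomplete one, away from an end of the segment.\<close>
  define D where "D = R1 + lip * real ((L + K + 2) * length c)"
  have D0: "0 \<le> lip * real ((L + K + 2) * length c)" using lip_nonneg by (intro mult_nonneg_nonneg) auto
  have "\<exists>s. 0 \<le> s \<and> s \<le> len [] (u @ v) \<and> hdist (geo [] (u @ v) s) (\<beta> u x) \<le> D" if th: "thin K (u @ v)" for u v
  proof -
    define r where "r = u @ v"
    have rc: "r \<in> carrier (Fn n)" using th unfolding thin_def r_def by blast
    hence r: "r \<in> carrier (Fn n)" "reduced r" "ok r" using carrier_ok[of r] by blast+
    have e: "[] \<in> carrier (Fn n)" by simp
    have ruv: "reduced u" "reduced v" "ok u" "ok v" using r(2,3) unfolding r_def by (simp_all add: reduced_append)
    have P0: "geo [] r 0 = x" "geo [] r (len [] r) = \<beta> r x" using geo_ends[OF e r(1)] x_H3 by simp_all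
    have T: "0 \<in> thick [] r" "len [] r \<in> thick [] r" using ends_thick[OF e r(1)] by auto
    have ln: "0 \<le> len [] r" using len_nonneg[OF e r(1)] .
    have "linked [] r R1 0 (len [] r) [] r"
      using ch1 e r T ln P0 x_H3 by simp
    then obtain W where W: "reduce_word W = r" "\<And>W1 W2. W = W1 @ W2 \<Longrightarrow> covered [] r R1 0 (len [] r) W1"
      using r(2) unfolding linked_def by auto
    obtain W1 W2 where W12: "W = W1 @ W2" "reduce_word W1 = u"
      using reduce_word_split[of W u v] W(1) unfolding r_def by blast
    have "reduce_word W1 = reduce_word u" using W12(2) ruv by simp
    note cov = covered_cong[OF this W(2)[OF W12(1)]]
    have close: "hdist y (\<beta> (h' @ V) x) \<le> D"
      if y: "y \<in> H3" "ok h'" "hdist y (\<beta> h' x) \<le> R1" "ok V" "length V \<le> (L + K + 2) * length c" for y h' V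
    proof -
      have "ok (h' @ V)" using y by simp
      hence "hdist y (\<beta> (h' @ V) x) \<le> hdist y (\<beta> h' x) + hdist (\<beta> h' x) (\<beta> (h' @ V) x)"
        using hdist_triangle[OF y(1) beta_H3[OF y(2) x_H3] beta_H3[OF _ x_H3]] by blast
      also have "hdist (\<beta> h' x) (\<beta> (h' @ V) x) \<le> lip * real ((L + K + 2) * length c)"
        unfolding orbit_dist[OF y(2,4)] using displacement_le_bound[OF y(4,5)] .
      finally show ?thesis using y(3) unfolding D_def by linarith
    qed
    consider (near) s where "0 \<le> s" "s \<le> len [] r" "hdist (geo [] r s) (\<beta> u x) \<le> R1"
      | (cross) a b k c' j m w1 w2 where "0 \<le> a" "b \<le> len [] r" "jump [] r a b k"
        "hdist (geo [] r a) (\<beta> k x) \<le> R1" "hdist (geo [] r b) (\<beta> (k @ wpow c' m) x) \<le> R1"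
        "c' \<in> {c, inv_word c}" "j < m" "c' = w1 @ w2" "reduce_word u = reduce_word (k @ wpow c' j @ w1)"
      using cov unfolding covered_def by blast
    thus ?thesis
    proof cases
      case near
      hence "hdist (geo [] r s) (\<beta> u x) \<le> D" using D0 unfolding D_def by linarith
      thus ?thesis using near(1,2) unfolding r_def by blast
    next
      case cross
      have k: "ok k" "a < b" "a \<in> thick [] r" "b \<in> thick [] r" "touches k (geo [] r a)" "touches k (geo [] r b)"
        using cross(3) unfolding jump_def by blast+
      have "ok c'" using cross(6) by auto
      moreover from this have "ok (w1 @ w2)" by (simp only: cross(8))
      ultimately have okc: "ok c'" "ok w1" "ok w2" by simp_all
      have lenc: "length c' = length c" "length c \<ge> 1" using cross(6) c(3) by (auto simp: Suc_le_eq)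
      have lw: "length w1 \<le> length c" "length w2 \<le> length c" using lenc(1) cross(8) by auto
      have cred: "reduced (wpow c' i)" for i using cyclically_reduced_wpow[OF cyclically_reduced_c'[OF cross(6)]] .
      have ab0: "0 \<le> b" "a \<le> len [] r" using k(2) cross(1,2) by linarith+
      note PH = geo_H3[OF e r(1) cross(1) ab0(2)] geo_H3[OF e r(1) ab0(1) cross(2)]
      have far: "i \<le> L" if i: "ok h'" "hdist (geo [] r t) (\<beta> h' x) \<le> R1" "geo [] r t \<in> H3"
        "cosh (hdist (geo [] r t) (\<beta> (h' @ q) x)) \<le> EB" "ok q" "reduced q" "length q = i * length c" for i h' q t
      proof -
        have H: "\<beta> h' x \<in> H3" "\<beta> (h' @ q) x \<in> H3" using beta_H3[OF _ x_H3] i by simp_all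
        have "hdist (\<beta> h' x) (\<beta> (h' @ q) x) \<le> hdist (\<beta> h' x) (geo [] r t) + hdist (geo [] r t) (\<beta> (h' @ q) x)"
          using hdist_triangle[OF H(1) i(3) H(2)] .
        also have "\<dots> \<le> R1 + 2 * EB"
          using i(2,4) hdist_sym[of "\<beta> h' x"] arg_le_cosh[of "hdist (geo [] r t) (\<beta> (h' @ q) x)"] by simp
        finally have "hdist x (\<beta> q x) \<le> R1 + 2 * EB" unfolding orbit_dist[OF i(1,5)] .
        hence "i * length c \<le> L" using L[OF i(5)] i(6,7) by simp
        moreover have "i * 1 \<le> i * length c" using lenc(2) by (rule mult_le_mono2)
        ultimately show ?thesis by linarith
      qed
      show ?thesis
      proof (cases "j \<le> L + K \<or> m - j - 1 \<le> L + K")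
        case True
        thus ?thesis
        proof
          assume j: "j \<le> L + K"
          have "\<beta> u = \<beta> (k @ wpow c' j @ w1)" by (rule beta_cong[OF cross(9)])
          moreover have "length (wpow c' j @ w1) \<le> (L + K + 2) * length c"
          proof -
            have "j * length c \<le> (L + K) * length c" using j by (rule mult_le_mono1)
            thus ?thesis using lw(1) lenc(1) by (simp add: algebra_simps)
          qed
          ultimately have "hdist (geo [] r a) (\<beta> u x) \<le> D"
            using close[OF PH(1) k(1) cross(4), of "wpow c' j @ w1"] ok_wpow[OF okc(1)] okc(2) by simp
          thus ?thesis using cross(1) ab0(2) unfolding r_def by blast
        next
          assume j: "m - j - 1 \<le> L + K"
          have m: "m = j + Suc (m - j - 1)" using cross(7) by simp
          define V where "V = inv_word (w2 @ wpow c' (m - j - 1))"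
          have pm: "wpow c' m = wpow c' j @ (w1 @ w2) @ wpow c' (m - j - 1)"
            by (subst m, subst wpow_add) (simp flip: cross(8))
          have "\<beta> u = \<beta> ((k @ wpow c' m) @ V)"
          proof (rule beta_cong)
            have "reduce_word ((k @ wpow c' m) @ V) =
              reduce_word ((k @ wpow c' j @ w1) @ (w2 @ wpow c' (m - j - 1)) @ inv_word (w2 @ wpow c' (m - j - 1)))"
              unfolding pm V_def by (simp del: inv_word_simps)
            also have "\<dots> = reduce_word (k @ wpow c' j @ w1)" by (rule reduce_cancel_mid(1))
            finally show "reduce_word u = reduce_word ((k @ wpow c' m) @ V)" using cross(9) by simp
          qed
          moreover have "length V \<le> (L + K + 2) * length c"
          proof -
            have "(m - j - 1) * length c \<le> (L + K) * length c" using j by (rule mult_le_mono1)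
            thus ?thesis using lw(2) lenc(1) by (simp add: V_def algebra_simps)
          qed
          moreover have "ok V" "ok (k @ wpow c' m)" unfolding V_def using ok_wpow[OF okc(1)] okc k(1) by simp_all
          ultimately have "hdist (geo [] r b) (\<beta> u x) \<le> D"
            using close[OF PH(2) _ cross(5), of V] by simp
          thus ?thesis using cross(2) ab0(1) unfolding r_def by blast
        qed
      next
        case False
        hence jm: "L + K < j" "L + K < m - j - 1" by auto
        \<comment> \<open>The labels of the axis just before and just after \<open>u\<close>. Both
          contain \<open>wpow c' K\<close>, so a thin word cannot follow the axis along both: the
          tree geodesic leaves the axis near \<open>u\<close> on one side.\<close>
        define tL tR where "tL = wpow c' K @ w1" "tR = w2 @ wpow c' K"
        have ne: "tL \<noteq> []" "tR \<noteq> []" using K lenc by (auto simp: tL_tR_def simp flip: length_0_conv)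
        have False
        proof (cases "\<exists>u'. u = u' @ tL")
          case uL: True
          show False
          proof (cases "\<exists>v'. v = tR @ v'")
            case True
            then obtain u' v' where "u @ v = u' @ wpow c' K @ (w1 @ w2 @ wpow c' K @ v')"
              using uL by (auto simp: tL_tR_def)
            hence "sublist (wpow c' K) (u @ v)" unfolding sublist_def by blast
            thus False using th cross(6) unfolding thin_def by blast
          next
            \<comment> \<open>As \<open>v\<close> does not set out along the axis, the reduced word
              from the far end \<open>k @ wpow c' m\<close> to \<open>r\<close> begins with
              \<open>s\<close>, which runs back along the axis to \<open>z\<close>. The walk that
              follows the geodesic after \<open>b\<close> therefore passes \<open>z\<close>, so
              \<open>covered_close\<close> puts \<open>z\<close> near the exit point, but
              \<open>z\<close> is \<open>i > L\<close> copies of \<open>c'\<close> from that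
              end.\<close>
            case nv: False
            define i where "i = m - j - 1 - K"
            define s y where "s = inv_word (wpow c' i)" "y = inv_word tR"
            have sy: "s @ y = inv_word (w2 @ wpow c' (K + i))" by (simp add: s_y_def tL_tR_def wpow_add)
            have mj: "m = j + Suc (K + i)" using jm cross(7) by (simp add: i_def)
            have pm: "wpow c' m = wpow c' j @ w1 @ w2 @ wpow c' (K + i)"
              unfolding mj wpow_add[of c' j] using cross(8) by simp
            have "reduced (wpow c' m)" using cred .
            hence "reduced (w2 @ wpow c' (K + i))" unfolding pm by (simp only: reduced_append)
            hence rsy: "reduced (s @ y)" unfolding sy by (rule reduced_inv_word[THEN iffD2])
            have yne: "y \<noteq> []" using ne by (simp add: s_y_def)
            from reduce_append_cases_left[OF ruv(2) rsy yne] have eq: "reduce_word (s @ y @ v) = s @ reduce_word (y @ v)"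
              using nv by (auto simp: s_y_def)
            have okm: "ok (k @ wpow c' m)" using k(1) ok_wpow[OF okc(1)] by simp
            have "linked [] r R2 b (len [] r) (k @ wpow c' m) r"
              using ch2 e r k(4) T(2) cross(2) okm cross(5) P0 R1 by simp
            then obtain W where W: "reduce_word ((k @ wpow c' m) @ W) = r"
              "\<And>W1 W2. W = W1 @ W2 \<Longrightarrow> covered [] r R2 b (len [] r) ((k @ wpow c' m) @ W1)"
              using r(2) unfolding linked_def by auto
            have "reduce_word W = reduce_word (inv_word (k @ wpow c' m) @ (k @ wpow c' m) @ W)"
              by (rule reduce_cancel_right(2)[symmetric])
            also have "\<dots> = reduce_word (inv_word (k @ wpow c' m) @ r)"
              unfolding W(1)[symmetric] by (rule reduce_append_right[symmetric])
            also have "\<dots> = reduce_word (inv_word (k @ wpow c' m) @ reduce_word u @ v)"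
              unfolding r_def using ruv(1) by simp
            also have "\<dots> = reduce_word (inv_word (k @ wpow c' m) @ (k @ wpow c' j @ w1) @ v)"
              unfolding cross(9) by (rule reduce_append_mid)
            also have "inv_word (k @ wpow c' m) = (s @ y) @ inv_word (k @ wpow c' j @ w1)"
              unfolding pm sy by simp
            also have "reduce_word (((s @ y) @ inv_word (k @ wpow c' j @ w1)) @ (k @ wpow c' j @ w1) @ v) = reduce_word ((s @ y) @ v)"
              by (simp only: append_assoc[of "s @ y"] reduce_cancel_mid(4))
            also have "\<dots> = s @ reduce_word (y @ v)" using eq by simp
            finally have Weq: "reduce_word W = s @ reduce_word (y @ v)" .
            obtain W1 W2 where W12: "W = W1 @ W2" "reduce_word W1 = s" using reduce_word_split[OF Weq] by blast
            have oks: "ok s" unfolding s_y_def using ok_wpow[OF okc(1)] by simp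
            have rs: "reduced s" using rsy by (simp add: reduced_append)
            define z where "z = (k @ wpow c' m) @ s"
            have "reduce_word ((k @ wpow c' m) @ W1) = reduce_word z"
              unfolding z_def W12(2)[symmetric] by (rule reduce_append_right[symmetric])
            note covz = covered_cong[OF this W(2)[OF W12(1)]]
            have zred: "reduce_word z = reduce_word (k @ wpow c' (j + Suc K))"
            proof -
              have "z = (k @ wpow c' (j + Suc K)) @ wpow c' i @ inv_word (wpow c' i)"
                unfolding z_def mj s_y_def by (simp add: wpow_add)
              thus ?thesis by (simp only: reduce_cancel_mid(1))
            qed
            have HBz: "HB z = HB k" unfolding HB_cong[OF zred] by (rule HB_append_wpow[OF k(1) cross(6)])
            have okz: "ok z" using okm oks by (simp add: z_def)
            have "cosh (hdist (geo [] r b) (\<beta> z x)) \<le> EB" unfolding EB_def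
            proof (rule covered_close[OF e r(1) \<rho> k(1,6) ab0(1) cross(2) order_refl _ _ okz HBz covz])
              show "b = b \<or> b = len [] r" by simp
              show "geo [] r u \<notin> HB k" if "b \<le> u" "u \<le> len [] r" for u
                using jump_outside[OF e r(1) cross(3)] that ab0(1) by simp
              show "0 \<le> R2" using R1 R2 by simp
            qed
            hence "i \<le> L"
              using far[OF okm cross(5) PH(2) _ oks rs, of i] lenc(1) unfolding z_def by (simp add: s_y_def)
            thus False using jm(2) by (simp add: i_def)
          qed
        next
          \<comment> \<open>The mirror image: \<open>u\<close> does not arrive along the axis, so
            the walk that follows the geodesic before \<open>a\<close> has to pass \<open>z\<close>,
            which is \<open>i > L\<close> copies of \<open>c'\<close> beyond the near end
            \<open>k\<close>.\<close>
          case nu: False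
          define i where "i = j - K"
          define s y where "s = inv_word (wpow c' i)" "y = inv_word tL"
          have jK: "j = i + K" using jm by (simp add: i_def)
          have ys: "y @ s = inv_word (wpow c' j @ w1)" by (simp add: s_y_def tL_tR_def jK wpow_add)
          have "wpow c' (Suc j) = (wpow c' j @ w1) @ w2" using cross(8) by (simp add: wpow_Suc_right del: wpow_simps(2))
          hence "reduced (wpow c' j @ w1)" using cred[of "Suc j"] by (metis reduced_append)
          hence rys: "reduced (y @ s)" unfolding ys by (rule reduced_inv_word[THEN iffD2])
          have yne: "y \<noteq> []" using ne by (simp add: s_y_def)
          from reduce_append_cases[OF ruv(1) rys yne] have eq: "reduce_word (u @ y @ s) = reduce_word (u @ y) @ s"
            using nu by (auto simp: s_y_def)
          have "linked [] r R2 0 a [] k"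
            using ch2 e r k(1,3) T(1) cross(1) cross(4) P0 R1 x_H3 by simp
          then obtain W where W: "reduce_word W = reduce_word k"
            "\<And>W1 W2. W = W1 @ W2 \<Longrightarrow> covered [] r R2 0 a W1"
            unfolding linked_def by auto
          have "reduce_word W = reduce_word (k @ (wpow c' j @ w1) @ inv_word (wpow c' j @ w1))"
            unfolding W(1) by (rule reduce_cancel_mid(1)[symmetric])
          also have "\<dots> = reduce_word (reduce_word (k @ wpow c' j @ w1) @ inv_word (wpow c' j @ w1))"
            by (simp only: reduce_append_left append_assoc)
          also have "\<dots> = reduce_word (u @ y @ s)" unfolding cross(9)[symmetric] ys by simp
          also have "\<dots> = reduce_word (u @ y) @ s" by (rule eq)
          finally have Weq: "reduce_word W = reduce_word (u @ y) @ s" .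
          obtain W1 W2 where W12: "W = W1 @ W2" "reduce_word W1 = reduce_word (u @ y)" using reduce_word_split[OF Weq] by blast
          define q where "q = wpow c' i"
          define z where "z = k @ q"
          have "reduce_word (u @ y) = reduce_word (reduce_word u @ y)" by simp
          also have "\<dots> = reduce_word ((k @ wpow c' i) @ (wpow c' K @ w1) @ inv_word (wpow c' K @ w1))"
            unfolding cross(9) reduce_append_left s_y_def tL_tR_def jK wpow_add by (simp del: inv_word_simps)
          also have "\<dots> = reduce_word z" unfolding z_def q_def by (rule reduce_cancel_mid(1))
          finally have "reduce_word W1 = reduce_word z" using W12(2) by simp
          note covz = covered_cong[OF this W(2)[OF W12(1)]]
          have HBz: "HB z = HB k" unfolding z_def q_def by (rule HB_append_wpow[OF k(1) cross(6)])
          have okq: "ok q" unfolding q_def using ok_wpow[OF okc(1)] .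
          have okz: "ok z" using k(1) okq by (simp add: z_def)
          have "cosh (hdist (geo [] r a) (\<beta> z x)) \<le> EB" unfolding EB_def
          proof (rule covered_close[OF e r(1) \<rho> k(1,5) order_refl cross(1) ab0(2) _ _ okz HBz covz])
            show "a = 0 \<or> a = a" by simp
            show "geo [] r u \<notin> HB k" if "0 \<le> u" "u \<le> a" for u
              using jump_outside[OF e r(1) cross(3)] that ab0(2) by simp
            show "0 \<le> R2" using R1 R2 by simp
          qed
          hence "i \<le> L"
            using far[OF k(1) cross(4) PH(1) _ okq _, of i] lenc(1) cred[of i] unfolding z_def by (simp add: q_def)
          thus False using jm(1) by (simp add: i_def)
        qed
        thus ?thesis ..
      qed
    qed
  qed
  thus ?thesis by blast
qed

text \<open>Each prefix of \<open>r\<close> gets a parameter where the geodesic is within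
  \<open>D\<close> of its orbit point. Prefixes whose parameters have the same integer part differ
  by an element moving \<open>x\<close> by at most \<open>2 * D + 1\<close>. There are
  \<open>card Z\<close> such elements, and at most \<open>d + 1\<close> integer parts.\<close>

lemma thin_words_linear:
  assumes K: "K \<ge> 1"
  shows "\<exists>A\<ge>0. \<forall>r. thin K r \<longrightarrow> real (length r) \<le> A * (hdist x (\<beta> r x) + 1)"
proof -
  obtain D where D: "\<And>u v. thin K (u @ v) \<Longrightarrow> \<exists>s. 0 \<le> s \<and> s \<le> len [] (u @ v) \<and> hdist (geo [] (u @ v) s) (\<beta> u x) \<le> D"
    using thin_words_track_geodesics[OF K] by blast
  define Z where "Z = {w \<in> carrier (Fn n). hdist x (\<beta> w x) \<le> 2 * D + 1}"
  have finZ: "finite Z" unfolding Z_def by (rule displacement_finite)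
  have "real (length r) \<le> real (card Z) * (hdist x (\<beta> r x) + 1)" if th: "thin K r" for r
  proof -
    have rc: "r \<in> carrier (Fn n)" using th unfolding thin_def by blast
    hence r: "r \<in> carrier (Fn n)" "reduced r" "ok r" using carrier_ok[of r] by blast+
    have e: "[] \<in> carrier (Fn n)" by simp
    define d where "d = len [] r"
    have d: "d = hdist x (\<beta> r x)" "0 \<le> d" using len_nonneg[OF e r(1)] x_H3 by (auto simp: d_def len_def)
    have "\<forall>i\<in>{..length r}. \<exists>s. 0 \<le> s \<and> s \<le> d \<and> hdist (geo [] r s) (\<beta> (take i r) x) \<le> D"
      using D[of "take i r" "drop i r" for i] th by (simp add: d_def)
    then obtain \<sigma> where \<sigma>: "\<forall>i\<in>{..length r}. 0 \<le> \<sigma> i \<and> \<sigma> i \<le> d \<and> hdist (geo [] r (\<sigma> i)) (\<beta> (take i r) x) \<le> D"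
      using bchoice by meson
    define f where "f i = nat \<lfloor>\<sigma> i\<rfloor>" for i
    have okt: "ok (take i r)" for i using r(3) by (metis append_take_drop_id ok_simps(2))
    have fibre: "card {i \<in> {..length r}. f i = b} \<le> card Z" for b
    proof (cases "{i \<in> {..length r}. f i = b} = {}")
      case False
      then obtain i0 where i0: "i0 \<le> length r" "f i0 = b" by blast
      let ?F = "{i \<in> {..length r}. f i = b}"
      let ?w = "\<lambda>i. reduce_word (inv_word (take i0 r) @ take i r)"
      have "?w ` ?F \<subseteq> Z"
      proof (rule image_subsetI)
        fix i assume "i \<in> ?F"
        hence i: "i \<le> length r" "f i = b" by auto
        have s: "0 \<le> \<sigma> i" "\<sigma> i \<le> d" "hdist (geo [] r (\<sigma> i)) (\<beta> (take i r) x) \<le> D"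
          "0 \<le> \<sigma> i0" "\<sigma> i0 \<le> d" "hdist (geo [] r (\<sigma> i0)) (\<beta> (take i0 r) x) \<le> D"
          using \<sigma> i(1) i0(1) by auto
        have "\<lfloor>\<sigma> i\<rfloor> = \<lfloor>\<sigma> i0\<rfloor>" using i(2) i0(2) s(1,4) unfolding f_def by (metis nat_eq_iff2 zero_le_floor)
        hence sd: "\<bar>\<sigma> i0 - \<sigma> i\<bar> \<le> 1" by linarith
        note G = geo_H3[OF e r(1) s(1) s(2)[unfolded d_def]] geo_H3[OF e r(1) s(4) s(5)[unfolded d_def]]
        note H = beta_H3[OF okt x_H3, of i] beta_H3[OF okt x_H3, of i0]
        have "hdist (\<beta> (take i0 r) x) (\<beta> (take i r) x) \<le> hdist (\<beta> (take i0 r) x) (geo [] r (\<sigma> i0)) + hdist (geo [] r (\<sigma> i0)) (\<beta> (take i r) x)"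
          using hdist_triangle[OF H(2) G(2) H(1)] .
        also have "hdist (geo [] r (\<sigma> i0)) (\<beta> (take i r) x) \<le> hdist (geo [] r (\<sigma> i0)) (geo [] r (\<sigma> i)) + hdist (geo [] r (\<sigma> i)) (\<beta> (take i r) x)"
          using hdist_triangle[OF G(2) G(1) H(1)] .
        also have "hdist (geo [] r (\<sigma> i0)) (geo [] r (\<sigma> i)) = \<bar>\<sigma> i0 - \<sigma> i\<bar>"
          using geo_dist[OF e r(1) s(4) s(5)[unfolded d_def] s(1) s(2)[unfolded d_def]] .
        finally have "hdist (\<beta> (take i0 r) x) (\<beta> (take i r) x) \<le> 2 * D + 1"
          using s(3,6) sd hdist_sym[of "\<beta> (take i0 r) x"] by simp
        hence "hdist x (\<beta> (inv_word (take i0 r) @ take i r) x) \<le> 2 * D + 1"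
          unfolding orbit_dist'[OF okt okt] .
        moreover have "ok (inv_word (take i0 r) @ take i r)" using okt by simp
        hence "?w i \<in> carrier (Fn n)" unfolding ok_def by (rule reduce_in_free_group)
        ultimately show "?w i \<in> Z" unfolding Z_def by simp
      qed
      moreover have "inj_on ?w ?F"
      proof (rule inj_onI)
        fix i j assume ij: "i \<in> ?F" "j \<in> ?F" and eq: "?w i = ?w j"
        have "reduce_word (take i0 r @ ?w i) = take i r" for i
        proof -
          have "reduced (take i r)" using r(2) by (metis append_take_drop_id reduced_append)
          thus ?thesis by simp
        qed
        hence "take i r = take j r" using eq by metis
        thus "i = j" using ij by (metis (no_types, lifting) atMost_iff length_take mem_Collect_eq min.absorb2)
      qed
      ultimately show ?thesis using card_inj_on_le finZ by blast
    next
      case True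
      show ?thesis unfolding True by simp
    qed
    have eq: "{..length r} = (\<Union>b\<in>{..nat \<lfloor>d\<rfloor>}. {i \<in> {..length r}. f i = b})"
    proof -
      have "f i \<le> nat \<lfloor>d\<rfloor>" if "i \<le> length r" for i
        unfolding f_def using \<sigma> that by (intro nat_mono floor_mono) auto
      thus ?thesis by auto
    qed
    have "card {..length r} \<le> (\<Sum>b\<le>nat \<lfloor>d\<rfloor>. card {i \<in> {..length r}. f i = b})"
      by (subst eq) (rule card_UN_le, simp)
    also have "\<dots> \<le> (\<Sum>b\<le>nat \<lfloor>d\<rfloor>. card Z)" by (intro sum_mono fibre)
    finally have "length r \<le> (nat \<lfloor>d\<rfloor> + 1) * card Z" by simp
    hence "real (length r) \<le> real ((nat \<lfloor>d\<rfloor> + 1) * card Z)" by (simp only: of_nat_le_iff)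
    also have "\<dots> \<le> (d + 1) * real (card Z)"
    proof -
      have "real (nat \<lfloor>d\<rfloor>) \<le> d" using d(2) by (simp add: of_nat_floor)
      thus ?thesis unfolding of_nat_mult of_nat_add by (intro mult_right_mono) auto
    qed
    finally show ?thesis unfolding d(1) by (simp only: mult.commute)
  qed
  thus ?thesis by (intro exI[of _ "real (card Z)"]) simp
qed

end

section \<open>Parabolic fixed points\<close>

text \<open>Up to conjugation by \<open>a\<close> the word is cyclically reduced and nonempty, so
  its powers do not cancel; the conjugation costs at most \<open>2 * length a\<close> letters, which
  is the witness for \<open>m\<close>.\<close>

lemma power_length:
  assumes "reduced u" "u \<noteq> []"
  shows "\<exists>m. \<forall>k. k \<le> length (reduce_word (wpow u k)) + m"
proof -
  obtain a w where aw: "u = a @ w @ inv_word a" "cyclically_reduced w" using cyclic_reduction[OF assms(1)] by blast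
  have w0: "w \<noteq> []"
  proof
    assume "w = []"
    hence "reduce_word u = []" using aw by simp
    thus False using assms by simp
  qed
  have pw: "reduce_word (wpow u k) = reduce_word (a @ wpow w k @ inv_word a)" for k
  proof (induction k)
    case (Suc k)
    have "reduce_word (wpow u (Suc k)) = reduce_word (u @ reduce_word (wpow u k))" by simp
    also have "\<dots> = reduce_word (u @ (a @ wpow w k @ inv_word a))" unfolding Suc by (rule reduce_append_right)
    also have "\<dots> = reduce_word ((a @ w) @ inv_word a @ a @ (wpow w k @ inv_word a))"
      by (subst aw(1)) (simp only: append_assoc)
    also have "\<dots> = reduce_word ((a @ w) @ (wpow w k @ inv_word a))" by (rule reduce_cancel_mid(4))
    finally show ?case by simp
  qed simp
  have "k \<le> length (reduce_word (wpow u k)) + 2 * length a" for k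
  proof -
    have "wpow w k = reduce_word (inv_word a @ a @ wpow w k @ inv_word a @ a)"
      using cyclically_reduced_wpow[OF aw(2), of k] by simp
    also have "\<dots> = reduce_word (inv_word a @ (a @ wpow w k @ inv_word a) @ a)" by simp
    also have "\<dots> = reduce_word (inv_word a @ reduce_word (wpow u k) @ a)"
      unfolding pw by (rule reduce_append_mid[symmetric])
    finally have "length (wpow w k) \<le> length (inv_word a @ reduce_word (wpow u k) @ a)" by (metis length_reduce_le)
    moreover have "k * 1 \<le> k * length w" using w0 by (intro mult_le_mono2) (simp add: Suc_le_eq)
    ultimately show ?thesis unfolding length_wpow length_append inv_word_simps by linarith
  qed
  thus ?thesis by blast
qed

lemma square_less_iff: "0 \<le> a \<Longrightarrow> 0 \<le> b \<Longrightarrow> a\<^sup>2 < b\<^sup>2 \<longleftrightarrow> a < (b::real)"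
  using power_less_imp_less_base[of a 2 b] power_strict_mono[of a b 2] by auto

text \<open>\<open>C\<close> sends the centre to infinity and is scaled to bring the horosphere to
  height 1: \<open>q\<close> is the reciprocal of the level for a horoball at infinity and the
  diameter for a ball. The explicit height serves to show that parabolic orbits converge to the
  centre.\<close>

lemma horoball_normal:
  assumes "horoball_at \<xi> H"
  shows "\<exists>C. det C = 1 \<and> SL2C_act_ideal C \<xi> = None \<and> H = horoset C \<and>
    (\<exists>q>0. \<forall>p\<in>H3. snd (SL2C_act C p) = (case \<xi> of None \<Rightarrow> snd p * q
       | Some z \<Rightarrow> snd p * q / ((cmod (fst p - z))\<^sup>2 + (snd p)\<^sup>2)))"
proof (cases \<xi>)
  case None
  then obtain h where h: "h > 0" "H = {p. snd p > h}" using assms by (auto simp: horoball_at_def)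
  define C where "C = mk2 (of_real (1 / sqrt h)) 0 0 (of_real (sqrt h))"
  have d: "det C = 1" using h by (simp add: C_def det_2)
  have s: "snd (SL2C_act C p) = snd p * (1 / h)" for p using h by (simp add: snd_SL2C_act C_def)
  have "H = horoset C"
  proof (intro equalityI subsetI)
    fix p assume "p \<in> H"
    hence "h < snd p" using h by simp
    thus "p \<in> horoset C" using h(1) by (simp add: horoset_def s H3_def)
  next
    fix p assume "p \<in> horoset C"
    thus "p \<in> H" using h by (simp add: horoset_def s)
  qed
  moreover have "SL2C_act_ideal C \<xi> = None" by (simp add: None SL2C_act_ideal_def C_def)
  moreover have "\<exists>q>0. \<forall>p\<in>H3. snd (SL2C_act C p) = snd p * q" using h(1) by (intro exI[of _ "1 / h"]) (simp add: s)
  ultimately show ?thesis using d unfolding None by (intro exI[of _ C]) simp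
next
  case (Some z)
  then obtain r where r: "r > 0" "H = ball (z, r) r" using assms by (auto simp: horoball_at_def)
  define s where "s = 1 / sqrt (2 * r)"
  have s: "s > 0" "s\<^sup>2 = 1 / (2 * r)" using r(1) by (simp_all add: s_def power_divide)
  define C where "C = mk2 0 (of_real (- 1 / s)) (of_real s) (- of_real s * z)"
  have d: "det C = 1" using s(1) by (simp add: C_def det_2)
  have sn: "snd (SL2C_act C p) = snd p * (2 * r) / ((cmod (fst p - z))\<^sup>2 + (snd p)\<^sup>2)" for p
  proof -
    have "C$2$1 * fst p + C$2$2 = of_real s * (fst p - z)" by (simp add: C_def algebra_simps)
    hence "cmod (C$2$1 * fst p + C$2$2) = s * cmod (fst p - z)" using s(1) by (simp add: norm_mult)
    moreover have "cmod (C$2$1) = s" using s(1) by (simp add: C_def)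
    ultimately have "snd (SL2C_act C p) = snd p / (s\<^sup>2 * ((cmod (fst p - z))\<^sup>2 + (snd p)\<^sup>2))"
      unfolding snd_SL2C_act by (simp add: power_mult_distrib distrib_left)
    thus ?thesis unfolding s(2) by simp
  qed
  have "H = horoset C"
  proof -
    have mem: "p \<in> H \<longleftrightarrow> (cmod (fst p - z))\<^sup>2 + (snd p)\<^sup>2 < snd p * (2 * r)" for p
    proof -
      have "p \<in> H \<longleftrightarrow> (dist p (z, r))\<^sup>2 < r\<^sup>2"
        unfolding r(2) mem_ball dist_commute[of "(z, r)"]
        using square_less_iff[of "dist p (z, r)" r] r(1) by simp
      thus ?thesis unfolding dist_hpoint by (simp add: power2_eq_square algebra_simps)
    qed
    have "p \<in> H \<longleftrightarrow> p \<in> horoset C" for p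
    proof (cases "snd p > 0")
      case True
      hence "(cmod (fst p - z))\<^sup>2 + (snd p)\<^sup>2 > 0" by (simp add: add_nonneg_pos)
      thus ?thesis using True unfolding mem horoset_def H3_def sn by simp
    next
      case False
      hence "snd p * (2 * r) \<le> 0" using r(1) by (simp add: mult_nonpos_nonneg)
      moreover have "0 \<le> (cmod (fst p - z))\<^sup>2 + (snd p)\<^sup>2" by simp
      ultimately show ?thesis using False unfolding mem horoset_def H3_def mem_Collect_eq by linarith
    qed
    thus ?thesis by blast
  qed
  moreover have "SL2C_act_ideal C \<xi> = None" by (simp add: Some SL2C_act_ideal_def C_def)
  moreover have "\<exists>q>0. \<forall>p\<in>H3. snd (SL2C_act C p) = snd p * q / ((cmod (fst p - z))\<^sup>2 + (snd p)\<^sup>2)"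
    using r(1) by (intro exI[of _ "2 * r"]) (simp add: sn)
  ultimately show ?thesis using d unfolding Some by (intro exI[of _ C]) simp
qed

text \<open>An element that fixes the centre of a horoball and preserves the horoball is parabolic or
  has a fixed point inside hyperbolic space.\<close>

lemma horoball_stabilizer:
  assumes A: "det A = 1" and C: "det C = 1" "SL2C_act_ideal C \<xi> = None"
    and fix\<xi>: "SL2C_act_ideal A \<xi> = \<xi>" and pres: "SL2C_act A ` horoset C = horoset C"
  shows "p \<in> H3 \<Longrightarrow> snd (SL2C_act C (SL2C_act A p)) = snd (SL2C_act C p)"
    and "SL2C_act_ideal A \<eta> = \<eta> \<Longrightarrow> \<eta> \<noteq> \<xi> \<Longrightarrow> \<exists>y\<in>H3. SL2C_act A y = y"
proof -
  note CI = inv2[OF C(1)]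
  \<comment> \<open>\<open>A\<close> in the coordinates of the standard horoball. It fixes infinity,
    so it is upper triangular and divides all heights by \<open>N\<close>.\<close>
  define A' where "A' = C ** (A ** inv2 C)"
  have d1: "det (A ** inv2 C) = 1" using A CI by (simp add: det_mul)
  have dA': "det A' = 1" unfolding A'_def using C(1) d1 by (simp add: det_mul)
  have act': "SL2C_act A' (SL2C_act C p) = SL2C_act C (SL2C_act A p)" if p: "p \<in> H3" for p
  proof -
    note Cp = hv_act(2)[OF C(1) p]
    show ?thesis unfolding A'_def SL2C_act_mult[OF C(1) d1 Cp] SL2C_act_mult[OF A CI(3) Cp] SL2C_act_inv2(1)[OF C(1) p] ..
  qed
  have ideal': "SL2C_act_ideal A' (SL2C_act_ideal C \<zeta>) = SL2C_act_ideal C (SL2C_act_ideal A \<zeta>)" for \<zeta>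
    unfolding A'_def SL2C_act_ideal_mult[OF d1] SL2C_act_ideal_mult[OF CI(3)] SL2C_act_ideal_inv2(1)[OF C(1)] ..
  have "SL2C_act_ideal A' None = None" using ideal'[of \<xi>] fix\<xi> C(2) by simp
  hence c0: "A'$2$1 = 0" by (simp add: SL2C_act_ideal_def Let_def split: if_splits)
  hence ad: "A'$1$1 * A'$2$2 = 1" using dA' by (simp add: det_2)
  hence dne: "A'$2$2 \<noteq> 0" by auto
  define N where "N = (cmod (A'$2$2))\<^sup>2"
  have N0: "N > 0" using dne by (simp add: N_def)
  have snd': "snd (SL2C_act A' q) = snd q / N" for q using c0 by (simp add: snd_SL2C_act N_def)
  have iff: "1 < snd q \<longleftrightarrow> 1 < snd q / N" if q: "q \<in> H3" for q
  proof -
    define p where "p = SL2C_act (inv2 C) q"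
    have p: "p \<in> H3" "SL2C_act C p = q"
      unfolding p_def using hv_act(2)[OF CI(3) q] SL2C_act_inv2(2)[OF C(1) q] by auto
    have "1 < snd q \<longleftrightarrow> p \<in> horoset C" using p by (simp add: horoset_def)
    also have "\<dots> \<longleftrightarrow> SL2C_act A p \<in> horoset C"
    proof
      assume "p \<in> horoset C" thus "SL2C_act A p \<in> horoset C" using pres by blast
    next
      assume "SL2C_act A p \<in> horoset C"
      then obtain p' where p': "p' \<in> horoset C" "SL2C_act A p = SL2C_act A p'" using pres by (metis imageE)
      hence "p = p'" using SL2C_act_inv2(1)[OF A] p(1) unfolding horoset_def by (metis (no_types, lifting) mem_Collect_eq)
      thus "p \<in> horoset C" using p' by simp
    qed
    also have "\<dots> \<longleftrightarrow> 1 < snd (SL2C_act C (SL2C_act A p))" using hv_act(2)[OF A p(1)] by (simp add: horoset_def)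
    also have "\<dots> \<longleftrightarrow> 1 < snd q / N" unfolding act'[OF p(1), symmetric] p(2) snd' ..
    finally show ?thesis .
  qed
  \<comment> \<open>A map that preserves the region above height 1 cannot rescale heights.\<close>
  have N1: "N = 1"
  proof (rule ccontr)
    assume "N \<noteq> 1"
    then consider "N < 1" | "N > 1" by linarith
    thus False
    proof cases
      case 1
      have "1 < 1 / N" using 1 N0 by simp
      thus False using iff[of "(0, 1)"] by (simp add: H3_def)
    next
      case 2
      have "\<not> 1 < N / N" using N0 by simp
      thus False using iff[of "(0, N)"] 2 N0 by (simp add: H3_def)
    qed
  qed
  show "snd (SL2C_act C (SL2C_act A p)) = snd (SL2C_act C p)" if "p \<in> H3"
    unfolding act'[OF that, symmetric] snd' N1 by simp
  show "\<exists>y\<in>H3. SL2C_act A y = y" if \<eta>: "SL2C_act_ideal A \<eta> = \<eta>" "\<eta> \<noteq> \<xi>"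
  proof -
    have "SL2C_act_ideal C \<eta> \<noteq> None" using \<eta>(2) C SL2C_act_ideal_inv2(1) by metis
    then obtain \<zeta> where \<zeta>: "SL2C_act_ideal C \<eta> = Some \<zeta>" by blast
    have "SL2C_act_ideal A' (Some \<zeta>) = Some \<zeta>" using ideal'[of \<eta>] \<eta>(1) \<zeta> by simp
    hence fz: "A'$1$1 * \<zeta> + A'$1$2 = \<zeta> * A'$2$2" using c0 dne by (simp add: SL2C_act_ideal_def Let_def divide_eq_eq)
    \<comment> \<open>The diagonal entries have modulus 1, so a finite boundary fixed point
      \<open>\<zeta>\<close> makes the point above it fixed as well.\<close>
    have "SL2C_act A' (\<zeta>, 1) = (\<zeta>, 1)"
    proof -
      have "A'$2$2 * cnj (A'$2$2) = of_real N"
        unfolding N_def complex_norm_square ..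
      hence "A'$2$2 * cnj (A'$2$2) = 1" using N1 by simp
      hence "\<zeta> * A'$2$2 * cnj (A'$2$2) = \<zeta>" by (simp add: mult.assoc)
      moreover have "(cmod (A'$2$2))\<^sup>2 = 1" using N1 by (simp add: N_def)
      ultimately show ?thesis unfolding SL2C_act_def Let_def using c0 fz by simp
    qed
    moreover have q: "(\<zeta>, 1) \<in> H3" by (simp add: H3_def)
    define y where "y = SL2C_act (inv2 C) (\<zeta>, 1)"
    have y: "y \<in> H3" "SL2C_act C y = (\<zeta>, 1)"
      unfolding y_def using hv_act(2)[OF CI(3) q] SL2C_act_inv2(2)[OF C(1) q] by auto
    ultimately have "SL2C_act C (SL2C_act A y) = SL2C_act C y" using act'[OF y(1)] by simp
    hence "SL2C_act A y = y" using SL2C_act_inv2(1)[OF C(1)] hv_act(2)[OF A y(1)] y(1) by metis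
    thus ?thesis using y(1) by blast
  qed
qed

text \<open>Collects what discreteness and the choice of horoballs give on their own; compactness
  and the one-cusp condition enter in \<open>cusped_action_exists\<close>.\<close>

locale cusped_rep =
  fixes n :: nat and \<rho> :: "nat word \<Rightarrow> (complex^2^2) set" and B :: "ideal_point \<Rightarrow> hpoint set"
  assumes n: "n \<ge> 2" and faithful: "faithful_rep n \<rho>"
    and discrete: "discrete_in_PSL2C (\<rho> ` carrier (Fn n))"
    and horoballs: "cusp_horoballs (\<rho> ` carrier (Fn n)) B"
begin

abbreviation "\<Gamma> \<equiv> \<rho> ` carrier (Fn n)"

abbreviation "PF \<equiv> parabolic_fixed_points \<Gamma>"

lemma rho_hom: "\<rho> \<in> hom (Fn n) PSL2C" and rho_inj: "inj_on \<rho> (carrier (Fn n))"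
  using faithful by (auto simp: faithful_rep_def)

sublocale PSL: group PSL2C by (rule PSL2C_group)

sublocale rho: group_hom "Fn n" PSL2C \<rho>
  by (intro group_hom.intro free_group_is_group PSL2C_group) (simp add: group_hom_axioms_def rho_hom)

lemma Gamma_subgroup: "subgroup \<Gamma> PSL2C" by (rule rho.img_is_subgroup)

lemma Gamma_carrier: "g \<in> \<Gamma> \<Longrightarrow> g \<in> carrier PSL2C" using Gamma_subgroup subgroup.mem_carrier by metis

lemma word_displacement_finite:
  assumes "x \<in> H3" shows "finite {u \<in> carrier (Fn n). hdist x (act (\<rho> u) x) \<le> R}" (is "finite ?S")
proof -
  have "\<rho> ` ?S \<subseteq> {g \<in> \<Gamma>. hdist x (act g x) \<le> R}" by blast
  hence "finite (\<rho> ` ?S)" using finite_small_displacement[OF Gamma_subgroup discrete assms] finite_subset by blast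
  moreover have "inj_on \<rho> ?S" using rho_inj by (rule inj_on_subset) blast
  ultimately show ?thesis using finite_imageD by blast
qed

lemma pow_in_Fn: "u \<in> carrier (Fn n) \<Longrightarrow> reduce_word (wpow u k) \<in> carrier (Fn n)"
  using fst_set_wpow[of u k] by (intro reduce_in_free_group) auto

lemma rho_pow: "u \<in> carrier (Fn n) \<Longrightarrow> \<rho> (reduce_word (wpow u (Suc k))) = \<rho> u \<otimes>\<^bsub>PSL2C\<^esub> \<rho> (reduce_word (wpow u k))"
  using rho.hom_mult[OF _ pow_in_Fn, of u u k] by simp

lemma powers_diverge:
  assumes u: "u \<in> carrier (Fn n)" "u \<noteq> []" and x: "x \<in> H3"
  shows "eventually (\<lambda>k. hdist x (act (\<rho> (reduce_word (wpow u k))) x) > R) sequentially"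
proof -
  obtain m where m: "\<And>k. k \<le> length (reduce_word (wpow u k)) + m" using power_length[of u] u by auto
  have "finite (length ` {u \<in> carrier (Fn n). hdist x (act (\<rho> u) x) \<le> R})" using word_displacement_finite[OF x] by simp
  then obtain L where L: "\<forall>l\<in>length ` {u \<in> carrier (Fn n). hdist x (act (\<rho> u) x) \<le> R}. l \<le> L"
    using finite_nat_set_iff_bounded_le by blast
  have "hdist x (act (\<rho> (reduce_word (wpow u k))) x) > R" if k: "k \<ge> Suc (L + m)" for k
  proof (rule ccontr)
    assume "\<not> hdist x (act (\<rho> (reduce_word (wpow u k))) x) > R"
    hence "reduce_word (wpow u k) \<in> {u \<in> carrier (Fn n). hdist x (act (\<rho> u) x) \<le> R}"
      using pow_in_Fn[OF u(1)] by simp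
    hence "length (reduce_word (wpow u k)) \<le> L" using L by blast
    thus False using m[of k] k by linarith
  qed
  thus ?thesis unfolding eventually_sequentially by blast
qed

text \<open>All powers would fix \<open>y\<close> too, although the powers of a nontrivial word move
  every point arbitrarily far. So the action is free.\<close>

lemma no_fixed_point:
  assumes u: "u \<in> carrier (Fn n)" "u \<noteq> []" and y: "y \<in> H3"
  shows "act (\<rho> u) y \<noteq> y"
proof
  assume fy: "act (\<rho> u) y = y"
  have "act (\<rho> (reduce_word (wpow u k))) y = y" for k
  proof (induction k)
    case 0
    have "\<rho> (reduce_word (wpow u 0)) = \<one>\<^bsub>PSL2C\<^esub>" using rho.hom_one by simp
    thus ?case using act_one[OF y] by simp
  next
    case (Suc k)
    show ?case unfolding rho_pow[OF u(1)]
      using act_mult[OF rho.hom_closed[OF u(1)] rho.hom_closed[OF pow_in_Fn[OF u(1)]] y, of k] Suc fy by simp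
  qed
  hence "eventually (\<lambda>k. False) sequentially" using powers_diverge[OF u y, of 0] by simp
  thus False by simp
qed

lemma horoball_at_B: "\<xi> \<in> PF \<Longrightarrow> horoball_at \<xi> (B \<xi>)"
  using horoballs by (auto simp: cusp_horoballs_def)

lemma B_equivariant: "\<xi> \<in> PF \<Longrightarrow> g \<in> \<Gamma> \<Longrightarrow> B (act_ideal g \<xi>) = act g ` B \<xi>"
  using horoballs unfolding cusp_horoballs_def by blast

lemma B_disjoint: "\<xi> \<in> PF \<Longrightarrow> \<eta> \<in> PF \<Longrightarrow> \<xi> \<noteq> \<eta> \<Longrightarrow> B \<xi> \<inter> B \<eta> = {}"
  using horoballs unfolding cusp_horoballs_def disjoint_family_on_def by blast

text \<open>Equivariance of the horoballs turns fixing \<open>\<xi>\<close> into preserving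
  \<open>B \<xi>\<close>. Of the two cases in \<open>horoball_stabilizer\<close>, the one with a
  fixed point in hyperbolic space is excluded by \<open>no_fixed_point\<close>.\<close>

lemma stabilizer_facts:
  assumes \<xi>: "\<xi> \<in> PF" and u: "u \<in> carrier (Fn n)" and fx: "act_ideal (\<rho> u) \<xi> = \<xi>"
    and C: "det C = 1" "SL2C_act_ideal C \<xi> = None" "B \<xi> = horoset C"
  shows "p \<in> H3 \<Longrightarrow> snd (SL2C_act C (act (\<rho> u) p)) = snd (SL2C_act C p)"
    and "u \<noteq> [] \<Longrightarrow> parabolic_fixing \<xi> (\<rho> u)"
proof -
  obtain A where A: "det A = 1" "\<rho> u = proj A" using PSL2C_lift[OF rho.hom_closed[OF u]] by blast
  have fA: "SL2C_act_ideal A \<xi> = \<xi>" using fx A by (simp add: act_ideal_proj)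
  have "act (\<rho> u) ` B \<xi> = B \<xi>" using B_equivariant[OF \<xi>, of "\<rho> u"] u fx by simp
  moreover have "act (\<rho> u) ` B \<xi> = SL2C_act A ` B \<xi>"
    by (rule image_cong) (auto simp: A(2) act_proj[OF A(1)] C(3) horoset_def)
  ultimately have pres: "SL2C_act A ` horoset C = horoset C" using C(3) by simp
  note S = horoball_stabilizer[OF A(1) C(1,2) fA pres]
  show "snd (SL2C_act C (act (\<rho> u) p)) = snd (SL2C_act C p)" if "p \<in> H3"
    using S(1)[OF that] act_proj[OF A(1) that] A(2) by simp
  show "parabolic_fixing \<xi> (\<rho> u)" if "u \<noteq> []"
  proof -
    have "\<eta> = \<xi>" if \<eta>: "act_ideal (\<rho> u) \<eta> = \<eta>" for \<eta>
    proof (rule ccontr)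
      assume "\<eta> \<noteq> \<xi>"
      then obtain y where "y \<in> H3" "SL2C_act A y = y" using S(2)[of \<eta>] \<eta> A by (auto simp: act_ideal_proj)
      thus False using no_fixed_point[OF u \<open>u \<noteq> []\<close>] act_proj[OF A(1)] A(2) by metis
    qed
    thus ?thesis unfolding parabolic_fixing_def using fx rho.hom_closed[OF u] by blast
  qed
qed

definition stab :: "ideal_point \<Rightarrow> (complex^2^2) set set" where
  "stab \<xi> = {g \<in> \<Gamma>. act_ideal g \<xi> = \<xi>}"

lemma act_ideal_inv: "g \<in> carrier PSL2C \<Longrightarrow> act_ideal (inv\<^bsub>PSL2C\<^esub> g) (act_ideal g \<xi>) = \<xi>"
  using act_ideal_mult[of "inv\<^bsub>PSL2C\<^esub> g" g \<xi>] act_ideal_one by simp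

lemma parabolic_in_PF: "g \<in> \<Gamma> \<Longrightarrow> parabolic_fixing \<xi> g \<Longrightarrow> \<xi> \<in> PF"
  unfolding parabolic_fixed_points_def by blast

lemma parabolic_nontrivial: "parabolic_fixing \<xi> g \<Longrightarrow> g \<noteq> \<one>\<^bsub>PSL2C\<^esub>"
proof
  assume "parabolic_fixing \<xi> g" "g = \<one>\<^bsub>PSL2C\<^esub>"
  hence "(UNIV :: ideal_point set) = {\<xi>}" by (simp add: parabolic_fixing_def act_ideal_one)
  moreover have "None \<noteq> Some (0::complex)" by simp
  ultimately show False by (metis UNIV_I singletonD)
qed

lemma stab_parabolic:
  assumes "\<xi> \<in> PF" "g \<in> stab \<xi>" "g \<noteq> \<one>\<^bsub>PSL2C\<^esub>" shows "parabolic_fixing \<xi> g"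
proof -
  obtain u where u: "u \<in> carrier (Fn n)" "g = \<rho> u" "act_ideal (\<rho> u) \<xi> = \<xi>" using assms(2) by (auto simp: stab_def)
  have "u \<noteq> []" using u(2) assms(3) rho.hom_one by auto
  moreover obtain C where "det C = 1" "SL2C_act_ideal C \<xi> = None" "B \<xi> = horoset C"
    using horoball_normal[OF horoball_at_B[OF assms(1)]] by blast
  ultimately show ?thesis using stabilizer_facts(2)[OF assms(1) u(1,3)] u(2) by blast
qed

text \<open>A larger parabolic subgroup shares a nontrivial element with the stabiliser, hence has
  the same fixed point and is contained in the stabiliser.\<close>

lemma stab_maximal:
  assumes \<xi>: "\<xi> \<in> PF" shows "maximal_parabolic_subgroup \<Gamma> (stab \<xi>)"
proof -
  have "subgroup (stab \<xi>) PSL2C"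
  proof (rule PSL.subgroupI)
    show "stab \<xi> \<subseteq> carrier PSL2C" using Gamma_carrier by (auto simp: stab_def)
    have "\<one>\<^bsub>PSL2C\<^esub> \<in> \<Gamma>" using Gamma_subgroup by (rule subgroup.one_closed)
    thus "stab \<xi> \<noteq> {}" using act_ideal_one by (auto simp: stab_def)
    fix a b assume a: "a \<in> stab \<xi>" and b: "b \<in> stab \<xi>"
    have aC: "a \<in> carrier PSL2C" "b \<in> carrier PSL2C" using a b Gamma_carrier by (auto simp: stab_def)
    show "inv\<^bsub>PSL2C\<^esub> a \<in> stab \<xi>"
      using a act_ideal_inv[OF aC(1), of \<xi>] subgroup.m_inv_closed[OF Gamma_subgroup] by (auto simp: stab_def)
    show "a \<otimes>\<^bsub>PSL2C\<^esub> b \<in> stab \<xi>"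
      using a b act_ideal_mult[OF aC] subgroup.m_closed[OF Gamma_subgroup] by (auto simp: stab_def)
  qed
  moreover obtain g where g: "g \<in> \<Gamma>" "parabolic_fixing \<xi> g" using \<xi> by (auto simp: parabolic_fixed_points_def)
  hence gs: "g \<in> stab \<xi>" by (auto simp: stab_def parabolic_fixing_def)
  have g1: "g \<noteq> \<one>\<^bsub>PSL2C\<^esub>" using parabolic_nontrivial[OF g(2)] .
  have "stab \<xi> \<subseteq> \<Gamma>" by (auto simp: stab_def)
  ultimately have par: "parabolic_subgroup \<Gamma> (stab \<xi>)"
    unfolding parabolic_subgroup_def using gs g1 stab_parabolic[OF \<xi>] by blast
  have "Q = stab \<xi>" if Q: "parabolic_subgroup \<Gamma> Q" "stab \<xi> \<subseteq> Q" for Q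
  proof -
    obtain \<eta> where \<eta>: "\<forall>h\<in>Q - {\<one>\<^bsub>PSL2C\<^esub>}. parabolic_fixing \<eta> h" using Q(1) by (auto simp: parabolic_subgroup_def)
    have "parabolic_fixing \<eta> g" using \<eta> Q(2) gs g1 by blast
    hence "\<eta> = \<xi>" using g(2) unfolding parabolic_fixing_def by (metis singleton_inject)
    have "h \<in> stab \<xi>" if h: "h \<in> Q" for h
    proof (cases "h = \<one>\<^bsub>PSL2C\<^esub>")
      case True
      thus ?thesis using act_ideal_one subgroup.one_closed[OF Gamma_subgroup] by (auto simp: stab_def)
    next
      case False
      hence "parabolic_fixing \<xi> h" using \<eta> h \<open>\<eta> = \<xi>\<close> by blast
      moreover have "h \<in> \<Gamma>" using Q(1) h by (auto simp: parabolic_subgroup_def)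
      ultimately show ?thesis by (auto simp: stab_def parabolic_fixing_def)
    qed
    thus ?thesis using Q(2) by blast
  qed
  thus ?thesis using par by (simp add: maximal_parabolic_subgroup_def)
qed

lemma PF_translate:
  assumes "\<xi> \<in> PF" "k \<in> \<Gamma>" shows "act_ideal k \<xi> \<in> PF"
proof -
  obtain g where g: "g \<in> \<Gamma>" "parabolic_fixing \<xi> g" using assms(1) by (auto simp: parabolic_fixed_points_def)
  have C: "g \<in> carrier PSL2C" "k \<in> carrier PSL2C" using g assms(2) Gamma_carrier by auto
  let ?h = "k \<otimes>\<^bsub>PSL2C\<^esub> g \<otimes>\<^bsub>PSL2C\<^esub> inv\<^bsub>PSL2C\<^esub> k"
  have act: "act_ideal ?h \<eta> = act_ideal k (act_ideal g (act_ideal (inv\<^bsub>PSL2C\<^esub> k) \<eta>))" for \<eta>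
    using C by (simp add: act_ideal_mult)
  have inv: "act_ideal k (act_ideal (inv\<^bsub>PSL2C\<^esub> k) \<eta>) = \<eta>" for \<eta>
    using act_ideal_inv[of "inv\<^bsub>PSL2C\<^esub> k" \<eta>] C by simp
  have "act_ideal ?h \<eta> = \<eta> \<longleftrightarrow> act_ideal g (act_ideal (inv\<^bsub>PSL2C\<^esub> k) \<eta>) = act_ideal (inv\<^bsub>PSL2C\<^esub> k) \<eta>" for \<eta>
    unfolding act using inv act_ideal_inv[OF C(2)] by metis
  moreover have "act_ideal g \<zeta> = \<zeta> \<longleftrightarrow> \<zeta> = \<xi>" for \<zeta> using g(2) unfolding parabolic_fixing_def by blast
  moreover have "act_ideal (inv\<^bsub>PSL2C\<^esub> k) \<eta> = \<xi> \<longleftrightarrow> \<eta> = act_ideal k \<xi>" for \<eta>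
    using inv act_ideal_inv[OF C(2)] by metis
  ultimately have "parabolic_fixing (act_ideal k \<xi>) ?h" unfolding parabolic_fixing_def using C by auto
  moreover have "?h \<in> \<Gamma>"
    using g(1) assms(2) Gamma_subgroup by (simp add: subgroup.m_closed subgroup.m_inv_closed)
  ultimately show ?thesis by (rule parabolic_in_PF[rotated])
qed

end

section \<open>The convex hull outside the horoballs\<close>

lemma hdist_le_cosh_bound: "p \<in> H3 \<Longrightarrow> q \<in> H3 \<Longrightarrow> cosh (hdist p q) \<le> b \<Longrightarrow> hdist p q \<le> 2 * b"
proof -
  assume H: "p \<in> H3" "q \<in> H3" "cosh (hdist p q) \<le> b"
  have "2 * cosh (hdist p q) = exp (hdist p q) + exp (- hdist p q)" by (simp add: cosh_def)
  moreover have "1 + hdist p q \<le> exp (hdist p q)" by (rule exp_ge_add_one_self)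
  moreover have "exp (- hdist p q) > 0" by simp
  ultimately show ?thesis using H(3) by linarith
qed

lemma cosh_line_coord:
  fixes s t :: real
  shows "(sinh s * cosh t - sinh t * cosh s)\<^sup>2 + (cosh s)\<^sup>2 + (cosh t)\<^sup>2 = 2 * cosh s * cosh t * cosh (s - t)"
proof -
  have c: "cosh s * cosh s = 1 + sinh s * sinh s" "cosh t * cosh t = 1 + sinh t * sinh t"
    using cosh_square_eq[of s] cosh_square_eq[of t] by (simp_all add: power2_eq_square)
  show ?thesis unfolding power2_eq_square cosh_diff using c by algebra
qed

lemma exp_small: "\<exists>s. exp s < (r::real)" if "r > 0"
  using that by (intro exI[of _ "ln (r / 2)"]) simp

text \<open>The semicircle over the segment from \<open>a\<close> to \<open>b\<close>, with arc
  length entering through \<open>tanh\<close> and \<open>1 / cosh\<close>.\<close>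

lemma line_finite_finite:
  fixes a b :: complex
  assumes "a \<noteq> b"
  shows "\<exists>\<gamma>. geodesic_line \<gamma> \<and> continuous_on UNIV \<gamma> \<and> tendsto_ideal \<gamma> (Some a) at_bot \<and> tendsto_ideal \<gamma> (Some b) at_top \<and>
    (\<forall>H. horoball_at (Some a) H \<longrightarrow> (\<exists>s. \<gamma> s \<in> H)) \<and> (\<forall>H. horoball_at (Some b) H \<longrightarrow> (\<exists>s. \<gamma> s \<in> H))"
proof -
  define q where "q = cmod (b - a) / 2"
  have q: "q > 0" using assms by (simp add: q_def)
  define \<gamma> where "\<gamma> s = ((a + b) / 2 + of_real (tanh s) * ((b - a) / 2), q / cosh s)" for s :: real
  have H: "\<gamma> s \<in> H3" for s using q by (simp add: \<gamma>_def H3_def)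
  have "hdist (\<gamma> s) (\<gamma> t) = \<bar>s - t\<bar>" for s t
  proof (rule hdist_eqI[OF H H])
    have ch: "cosh s > 0" "cosh t > 0" by simp_all
    have th: "tanh s - tanh t = (sinh s * cosh t - sinh t * cosh s) / (cosh s * cosh t)"
      using ch by (simp add: tanh_def diff_frac_eq mult.commute)
    have e: "fst (\<gamma> s) - fst (\<gamma> t) = of_real (tanh s - tanh t) * ((b - a) / 2)"
      unfolding \<gamma>_def fst_conv of_real_diff left_diff_distrib by (rule add_diff_cancel_left)
    have "cmod (fst (\<gamma> s) - fst (\<gamma> t)) = \<bar>tanh s - tanh t\<bar> * q"
      unfolding e norm_mult norm_of_real q_def by (simp add: norm_divide)
    hence "(cmod (fst (\<gamma> s) - fst (\<gamma> t)))\<^sup>2 = (tanh s - tanh t)\<^sup>2 * q\<^sup>2" by (simp add: power_mult_distrib)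
    also have "\<dots> = (q\<^sup>2 / (cosh s * cosh t)\<^sup>2) * (sinh s * cosh t - sinh t * cosh s)\<^sup>2"
      unfolding th by (simp add: power_divide)
    finally have 1: "(cmod (fst (\<gamma> s) - fst (\<gamma> t)))\<^sup>2 = (q\<^sup>2 / (cosh s * cosh t)\<^sup>2) * (sinh s * cosh t - sinh t * cosh s)\<^sup>2" .
    have 2: "(snd (\<gamma> s))\<^sup>2 = (q\<^sup>2 / (cosh s * cosh t)\<^sup>2) * (cosh t)\<^sup>2" "(snd (\<gamma> t))\<^sup>2 = (q\<^sup>2 / (cosh s * cosh t)\<^sup>2) * (cosh s)\<^sup>2"
      using ch by (simp_all add: \<gamma>_def power_divide power_mult_distrib)
    have 3: "2 * snd (\<gamma> s) * snd (\<gamma> t) = (q\<^sup>2 / (cosh s * cosh t)\<^sup>2) * (2 * cosh s * cosh t)"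
      using ch by (simp add: \<gamma>_def power2_eq_square)
    have "cosh (hdist (\<gamma> s) (\<gamma> t)) = (q\<^sup>2 / (cosh s * cosh t)\<^sup>2) * ((sinh s * cosh t - sinh t * cosh s)\<^sup>2 + (cosh s)\<^sup>2 + (cosh t)\<^sup>2)
       / ((q\<^sup>2 / (cosh s * cosh t)\<^sup>2) * (2 * cosh s * cosh t))"
      unfolding cosh_hdist_coord[OF H H] 1 2 3 by (simp add: algebra_simps)
    also have "\<dots> = cosh (s - t)"
      unfolding cosh_line_coord using q ch by simp
    finally show "cosh (hdist (\<gamma> s) (\<gamma> t)) = cosh \<bar>s - t\<bar>" by simp
  qed simp
  hence line: "geodesic_line \<gamma>" unfolding geodesic_line_def using H by blast
  have cont: "continuous_on UNIV \<gamma>" unfolding \<gamma>_def by (intro continuous_intros) auto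
  have ta: "tendsto_ideal \<gamma> (Some a) at_bot"
  proof -
    have "((\<lambda>s. q / cosh s) \<longlongrightarrow> 0) at_bot"
      by (rule real_tendsto_divide_at_top[OF tendsto_const cosh_real_at_bot])
    moreover have "((\<lambda>s. (a + b) / 2 + of_real (tanh s) * ((b - a) / 2)) \<longlongrightarrow> (a + b) / 2 + of_real (- 1) * ((b - a) / 2)) at_bot"
      by (intro tendsto_intros tanh_real_at_bot)
    moreover have "(a + b) / 2 + of_real (- 1) * ((b - a) / 2) = a" by (simp add: field_simps)
    ultimately show ?thesis unfolding tendsto_ideal_def \<gamma>_def by (simp add: tendsto_Pair)
  qed
  have tb: "tendsto_ideal \<gamma> (Some b) at_top"
  proof -
    have "((\<lambda>s. q / cosh s) \<longlongrightarrow> 0) at_top"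
      by (rule real_tendsto_divide_at_top[OF tendsto_const cosh_real_at_top])
    moreover have "((\<lambda>s. (a + b) / 2 + of_real (tanh s) * ((b - a) / 2)) \<longlongrightarrow> (a + b) / 2 + of_real 1 * ((b - a) / 2)) at_top"
      by (intro tendsto_intros tanh_real_at_top)
    moreover have "(a + b) / 2 + of_real 1 * ((b - a) / 2) = b" by (simp add: field_simps)
    ultimately show ?thesis unfolding tendsto_ideal_def \<gamma>_def by (simp add: tendsto_Pair)
  qed
  \<comment> \<open>Towards an end the horizontal distance decays like the square of the height, so
    the line enters every ball tangent to the boundary there.\<close>
  have reach: "\<exists>s. \<gamma> s \<in> ball (e, r) r" if e: "e = a \<or> e = b" and r: "r > 0" for e r
  proof -
    obtain s0 where s0: "exp s0 < r / q" using exp_small[of "r / q"] q r by auto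
    define s where "s = (if e = a then s0 else - s0)"
    have half: "cmod ((b - a) / 2) = q" by (simp add: norm_divide q_def)
    have ch: "cosh s > 0" by simp
    have "cmod (fst (\<gamma> s) - e) = q * (exp s0 / cosh s)"
    proof (cases "e = a")
      case True
      have e1: "fst (\<gamma> s) - e = of_real (1 + tanh s) * ((b - a) / 2)" unfolding True \<gamma>_def by (simp add: field_simps)
      have e2: "1 + tanh s = exp s0 / cosh s"
      proof -
        have "1 + tanh s = (cosh s + sinh s) / cosh s" using ch by (simp add: tanh_def add_divide_distrib)
        thus ?thesis using True by (simp add: cosh_plus_sinh s_def)
      qed
      show ?thesis unfolding e1 norm_mult half norm_of_real e2 using ch by simp
    next
      case False
      hence eb: "e = b" using e by blast
      have e1: "fst (\<gamma> s) - e = of_real (- (1 - tanh s)) * ((b - a) / 2)" unfolding eb \<gamma>_def by (simp add: field_simps)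
      have e2: "1 - tanh s = exp s0 / cosh s"
      proof -
        have "1 - tanh s = (cosh s - sinh s) / cosh s" using ch by (simp add: tanh_def diff_divide_distrib)
        thus ?thesis using False cosh_minus_sinh[of s] by (simp add: s_def)
      qed
      show ?thesis unfolding e1 norm_mult half norm_of_real e2 using ch by simp
    qed
    hence 1: "(cmod (fst (\<gamma> s) - e))\<^sup>2 = (q / cosh s)\<^sup>2 * (exp s0)\<^sup>2" by (simp add: power_divide power_mult_distrib)
    have "cosh s = (exp s0 + exp (- s0)) / 2" by (simp add: s_def cosh_def add.commute)
    hence "2 * cosh s * exp s0 = (exp s0)\<^sup>2 + 1" by (simp add: power2_eq_square algebra_simps flip: exp_add)
    hence 2: "(exp s0)\<^sup>2 + 1 = 2 * cosh s * exp s0" by simp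
    have "(cmod (fst (\<gamma> s) - e))\<^sup>2 + (snd (\<gamma> s))\<^sup>2 = (q / cosh s)\<^sup>2 * ((exp s0)\<^sup>2 + 1)"
      unfolding 1 by (simp add: \<gamma>_def algebra_simps)
    also have "\<dots> = (q / cosh s) * (2 * (q * exp s0))" unfolding 2 using ch by (simp add: power2_eq_square)
    also have "\<dots> < (q / cosh s) * (2 * r)"
      using s0 q ch by (intro mult_strict_left_mono) (auto simp: pos_less_divide_eq mult.commute)
    finally have lt: "(cmod (fst (\<gamma> s) - e))\<^sup>2 + (snd (\<gamma> s))\<^sup>2 < 2 * r * snd (\<gamma> s)" by (simp add: \<gamma>_def mult_ac)
    have "(dist (\<gamma> s) (e, r))\<^sup>2 < r\<^sup>2" using lt unfolding dist_hpoint by (simp add: power2_eq_square algebra_simps)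
    hence "dist (\<gamma> s) (e, r) < r" using square_less_iff[of "dist (\<gamma> s) (e, r)" r] r by simp
    thus ?thesis by (metis dist_commute mem_ball)
  qed
  have "(\<forall>H. horoball_at (Some e) H \<longrightarrow> (\<exists>s. \<gamma> s \<in> H))" if "e = a \<or> e = b" for e
    unfolding horoball_at_def using reach[OF that] by auto
  thus ?thesis using line cont ta tb by blast
qed

lemma line_finite_infinity:
  fixes a :: complex
  shows "\<exists>\<gamma>. geodesic_line \<gamma> \<and> continuous_on UNIV \<gamma> \<and> tendsto_ideal \<gamma> (Some a) at_bot \<and> tendsto_ideal \<gamma> None at_top \<and>
    (\<forall>H. horoball_at (Some a) H \<longrightarrow> (\<exists>s. \<gamma> s \<in> H)) \<and> (\<forall>H. horoball_at None H \<longrightarrow> (\<exists>s. \<gamma> s \<in> H))"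
proof -
  define \<gamma> where "\<gamma> s = (a, exp s)" for s :: real
  have H: "\<gamma> s \<in> H3" for s by (simp add: \<gamma>_def H3_def)
  have "hdist (\<gamma> s) (\<gamma> t) = \<bar>s - t\<bar>" for s t
  proof (rule hdist_eqI[OF H H])
    have "cosh (hdist (\<gamma> s) (\<gamma> t)) = ((exp s)\<^sup>2 + (exp t)\<^sup>2) / (2 * exp s * exp t)"
      unfolding cosh_hdist_coord[OF H H] by (simp add: \<gamma>_def)
    also have "\<dots> = (exp s / exp t + exp t / exp s) / 2" by (simp add: power2_eq_square field_simps)
    also have "\<dots> = cosh (s - t)" by (simp add: cosh_def exp_diff)
    finally show "cosh (hdist (\<gamma> s) (\<gamma> t)) = cosh \<bar>s - t\<bar>" by simp
  qed simp
  hence line: "geodesic_line \<gamma>" unfolding geodesic_line_def using H by blast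
  have cont: "continuous_on UNIV \<gamma>" unfolding \<gamma>_def by (intro continuous_intros)
  have ta: "tendsto_ideal \<gamma> (Some a) at_bot"
    unfolding tendsto_ideal_def \<gamma>_def by (simp add: tendsto_Pair exp_at_bot)
  have tb: "tendsto_ideal \<gamma> None at_top"
  proof -
    have "filterlim \<gamma> at_infinity at_top"
    proof (rule filterlim_norm_at_top_imp_at_infinity)
      have "\<And>s. exp s \<le> norm (\<gamma> s)" by (simp add: \<gamma>_def norm_prod_def real_le_rsqrt)
      thus "filterlim (\<lambda>s. norm (\<gamma> s)) at_top at_top"
        using filterlim_at_top_mono[OF exp_at_top] by (simp add: always_eventually)
    qed
    thus ?thesis by (simp add: tendsto_ideal_def)
  qed
  have ra: "\<exists>s. \<gamma> s \<in> ball (a, r) r" if r: "r > 0" for r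
  proof (intro exI[of _ "ln r"])
    show "\<gamma> (ln r) \<in> ball (a, r) r" using r by (simp add: \<gamma>_def)
  qed
  have rb: "\<exists>s. \<gamma> s \<in> {p. h < snd p}" if h: "h > 0" for h
    using h by (intro exI[of _ "ln (2 * h)"]) (simp add: \<gamma>_def)
  show ?thesis using line cont ta tb ra rb by (intro exI[of _ \<gamma>]) (auto simp: horoball_at_def)
qed

context cusped_rep
begin

text \<open>Powers of a parabolic element keep an orbit on one horosphere centred at
  \<open>\<xi>\<close>, while the orbit leaves every ball. The only accumulation point at infinity
  of a horosphere is its centre.\<close>

lemma PF_in_limit_set:
  assumes \<xi>: "\<xi> \<in> PF" shows "\<xi> \<in> limit_set \<Gamma>"
proof -
  obtain g where g: "g \<in> \<Gamma>" "parabolic_fixing \<xi> g" using \<xi> by (auto simp: parabolic_fixed_points_def)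
  then obtain u where u: "u \<in> carrier (Fn n)" "g = \<rho> u" by blast
  have une: "u \<noteq> []" using parabolic_nontrivial[OF g(2)] u(2) rho.hom_one by auto
  have fu: "act_ideal (\<rho> u) \<xi> = \<xi>" using g(2) u(2) by (auto simp: parabolic_fixing_def)
  obtain C q where C: "det C = 1" "SL2C_act_ideal C \<xi> = None" "B \<xi> = horoset C" and q: "q > 0"
    "\<And>p. p \<in> H3 \<Longrightarrow> snd (SL2C_act C p) = (case \<xi> of None \<Rightarrow> snd p * q
       | Some z \<Rightarrow> snd p * q / ((cmod (fst p - z))\<^sup>2 + (snd p)\<^sup>2))"
    using horoball_normal[OF horoball_at_B[OF \<xi>]] by blast
  define x where "x = base_pt"
  have xH: "x \<in> H3" by (simp add: x_def)
  define p where "p k = act (\<rho> (reduce_word (wpow u k))) x" for k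
  have pH: "p k \<in> H3" for k
    unfolding p_def using act_H3[OF rho.hom_closed[OF pow_in_Fn[OF u(1)]] rho.hom_closed[OF u(1)] xH] .
  have pS: "p (Suc k) = act (\<rho> u) (p k)" for k
    unfolding p_def rho_pow[OF u(1)]
    using act_mult[OF rho.hom_closed[OF u(1)] rho.hom_closed[OF pow_in_Fn[OF u(1)]] xH] .
  have p0: "p 0 = x" unfolding p_def using rho.hom_one act_one[OF xH] by simp
  have hgt: "snd (SL2C_act C (p k)) = snd (SL2C_act C x)" for k
  proof (induction k)
    case (Suc k)
    thus ?case using stabilizer_facts(1)[OF \<xi> u(1) fu C pH] pS by simp
  qed (simp add: p0)
  have div: "eventually (\<lambda>k. hdist x (p k) > R) sequentially" for R
    unfolding p_def using powers_diverge[OF u(1) une xH] .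
  have "tendsto_ideal p \<xi> sequentially"
  proof (cases \<xi>)
    case None
    have t: "snd (p k) = snd x" for k using hgt[of k] q(2)[OF pH] q(2)[OF xH] q(1) unfolding None by simp
    have "filterlim p at_infinity sequentially"
    proof (subst filterlim_at_infinity[OF order_refl], intro allI impI)
      fix r :: real assume r: "0 < r"
      define b where "b = 1 + (norm x + r)\<^sup>2 / (2 * snd x * snd x)"
      show "eventually (\<lambda>k. r \<le> norm (p k)) sequentially"
        using div[of "2 * b"]
      proof (rule eventually_mono)
        fix k assume k: "2 * b < hdist x (p k)"
        show "r \<le> norm (p k)"
        proof (rule ccontr)
          assume "\<not> r \<le> norm (p k)"
          hence "dist x (p k) \<le> norm x + r" using norm_triangle_ineq4[of x "p k"] by (simp add: dist_norm)
          hence "(dist x (p k))\<^sup>2 \<le> (norm x + r)\<^sup>2" by (rule power_mono) simp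
          hence "cosh (hdist x (p k)) \<le> b"
            unfolding cosh_hdist_eq[OF xH pH] b_def t using xH by (simp add: H3_def divide_right_mono)
          hence "hdist x (p k) \<le> 2 * b" by (rule hdist_le_cosh_bound[OF xH pH])
          thus False using k by linarith
        qed
      qed
    qed
    thus ?thesis by (simp add: tendsto_ideal_def None)
  next
    case (Some z)
    define M where "M = q / snd (SL2C_act C x)"
    have hx: "snd (SL2C_act C x) > 0" using hv_act(2)[OF C(1) xH] by (simp add: H3_def)
    have M: "M > 0" using q(1) hx by (simp add: M_def)
    have sp: "snd (p k) > 0" for k using pH[of k] by (simp add: H3_def)
    \<comment> \<open>The horosphere as a Euclidean sphere of diameter \<open>M\<close> tangent to
      the boundary at \<open>z\<close>.\<close>
    have eq: "(cmod (fst (p k) - z))\<^sup>2 + (snd (p k))\<^sup>2 = M * snd (p k)" for k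
    proof -
      have pos: "(cmod (fst (p k) - z))\<^sup>2 + (snd (p k))\<^sup>2 > 0" using sp[of k] by (simp add: add_nonneg_pos)
      have "snd (SL2C_act C x) = snd (p k) * q / ((cmod (fst (p k) - z))\<^sup>2 + (snd (p k))\<^sup>2)"
        using hgt[of k] q(2)[OF pH[of k]] unfolding Some by simp
      hence "snd (SL2C_act C x) * ((cmod (fst (p k) - z))\<^sup>2 + (snd (p k))\<^sup>2) = snd (p k) * q"
        using pos by (metis nonzero_eq_divide_eq less_irrefl)
      hence "(cmod (fst (p k) - z))\<^sup>2 + (snd (p k))\<^sup>2 = snd (p k) * q / snd (SL2C_act C x)"
        using hx by (metis nonzero_mult_div_cancel_left order_less_imp_not_eq2)
      thus ?thesis unfolding M_def by (simp add: mult.commute)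
    qed
    have tM: "snd (p k) \<le> M" for k
    proof -
      have "snd (p k) * snd (p k) \<le> M * snd (p k)" using eq[of k] zero_le_power2[of "cmod (fst (p k) - z)"]
        unfolding power2_eq_square[of "snd (p k)"] by linarith
      thus ?thesis using sp[of k] by (rule mult_right_le_imp_le)
    qed
    \<comment> \<open>The part of the horosphere at height at least \<open>e\<close> is bounded in
      the hyperbolic metric, so the orbit eventually drops below it.\<close>
    have small: "eventually (\<lambda>k. snd (p k) < e) sequentially" if e: "e > 0" for e
    proof -
      define b where "b = ((cmod (fst x - z) + M)\<^sup>2 + (snd x)\<^sup>2 + M\<^sup>2) / (2 * snd x * e)"
      have sx: "snd x > 0" using xH by (simp add: H3_def)
      show ?thesis using div[of "2 * b"]
      proof (rule eventually_mono)
        fix k assume k: "2 * b < hdist x (p k)"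
        show "snd (p k) < e"
        proof (rule ccontr)
          assume "\<not> snd (p k) < e"
          hence ek: "e \<le> snd (p k)" by simp
          have "(cmod (fst (p k) - z))\<^sup>2 \<le> M * M"
            using eq[of k] zero_le_power2[of "snd (p k)"] mult_left_mono[OF tM[of k], of M] M by linarith
          hence "(cmod (fst (p k) - z))\<^sup>2 \<le> M\<^sup>2" unfolding power2_eq_square[of M] .
          hence zM: "cmod (fst (p k) - z) \<le> M" using M by (rule power2_le_imp_le[OF _ less_imp_le])
          have "fst x - fst (p k) = (fst x - z) - (fst (p k) - z)" by simp
          hence "cmod (fst x - fst (p k)) \<le> cmod (fst x - z) + cmod (fst (p k) - z)"
            by (metis norm_triangle_ineq4)
          hence "cmod (fst x - fst (p k)) \<le> cmod (fst x - z) + M" using zM by linarith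
          hence "(cmod (fst x - fst (p k)))\<^sup>2 \<le> (cmod (fst x - z) + M)\<^sup>2" by (rule power_mono) simp
          moreover have "(snd (p k))\<^sup>2 \<le> M\<^sup>2" using tM[of k] sp[of k] by (intro power_mono) auto
          ultimately have "cosh (hdist x (p k)) \<le> b"
            unfolding cosh_hdist_coord[OF xH pH] b_def
            by (intro frac_le add_mono mult_left_mono mult_pos_pos order_refl ek e sx add_nonneg_nonneg zero_le_power2
                zero_less_numeral mult_nonneg_nonneg less_imp_le[OF sx] zero_le_numeral)
          hence "hdist x (p k) \<le> 2 * b" by (rule hdist_le_cosh_bound[OF xH pH])
          thus False using k by linarith
        qed
      qed
    qed
    have "(p \<longlongrightarrow> (z, 0)) sequentially"
    proof (rule tendstoI)
      fix e :: real assume e: "e > 0"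
      have "e\<^sup>2 / M > 0" using e M by simp
      show "eventually (\<lambda>k. dist (p k) (z, 0) < e) sequentially"
        using small[OF \<open>e\<^sup>2 / M > 0\<close>]
      proof (rule eventually_mono)
        fix k assume "snd (p k) < e\<^sup>2 / M"
        hence "M * snd (p k) < e\<^sup>2" using M by (simp add: pos_less_divide_eq mult.commute)
        hence "(dist (p k) (z, 0))\<^sup>2 < e\<^sup>2" unfolding dist_hpoint using eq[of k] by simp
        thus "dist (p k) (z, 0) < e" using square_less_iff[of "dist (p k) (z, 0)" e] e by simp
      qed
    qed
    thus ?thesis by (simp add: tendsto_ideal_def Some)
  qed
  moreover have "range (\<lambda>k. \<rho> (reduce_word (wpow u k))) \<subseteq> \<Gamma>" using pow_in_Fn[OF u(1)] by blast
  ultimately show ?thesis unfolding limit_set_def p_def using xH by blast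
qed

lemma open_B: "\<xi> \<in> PF \<Longrightarrow> open (B \<xi>)"
  using horoball_normal[OF horoball_at_B[of \<xi>]] open_horoset by metis

text \<open>The geodesic line joining the two points lies in the hull and meets two different
  horoballs. Being connected, it is not covered by pairwise disjoint open sets that it meets in this
  way. The lemma supplies the base point.\<close>

lemma hull_outside_nonempty:
  assumes "\<xi> \<in> PF" "\<eta> \<in> PF" "\<xi> \<noteq> \<eta>"
  shows "hhull (limit_set \<Gamma>) - \<Union>(B ` PF) \<noteq> {}"
proof -
  have "\<exists>\<gamma> \<xi> \<eta>. \<xi> \<in> PF \<and> \<eta> \<in> PF \<and> \<xi> \<noteq> \<eta> \<and> geodesic_line \<gamma> \<and> continuous_on UNIV \<gamma> \<and> tendsto_ideal \<gamma> \<xi> at_bot \<and> tendsto_ideal \<gamma> \<eta> at_top \<and>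
    (\<forall>H. horoball_at \<xi> H \<longrightarrow> (\<exists>s. \<gamma> s \<in> H)) \<and> (\<forall>H. horoball_at \<eta> H \<longrightarrow> (\<exists>s. \<gamma> s \<in> H))"
  proof (cases \<xi>)
    case None
    then obtain b where "\<eta> = Some b" using assms(3) by (cases \<eta>) auto
    thus ?thesis using line_finite_infinity[of b] assms None by blast
  next
    case (Some a)
    show ?thesis
    proof (cases \<eta>)
      case None
      thus ?thesis using line_finite_infinity[of a] assms Some by blast
    next
      case S: (Some b)
      hence "a \<noteq> b" using assms(3) Some by simp
      thus ?thesis using line_finite_finite[of a b] assms(1,2) Some S by blast
    qed
  qed
  then obtain \<gamma> \<xi> \<eta> where \<gamma>: "\<xi> \<in> PF" "\<eta> \<in> PF" "\<xi> \<noteq> \<eta>" "geodesic_line \<gamma>" "continuous_on UNIV \<gamma>"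
    "tendsto_ideal \<gamma> \<xi> at_bot" "tendsto_ideal \<gamma> \<eta> at_top" "\<exists>s. \<gamma> s \<in> B \<xi>" "\<exists>s. \<gamma> s \<in> B \<eta>"
    using horoball_at_B by blast
  have hull: "range \<gamma> \<subseteq> hhull (limit_set \<Gamma>)"
    unfolding hhull_def using \<gamma>(4,6,7) PF_in_limit_set[OF \<gamma>(1)] PF_in_limit_set[OF \<gamma>(2)] by blast
  show ?thesis
  proof
    assume "hhull (limit_set \<Gamma>) - \<Union>(B ` PF) = {}"
    hence cov: "range \<gamma> \<subseteq> B \<xi> \<union> \<Union>(B ` (PF - {\<xi>}))" using hull by blast
    have "open (\<Union>(B ` (PF - {\<xi>})))" using open_B by blast
    moreover have "connected (range \<gamma>)" using connected_continuous_image[OF \<gamma>(5)] by simp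
    moreover have "B \<xi> \<inter> \<Union>(B ` (PF - {\<xi>})) = {}" using B_disjoint[OF \<gamma>(1)] by blast
    moreover have "B \<xi> \<inter> range \<gamma> \<noteq> {}" using \<gamma>(8) by blast
    moreover have "\<Union>(B ` (PF - {\<xi>})) \<inter> range \<gamma> \<noteq> {}" using \<gamma>(2,3,9) by blast
    ultimately show False
      using connectedD[of "range \<gamma>" "B \<xi>" "\<Union>(B ` (PF - {\<xi>}))"] open_B[OF \<gamma>(1)] cov by blast
  qed
qed

end

text \<open>Stated for all points, because the compact set of \<open>geometrically_finite\<close> is
  not given as a subset of \<open>H3\<close>; the trivial element then places it inside the
  hull.\<close>

lemma act_one_any: "act \<one>\<^bsub>PSL2C\<^esub> p = p"
  by (cases p) (simp add: PSL2C_one act_def proj_def SL2C_act_def Let_def)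

text \<open>\<open>H3\<close> is itself one of the convex sets in the intersection.\<close>

lemma hhull_subset_H3: "hhull \<Lambda> \<subseteq> H3"
  unfolding hhull_def by (rule Inter_lower) (auto simp: hconvex_def geodesic_segment_def geodesic_line_def)

lemma hhull_segment:
  assumes "p \<in> hhull \<Lambda>" "q \<in> hhull \<Lambda>" shows "geodesic_segment p q \<subseteq> hhull \<Lambda>"
  using assms unfolding hhull_def hconvex_def by blast

lemma Fn_not_commutative:
  assumes "n \<ge> 2" shows "\<exists>u\<in>carrier (Fn n). \<exists>v\<in>carrier (Fn n). u \<otimes>\<^bsub>Fn n\<^esub> v \<noteq> v \<otimes>\<^bsub>Fn n\<^esub> u"
proof -
  have C: "[(0, True)] \<in> carrier (Fn n)" "[(1, True)] \<in> carrier (Fn n)" using assms by (auto simp: reduced_Cons)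
  have "[(0, True)] \<otimes>\<^bsub>Fn n\<^esub> [(1, True)] \<noteq> [(1, True)] \<otimes>\<^bsub>Fn n\<^esub> [(0, True)]"
    by (simp add: reduce_word_def inv_letter_def)
  with C show ?thesis by blast
qed

lemma Fn_int_pow:
  assumes c: "c \<in> carrier (Fn n)" "cyclically_reduced c"
  shows "\<exists>m. c [^]\<^bsub>Fn n\<^esub> (i::int) = wpow c m \<or> c [^]\<^bsub>Fn n\<^esub> i = wpow (inv_word c) m"
proof -
  have nat: "c [^]\<^bsub>Fn n\<^esub> (int m) = wpow c m" for m
    using cyclically_reduced_wpow[OF c(2), of m] by (simp add: int_pow_int Fn_pow)
  show ?thesis
  proof (cases "i \<ge> 0")
    case True
    then obtain m where "i = int m" using nonneg_int_cases by blast
    thus ?thesis using nat by blast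
  next
    case False
    then obtain m where m: "i = - int m" using neg_int_cases[of i] by force
    have "c [^]\<^bsub>Fn n\<^esub> i = inv\<^bsub>Fn n\<^esub> (wpow c m)" unfolding m using Fn.int_pow_neg[OF c(1)] nat by metis
    also have "\<dots> = inv_word (wpow c m)"
    proof (rule inv_free_group)
      have "fst ` set (wpow c m) \<subseteq> {0..<n}" using fst_set_wpow[of c m] c(1) by auto
      thus "wpow c m \<in> carrier (Fn n)" using cyclically_reduced_wpow[OF c(2)] by simp
    qed
    finally show ?thesis using inv_word_wpow by metis
  qed
qed

text \<open>The base point is taken in the hull outside the horoballs. By convexity geodesics
  between orbit points stay in the hull, so outside the horoballs they run through the translates of
  \<open>K\<close>, and \<open>K\<close> is within bounded distance of \<open>x\<close>.\<close>

theorem cusped_action_exists: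
  assumes n: "n \<ge> 2" and faithful: "faithful_rep n \<rho>" and disc: "discrete_in_PSL2C (\<rho> ` carrier (Fn n))"
    and gf: "geometrically_finite (\<rho> ` carrier (Fn n))" and oc: "one_cusp n \<rho> cl"
    and c: "c \<in> cl" "c \<in> carrier (Fn n)" "cyclically_reduced c" "c \<noteq> []"
  shows "\<exists>B0 x R0. cusped_action n (\<lambda>w. act (\<rho> (reduce_word w))) c B0 x R0"
proof -
  obtain B K where BK: "cusp_horoballs (\<rho> ` carrier (Fn n)) B" "compact K"
    "(\<Union>g\<in>\<rho> ` carrier (Fn n). act g ` K) = hhull (limit_set (\<rho> ` carrier (Fn n))) - \<Union>(B ` parabolic_fixed_points (\<rho> ` carrier (Fn n)))"
    using gf unfolding geometrically_finite_def by blast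
  interpret cusped_rep n \<rho> B using n faithful disc BK(1) by unfold_locales
  have conjP: "\<And>P Q. maximal_parabolic_subgroup \<Gamma> P \<Longrightarrow> maximal_parabolic_subgroup \<Gamma> Q \<Longrightarrow>
        \<exists>g\<in>\<Gamma>. Q = (\<lambda>p. g \<otimes>\<^bsub>PSL2C\<^esub> p \<otimes>\<^bsub>PSL2C\<^esub> inv\<^bsub>PSL2C\<^esub> g) ` P"
    using oc unfolding one_cusp_def Let_def by blast
  obtain g0 where g0: "g0 \<in> carrier (Fn n)" "maximal_parabolic_subgroup \<Gamma> (generate PSL2C {\<rho> g0})" "cl = conj_class (Fn n) g0"
    using oc unfolding one_cusp_def Let_def by blast
  define P0 where "P0 = generate PSL2C {\<rho> g0}"
  have rg0: "\<rho> g0 \<in> carrier PSL2C" using g0(1) by simp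
  obtain k where k: "k \<in> carrier (Fn n)" "c = k \<otimes>\<^bsub>Fn n\<^esub> g0 \<otimes>\<^bsub>Fn n\<^esub> inv\<^bsub>Fn n\<^esub> k"
    using c(1) unfolding g0(3) conj_class_def by blast
  have rk: "\<rho> k \<in> carrier PSL2C" using k(1) by simp
  have par: "subgroup P0 PSL2C" "P0 \<subseteq> \<Gamma>" "P0 \<noteq> {\<one>\<^bsub>PSL2C\<^esub>}" "\<exists>\<xi>. \<forall>g\<in>P0 - {\<one>\<^bsub>PSL2C\<^esub>}. parabolic_fixing \<xi> g"
    using g0(2) unfolding P0_def maximal_parabolic_subgroup_def parabolic_subgroup_def by blast+
  obtain \<xi>0 where \<xi>0: "\<forall>g\<in>P0 - {\<one>\<^bsub>PSL2C\<^esub>}. parabolic_fixing \<xi>0 g" using par(4) by blast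
  obtain g1 where g1: "g1 \<in> P0" "g1 \<noteq> \<one>\<^bsub>PSL2C\<^esub>" using par(3) subgroup.one_closed[OF par(1)] by blast
  have g1f: "parabolic_fixing \<xi>0 g1" "g1 \<in> \<Gamma>" using g1 \<xi>0 par(2) by blast+
  have \<xi>0PF: "\<xi>0 \<in> PF" using parabolic_in_PF[OF g1f(2,1)] .
  have P0fix: "act_ideal p \<xi>0 = \<xi>0" if "p \<in> P0" for p
  proof (cases "p = \<one>\<^bsub>PSL2C\<^esub>")
    case False
    hence "parabolic_fixing \<xi>0 p" using \<xi>0 that by blast
    thus ?thesis unfolding parabolic_fixing_def by blast
  qed (simp add: act_ideal_one)
  have sub: "P0 \<subseteq> stab \<xi>0" using P0fix par(2) by (auto simp: stab_def)
  \<comment> \<open>Maximality of \<open>P0\<close> identifies it with the full stabiliser of its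
    fixed point.\<close>
  have stab0: "stab \<xi>0 = P0"
    using g0(2) stab_maximal[OF \<xi>0PF] sub unfolding P0_def maximal_parabolic_subgroup_def by blast
  \<comment> \<open>The fixed point that belongs to the chosen representative \<open>c\<close>, a
    conjugate by \<open>k\<close> of the generator \<open>g0\<close> of \<open>P0\<close>.\<close>
  define \<xi>c where "\<xi>c = act_ideal (\<rho> k) \<xi>0"
  have \<xi>c: "\<xi>c \<in> PF" unfolding \<xi>c_def using PF_translate[OF \<xi>0PF] k(1) by blast
  have k_inv: "act_ideal (inv\<^bsub>PSL2C\<^esub> (\<rho> k)) \<xi>c = \<xi>0" unfolding \<xi>c_def by (rule act_ideal_inv[OF rk])
  have stabc: "\<exists>i::int. u = c [^]\<^bsub>Fn n\<^esub> i" if u: "u \<in> carrier (Fn n)" "act_ideal (\<rho> u) \<xi>c = \<xi>c" for u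
  proof -
    define v where "v = inv\<^bsub>Fn n\<^esub> k \<otimes>\<^bsub>Fn n\<^esub> u \<otimes>\<^bsub>Fn n\<^esub> k"
    have v: "v \<in> carrier (Fn n)" unfolding v_def using k(1) u(1) Fn.m_closed Fn.inv_closed by blast
    have ru: "\<rho> u \<in> carrier PSL2C" using u(1) by simp
    have "\<rho> v = \<rho> (inv\<^bsub>Fn n\<^esub> k \<otimes>\<^bsub>Fn n\<^esub> u) \<otimes>\<^bsub>PSL2C\<^esub> \<rho> k"
      unfolding v_def by (rule rho.hom_mult[OF Fn.m_closed[OF Fn.inv_closed[OF k(1)] u(1)] k(1)])
    also have "\<dots> = inv\<^bsub>PSL2C\<^esub> (\<rho> k) \<otimes>\<^bsub>PSL2C\<^esub> \<rho> u \<otimes>\<^bsub>PSL2C\<^esub> \<rho> k"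
      unfolding rho.hom_mult[OF Fn.inv_closed[OF k(1)] u(1)] rho.hom_inv[OF k(1)] ..
    finally have rv: "\<rho> v = inv\<^bsub>PSL2C\<^esub> (\<rho> k) \<otimes>\<^bsub>PSL2C\<^esub> \<rho> u \<otimes>\<^bsub>PSL2C\<^esub> \<rho> k" .
    have "act_ideal (\<rho> v) \<xi>0 = act_ideal (inv\<^bsub>PSL2C\<^esub> (\<rho> k)) (act_ideal (\<rho> u) (act_ideal (\<rho> k) \<xi>0))"
      unfolding rv act_ideal_mult[OF PSL.m_closed[OF PSL.inv_closed[OF rk] ru] rk] act_ideal_mult[OF PSL.inv_closed[OF rk] ru] ..
    also have "\<dots> = \<xi>0" using u(2) k_inv by (simp flip: \<xi>c_def)
    finally have "\<rho> v \<in> stab \<xi>0" using v unfolding stab_def by blast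
    hence "\<rho> v \<in> generate PSL2C {\<rho> g0}" using stab0 P0_def by simp
    then obtain i :: int where "\<rho> v = \<rho> g0 [^]\<^bsub>PSL2C\<^esub> i" using PSL.generate_pow[OF rg0] by auto
    hence "\<rho> v = \<rho> (g0 [^]\<^bsub>Fn n\<^esub> i)" using rho.hom_int_pow[OF g0(1)] by simp
    hence vi: "v = g0 [^]\<^bsub>Fn n\<^esub> i" using rho_inj v Fn.int_pow_closed[OF g0(1)] by (meson inj_onD)
    have u_v: "u = k \<otimes>\<^bsub>Fn n\<^esub> v \<otimes>\<^bsub>Fn n\<^esub> inv\<^bsub>Fn n\<^esub> k"
    proof -
      have "k \<otimes>\<^bsub>Fn n\<^esub> v \<otimes>\<^bsub>Fn n\<^esub> inv\<^bsub>Fn n\<^esub> k = (k \<otimes>\<^bsub>Fn n\<^esub> inv\<^bsub>Fn n\<^esub> k) \<otimes>\<^bsub>Fn n\<^esub> u \<otimes>\<^bsub>Fn n\<^esub> (k \<otimes>\<^bsub>Fn n\<^esub> inv\<^bsub>Fn n\<^esub> k)"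
        unfolding v_def using k(1) u(1) Fn.inv_closed[OF k(1)] by (simp only: Fn.m_assoc Fn.m_closed)
      thus ?thesis unfolding Fn.r_inv[OF k(1)] Fn.l_one[OF u(1)] Fn.r_one[OF u(1)] by (rule sym)
    qed
    have "(\<lambda>x. k \<otimes>\<^bsub>Fn n\<^esub> x \<otimes>\<^bsub>Fn n\<^esub> inv\<^bsub>Fn n\<^esub> k) \<in> hom (Fn n) (Fn n)" using Fn.conj_iso[OF k(1)] unfolding iso_def by blast
    then interpret cj: group_hom "Fn n" "Fn n" "\<lambda>x. k \<otimes>\<^bsub>Fn n\<^esub> x \<otimes>\<^bsub>Fn n\<^esub> inv\<^bsub>Fn n\<^esub> k"
      by (intro group_hom.intro free_group_is_group) (simp add: group_hom_axioms_def)
    have "u = c [^]\<^bsub>Fn n\<^esub> i" unfolding u_v vi k(2) by (rule cj.hom_int_pow[OF g0(1)])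
    thus ?thesis by blast
  qed
  have c_fix: "act_ideal (\<rho> c) \<xi>c = \<xi>c"
  proof -
    have rc: "\<rho> c = \<rho> k \<otimes>\<^bsub>PSL2C\<^esub> \<rho> g0 \<otimes>\<^bsub>PSL2C\<^esub> inv\<^bsub>PSL2C\<^esub> (\<rho> k)"
      unfolding k(2) rho.hom_mult[OF Fn.m_closed[OF k(1) g0(1)] Fn.inv_closed[OF k(1)]]
        rho.hom_mult[OF k(1) g0(1)] rho.hom_inv[OF k(1)] ..
    have "act_ideal (\<rho> c) \<xi>c = act_ideal (\<rho> k) (act_ideal (\<rho> g0) (act_ideal (inv\<^bsub>PSL2C\<^esub> (\<rho> k)) \<xi>c))"
      unfolding rc act_ideal_mult[OF PSL.m_closed[OF rk rg0] PSL.inv_closed[OF rk]] act_ideal_mult[OF rk rg0] ..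
    also have "\<dots> = \<xi>c" unfolding k_inv using P0fix[of "\<rho> g0"] by (simp add: P0_def generate.incl \<xi>c_def)
    finally show ?thesis .
  qed
  \<comment> \<open>A single conjugacy class of maximal parabolic subgroups means a single orbit of
    parabolic fixed points, because each stabiliser determines its fixed point.\<close>
  have orbit: "\<exists>u\<in>carrier (Fn n). \<xi> = act_ideal (\<rho> u) \<xi>c" if \<xi>: "\<xi> \<in> PF" for \<xi>
  proof -
    obtain g where g: "g \<in> \<Gamma>" "stab \<xi> = (\<lambda>p. g \<otimes>\<^bsub>PSL2C\<^esub> p \<otimes>\<^bsub>PSL2C\<^esub> inv\<^bsub>PSL2C\<^esub> g) ` P0"
      using conjP[OF g0(2) stab_maximal[OF \<xi>]] unfolding P0_def by blast
    obtain w where w: "w \<in> carrier (Fn n)" "g = \<rho> w" using g(1) by blast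
    have gC: "g \<in> carrier PSL2C" "g1 \<in> carrier PSL2C" using Gamma_carrier g(1) g1f(2) by blast+
    define h where "h = g \<otimes>\<^bsub>PSL2C\<^esub> g1 \<otimes>\<^bsub>PSL2C\<^esub> inv\<^bsub>PSL2C\<^esub> g"
    have hs: "h \<in> stab \<xi>" unfolding g(2) h_def using g1(1) by blast
    have h1: "h \<noteq> \<one>\<^bsub>PSL2C\<^esub>"
    proof
      assume "h = \<one>\<^bsub>PSL2C\<^esub>"
      hence "g \<otimes>\<^bsub>PSL2C\<^esub> g1 = inv\<^bsub>PSL2C\<^esub> (inv\<^bsub>PSL2C\<^esub> g)"
        unfolding h_def by (intro PSL.inv_equality[symmetric] PSL.m_closed gC PSL.inv_closed)
      hence "g \<otimes>\<^bsub>PSL2C\<^esub> g1 = g" unfolding PSL.inv_inv[OF gC(1)] .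
      thus False using PSL.l_cancel_one[OF gC] g1(2) by blast
    qed
    have "act_ideal h (act_ideal g \<xi>0) = act_ideal g (act_ideal g1 (act_ideal (inv\<^bsub>PSL2C\<^esub> g) (act_ideal g \<xi>0)))"
      unfolding h_def act_ideal_mult[OF PSL.m_closed[OF gC] PSL.inv_closed[OF gC(1)]] act_ideal_mult[OF gC] ..
    also have "\<dots> = act_ideal g \<xi>0" unfolding act_ideal_inv[OF gC(1)] using P0fix[OF g1(1)] by simp
    finally have "act_ideal g \<xi>0 = \<xi>" using stab_parabolic[OF \<xi> hs h1] unfolding parabolic_fixing_def by blast
    hence "\<xi> = act_ideal (\<rho> w \<otimes>\<^bsub>PSL2C\<^esub> inv\<^bsub>PSL2C\<^esub> (\<rho> k)) \<xi>c"
      using act_ideal_mult[OF gC(1) PSL.inv_closed[OF rk], of \<xi>c] k_inv w(2) by simp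
    also have "\<rho> w \<otimes>\<^bsub>PSL2C\<^esub> inv\<^bsub>PSL2C\<^esub> (\<rho> k) = \<rho> (w \<otimes>\<^bsub>Fn n\<^esub> inv\<^bsub>Fn n\<^esub> k)"
      unfolding rho.hom_mult[OF w(1) Fn.inv_closed[OF k(1)]] rho.hom_inv[OF k(1)] ..
    finally show ?thesis using Fn.m_closed[OF w(1) Fn.inv_closed[OF k(1)]] by blast
  qed
  \<comment> \<open>Otherwise all of the free group would consist of powers of \<open>c\<close>, but
    it is not commutative. This yields the two parabolic points needed for
    \<open>hull_outside_nonempty\<close>.\<close>
  have "\<exists>h\<in>carrier (Fn n). act_ideal (\<rho> h) \<xi>c \<noteq> \<xi>c"
  proof (rule ccontr)
    assume "\<not> ?thesis"
    hence pow: "\<exists>i::int. u = c [^]\<^bsub>Fn n\<^esub> i" if "u \<in> carrier (Fn n)" for u using stabc that by blast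
    obtain u v where uv: "u \<in> carrier (Fn n)" "v \<in> carrier (Fn n)" "u \<otimes>\<^bsub>Fn n\<^esub> v \<noteq> v \<otimes>\<^bsub>Fn n\<^esub> u"
      using Fn_not_commutative[OF n] by blast
    obtain i j :: int where ij: "u = c [^]\<^bsub>Fn n\<^esub> i" "v = c [^]\<^bsub>Fn n\<^esub> j" using pow uv by meson
    have "u \<otimes>\<^bsub>Fn n\<^esub> v = c [^]\<^bsub>Fn n\<^esub> (i + j)" "v \<otimes>\<^bsub>Fn n\<^esub> u = c [^]\<^bsub>Fn n\<^esub> (j + i)"
      unfolding ij Fn.int_pow_mult[OF c(2)] by (rule refl)+
    thus False using uv(3) by (simp add: add.commute)
  qed
  then obtain h where h: "h \<in> carrier (Fn n)" "act_ideal (\<rho> h) \<xi>c \<noteq> \<xi>c" by blast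
  have hPF: "act_ideal (\<rho> h) \<xi>c \<in> PF" using PF_translate[OF \<xi>c] h(1) by blast
  define Y where "Y = hhull (limit_set \<Gamma>) - \<Union>(B ` PF)"
  have Y: "(\<Union>g\<in>\<Gamma>. act g ` K) = Y" unfolding Y_def by (rule BK(3))
  obtain x where x: "x \<in> Y" using hull_outside_nonempty[OF \<xi>c hPF h(2)[symmetric]] unfolding Y_def ex_in_conv[symmetric] by blast
  have YH: "Y \<subseteq> H3" using hhull_subset_H3 unfolding Y_def by blast
  have xH: "x \<in> H3" using x YH by blast
  have one\<Gamma>: "\<one>\<^bsub>PSL2C\<^esub> \<in> \<Gamma>" using Gamma_subgroup by (rule subgroup.one_closed)
  have KY: "K \<subseteq> Y"
  proof
    fix q assume "q \<in> K"
    hence "act \<one>\<^bsub>PSL2C\<^esub> q \<in> (\<Union>g\<in>\<Gamma>. act g ` K)" using one\<Gamma> by blast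
    thus "q \<in> Y" unfolding Y act_one_any .
  qed
  have KH: "q \<in> H3" if "q \<in> K" for q using that KY YH by blast
  have Yinv: "act g y \<in> Y" if g: "g \<in> \<Gamma>" and y: "y \<in> Y" for g y
  proof -
    obtain g' q where q: "g' \<in> \<Gamma>" "q \<in> K" "y = act g' q" using y unfolding Y[symmetric] by blast
    have "act g y = act (g \<otimes>\<^bsub>PSL2C\<^esub> g') q"
      unfolding q(3) by (rule act_mult[OF Gamma_carrier[OF g] Gamma_carrier[OF q(1)] KH[OF q(2)], symmetric])
    moreover have "g \<otimes>\<^bsub>PSL2C\<^esub> g' \<in> \<Gamma>" using subgroup.m_closed[OF Gamma_subgroup g q(1)] .
    ultimately show ?thesis unfolding Y[symmetric] using q(2) by blast
  qed
  have "\<exists>R0. \<forall>q\<in>K. hdist q x \<le> R0"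
  proof -
    have "continuous_on K (\<lambda>q. 1 + (dist q x)\<^sup>2 / (2 * snd q * snd x))"
    proof (intro continuous_intros ballI)
      fix q assume "q \<in> K"
      hence "snd q > 0" "snd x > 0" using KH xH unfolding H3_def by blast+
      thus "2 * snd q * snd x \<noteq> 0" by simp
    qed
    hence "bounded ((\<lambda>q. 1 + (dist q x)\<^sup>2 / (2 * snd q * snd x)) ` K)"
      using BK(2) compact_continuous_image compact_imp_bounded by blast
    then obtain b where b: "\<And>q. q \<in> K \<Longrightarrow> norm (1 + (dist q x)\<^sup>2 / (2 * snd q * snd x)) \<le> b"
      unfolding bounded_iff by blast
    have "hdist q x \<le> 2 * b" if q: "q \<in> K" for q
    proof (rule hdist_le_cosh_bound[OF KH[OF q] xH])
      show "cosh (hdist q x) \<le> b" unfolding cosh_hdist_eq[OF KH[OF q] xH]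
        using b[OF q] unfolding real_norm_def by linarith
    qed
    thus ?thesis by blast
  qed
  then obtain R0 where R0: "\<And>q. q \<in> K \<Longrightarrow> hdist q x \<le> R0" by blast
  let ?\<beta> = "\<lambda>w. act (\<rho> (reduce_word w))"
  have red: "reduce_word w \<in> carrier (Fn n)" if "fst ` set w \<subseteq> {0..<n}" for w :: "nat word"
    using reduce_in_free_group[OF that] .
  have Bw: "?\<beta> w ` B \<xi>c = B (act_ideal (\<rho> (reduce_word w)) \<xi>c)" "act_ideal (\<rho> (reduce_word w)) \<xi>c \<in> PF"
    if w: "fst ` set w \<subseteq> {0..<n}" for w :: "nat word"
  proof -
    have "\<rho> (reduce_word w) \<in> \<Gamma>" using red[OF w] by blast
    thus "?\<beta> w ` B \<xi>c = B (act_ideal (\<rho> (reduce_word w)) \<xi>c)" "act_ideal (\<rho> (reduce_word w)) \<xi>c \<in> PF"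
      using B_equivariant[OF \<xi>c] PF_translate[OF \<xi>c] by simp_all
  qed
  have "cusped_action n ?\<beta> c (B \<xi>c) x R0"
  proof (unfold_locales)
    fix w :: "nat word" assume w: "fst ` set w \<subseteq> {0..<n}"
    obtain A where A: "det A = 1" "\<rho> (reduce_word w) = proj A" using PSL2C_lift[OF rho.hom_closed[OF red[OF w]]] by blast
    show "\<exists>A. det A = 1 \<and> (\<forall>p\<in>H3. ?\<beta> w p = SL2C_act A p)"
      using A act_proj[OF A(1)] by (intro exI[of _ A]) simp
    show "x \<notin> ?\<beta> w ` B \<xi>c" unfolding Bw(1)[OF w] using x Bw(2)[OF w] unfolding Y_def by blast
    show "\<exists>m. reduce_word w = wpow c m \<or> reduce_word w = wpow (inv_word c) m" if "?\<beta> w ` B \<xi>c \<inter> B \<xi>c \<noteq> {}"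
    proof -
      have "act_ideal (\<rho> (reduce_word w)) \<xi>c = \<xi>c"
        using that B_disjoint[OF Bw(2)[OF w] \<xi>c] unfolding Bw(1)[OF w] by blast
      then obtain i :: int where i: "reduce_word w = c [^]\<^bsub>Fn n\<^esub> i" using stabc[OF red[OF w]] by blast
      show ?thesis unfolding i by (rule Fn_int_pow[OF c(2,3)])
    qed
  next
    fix u v :: "nat word" and p assume uv: "fst ` set u \<subseteq> {0..<n}" "fst ` set v \<subseteq> {0..<n}" and p: "p \<in> H3"
    have "\<rho> (reduce_word (u @ v)) = \<rho> (reduce_word u) \<otimes>\<^bsub>PSL2C\<^esub> \<rho> (reduce_word v)"
      using rho.hom_mult[OF red[OF uv(1)] red[OF uv(2)]] by simp
    thus "?\<beta> (u @ v) p = ?\<beta> u (?\<beta> v p)"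
      using act_mult[OF rho.hom_closed[OF red[OF uv(1)]] rho.hom_closed[OF red[OF uv(2)]] p] by simp
  next
    fix w :: "nat word" show "?\<beta> (reduce_word w) = ?\<beta> w" by simp
  next
    fix p show "?\<beta> [] p = p" using rho.hom_one act_one_any by simp
  next
    fix R
    have "{w \<in> carrier (Fn n). hdist x (?\<beta> w x) \<le> R} \<subseteq> {u \<in> carrier (Fn n). hdist x (act (\<rho> u) x) \<le> R}" by auto
    thus "finite {w \<in> carrier (Fn n). hdist x (?\<beta> w x) \<le> R}"
      using word_displacement_finite[OF xH] by (rule finite_subset)
  next
    show "c \<in> carrier (Fn n)" "cyclically_reduced c" "c \<noteq> []" by (rule c)+
    show "x \<in> H3" by (rule xH)
    show "\<exists>C. det C = 1 \<and> B \<xi>c = horoset C" using horoball_normal[OF horoball_at_B[OF \<xi>c]] by blast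
    have "reduce_word c = c" using c(3) by (simp add: cyclically_reduced_def)
    thus "?\<beta> c ` B \<xi>c = B \<xi>c" using B_equivariant[OF \<xi>c, of "\<rho> c"] c(2) c_fix by simp
  next
    fix g h s
    assume g: "g \<in> carrier (Fn n)" and h: "h \<in> carrier (Fn n)" and s: "0 \<le> s" "s \<le> hdist (?\<beta> g x) (?\<beta> h x)"
      and out: "\<forall>w. fst ` set w \<subseteq> {0..<n} \<longrightarrow> geod (?\<beta> g x) (?\<beta> h x) s \<notin> ?\<beta> w ` B \<xi>c"
    define y where "y = geod (?\<beta> g x) (?\<beta> h x) s"
    have rr: "reduce_word g = g" "reduce_word h = h" using g h by simp_all
    have gY: "?\<beta> g x \<in> Y" "?\<beta> h x \<in> Y" unfolding rr using Yinv[OF _ x] g h by blast+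
    have gH: "?\<beta> g x \<in> H3" "?\<beta> h x \<in> H3" using gY YH by blast+
    have "y \<in> geodesic_segment (?\<beta> g x) (?\<beta> h x)" unfolding y_def using geod_in_segment[OF gH s] .
    hence yh: "y \<in> hhull (limit_set \<Gamma>)" using hhull_segment[of "?\<beta> g x" _ "?\<beta> h x"] gY unfolding Y_def by blast
    have "y \<notin> B \<xi>" if \<xi>: "\<xi> \<in> PF" for \<xi>
    proof -
      obtain u where u: "u \<in> carrier (Fn n)" "\<xi> = act_ideal (\<rho> u) \<xi>c" using orbit[OF \<xi>] by blast
      have wu: "fst ` set u \<subseteq> {0..<n}" "reduce_word u = u" using u(1) by simp_all
      have "B \<xi> = ?\<beta> u ` B \<xi>c" using Bw(1)[OF wu(1)] unfolding wu(2) u(2) by (rule sym)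
      thus ?thesis using out wu(1) unfolding y_def by blast
    qed
    hence "y \<in> Y" using yh unfolding Y_def by blast
    then obtain g' q where q: "g' \<in> \<Gamma>" "q \<in> K" "y = act g' q" unfolding Y[symmetric] by blast
    obtain u where u: "u \<in> carrier (Fn n)" "g' = \<rho> u" using q(1) by blast
    have "hdist y (?\<beta> u x) = hdist q x"
      unfolding q(3) u(2) using act_isometry[OF rho.hom_closed[OF u(1)] rho.hom_closed[OF u(1)] KH[OF q(2)] xH] u(1) by simp
    hence "hdist y (?\<beta> u x) \<le> R0" using R0[OF q(2)] by simp
    thus "\<exists>k\<in>carrier (Fn n). hdist (geod (?\<beta> g x) (?\<beta> h x) s) (?\<beta> k x) \<le> R0" using u(1) unfolding y_def by blast
  qed
  thus ?thesis by blast
qed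

section \<open>Axes in the Cayley graph\<close>

lemma reduce_inv_word: "reduce_word (inv_word w) = inv_word (reduce_word w)"
proof -
  have "reduce_word (inv_word w) = reduce_word (inv_word w @ reduce_word w @ inv_word (reduce_word w))"
    by (rule reduce_cancel_mid(1)[symmetric])
  also have "\<dots> = reduce_word (inv_word w @ w @ inv_word (reduce_word w))" by (rule reduce_append_mid)
  also have "\<dots> = inv_word (reduce_word w)" by simp
  finally show ?thesis .
qed

lemma sublist_inv_word: "sublist u v \<Longrightarrow> sublist (inv_word u) (inv_word v)"
  unfolding sublist_def by (metis append_assoc inv_word_simps(3))

definition word_dist :: "nat word \<Rightarrow> nat word \<Rightarrow> nat" where
  "word_dist u v = length (reduce_word (inv_word u @ v))"

lemma word_dist_sym: "word_dist u v = word_dist v u"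
proof -
  have "reduce_word (inv_word u @ v) = inv_word (reduce_word (inv_word v @ u))"
    unfolding reduce_inv_word[symmetric] by simp
  thus ?thesis by (simp add: word_dist_def)
qed

lemma word_dist_triangle: "word_dist u w \<le> word_dist u v + word_dist v w"
proof -
  have "reduce_word (inv_word u @ w) = reduce_word (reduce_word (inv_word u @ v) @ reduce_word (inv_word v @ w))"
    by simp
  also have "length \<dots> \<le> length (reduce_word (inv_word u @ v) @ reduce_word (inv_word v @ w))"
    by (rule length_reduce_le)
  finally show ?thesis by (simp add: word_dist_def)
qed

lemma adjacent_carrier: "adjacent n g h \<Longrightarrow> g \<in> carrier (Fn n)" "adjacent n g h \<Longrightarrow> h \<in> carrier (Fn n)"
  unfolding adjacent_def by blast+

lemma adjacent_letter:
  assumes "adjacent n g h" shows "\<exists>i<n. \<exists>e. h = reduce_word (g @ [(i, e)]) \<and> reduce_word (inv_word g @ h) = [(i, e)]"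
proof -
  have C: "reduced g" "reduced h" using assms unfolding adjacent_def by simp_all
  obtain i where i: "i < n" "h = reduce_word (g @ [(i, True)]) \<or> g = reduce_word (h @ [(i, True)])"
    using assms unfolding adjacent_def by auto
  have "\<exists>e. h = reduce_word (g @ [(i, e)])"
  proof (cases "h = reduce_word (g @ [(i, True)])")
    case False
    hence "g = reduce_word (h @ [(i, True)])" using i(2) by blast
    hence "reduce_word (g @ inv_word [(i, True)]) = reduce_word (h @ [(i, True)] @ inv_word [(i, True)])" by simp
    also have "\<dots> = reduce_word h" by (rule reduce_cancel_mid(1))
    finally have "h = reduce_word (g @ [(i, False)])" using C(2) by (simp add: inv_letter_def)
    thus ?thesis by blast
  qed blast
  then obtain e where e: "h = reduce_word (g @ [(i, e)])" by blast
  have "reduce_word (inv_word g @ h) = reduce_word [(i, e)]" unfolding e by simp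
  hence "reduce_word (inv_word g @ h) = [(i, e)]" by (simp add: reduced_Cons reduced_def)
  thus ?thesis using e i(1) by blast
qed

lemma adjacent_neq: "adjacent n g h \<Longrightarrow> g \<noteq> h"
  using adjacent_letter[of n g h] by force

lemma adjacent_dist: "adjacent n g h \<Longrightarrow> word_dist g h = 1"
  using adjacent_letter[of n g h] unfolding word_dist_def by force

lemma edge_point_pos: "edge_point g h s u > 0 \<Longrightarrow> u = g \<or> u = h"
  by (auto simp: edge_point_def vertex_def split: if_splits)

lemma edge_point_values:
  assumes "g \<noteq> h" shows "edge_point g h s g = 1 - s" "edge_point g h s h = s"
  using assms by (simp_all add: edge_point_def vertex_def)

lemma cayley_le_1: "p \<in> cayley n \<Longrightarrow> p u \<le> 1"
  unfolding cayley_def edge_point_def vertex_def by auto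

lemma cayley_support:
  assumes "p \<in> cayley n" shows "\<exists>u. p u > 0"
proof -
  obtain g h s where e: "adjacent n g h" "0 \<le> s" "s \<le> 1" "p = edge_point g h s" using assms unfolding cayley_def by blast
  have "p g = 1 - s" "p h = s" unfolding e(4) using edge_point_values[OF adjacent_neq[OF e(1)]] by blast+
  hence "p g > 0 \<or> p h > 0" by linarith
  thus ?thesis by blast
qed

lemma support_carrier:
  assumes "p \<in> cayley n" "p u > 0" shows "u \<in> carrier (Fn n)"
proof -
  obtain g h s where e: "adjacent n g h" "p = edge_point g h s" using assms unfolding cayley_def by blast
  show ?thesis using edge_point_pos[of g h s u] assms(2) adjacent_carrier[OF e(1)] unfolding e(2) by blast
qed

lemma word_dist_self [simp]: "word_dist u u = 0"
  by (simp add: word_dist_def reduce_word_def[of "[]"])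

lemma edge_dist_le:
  assumes "adjacent n g h" "u = g \<or> u = h" "v = g \<or> v = h" shows "word_dist u v \<le> 1"
  using assms(2,3) adjacent_dist[OF assms(1)] word_dist_sym[of h g] by auto

lemma support_dist:
  assumes "p \<in> cayley n" "p u > 0" "p v > 0" shows "word_dist u v \<le> 1"
proof -
  obtain g h s where e: "adjacent n g h" "p = edge_point g h s" using assms(1) unfolding cayley_def by blast
  show ?thesis using edge_dist_le[OF e(1) edge_point_pos[of g h s u] edge_point_pos[of g h s v]] assms(2,3) unfolding e(2) by blast
qed

text \<open>A point has distance less than 1 from a vertex with positive coordinate, whence the 2.
  The infimum has to be bounded below over both kinds of paths, where vertices supporting one point
  are at most 1 apart.\<close>

lemma cayley_dist_word_dist:
  assumes p: "p \<in> cayley n" "p u > 0" and q: "q \<in> cayley n" "q v > 0"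
  shows "\<bar>cayley_dist n p q - word_dist u v\<bar> \<le> 2"
proof -
  define S1 where "S1 = {\<bar>s - t\<bar> | s t. \<exists>g h. adjacent n g h \<and> s \<in> {0..1} \<and> t \<in> {0..1} \<and>
        p = edge_point g h s \<and> q = edge_point g h t}"
  define S2 where "S2 = {(1 - p u) + length (inv\<^bsub>Fn n\<^esub> u \<otimes>\<^bsub>Fn n\<^esub> v) + (1 - q v) | u v.
        u \<in> carrier (Fn n) \<and> v \<in> carrier (Fn n) \<and> p u > 0 \<and> q v > 0}"
  have cd: "cayley_dist n p q = Inf (S1 \<union> S2)" unfolding cayley_dist_def S1_def S2_def ..
  have wd: "real (length (inv\<^bsub>Fn n\<^esub> u \<otimes>\<^bsub>Fn n\<^esub> v)) = real (word_dist u v)" if "u \<in> carrier (Fn n)" for u v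
    unfolding inv_free_group[OF that] word_dist_def by simp
  have uv: "u \<in> carrier (Fn n)" "v \<in> carrier (Fn n)" using support_carrier[OF p] support_carrier[OF q] by blast+
  have ge: "0 \<le> z \<and> real (word_dist u v) - 2 \<le> z" if z: "z \<in> S1 \<union> S2" for z
  proof (cases "z \<in> S1")
    case True
    then obtain s t g h where e: "z = \<bar>s - t\<bar>" "adjacent n g h" "p = edge_point g h s" "q = edge_point g h t"
      unfolding S1_def by blast
    have "word_dist u v \<le> 1" using edge_dist_le[OF e(2) edge_point_pos[of g h s u] edge_point_pos[of g h t v]] p(2) q(2) e(3,4) by blast
    thus ?thesis unfolding e(1) by simp
  next
    case False
    then obtain u' v' where e: "z = (1 - p u') + length (inv\<^bsub>Fn n\<^esub> u' \<otimes>\<^bsub>Fn n\<^esub> v') + (1 - q v')"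
      "u' \<in> carrier (Fn n)" "p u' > 0" "q v' > 0" using z unfolding S2_def by blast
    have z': "z = (1 - p u') + real (word_dist u' v') + (1 - q v')" unfolding e(1) wd[OF e(2)] ..
    have "word_dist u v \<le> word_dist u u' + (word_dist u' v' + word_dist v' v)"
      using word_dist_triangle[of u v u'] word_dist_triangle[of u' v v'] by linarith
    moreover have "word_dist u u' \<le> 1" "word_dist v' v \<le> 1"
      using support_dist[OF p e(3)] support_dist[OF q(1) e(4) q(2)] by blast+
    ultimately have "real (word_dist u v) - 2 \<le> real (word_dist u' v')" by linarith
    thus ?thesis unfolding z' using cayley_le_1[OF p(1), of u'] cayley_le_1[OF q(1), of v'] by linarith
  qed
  have mem: "(1 - p u) + real (word_dist u v) + (1 - q v) \<in> S1 \<union> S2"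
    unfolding S2_def wd[OF uv(1), symmetric] using uv p(2) q(2) by blast
  have "Inf (S1 \<union> S2) \<le> (1 - p u) + real (word_dist u v) + (1 - q v)"
    by (rule cInf_lower[OF mem]) (rule bdd_belowI[of _ 0], use ge in blast)
  moreover have "real (word_dist u v) - 2 \<le> Inf (S1 \<union> S2)"
    by (rule cInf_greatest) (use mem ge in blast)+
  ultimately show ?thesis unfolding cd using p(2) q(2) by linarith
qed

lemma common_prefix: "\<exists>p u' v'. u = p @ u' \<and> v = p @ v' \<and> (u' = [] \<or> v' = [] \<or> hd u' \<noteq> hd v')"
proof (induction u arbitrary: v)
  case (Cons a u)
  show ?case
  proof (cases "v \<noteq> [] \<and> hd v = a")
    case True
    then obtain v1 where v1: "v = a # v1" by (cases v) auto
    obtain p u' v' where "u = p @ u'" "v1 = p @ v'" "u' = [] \<or> v' = [] \<or> hd u' \<noteq> hd v'" using Cons by blast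
    thus ?thesis unfolding v1 by (intro exI[of _ "a # p"] exI[of _ u'] exI[of _ v']) auto
  qed (rule exI[of _ "[]"], auto)
qed auto

text \<open>After removal of the common prefix nothing cancels between the two rests, so the excess
  of the detour over \<open>b\<close> is exactly twice the length of \<open>b'\<close>.\<close>

lemma near_prefix:
  assumes "reduced w" "reduced b" "length b + length (reduce_word (inv_word w @ b)) \<le> length w + 2 * K"
  shows "\<exists>p b'. prefix p w \<and> b = p @ b' \<and> length b' \<le> K"
proof -
  obtain p w' b' where e: "w = p @ w'" "b = p @ b'" "w' = [] \<or> b' = [] \<or> hd w' \<noteq> hd b'" using common_prefix[of w b] by blast
  have "reduced (inv_word w' @ b')"
  proof (cases "w' = []")
    case False
    have "last (inv_word w') = inv_letter (hd w')" using False by (cases w') auto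
    thus ?thesis using assms(1,2) e by (auto simp: reduced_append)
  qed (use assms(2) e(2) in \<open>simp add: reduced_append\<close>)
  hence "reduce_word (inv_word w @ b) = inv_word w' @ b'" unfolding e(1,2) by simp
  hence "length b' \<le> K" using assms(3) unfolding e(1,2) by simp
  thus ?thesis using e(1,2) by (intro exI[of _ p] exI[of _ b']) simp
qed

lemma reduced_conj_wpow:
  assumes "reduced (a @ w @ inv_word a)" "cyclically_reduced w" "w \<noteq> []"
  shows "reduced (a @ wpow w (Suc k) @ inv_word a)"
proof -
  have P: "reduced (wpow w (Suc k))" by (rule cyclically_reduced_wpow[OF assms(2)])
  have h: "hd (wpow w (Suc k)) = hd w" using assms(3) by simp
  have l: "last (wpow w (Suc k)) = last w" unfolding wpow_Suc_right using assms(3) by simp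
  have ne: "wpow w (Suc k) \<noteq> []" using assms(3) by simp
  show ?thesis using assms(1) P h l ne assms(3) by (simp add: reduced_append del: wpow_simps)
qed

lemma reduce_conj_wpow: "reduce_word (u @ wpow (inv_word u @ g @ u) k) = reduce_word (wpow g k @ u)"
proof (induction k)
  case (Suc k)
  have "reduce_word (u @ wpow (inv_word u @ g @ u) (Suc k)) = reduce_word (g @ reduce_word (u @ wpow (inv_word u @ g @ u) k))"
    by simp
  also have "\<dots> = reduce_word (g @ wpow g k @ u)" unfolding Suc by simp
  finally show ?case by simp
qed simp

lemma reduce_wpow_cong: "reduce_word u = reduce_word v \<Longrightarrow> reduce_word (wpow u k) = reduce_word (wpow v k)"
proof (induction k)
  case (Suc k)
  have "reduce_word (wpow u (Suc k)) = reduce_word (reduce_word u @ reduce_word (wpow u k))" by simp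
  also have "\<dots> = reduce_word (reduce_word v @ reduce_word (wpow v k))" using Suc by simp
  finally show ?case by simp
qed simp

lemma linear_bounded:
  fixes x b :: real
  assumes "\<And>k::nat. k \<ge> 1 \<Longrightarrow> \<bar>b + k * x\<bar> \<le> 2" shows "x = 0"
proof (rule ccontr)
  assume "x \<noteq> 0"
  then obtain k :: nat where k: "real k * \<bar>x\<bar> > 4 + \<bar>b\<bar>" using ex_less_of_nat_mult[of "\<bar>x\<bar>"] by auto
  have "\<bar>b + Suc k * x\<bar> \<le> 2" using assms[of "Suc k"] by simp
  moreover have "\<bar>Suc k * x\<bar> = real k * \<bar>x\<bar> + \<bar>x\<bar>"
    unfolding abs_mult abs_of_nat by (simp add: algebra_simps)
  ultimately show False using k by linarith
qed

text \<open>The leaf is given as an abstract isometric line, and its labels have to be recovered.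
  Comparing the distance from \<open>u\<close> to its translates by powers of \<open>g\<close>, once
  along the line and once in the word metric, forces the translation length to be the length of the
  cyclically reduced conjugate \<open>w\<close>, and \<open>u\<close> to lie next to the
  axis.\<close>

theorem primitive_leaf_words:
  assumes L: "primitive_leaf n L" and pq: "p \<in> L" "q \<in> L" "p u > 0" "q v > 0"
  shows "\<exists>w m a r b u' v'. {u', v'} = {u, v} \<and> primitive_element n w \<and> cyclically_reduced w \<and>
    sublist r (wpow w m) \<and> reduce_word (inv_word u' @ v') = reduce_word (a @ r @ b) \<and>
    length a \<le> 3 \<and> length b \<le> 3 \<and> fst ` set (a @ b) \<subseteq> {0..<n}"
proof -
  obtain g where g: "primitive_element n g" "axis_of n g L" using L unfolding primitive_leaf_def by blast
  obtain \<gamma> :: "real \<Rightarrow> cpoint" and l where \<gamma>: "L = range \<gamma>" "range \<gamma> \<subseteq> cayley n" "\<And>s t. cayley_dist n (\<gamma> s) (\<gamma> t) = \<bar>s - t\<bar>"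
    "l > 0" "\<And>t. cayley_act n g (\<gamma> t) = \<gamma> (t + l)" using g(2) unfolding axis_of_def by blast
  have \<gamma>C: "\<gamma> t \<in> cayley n" for t using \<gamma>(2) by blast
  have gC: "g \<in> carrier (Fn n)" using primitive_in_carrier[OF g(1)] .
  \<comment> \<open>The order of the two points along the line fixes the direction in which
    \<open>w\<close> is read; for the other order \<open>u\<close> and \<open>v\<close> change
    roles, hence \<open>u'\<close> and \<open>v'\<close>.\<close>
  have main: "\<exists>w m a r b. primitive_element n w \<and> cyclically_reduced w \<and>
    sublist r (wpow w m) \<and> reduce_word (inv_word u @ v) = reduce_word (a @ r @ b) \<and>
    length a \<le> 3 \<and> length b \<le> 3 \<and> fst ` set (a @ b) \<subseteq> {0..<n}"
    if st: "s \<le> t" and u: "\<gamma> s u > 0" and v: "\<gamma> t v > 0" for s t u v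
  proof -
    have uC: "u \<in> carrier (Fn n)" "v \<in> carrier (Fn n)" using support_carrier[OF \<gamma>C u] support_carrier[OF \<gamma>C v] by blast+
    hence uR: "reduced u" "reduced v" "fst ` set u \<subseteq> {0..<n}" "fst ` set v \<subseteq> {0..<n}" by simp_all
    have gR: "fst ` set g \<subseteq> {0..<n}" using gC by simp
    have translate: "\<gamma> (s + real k * l) (reduce_word (wpow g k @ u)) > 0" for k
    proof (induction k)
      case (Suc k)
      define y where "y = reduce_word (wpow g k @ u)"
      have y: "y \<in> carrier (Fn n)" using support_carrier[OF \<gamma>C Suc] unfolding y_def .
      have e: "reduce_word (wpow g (Suc k) @ u) = g \<otimes>\<^bsub>Fn n\<^esub> y" unfolding y_def by simp
      have c: "g \<otimes>\<^bsub>Fn n\<^esub> y \<in> carrier (Fn n)" using Fn.m_closed[OF gC y] .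
      have "\<gamma> (s + real k * l + l) (g \<otimes>\<^bsub>Fn n\<^esub> y) = \<gamma> (s + real k * l) (inv\<^bsub>Fn n\<^esub> g \<otimes>\<^bsub>Fn n\<^esub> (g \<otimes>\<^bsub>Fn n\<^esub> y))"
        unfolding \<gamma>(5)[symmetric] cayley_act_def using c by (simp only: if_True)
      also have "inv\<^bsub>Fn n\<^esub> g \<otimes>\<^bsub>Fn n\<^esub> (g \<otimes>\<^bsub>Fn n\<^esub> y) = y" using Fn.inv_solve_left'[OF y gC c] by simp
      finally have "\<gamma> (s + real k * l + l) (g \<otimes>\<^bsub>Fn n\<^esub> y) > 0" using Suc unfolding y_def by simp
      moreover have "s + real k * l + l = s + real (Suc k) * l" by (simp add: algebra_simps)
      ultimately show ?case unfolding e by simp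
    qed (use u uR(1) in simp)
    have dist: "\<bar>\<bar>s + real k * l - t'\<bar> - real (word_dist (reduce_word (wpow g k @ u)) v')\<bar> \<le> 2" if "\<gamma> t' v' > 0" for k t' v'
      using cayley_dist_word_dist[OF \<gamma>C translate[of k] \<gamma>C that] unfolding \<gamma>(3) .
    \<comment> \<open>Seen from \<open>u\<close>, the word \<open>a\<close> leads to the axis of
      \<open>g\<close>, along which \<open>w\<close> is read.\<close>
    obtain a w where aw: "reduce_word (inv_word u @ g @ u) = a @ w @ inv_word a" "cyclically_reduced w"
      using cyclic_reduction[OF reduced_reduce[of "inv_word u @ g @ u"]] by blast
    have x: "primitive_element n (a @ w @ inv_word a)"
      unfolding aw(1)[symmetric] using primitive_conj[OF g(1), of "inv_word u"] uC(1) by simp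
    have xC: "a @ w @ inv_word a \<in> carrier (Fn n)" using primitive_in_carrier[OF x] .
    hence xR: "reduced (a @ w @ inv_word a)" "reduced w" "reduced a" "fst ` set a \<subseteq> {0..<n}" "fst ` set w \<subseteq> {0..<n}"
      by (simp_all add: reduced_append image_Un)
    have "reduce_word (inv_word a @ (a @ w @ inv_word a) @ inv_word (inv_word a)) = w" using xR(2) by simp
    hence w: "primitive_element n w" using primitive_conj[OF x, of "inv_word a"] xR(3,4) by simp
    have wne: "w \<noteq> []" using primitive_nonempty[OF w] .
    have gu: "reduce_word (wpow g k @ u @ a) = reduce_word (u @ a @ wpow w k)" for k
    proof -
      have "reduce_word (g @ u @ a) = reduce_word (u @ reduce_word (inv_word u @ g @ u) @ a)"
        unfolding reduce_append_mid by simp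
      also have "\<dots> = reduce_word ((u @ a) @ w)" unfolding aw(1) using reduce_cancel_mid(2)[of "u @ a @ w" a] by simp
      finally have "reduce_word (g @ u @ a) = reduce_word ((u @ a) @ w)" .
      hence "reduce_word (inv_word (u @ a) @ reduce_word (g @ u @ a)) = reduce_word (inv_word (u @ a) @ reduce_word ((u @ a) @ w))"
        by (rule arg_cong)
      hence e: "reduce_word (inv_word (u @ a) @ g @ (u @ a)) = reduce_word w"
        unfolding reduce_append_right reduce_cancel_right(2) .
      have "reduce_word (wpow g k @ (u @ a)) = reduce_word ((u @ a) @ reduce_word (wpow (inv_word (u @ a) @ g @ (u @ a)) k))"
        unfolding reduce_append_right reduce_conj_wpow ..
      also have "\<dots> = reduce_word ((u @ a) @ wpow w k)" unfolding reduce_wpow_cong[OF e] reduce_append_right ..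
      finally show ?thesis by simp
    qed
    \<comment> \<open>In the word metric the translate of \<open>u\<close> by the
      \<open>k\<close>-th power of \<open>g\<close> is \<open>2 * length a + k * length w\<close>
      away, along the line \<open>k * l\<close>. For \<open>k = 0\<close> the detour along
      \<open>a\<close> disappears, hence \<open>k \<ge> 1\<close>.\<close>
    have lens: "\<bar>2 * real (length a) + real k * (real (length w) - l)\<bar> \<le> 2" if k: "k \<ge> 1" for k
    proof -
      obtain k' where k': "k = Suc k'" using k by (cases k) auto
      have "reduce_word (inv_word u @ reduce_word (wpow g k @ u)) = reduce_word (inv_word u @ reduce_word (wpow g k @ u @ a) @ inv_word a)"
        unfolding reduce_append_mid using reduce_cancel_mid(1)[of "inv_word u @ wpow g k @ u" a] by simp
      also have "\<dots> = reduce_word (inv_word u @ (u @ a @ wpow w k) @ inv_word a)" unfolding gu reduce_append_mid ..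
      also have "\<dots> = reduce_word (a @ wpow w k @ inv_word a)" by simp
      also have "\<dots> = a @ wpow w k @ inv_word a" unfolding k' by (rule reduce_reduced[OF reduced_conj_wpow[OF xR(1) aw(2) wne]])
      finally have "real (word_dist (reduce_word (wpow g k @ u)) u) = 2 * real (length a) + real k * real (length w)"
        unfolding word_dist_sym[of _ u] by (simp add: word_dist_def)
      moreover have "\<bar>s + real k * l - s\<bar> = real k * l" using \<gamma>(4) by simp
      ultimately show ?thesis using dist[OF u, of k] by (simp add: right_diff_distrib abs_minus_commute algebra_simps)
    qed
    have wl: "real (length w) = l" using linear_bounded[of "2 * real (length a)" "real (length w) - l"] lens by simp
    have a1: "length a \<le> 1" using lens[of 1] wl by simp
    \<comment> \<open>The number of full periods between the two points; the rest \<open>r\<close>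
      is less than one period.\<close>
    define m where "m = nat \<lfloor>(t - s) / l\<rfloor>"
    have m0: "0 \<le> \<lfloor>(t - s) / l\<rfloor>" using st \<gamma>(4) by simp
    have "real m = of_int \<lfloor>(t - s) / l\<rfloor>" unfolding m_def using m0 by simp
    hence "real m \<le> (t - s) / l" "(t - s) / l < real m + 1" by linarith+
    hence m: "real m * l \<le> t - s" "t - s < (real m + 1) * l" using \<gamma>(4) by (simp_all add: pos_le_divide_eq pos_divide_less_eq)
    define r where "r = t - s - real m * l"
    define b where "b = reduce_word (inv_word (wpow g m @ u @ a) @ v)"
    have step: "real (length (reduce_word (inv_word (wpow g k @ u @ a) @ v))) \<le> \<bar>s + real k * l - t\<bar> + 3" for k
    proof -
      have "reduce_word (inv_word (wpow g k @ u @ a) @ v) = reduce_word (inv_word a @ reduce_word (inv_word (wpow g k @ u) @ v))" by simp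
      also have "reduce_word (inv_word (wpow g k @ u) @ v) = reduce_word (reduce_word (inv_word (wpow g k @ u)) @ v)"
        by (rule reduce_append_left[symmetric])
      also have "reduce_word (inv_word (wpow g k @ u)) = inv_word (reduce_word (wpow g k @ u))" by (rule reduce_inv_word)
      finally have "length (reduce_word (inv_word (wpow g k @ u @ a) @ v)) \<le> length a + word_dist (reduce_word (wpow g k @ u)) v"
        using length_reduce_le[of "inv_word a @ reduce_word (inv_word (reduce_word (wpow g k @ u)) @ v)"]
        unfolding word_dist_def by simp
      thus ?thesis using dist[OF v, of k] a1 by linarith
    qed
    have bR: "reduced b" unfolding b_def by (rule reduced_reduce)
    have b1: "real (length b) \<le> r + 3" using step[of m] m(1) unfolding b_def r_def by linarith
    have wb: "reduce_word (inv_word w @ b) = reduce_word (inv_word (wpow g (Suc m) @ u @ a) @ v)"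
    proof -
      have i: "reduce_word (inv_word (wpow g k @ u @ a) @ v) = reduce_word (inv_word (u @ a @ wpow w k) @ v)" for k
      proof -
        have "reduce_word (inv_word (wpow g k @ u @ a) @ v) = reduce_word (reduce_word (inv_word (wpow g k @ u @ a)) @ v)"
          by (rule reduce_append_left[symmetric])
        also have "\<dots> = reduce_word (reduce_word (inv_word (u @ a @ wpow w k)) @ v)" unfolding reduce_inv_word gu ..
        finally show ?thesis unfolding reduce_append_left .
      qed
      have "reduce_word (inv_word w @ b) = reduce_word (inv_word w @ reduce_word (inv_word (u @ a @ wpow w m) @ v))"
        unfolding b_def i ..
      also have "\<dots> = reduce_word (inv_word (u @ a @ wpow w (Suc m)) @ v)"
        unfolding wpow_Suc_right reduce_append_right by simp
      also have "\<dots> = reduce_word (inv_word (wpow g (Suc m) @ u @ a) @ v)" by (rule i[symmetric])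
      finally show ?thesis .
    qed
    have b2: "real (length (reduce_word (inv_word w @ b))) \<le> l - r + 3"
      using step[of "Suc m"] m(2) unfolding wb r_def by (simp add: algebra_simps)
    \<comment> \<open>\<open>b\<close> is the position of \<open>v\<close> seen from the axis vertex
      after \<open>m\<close> periods. Its distances to the two ends of the next period exceed
      \<open>r\<close> and \<open>l - r\<close> by at most 3, so it branches off that period within
      distance 3.\<close>
    have lens': "length b + length (reduce_word (inv_word w @ b)) \<le> length w + 2 * 3" using b1 b2 wl by linarith
    obtain p b' where p: "prefix p w" "b = p @ b'" "length b' \<le> 3"
      using near_prefix[OF xR(2) bR lens'] by blast
    have uv: "reduce_word (inv_word u @ v) = reduce_word (a @ (wpow w m @ p) @ b')"
    proof -
      have e1: "reduce_word (a @ (wpow w m @ p) @ b') = reduce_word ((a @ wpow w m) @ b)" unfolding p(2) by simp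
      have e2: "reduce_word ((a @ wpow w m) @ b) = reduce_word (inv_word u @ (u @ a @ wpow w m) @ b)" by simp
      have e3: "reduce_word (inv_word u @ (u @ a @ wpow w m) @ b) = reduce_word (inv_word u @ (wpow g m @ u @ a) @ b)"
        using arg_cong[OF gu[of m], of "\<lambda>z. reduce_word (inv_word u @ z @ b)"] unfolding reduce_append_mid by (rule sym)
      have e4: "reduce_word ((wpow g m @ u @ a) @ b) = reduce_word v" unfolding b_def reduce_append_right by (rule reduce_cancel_right(1))
      have e5: "reduce_word (inv_word u @ (wpow g m @ u @ a) @ b) = reduce_word (inv_word u @ v)"
        using arg_cong[OF e4, of "\<lambda>z. reduce_word (inv_word u @ z)"] by (simp only: reduce_append_right)
      show ?thesis by (rule sym[OF trans[OF e1 trans[OF e2 trans[OF e3 e5]]]])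
    qed
    have "sublist (wpow w m @ p) (wpow w (Suc m))"
      unfolding wpow_Suc_right using p(1) by (simp add: prefix_imp_sublist)
    moreover have "fst ` set (a @ b') \<subseteq> {0..<n}"
    proof -
      have "fst ` set b \<subseteq> fst ` set (inv_word (wpow g m @ u @ a) @ v)" unfolding b_def by (rule fst_set_reduce_subset)
      also have "\<dots> \<subseteq> {0..<n}" unfolding set_append image_Un fst_set_inv_word
        by (intro Un_least subset_trans[OF fst_set_wpow gR] uR(3,4) xR(4))
      finally have "fst ` set p \<union> fst ` set b' \<subseteq> {0..<n}" unfolding p(2) set_append image_Un .
      thus ?thesis unfolding set_append image_Un using xR(4) by (meson Un_least Un_subset_iff)
    qed
    ultimately have "primitive_element n w \<and> cyclically_reduced w \<and>
      sublist (wpow w m @ p) (wpow w (Suc m)) \<and> reduce_word (inv_word u @ v) = reduce_word (a @ (wpow w m @ p) @ b') \<and>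
      length a \<le> 3 \<and> length b' \<le> 3 \<and> fst ` set (a @ b') \<subseteq> {0..<n}"
      by (intro conjI w aw(2) uv p(3) order_trans[OF a1]) simp_all
    thus ?thesis by (intro exI)
  qed
  obtain s t where st: "p = \<gamma> s" "q = \<gamma> t" using pq(1,2) unfolding \<gamma>(1) by blast
  show ?thesis
  proof (cases "s \<le> t")
    case True
    obtain w m a r b where *: "primitive_element n w \<and> cyclically_reduced w \<and>
      sublist r (wpow w m) \<and> reduce_word (inv_word u @ v) = reduce_word (a @ r @ b) \<and>
      length a \<le> 3 \<and> length b \<le> 3 \<and> fst ` set (a @ b) \<subseteq> {0..<n}"
      using main[OF True pq(3)[unfolded st(1)] pq(4)[unfolded st(2)]] by (elim exE)
    have "{u, v} = {u, v}" ..
    from conjI[OF this *] show ?thesis by (intro exI)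
  next
    case False
    hence "t \<le> s" by simp
    from main[OF this pq(4)[unfolded st(2)] pq(3)[unfolded st(1)]]
    obtain w m a r b where *: "primitive_element n w \<and> cyclically_reduced w \<and>
      sublist r (wpow w m) \<and> reduce_word (inv_word v @ u) = reduce_word (a @ r @ b) \<and>
      length a \<le> 3 \<and> length b \<le> 3 \<and> fst ` set (a @ b) \<subseteq> {0..<n}"
      by (elim exE)
    have "{v, u} = {u, v}" by (rule insert_commute)
    from conjI[OF this *] show ?thesis by (intro exI)
  qed
qed

section \<open>The orbit map\<close>

text \<open>Lists the ambiguity in naming a point of the graph, which the orbit map has to
  respect.\<close>

lemma edge_point_eq:
  assumes "g \<noteq> h" "g' \<noteq> h'" "edge_point g h s = edge_point g' h' s'"
  shows "g = g' \<and> h = h' \<and> s = s' \<or> g = h' \<and> h = g' \<and> s' = 1 - s \<or> s = 0 \<and> s' = 0 \<and> g = g' \<or>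
    s = 0 \<and> s' = 1 \<and> g = h' \<or> s = 1 \<and> s' = 0 \<and> h = g' \<or> s = 1 \<and> s' = 1 \<and> h = h'"
proof -
  have "edge_point g' h' s' g = 1 - s" "edge_point g' h' s' h = s" using edge_point_values[OF assms(1), of s] assms(3) by simp_all
  moreover have "edge_point g h s g' = 1 - s'" "edge_point g h s h' = s'" using edge_point_values[OF assms(2), of s'] assms(3) by simp_all
  ultimately show ?thesis using assms(1,2) by (auto simp: edge_point_def vertex_def split: if_splits)
qed

lemma vertex_edge_point: "vertex g = edge_point g h 0" "vertex h = edge_point g h 1"
  by (simp_all add: edge_point_def)

lemma cayley_act_edge_point:
  assumes "a \<in> carrier (Fn n)" "g \<in> carrier (Fn n)" "h \<in> carrier (Fn n)"
  shows "cayley_act n a (edge_point g h s) = edge_point (a \<otimes>\<^bsub>Fn n\<^esub> g) (a \<otimes>\<^bsub>Fn n\<^esub> h) s"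
proof
  fix v
  have vx: "vertex y (inv\<^bsub>Fn n\<^esub> a \<otimes>\<^bsub>Fn n\<^esub> v) = vertex (a \<otimes>\<^bsub>Fn n\<^esub> y) v" if "y \<in> carrier (Fn n)" "v \<in> carrier (Fn n)" for y
    unfolding vertex_def using Fn.inv_solve_left[OF assms(1) that(2) that(1)] Fn.inv_solve_left'[OF that(1) assms(1) that(2)] by metis
  show "cayley_act n a (edge_point g h s) v = edge_point (a \<otimes>\<^bsub>Fn n\<^esub> g) (a \<otimes>\<^bsub>Fn n\<^esub> h) s v"
  proof (cases "v \<in> carrier (Fn n)")
    case True
    thus ?thesis unfolding cayley_act_def edge_point_def vx[OF assms(2) True] vx[OF assms(3) True] by (simp only: if_True)
  next
    case False
    hence "a \<otimes>\<^bsub>Fn n\<^esub> g \<noteq> v" "a \<otimes>\<^bsub>Fn n\<^esub> h \<noteq> v" using Fn.m_closed[OF assms(1,2)] Fn.m_closed[OF assms(1,3)] by blast+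
    thus ?thesis using False unfolding cayley_act_def edge_point_def vertex_def by (simp only: if_False) auto
  qed
qed

lemma adjacent_translate:
  assumes "a \<in> carrier (Fn n)" "adjacent n g h" shows "adjacent n (a \<otimes>\<^bsub>Fn n\<^esub> g) (a \<otimes>\<^bsub>Fn n\<^esub> h)"
proof -
  obtain i where i: "i < n" "h = g \<otimes>\<^bsub>Fn n\<^esub> [(i, True)] \<or> g = h \<otimes>\<^bsub>Fn n\<^esub> [(i, True)]"
    and C: "g \<in> carrier (Fn n)" "h \<in> carrier (Fn n)" using assms(2) unfolding adjacent_def by blast
  have "[(i, True)] \<in> carrier (Fn n)" using i(1) by (simp add: reduced_Cons reduced_def)
  hence "a \<otimes>\<^bsub>Fn n\<^esub> h = a \<otimes>\<^bsub>Fn n\<^esub> g \<otimes>\<^bsub>Fn n\<^esub> [(i, True)] \<or> a \<otimes>\<^bsub>Fn n\<^esub> g = a \<otimes>\<^bsub>Fn n\<^esub> h \<otimes>\<^bsub>Fn n\<^esub> [(i, True)]"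
    using i(2) Fn.m_assoc[OF assms(1) C(1)] Fn.m_assoc[OF assms(1) C(2)] by metis
  thus ?thesis unfolding adjacent_def using Fn.m_closed[OF assms(1) C(1)] Fn.m_closed[OF assms(1) C(2)] i(1) by blast
qed

lemma base_edge: "n \<ge> 1 \<Longrightarrow> adjacent n [] [(0, True)]"
  unfolding adjacent_def by (auto simp: reduced_Cons reduced_def intro!: exI[of _ 0])

theorem orbit_map_exists:
  assumes n: "n \<ge> 1" and hom: "\<rho> \<in> hom (Fn n) PSL2C" and x: "x \<in> H3"
  shows "\<exists>\<tau>. orbit_map n \<rho> x \<tau>"
proof -
  interpret rho: group_hom "Fn n" PSL2C \<rho>
    by (intro group_hom.intro free_group_is_group PSL2C_group) (simp add: group_hom_axioms_def hom)
  define V where "V g = act (\<rho> g) x" for g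
  define E where "E g h s = geod (V g) (V h) (s * hdist (V g) (V h))" for g h s
  have VH: "V g \<in> H3" if "g \<in> carrier (Fn n)" for g
    unfolding V_def using act_H3[OF rho.hom_closed[OF that] rho.hom_closed[OF that] x] .
  have bd: "0 \<le> s * hdist (V g) (V h)" "s * hdist (V g) (V h) \<le> hdist (V g) (V h)"
    if "adjacent n g h" "0 \<le> s" "s \<le> 1" for g h s
    using hdist_nonneg[OF VH VH, OF adjacent_carrier[OF that(1)]] that(2,3) by (simp_all add: mult_left_le_one_le)
  have E0: "E g h 0 = V g" "E g h 1 = V h" "E h g (1 - s) = E g h s" if "adjacent n g h" for g h s
  proof -
    have H: "V g \<in> H3" "V h \<in> H3" using VH adjacent_carrier[OF that] by blast+
    show "E g h 0 = V g" "E g h 1 = V h" unfolding E_def using H by simp_all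
    show "E h g (1 - s) = E g h s" unfolding E_def geod_rev[OF H] hdist_sym[of "V h"] by (simp add: algebra_simps)
  qed
  have wd: "E g h s = E g' h' s'" if "adjacent n g h" "adjacent n g' h'" "edge_point g h s = edge_point g' h' s'" for g h s g' h' s'
    using edge_point_eq[OF adjacent_neq[OF that(1)] adjacent_neq[OF that(2)] that(3)] E0[OF that(1)] E0[OF that(2)] by metis
  \<comment> \<open>A point has several names as an edge point; by \<open>wd\<close> they all give
    the same value.\<close>
  define \<tau> where "\<tau> p = (SOME y. \<exists>g h s. adjacent n g h \<and> p = edge_point g h s \<and> y = E g h s)" for p
  have \<tau>: "\<tau> (edge_point g h s) = E g h s" if a: "adjacent n g h" for g h s
    unfolding \<tau>_def
  proof (rule some_equality)
    show "\<exists>g' h' s'. adjacent n g' h' \<and> edge_point g h s = edge_point g' h' s' \<and> E g h s = E g' h' s'" using a by blast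
    fix y assume "\<exists>g' h' s'. adjacent n g' h' \<and> edge_point g h s = edge_point g' h' s' \<and> y = E g' h' s'"
    then obtain g' h' s' where e: "adjacent n g' h'" "edge_point g h s = edge_point g' h' s'" "y = E g' h' s'" by blast
    show "y = E g h s" unfolding e(3) by (rule wd[OF a e(1,2), symmetric])
  qed
  have \<tau>v: "\<tau> (vertex g) = V g" "\<tau> (vertex h) = V h" if a: "adjacent n g h" for g h
    using \<tau>[OF a] E0[OF a] vertex_edge_point[where g = g and h = h] by metis+
  have VV: "V (a \<otimes>\<^bsub>Fn n\<^esub> g) = act (\<rho> a) (V g)" if "a \<in> carrier (Fn n)" "g \<in> carrier (Fn n)" for a g
    unfolding V_def rho.hom_mult[OF that] using act_mult[OF rho.hom_closed[OF that(1)] rho.hom_closed[OF that(2)] x] .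
  show ?thesis unfolding orbit_map_def
  proof (intro exI[of _ \<tau>] conjI ballI allI impI)
    show "\<tau> ` cayley n \<subseteq> H3"
    proof
      fix y assume "y \<in> \<tau> ` cayley n"
      then obtain g h s where e: "adjacent n g h" "0 \<le> s" "s \<le> 1" "y = \<tau> (edge_point g h s)" unfolding cayley_def by blast
      show "y \<in> H3" unfolding e(4) \<tau>[OF e(1)] E_def by (intro geod_H3 VH adjacent_carrier[OF e(1)] bd[OF e(1-3)])
    qed
    show "\<tau> (vertex []) = x" unfolding \<tau>v(1)[OF base_edge[OF n]] V_def using rho.hom_one act_one[OF x] by simp
  next
    fix a p assume a: "a \<in> carrier (Fn n)" and "p \<in> cayley n"
    then obtain g h s where e: "adjacent n g h" "0 \<le> s" "s \<le> 1" "p = edge_point g h s" unfolding cayley_def by blast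
    have C: "g \<in> carrier (Fn n)" "h \<in> carrier (Fn n)" using adjacent_carrier[OF e(1)] by blast+
    have ra: "\<rho> a \<in> carrier PSL2C" using a by (rule rho.hom_closed)
    show "\<tau> (cayley_act n a p) = act (\<rho> a) (\<tau> p)"
      unfolding e(4) cayley_act_edge_point[OF a C] \<tau>[OF adjacent_translate[OF a e(1)]] \<tau>[OF e(1)] E_def VV[OF a C(1)] VV[OF a C(2)]
        act_isometry[OF ra ra VH[OF C(1)] VH[OF C(2)]]
      using act_geod[OF ra ra VH[OF C(1)] VH[OF C(2)] bd[OF e(1-3)]] by (rule sym)
  next
    fix g h s assume e: "adjacent n g h" "(0::real) \<le> s" "s \<le> 1"
    have H: "V g \<in> H3" "V h \<in> H3" using VH adjacent_carrier[OF e(1)] by blast+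
    note d = geod_dist_ends[OF H bd[OF e]]
    show "hdist (\<tau> (vertex g)) (\<tau> (edge_point g h s)) = s * hdist (\<tau> (vertex g)) (\<tau> (vertex h))"
      "hdist (\<tau> (edge_point g h s)) (\<tau> (vertex h)) = (1 - s) * hdist (\<tau> (vertex g)) (\<tau> (vertex h))"
      unfolding \<tau>[OF e(1)] \<tau>v[OF e(1)] E_def d by (simp_all add: left_diff_distrib)
  qed
qed

lemma orbit_map_vertex:
  assumes "n \<ge> 1" "orbit_map n \<rho> x \<tau>" "g \<in> carrier (Fn n)" shows "\<tau> (vertex g) = act (\<rho> g) x"
proof -
  have "vertex [] \<in> cayley n"
    unfolding cayley_def using base_edge[OF assms(1)] vertex_edge_point(1)[of "[]" "[(0, True)]"] by fastforce
  hence "\<tau> (cayley_act n g (vertex [])) = act (\<rho> g) x" using assms(2,3) unfolding orbit_map_def by blast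
  moreover have "[] \<in> carrier (Fn n)" "[(0, True)] \<in> carrier (Fn n)" using adjacent_carrier[OF base_edge[OF assms(1)]] by blast+
  hence "cayley_act n g (vertex []) = vertex (g \<otimes>\<^bsub>Fn n\<^esub> [])"
    using cayley_act_edge_point[OF assms(3)] vertex_edge_point(1) by metis
  moreover have "g \<otimes>\<^bsub>Fn n\<^esub> [] = g" using assms(3) by simp
  ultimately show ?thesis by metis
qed

lemma orbit_map_H3: "orbit_map n \<rho> x \<tau> \<Longrightarrow> p \<in> cayley n \<Longrightarrow> \<tau> p \<in> H3"
  unfolding orbit_map_def by blast

lemma orbit_map_near:
  assumes n: "n \<ge> 1" and om: "orbit_map n \<rho> x \<tau>" and p: "p \<in> cayley n" "p u > 0"
    and bound: "\<And>g h. adjacent n g h \<Longrightarrow> hdist (act (\<rho> g) x) (act (\<rho> h) x) \<le> D" and D: "D \<ge> 0"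
  shows "hdist (\<tau> p) (act (\<rho> u) x) \<le> D"
proof -
  obtain g h s where e: "adjacent n g h" "0 \<le> s" "s \<le> 1" "p = edge_point g h s" using p(1) unfolding cayley_def by blast
  have vg: "\<tau> (vertex g) = act (\<rho> g) x" "\<tau> (vertex h) = act (\<rho> h) x"
    using orbit_map_vertex[OF n om] adjacent_carrier[OF e(1)] by blast+
  have d: "hdist (act (\<rho> g) x) (\<tau> p) = s * hdist (act (\<rho> g) x) (act (\<rho> h) x)"
    "hdist (\<tau> p) (act (\<rho> h) x) = (1 - s) * hdist (act (\<rho> g) x) (act (\<rho> h) x)"
    using om e(1-3) unfolding orbit_map_def vg[symmetric] e(4) by blast+
  have le: "r * hdist (act (\<rho> g) x) (act (\<rho> h) x) \<le> D" if "0 \<le> r" "r \<le> 1" for r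
    using mult_left_mono[OF bound[OF e(1)] that(1)] mult_right_mono[OF that(2) D] by linarith
  have "u = g \<or> u = h" using edge_point_pos[of g h s u] p(2) unfolding e(4) .
  thus ?thesis
  proof
    assume "u = g"
    thus ?thesis using d(1) le[OF e(2,3)] hdist_sym[of "\<tau> p"] by simp
  next
    assume "u = h"
    thus ?thesis using d(2) le[of "1 - s"] e(2,3) by simp
  qed
qed

context cusped_action
begin

lemma beta_dist: "u \<in> carrier (Fn n) \<Longrightarrow> v \<in> carrier (Fn n) \<Longrightarrow> hdist (\<beta> u x) (\<beta> v x) = hdist x (\<beta> (reduce_word (inv_word u @ v)) x)"
  using orbit_dist'[of u v] carrier_ok[of u] carrier_ok[of v] unfolding beta_reduce by blast

lemma beta_dist_le: 
  assumes "u \<in> carrier (Fn n)" "v \<in> carrier (Fn n)" shows "hdist (\<beta> u x) (\<beta> v x) \<le> lip * word_dist u v"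
  unfolding beta_dist[OF assms] word_dist_def
  using assms carrier_ok[of u] carrier_ok[of v] by (intro displacement_le ok_reduce) simp

text \<open>The upper bound is the Lipschitz property of the orbit. For the lower bound, the label
  of a piece of a primitive leaf is thin because it occurs in a power of a primitive word, and
  \<open>thin_words_linear\<close> applies to it with constants independent of the leaf.\<close>

theorem primitive_leaves_quasi_geodesic:
  assumes \<tau>H: "\<And>p. p \<in> cayley n \<Longrightarrow> \<tau> p \<in> H3" and \<tau>near: "\<And>p u. p \<in> cayley n \<Longrightarrow> p u > 0 \<Longrightarrow> hdist (\<tau> p) (\<beta> u x) \<le> lip"
    and K: "K \<ge> 1" and block: "\<And>w m. primitive_element n w \<Longrightarrow> cyclically_reduced w \<Longrightarrow> \<not> sublist (wpow c K) (wpow w m)"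
  shows "\<exists>M\<ge>1. \<exists>\<delta>\<ge>0. \<forall>L. primitive_leaf n L \<longrightarrow> quasi_geodesic_on n M \<delta> \<tau> L"
proof -
  obtain A where A: "A \<ge> 0" "\<And>r. thin K r \<Longrightarrow> real (length r) \<le> A * (hdist x (\<beta> r x) + 1)"
    using thin_words_linear[OF K] by blast
  have thin: "thin K r" if r: "primitive_element n w" "cyclically_reduced w" "sublist r (wpow w m)" for r w m
    unfolding thin_def
  proof (intro conjI ballI)
    have "set r \<subseteq> set (wpow w m)" using r(3) by (rule set_mono_sublist)
    hence "fst ` set r \<subseteq> fst ` set w" using fst_set_wpow[of w m] by blast
    also have "\<dots> \<subseteq> {0..<n}" using primitive_in_carrier[OF r(1)] by simp
    finally show "r \<in> carrier (Fn n)" using reduced_sublist[OF cyclically_reduced_wpow[OF r(2)] r(3)] by simp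
    fix c' assume c': "c' \<in> {c, inv_word c}"
    show "\<not> sublist (wpow c' K) r"
    proof
      assume "sublist (wpow c' K) r"
      hence s: "sublist (wpow c' K) (wpow w m)" using r(3) by (rule sublist_order.order_trans)
      show False
      \<comment> \<open>Only powers of \<open>c\<close> are blocked by hypothesis. A power of the
        inverse of \<open>c\<close> in a power of \<open>w\<close> is read backwards, as a power of
        \<open>c\<close> in a power of the inverse of \<open>w\<close>, which is primitive as
        well.\<close>
      proof (cases "c' = c")
        case True
        thus False using block[OF r(1,2)] s by blast
      next
        case False
        hence "c' = inv_word c" using c' by blast
        hence "sublist (wpow c K) (wpow (inv_word w) m)" using sublist_inv_word[OF s] by (simp add: inv_word_wpow)
        thus False using block[OF primitive_inv_word[OF r(1)] cyclically_reduced_inv_word[OF r(2)]] by blast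
      qed
    qed
  qed
  \<comment> \<open>Of the \<open>8 * lip\<close>, six account for the two words \<open>a\<close>
    and \<open>b\<close> of at most 3 letters each, and two for moving from points to vertices. The
    final 8 consists of these 6 letters and the error 2 of
    \<open>cayley_dist_word_dist\<close>.\<close>
  define C where "C = A * (8 * lip + 1) + 8"
  have lip: "lip \<ge> 0" by (rule lip_nonneg)
  have C0: "C \<ge> 0" unfolding C_def using A(1) lip by (intro add_nonneg_nonneg mult_nonneg_nonneg) auto
  define M where "M = A + lip + 1"
  have M: "M \<ge> 1" "M > 0" "A \<le> M" "lip \<le> M" unfolding M_def using A(1) lip by linarith+
  have "quasi_geodesic_on n M (C + 4 * lip) \<tau> L" if L: "primitive_leaf n L" for L
    unfolding quasi_geodesic_on_def
  proof (intro ballI)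
    fix p q assume pq: "p \<in> L" "q \<in> L"
    have "L \<subseteq> cayley n" using L unfolding primitive_leaf_def axis_of_def by blast
    hence pC: "p \<in> cayley n" "q \<in> cayley n" using pq by blast+
    obtain u v where uv: "p u > 0" "q v > 0" using cayley_support[OF pC(1)] cayley_support[OF pC(2)] by blast
    have uC: "u \<in> carrier (Fn n)" "v \<in> carrier (Fn n)" using support_carrier[OF pC(1) uv(1)] support_carrier[OF pC(2) uv(2)] by blast+
    have bH: "\<beta> w x \<in> H3" if "w \<in> carrier (Fn n)" for w using that carrier_ok[of w] beta_H3[OF _ x_H3] by blast
    have H: "\<tau> p \<in> H3" "\<tau> q \<in> H3" "\<beta> u x \<in> H3" "\<beta> v x \<in> H3" using \<tau>H pC bH uC by blast+
    define D where "D = hdist (\<beta> u x) (\<beta> v x)"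
    have near: "hdist (\<tau> p) (\<beta> u x) \<le> lip" "hdist (\<beta> v x) (\<tau> q) \<le> lip"
      using \<tau>near[OF pC(1) uv(1)] \<tau>near[OF pC(2) uv(2)] hdist_sym[of "\<tau> q"] by simp_all
    have cd: "\<bar>cayley_dist n p q - real (word_dist u v)\<bar> \<le> 2" using cayley_dist_word_dist[OF pC(1) uv(1) pC(2) uv(2)] .
    have up: "hdist (\<tau> p) (\<tau> q) \<le> D + 2 * lip"
      using hdist_triangle[OF H(1,3,2)] hdist_triangle[OF H(3,4,2)] near unfolding D_def by linarith
    have lo: "D \<le> hdist (\<tau> p) (\<tau> q) + 2 * lip"
      using hdist_triangle[OF H(3,1,4)] hdist_triangle[OF H(1,2,4)] near hdist_sym[of "\<beta> u x" "\<tau> p"] hdist_sym[of "\<tau> q" "\<beta> v x"]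
      unfolding D_def by linarith
    have "D \<le> lip * real (word_dist u v)" unfolding D_def by (rule beta_dist_le[OF uC])
    also have "\<dots> \<le> lip * (cayley_dist n p q + 2)" using cd lip by (intro mult_left_mono) linarith+
    finally have D1: "D \<le> lip * cayley_dist n p q + 2 * lip" by (simp add: distrib_left)
    have cd0: "cayley_dist n p q \<ge> 0"
    proof -
      obtain \<gamma> :: "real \<Rightarrow> cpoint" where \<gamma>: "L = range \<gamma>" "\<And>s t. cayley_dist n (\<gamma> s) (\<gamma> t) = \<bar>s - t\<bar>"
        using L unfolding primitive_leaf_def axis_of_def by blast
      obtain s t where "p = \<gamma> s" "q = \<gamma> t" using pq unfolding \<gamma>(1) by blast
      thus ?thesis using \<gamma>(2)[of s t] by simp
    qed
    have "lip * cayley_dist n p q \<le> M * cayley_dist n p q" using M(4) cd0 by (rule mult_right_mono)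
    hence upper: "hdist (\<tau> p) (\<tau> q) \<le> M * cayley_dist n p q + (C + 4 * lip)" using up D1 C0 by linarith
    from primitive_leaf_words[OF L pq uv]
    obtain w m a r b u' v' where *: "{u', v'} = {u, v} \<and> primitive_element n w \<and> cyclically_reduced w \<and>
      sublist r (wpow w m) \<and> reduce_word (inv_word u' @ v') = reduce_word (a @ r @ b) \<and>
      length a \<le> 3 \<and> length b \<le> 3 \<and> fst ` set (a @ b) \<subseteq> {0..<n}"
      by (elim exE)
    hence w: "{u', v'} = {u, v}" "primitive_element n w" "cyclically_reduced w"
      "sublist r (wpow w m)" "reduce_word (inv_word u' @ v') = reduce_word (a @ r @ b)"
      "length a \<le> 3" "length b \<le> 3" "fst ` set (a @ b) \<subseteq> {0..<n}"
      by - (elim conjE, assumption)+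
    have u'v': "u' = u \<and> v' = v \<or> u' = v \<and> v' = u" using w(1) by (simp add: doubleton_eq_iff)
    have "D = hdist (\<beta> u' x) (\<beta> v' x) \<and> word_dist u v = word_dist u' v' \<and> u' \<in> carrier (Fn n) \<and> v' \<in> carrier (Fn n)"
      using u'v'
    proof
      assume e: "u' = u \<and> v' = v"
      show ?thesis unfolding conjunct1[OF e] conjunct2[OF e] D_def by (intro conjI refl uC)
    next
      assume e: "u' = v \<and> v' = u"
      show ?thesis unfolding conjunct1[OF e] conjunct2[OF e] D_def by (intro conjI hdist_sym word_dist_sym uC)
    qed
    hence D': "D = hdist (\<beta> u' x) (\<beta> v' x)" "word_dist u v = word_dist u' v'" "u' \<in> carrier (Fn n)" "v' \<in> carrier (Fn n)"
      by - (elim conjE, assumption)+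
    note th = thin[OF w(2-4)]
    have ok_ab: "ok a" "ok b" using w(8) unfolding ok_def set_append image_Un by blast+
    have "ok r" using th carrier_ok[of r] unfolding thin_def by blast
    note ok = ok_ab this
    have Dr: "D = hdist x (\<beta> (a @ r @ b) x)"
      unfolding D'(1) beta_dist[OF D'(3,4)] w(5) beta_reduce ..
    have Hs: "\<beta> a x \<in> H3" "\<beta> (a @ r) x \<in> H3" "\<beta> (a @ r @ b) x \<in> H3" using ok by (auto intro!: beta_H3[OF _ x_H3])
    have "hdist x (\<beta> r x) = hdist (\<beta> a x) (\<beta> (a @ r) x)" using orbit_dist[OF ok(1,3)] by simp
    also have "\<dots> \<le> hdist (\<beta> a x) x + hdist x (\<beta> (a @ r @ b) x) + hdist (\<beta> (a @ r @ b) x) (\<beta> (a @ r) x)"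
      using hdist_triangle[OF Hs(1) x_H3 Hs(2)] hdist_triangle[OF x_H3 Hs(3,2)] by linarith
    also have "hdist (\<beta> a x) x \<le> 3 * lip"
      using displacement_le_bound[OF ok(1) w(6)] hdist_sym[of "\<beta> a x" x] by simp
    also have "hdist (\<beta> (a @ r @ b) x) (\<beta> (a @ r) x) \<le> 3 * lip"
    proof -
      have "hdist (\<beta> (a @ r) x) (\<beta> ((a @ r) @ b) x) = hdist x (\<beta> b x)" using ok by (intro orbit_dist) simp_all
      thus ?thesis using displacement_le_bound[OF ok(2) w(7)] hdist_sym[of "\<beta> (a @ r @ b) x"] by simp
    qed
    finally have rD: "hdist x (\<beta> r x) \<le> D + 6 * lip" unfolding Dr by linarith
    have "word_dist u v = length (reduce_word (a @ r @ b))" unfolding D'(2) using w(5) by (simp only: word_dist_def)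
    hence "word_dist u v \<le> length r + 6" using length_reduce_le[of "a @ r @ b"] w(6,7) by simp
    moreover have "real (length r) \<le> A * (hdist x (\<beta> r x) + 1)" by (rule A(2)[OF th])
    moreover have "A * (hdist x (\<beta> r x) + 1) \<le> A * (hdist (\<tau> p) (\<tau> q) + (8 * lip + 1))"
      using rD lo A(1) by (intro mult_left_mono) linarith+
    ultimately have "cayley_dist n p q \<le> A * hdist (\<tau> p) (\<tau> q) + C"
      using cd unfolding C_def distrib_left[of A "hdist (\<tau> p) (\<tau> q)"] by linarith
    also have "\<dots> \<le> M * hdist (\<tau> p) (\<tau> q) + M * (C + 4 * lip)"
    proof (intro add_mono mult_right_mono M(3) hdist_nonneg H)
      show "C \<le> M * (C + 4 * lip)" using mult_mono[of 1 M C "C + 4 * lip"] M(1) C0 lip by simp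
    qed
    finally have "cayley_dist n p q \<le> (hdist (\<tau> p) (\<tau> q) + (C + 4 * lip)) * M" by (simp add: algebra_simps)
    hence "cayley_dist n p q / M \<le> hdist (\<tau> p) (\<tau> q) + (C + 4 * lip)" unfolding pos_divide_le_eq[OF M(2)] .
    thus "1 / M * cayley_dist n p q - (C + 4 * lip) \<le> hdist (\<tau> p) (\<tau> q) \<and> hdist (\<tau> p) (\<tau> q) \<le> M * cayley_dist n p q + (C + 4 * lip)"
      using upper by simp
  qed
  moreover have "C + 4 * lip \<ge> 0" using C0 lip by linarith
  ultimately show ?thesis using M(1) by blast
qed

end

text \<open>A conjugate of the generator of a parabolic subgroup cannot be trivial, as parabolic
  subgroups are nontrivial.\<close>

lemma one_cusp_nontrivial:
  assumes "faithful_rep n \<rho>" "one_cusp n \<rho> cl" "c \<in> cl" shows "c \<noteq> []"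
proof
  assume c: "c = []"
  interpret rho: group_hom "Fn n" PSL2C \<rho>
    by (intro group_hom.intro free_group_is_group PSL2C_group)
      (use assms(1) in \<open>simp add: group_hom_axioms_def faithful_rep_def\<close>)
  obtain g where g: "g \<in> carrier (Fn n)" "maximal_parabolic_subgroup (\<rho> ` carrier (Fn n)) (generate PSL2C {\<rho> g})"
    "cl = conj_class (Fn n) g"
    using assms(2) unfolding one_cusp_def Let_def by blast
  obtain k where k: "k \<in> carrier (Fn n)" "c = k \<otimes>\<^bsub>Fn n\<^esub> g \<otimes>\<^bsub>Fn n\<^esub> inv\<^bsub>Fn n\<^esub> k"
    using assms(3) unfolding g(3) conj_class_def by blast
  have "k \<otimes>\<^bsub>Fn n\<^esub> g \<otimes>\<^bsub>Fn n\<^esub> inv\<^bsub>Fn n\<^esub> k = \<one>\<^bsub>Fn n\<^esub>" using k(2) c by simp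
  hence "inv\<^bsub>Fn n\<^esub> (inv\<^bsub>Fn n\<^esub> k) = k \<otimes>\<^bsub>Fn n\<^esub> g"
    by (rule Fn.inv_equality[OF _ Fn.inv_closed[OF k(1)] Fn.m_closed[OF k(1) g(1)]])
  hence "k \<otimes>\<^bsub>Fn n\<^esub> g = k" unfolding Fn.inv_inv[OF k(1)] by (rule sym)
  hence "g = \<one>\<^bsub>Fn n\<^esub>" using Fn.l_cancel_one[OF k(1) g(1)] by blast
  hence "\<rho> g = \<one>\<^bsub>PSL2C\<^esub>" using rho.hom_one by metis
  hence "generate PSL2C {\<rho> g} = {\<one>\<^bsub>PSL2C\<^esub>}" using rho.H.generate_one by metis
  thus False using g(2) unfolding maximal_parabolic_subgroup_def parabolic_subgroup_def by blast
qed

theorem theorem4p1: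
  fixes n :: nat
    and \<rho> :: "nat word \<Rightarrow> (complex^2^2) set"
    and c :: "nat word set"
  assumes "n \<ge> 2"
    and "faithful_rep n \<rho>"
    and "discrete_in_PSL2C (\<rho> ` carrier (Fn n))"
    and "geometrically_finite (\<rho> ` carrier (Fn n))"
    and "one_cusp n \<rho> c"
    and "blocking_curve n c"
  shows "primitive_stable n \<rho>"
proof -
  obtain g K where g: "g \<in> c" "g \<in> carrier (Fn n)" "cyclically_reduced g" and K: "K \<ge> 1" "primitive_blocking n (wpow g K)"
    using assms(6) unfolding blocking_curve_def blocking_word_def wpow_def by blast
  have block: "\<not> sublist (wpow g K) (wpow w m)" if "primitive_element n w" "cyclically_reduced w" for w m
    using blocking_not_in_power[OF assms(1) K(2) that] .
  from cusped_action_exists[OF assms(1-5) g one_cusp_nontrivial[OF assms(2,5) g(1)]]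
  obtain B0 x R0 where "cusped_action n (\<lambda>w. act (\<rho> (reduce_word w))) g B0 x R0" by (elim exE)
  then interpret A: cusped_action n "\<lambda>w. act (\<rho> (reduce_word w))" g B0 x R0 .
  have n1: "n \<ge> 1" using assms(1) by simp
  have hom: "\<rho> \<in> hom (Fn n) PSL2C" using assms(2) unfolding faithful_rep_def by blast
  obtain \<tau> where \<tau>: "orbit_map n \<rho> x \<tau>" using orbit_map_exists[OF n1 hom A.x_H3] by blast
  have edge: "hdist (act (\<rho> u) x) (act (\<rho> v) x) \<le> A.lip" if "adjacent n u v" for u v
  proof -
    have C: "u \<in> carrier (Fn n)" "v \<in> carrier (Fn n)" using adjacent_carrier[OF that] by blast+
    hence "reduce_word u = u" "reduce_word v = v" by simp_all
    thus ?thesis using A.beta_dist_le[OF C] unfolding adjacent_dist[OF that] by simp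
  qed
  have near: "hdist (\<tau> p) (act (\<rho> (reduce_word u)) x) \<le> A.lip" if p: "p \<in> cayley n" "p u > 0" for p u
  proof -
    have "reduce_word u = u" using support_carrier[OF p] by simp
    thus ?thesis using orbit_map_near[OF n1 \<tau> p edge A.lip_nonneg] by simp
  qed
  have "\<exists>M\<ge>1. \<exists>\<delta>\<ge>0. \<forall>L. primitive_leaf n L \<longrightarrow> quasi_geodesic_on n M \<delta> \<tau> L"
  proof (rule A.primitive_leaves_quasi_geodesic[OF _ _ K(1) block])
    show "\<tau> p \<in> H3" if "p \<in> cayley n" for p using orbit_map_H3[OF \<tau> that] .
    show "hdist (\<tau> p) (act (\<rho> (reduce_word u)) x) \<le> A.lip" if "p \<in> cayley n" "p u > 0" for p u using near[OF that] .
  qed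
  then obtain M \<delta> where M: "M \<ge> 1" "\<delta> \<ge> 0" "\<forall>L. primitive_leaf n L \<longrightarrow> quasi_geodesic_on n M \<delta> \<tau> L"
    by (elim exE conjE) (rule that)
  show ?thesis unfolding primitive_stable_def
    by (rule exI[of _ M], rule conjI[OF M(1)], rule exI[of _ \<delta>], rule conjI[OF M(2)], rule bexI[OF _ A.x_H3],
        rule exI[of _ \<tau>], rule conjI[OF \<tau> M(3)])
qed

end
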